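(* Let $Y$ be a compact hyperbolic Riemann surface and let $\ell\subset Y$ be a closed geodesic. There exists a constant $C_\ell>0$ such that for every eigenfunction $\phi_i$ of the Laplace-Beltrami operator on $Y$ with $\|\phi_i\|_{L^2(Y)}=1$ and eigenvalue $\mu_i\ge\frac14$, and for every real $T\geq 1$, $$\sum_{|n|\leq T}|a^\ell_n(\phi_i)|^2\leq C_\ell\cdot\max\{T,\sqrt{\mu_i}\},$$ where the sum is over integers $n$ and the coefficients $a^\ell_n(\phi_i)$ are the normalized Fourier coefficients of $\phi_i$ along $\ell$ defined in the context.
   Context: $Y$ is a compact connected Riemann surface with a Riemannian metric of constant curvature $-1$ and volume element $dv$; $\Delta\ge0$ is the non-negative Laplace-Beltrami operator, $\Delta\phi_i=\mu_i\phi_i$, and $\phi_i$ has norm one in $L^2(Y,dv)$. Let $\ell$ be a closed geodesic of length $l>0$, with constant speed parametrization $t_\ell:\mathbb R/\mathbb Z\to\ell$ and line element $d\ell=l\,d\theta$. The $n$-th generalized period of $\phi_i$ along $\ell$ is $$p_n^\ell(\phi_i)=\int_\ell\phi_i(t_\ell(\theta))e^{-2\pi in\theta}\,d\ell=l\int_0^1\phi_i(t_\ell(\theta))e^{-2\pi in\theta}\,d\theta,\qquad n\in\mathbb Z.$$ For $\mu\ge\frac14$ put $\lambda=i\sqrt{4\mu-1}$, so that $\mu=\frac{1-\lambda^2}4$, and $$G_\mu(l,n)=l\int_{\mathbb R}|x|^{-\frac12-\frac\lambda2+\frac{2\pi in}{l}}(1+x^2)^{\frac{\lambda-1}2}\,dx=l\cdot\frac{\Gamma\!\left(\frac{1-\lambda}{4}+\frac{\pi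 i n}{l}\right)\Gamma\!\left(\frac{1-\lambda}{4}-\frac{\pi in}{l}\right)}{\Gamma\!\left(\frac{1-\lambda}{2}\right)},$$ which is nonzero. (The integral is the value, on the $K$-fixed vector $(1+x^2)^{(\lambda-1)/2}$ of the principal series representation $V_\lambda$ of $PGL_2(\mathbb R)$ in its line model, of the functional with kernel $|x|^{-\frac12-\frac\lambda2+\frac{2\pi in}{l}}$, which is equivariant under the diagonal subgroup.) The coefficient $a_n^\ell(\phi_i)\in\mathbb C$ is defined by $$p_n^\ell(\phi_i)=a_n^\ell(\phi_i)\,G_{\mu_i}(l,n).$$ *)

theory Defs
  imports "HOL-Analysis.Analysis"
begin

text \<open>
  \<open>Ck_on k S f\<close> is only meant for open \<open>S\<close>: all iterated directional derivatives of \<open>f\<close>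
  up to order \<open>k\<close> exist on \<open>S\<close> and are continuous there.
\<close>

primrec Ck_on :: "nat \<Rightarrow> 'a::real_normed_vector set \<Rightarrow> ('a \<Rightarrow> 'b::real_normed_vector) \<Rightarrow> bool"
  where
    "Ck_on 0 S f \<longleftrightarrow> continuous_on S f"
  | "Ck_on (Suc k) S f \<longleftrightarrow>
       f differentiable_on S \<and> (\<forall>h. Ck_on k S (\<lambda>x. frechet_derivative f (at x) h))"

definition smooth_on :: "'a::real_normed_vector set \<Rightarrow> ('a \<Rightarrow> 'b::real_normed_vector) \<Rightarrow> bool"
  where "smooth_on S f \<longleftrightarrow> (\<forall>k. Ck_on k S f)"

definition pdx :: "(complex \<Rightarrow> 'b::real_normed_vector) \<Rightarrow> complex \<Rightarrow> 'b"
  where "pdx f = (\<lambda>\<zeta>. frechet_derivative f (at \<zeta>) 1)"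

definition pdy :: "(complex \<Rightarrow> 'b::real_normed_vector) \<Rightarrow> complex \<Rightarrow> 'b"
  where "pdy f = (\<lambda>\<zeta>. frechet_derivative f (at \<zeta>) \<i>)"

definition flat_laplacian :: "(complex \<Rightarrow> 'b::real_normed_vector) \<Rightarrow> complex \<Rightarrow> 'b"
  where "flat_laplacian f \<zeta> = pdx (pdx f) \<zeta> + pdy (pdy f) \<zeta>"

text \<open>
  A chart is a pair \<open>(U, z)\<close> of an open set and a complex coordinate on it; the values of \<open>z\<close>
  outside \<open>U\<close> are irrelevant. The surface is the whole type, and a Riemann surface structure on it
  is given by a (not necessarily maximal) holomorphic atlas.
\<close>

type_synonym 'a chart = "'a set \<times> ('a \<Rightarrow> complex)"

abbreviation cdom :: "'a chart \<Rightarrow> 'a set"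
  where "cdom c \<equiv> fst c"

abbreviation cmap :: "'a chart \<Rightarrow> 'a \<Rightarrow> complex"
  where "cmap c \<equiv> snd c"

abbreviation cimg :: "'a chart \<Rightarrow> complex set"
  where "cimg c \<equiv> cmap c ` cdom c"

abbreviation cinv :: "'a chart \<Rightarrow> complex \<Rightarrow> 'a"
  where "cinv c \<equiv> inv_into (cdom c) (cmap c)"

definition riemann_surface :: "'a::t2_space chart set \<Rightarrow> bool"
  where "riemann_surface A \<longleftrightarrow>
    (\<Union>c\<in>A. cdom c) = UNIV \<and>
    (\<forall>c\<in>A. open (cdom c) \<and> open (cimg c) \<and>
       homeomorphism (cdom c) (cimg c) (cmap c) (cinv c)) \<and>
    (\<forall>c\<in>A. \<forall>d\<in>A. (cmap d \<circ> cinv c) holomorphic_on (cmap c ` (cdom c \<inter> cdom d)))"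

text \<open>
  A Riemannian metric compatible with the complex structure: in the chart \<open>c\<close> it is
  \<open>(\<rho> c)\<^sup>2 (dx\<^sup>2 + dy\<^sup>2)\<close>, so the densities transform by the modulus of the derivative of the
  coordinate change.
\<close>

definition conformal_metric ::
    "'a::t2_space chart set \<Rightarrow> ('a chart \<Rightarrow> complex \<Rightarrow> real) \<Rightarrow> bool"
  where "conformal_metric A \<rho> \<longleftrightarrow>
    (\<forall>c\<in>A. smooth_on (cimg c) (\<rho> c) \<and> (\<forall>\<zeta>\<in>cimg c. \<rho> c \<zeta> > 0)) \<and>
    (\<forall>c\<in>A. \<forall>d\<in>A. \<forall>p\<in>cdom c \<inter> cdom d.
       \<rho> c (cmap c p) = \<rho> d (cmap d p) * cmod (deriv (cmap d \<circ> cinv c) (cmap c p)))"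

definition gaussian_curvature :: "(complex \<Rightarrow> real) \<Rightarrow> complex \<Rightarrow> real"
  where "gaussian_curvature r \<zeta> = - flat_laplacian (\<lambda>w. ln (r w)) \<zeta> / (r \<zeta>)\<^sup>2"

definition compact_hyperbolic_surface ::
    "'a::t2_space chart set \<Rightarrow> ('a chart \<Rightarrow> complex \<Rightarrow> real) \<Rightarrow> bool"
  where "compact_hyperbolic_surface A \<rho> \<longleftrightarrow>
    compact (UNIV :: 'a set) \<and> connected (UNIV :: 'a set) \<and>
    riemann_surface A \<and> conformal_metric A \<rho> \<and>
    (\<forall>c\<in>A. \<forall>\<zeta>\<in>cimg c. gaussian_curvature (\<rho> c) \<zeta> = -1)"

text \<open>
  The Riemannian volume is determined uniquely by its restrictions to the chart domains.
\<close>

definition volume_measure ::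
    "'a::t2_space chart set \<Rightarrow> ('a chart \<Rightarrow> complex \<Rightarrow> real) \<Rightarrow> 'a measure \<Rightarrow> bool"
  where "volume_measure A \<rho> v \<longleftrightarrow>
    sets v = sets borel \<and>
    (\<forall>c\<in>A. \<forall>B\<in>sets borel. B \<subseteq> cdom c \<longrightarrow>
       emeasure v B = (\<integral>\<^sup>+\<zeta>\<in>cmap c ` B. ennreal ((\<rho> c \<zeta>)\<^sup>2) \<partial>lborel))"

definition norm_L2 :: "'a measure \<Rightarrow> ('a \<Rightarrow> complex) \<Rightarrow> real"
  where "norm_L2 v f = sqrt (LINT p|v. (cmod (f p))\<^sup>2)"

text \<open>The non-negative Laplace-Beltrami operator, computed in a chart around the point.\<close>

definition laplace_beltrami ::
    "('a chart \<Rightarrow> complex \<Rightarrow> real) \<Rightarrow> 'a chart \<Rightarrow> ('a \<Rightarrow> complex) \<Rightarrow> 'a \<Rightarrow> complex"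
  where "laplace_beltrami \<rho> c f p =
    - flat_laplacian (f \<circ> cinv c) (cmap c p) / complex_of_real ((\<rho> c (cmap c p))\<^sup>2)"

definition laplace_eigenfunction ::
    "'a::t2_space chart set \<Rightarrow> ('a chart \<Rightarrow> complex \<Rightarrow> real) \<Rightarrow> real \<Rightarrow> ('a \<Rightarrow> complex) \<Rightarrow> bool"
  where "laplace_eigenfunction A \<rho> \<mu> f \<longleftrightarrow>
    (\<forall>c\<in>A. Ck_on 2 (cimg c) (f \<circ> cinv c)) \<and>
    (\<forall>c\<in>A. \<forall>p\<in>cdom c. laplace_beltrami \<rho> c f p = complex_of_real \<mu> * f p)"

text \<open>
  For the metric \<open>r\<^sup>2 (dx\<^sup>2 + dy\<^sup>2)\<close> with \<open>u = ln r\<close>, the Christoffel symbols are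
  \<open>\<Gamma>\<^sup>x\<^sub>x\<^sub>x = \<Gamma>\<^sup>y\<^sub>x\<^sub>y = -\<Gamma>\<^sup>x\<^sub>y\<^sub>y = u\<^sub>x\<close> and \<open>\<Gamma>\<^sup>y\<^sub>y\<^sub>y = \<Gamma>\<^sup>x\<^sub>x\<^sub>y = -\<Gamma>\<^sup>y\<^sub>x\<^sub>x = u\<^sub>y\<close>; in complex notation the acceleration
  of a curve \<open>w\<close> is \<open>w'' + (u\<^sub>x - \<i> u\<^sub>y) w'\<^sup>2\<close>.
\<close>

definition covariant_acceleration :: "(complex \<Rightarrow> real) \<Rightarrow> (real \<Rightarrow> complex) \<Rightarrow> real \<Rightarrow> complex"
  where "covariant_acceleration r w \<theta> =
    vector_derivative (\<lambda>s. vector_derivative w (at s)) (at \<theta>) +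
    Complex (pdx (\<lambda>\<zeta>. ln (r \<zeta>)) (w \<theta>)) (- pdy (\<lambda>\<zeta>. ln (r \<zeta>)) (w \<theta>)) *
      (vector_derivative w (at \<theta>))\<^sup>2"

text \<open>
  \<open>t\<close> is the lift to the real line of a parametrization by \<open>\<real>/\<int>\<close>; its constant speed is the length
  \<open>l\<close> of the closed geodesic. Self-intersections are allowed.
\<close>

definition closed_geodesic ::
    "'a::t2_space chart set \<Rightarrow> ('a chart \<Rightarrow> complex \<Rightarrow> real) \<Rightarrow> real \<Rightarrow> (real \<Rightarrow> 'a) \<Rightarrow> bool"
  where "closed_geodesic A \<rho> l t \<longleftrightarrow>
    l > 0 \<and> continuous_on UNIV t \<and> (\<forall>\<theta>. t (\<theta> + 1) = t \<theta>) \<and>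
    (\<forall>c\<in>A. Ck_on 2 (t -` cdom c) (cmap c \<circ> t)) \<and>
    (\<forall>c\<in>A. \<forall>\<theta>\<in>t -` cdom c.
       \<rho> c (cmap c (t \<theta>)) * cmod (vector_derivative (cmap c \<circ> t) (at \<theta>)) = l \<and>
       covariant_acceleration (\<rho> c) (cmap c \<circ> t) \<theta> = 0)"

definition period :: "real \<Rightarrow> (real \<Rightarrow> 'a) \<Rightarrow> ('a \<Rightarrow> complex) \<Rightarrow> int \<Rightarrow> complex"
  where "period l t f n =
    complex_of_real l *
      integral {0..1} (\<lambda>\<theta>. f (t \<theta>) * exp (- 2 * complex_of_real pi * \<i> * of_int n * of_real \<theta>))"

definition spectral_parameter :: "real \<Rightarrow> complex"
  where "spectral_parameter \<mu> = \<i> * complex_of_real (sqrt (4 * \<mu> - 1))"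

definition model_period :: "real \<Rightarrow> real \<Rightarrow> int \<Rightarrow> complex"
  where "model_period \<mu> l n =
    (let s = spectral_parameter \<mu> in
      complex_of_real l *
      (LINT x|lborel.
         complex_of_real \<bar>x\<bar> powr (- 1 / 2 - s / 2 + 2 * complex_of_real pi * \<i> * of_int n / of_real l) *
         complex_of_real (1 + x\<^sup>2) powr ((s - 1) / 2)))"

text \<open>
  The model period never vanishes when \<open>\<mu> \<ge> 1/4\<close> and \<open>l > 0\<close>, so this is the unique solution \<open>a\<close> of
  \<open>period l t f n = a * model_period \<mu> l n\<close>.
\<close>

definition fourier_coeff ::
    "real \<Rightarrow> real \<Rightarrow> (real \<Rightarrow> 'a) \<Rightarrow> ('a \<Rightarrow> complex) \<Rightarrow> int \<Rightarrow> complex"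
  where "fourier_coeff \<mu> l t f n = period l t f n / model_period \<mu> l n"

end

theory Submission
  imports Defs "HOL-Complex_Analysis.Complex_Analysis" "HOL-Real_Asymp.Real_Asymp"
begin

text \<open>
  Around the geodesic the surface is developed onto the strip \<open>\<bar>Im w\<bar> < \<pi>/2\<close> with metric
  \<open>\<bar>dw\<bar> / cos (Im w)\<close>, the real axis covering the geodesic; at distance \<open>s\<close> from the axis the
  \<open>n\<close>-th Fourier mode of an eigenfunction, symmetrized and scaled by \<open>sqrt (cosh s)\<close>, solves
  \<open>f'' = (\<kappa>\<^sup>2 / cosh\<^sup>2 s - r\<^sup>2) f\<close> with \<open>r\<^sup>2 = \<mu> - 1/4\<close>, \<open>\<kappa>\<^sup>2 = (2\<pi>n/l)\<^sup>2 + 1/4\<close>, \<open>f 0\<close> the period and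
  \<open>f' 0 = 0\<close>. The Wronskian with the solution \<open>\<psi> \<sim> e\<^sup>i\<^sup>r\<^sup>s\<close> equals \<open>f 0 * \<psi>' 0\<close>, and by the duplication
  formula \<open>\<bar>\<psi>' 0\<bar>\<close> times the model period has size at least \<open>(1 + r)\<^sup>1\<^sup>/\<^sup>2\<close> uniformly in \<open>n\<close>. Hence the
  coefficient is bounded by \<open>(1 + r)\<^sup>1\<^sup>/\<^sup>2\<close> times the \<open>L\<^sup>2\<close> norm of \<open>f\<close> over a unit window beyond the
  turning point \<open>e\<^sup>S = 1 + O(\<kappa> / (1 + r))\<close>. Bessel's inequality sums the modes, and the window, an annulus
  of area \<open>O(e\<^sup>S)\<close>, is covered by \<open>O(e\<^sup>S)\<close> embedded boxes, each of which carries at most the total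
  mass 1; so the sum is \<open>O((1 + r) e\<^sup>S) = O(1 + r + \<kappa>)\<close>.
\<close>

section \<open>Holomorphic linear differential equations of second order\<close>

text \<open>The function \<psi> is the Fourier mode of a power of a Poisson kernel. With
  \<open>u\<close> along the axis and \<open>s\<close> the distance from it,
  \<open>cosh s * cosh u + sinh s\<close> to the power -1/2 + ir is an eigenfunction for \<mu>,
  attached to a boundary point on the side s < 0. Its Fourier transform in \<open>u\<close>, times
  \<open>sqrt (cosh s)\<close>, solves the mode equation and is purely outgoing for s > 0. Therefore
  its derivative at 0, its amplitude at infinity and the model period are values of one Beta-type
  integral. The obstacle is uniformity in n and \<mu> together, where asymptotics of Legendre
  functions would split into several regimes. Here the amplitude at infinity enters the bound for
  \<psi> and the Wronskian in the same power and cancels; what remains is a Gamma quotient in r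
  alone. The surface is given by an atlas and a curvature equation only, so the developing map has
  to be built: the metric is linearized locally, compactness yields one radius to which every germ
  of an isometry extends, and steps of that size reach the whole disc. The same radius measures the
  embedded boxes. Since only upper bounds of mass enter, measures are compared by
  inequalities.\<close>

fun ode_coeff :: "(nat \<Rightarrow> complex) \<Rightarrow> complex \<Rightarrow> complex \<Rightarrow> nat \<Rightarrow> complex" where
  "ode_coeff c a b n = (if n = 0 then a else if n = 1 then b
     else (\<Sum>j\<le>n-2. c j * ode_coeff c a b (n - 2 - j)) / (of_nat n * of_nat (n - 1)))"

declare ode_coeff.simps [simp del]

lemma ode_coeff_Suc_Suc:
  "of_nat (n + 2) * of_nat (n + 1) * ode_coeff c a b (n + 2)
    = (\<Sum>j\<le>n. c j * ode_coeff c a b (n - j))"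
  by (subst ode_coeff.simps) (auto simp del: of_nat_Suc of_nat_add)

text \<open>Majorant argument: \<open>A \<ge> 2 * B\<close> turns the convolution into a geometric
  series of ratio 1/2, and \<open>A \<ge> M + 1\<close> lets two powers of \<open>A\<close> absorb
  the factor \<open>M\<close>. The rate \<open>A\<close> is independent of the initial values, which
  enter only through \<open>K\<close>.\<close>

lemma ode_coeff_bound:
  assumes c: "\<And>j. cmod (c j) \<le> M * B ^ j" and B: "B > 0" and M: "M \<ge> 0"
    and A: "A \<ge> 2 * B" "A \<ge> M + 1" "A \<ge> 1"
    and K: "cmod a \<le> K" "cmod b \<le> K"
  shows "cmod (ode_coeff c a b n) \<le> K * A ^ n"
proof (induction n rule: less_induct)
  case (less n)
  have K0: "K \<ge> 0" using K(1) norm_ge_zero order_trans by blast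
  consider "n = 0" | "n = 1" | m where "n = m + 2"
    by (metis One_nat_def add_2_eq_Suc' not0_implies_Suc)
  then show ?case
  proof cases
    case 1 then show ?thesis using K by (simp add: ode_coeff.simps)
  next
    case 2
    have "K \<le> K * A" using K0 A by (simp add: mult_le_cancel_left1)
    then show ?thesis using 2 K by (simp add: ode_coeff.simps)
  next
    case 3
    have "cmod (\<Sum>j\<le>m. c j * ode_coeff c a b (m - j)) \<le> (\<Sum>j\<le>m. (M * B ^ j) * (K * A ^ (m - j)))"
      by (intro sum_norm_le) (auto simp: norm_mult 3 intro!: mult_mono c less mult_nonneg_nonneg M K0 zero_le_power less_imp_le[OF B])
    also have "\<dots> \<le> (\<Sum>j\<le>m. M * K * A ^ m * (1/2) ^ j)"
    proof (rule sum_mono)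
      fix j assume j: "j \<in> {..m}"
      have "B ^ j \<le> (A / 2) ^ j" using A B by (intro power_mono) auto
      then have "B ^ j * A ^ (m - j) \<le> (A / 2) ^ j * A ^ (m - j)"
        using A by (intro mult_right_mono) auto
      also have "\<dots> = A ^ m * (1/2) ^ j"
        using j by (simp add: power_divide flip: power_add)
      finally have "M * K * (B ^ j * A ^ (m - j)) \<le> M * K * (A ^ m * (1/2) ^ j)"
        using M K0 by (intro mult_left_mono) auto
      then show "(M * B ^ j) * (K * A ^ (m - j)) \<le> M * K * A ^ m * (1/2) ^ j"
        by (simp add: mult_ac)
    qed
    also have "\<dots> = M * K * A ^ m * (\<Sum>j\<le>m. (1/2) ^ j)" by (simp add: sum_distrib_left)
    also have "\<dots> \<le> M * K * A ^ m * 2"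
    proof (intro mult_left_mono mult_nonneg_nonneg M K0)
      have "(\<Sum>j\<le>m. (1/2::real) ^ j) = 2 - (1/2) ^ m" by (induction m) auto
      then show "(\<Sum>j\<le>m. (1/2::real) ^ j) \<le> 2" by simp
    qed (use A in auto)
    finally have S: "cmod (\<Sum>j\<le>m. c j * ode_coeff c a b (m - j)) \<le> 2 * (M * K * A ^ m)" by simp
    have "real (m + 2) * real (m + 1) * cmod (ode_coeff c a b (m + 2))
        = cmod (of_nat (m + 2) * of_nat (m + 1) * ode_coeff c a b (m + 2))"
      by (simp only: norm_mult norm_of_nat)
    also have "\<dots> \<le> 2 * (M * K * A ^ m)" using S by (simp only: ode_coeff_Suc_Suc)
    finally have "real (m + 2) * real (m + 1) * cmod (ode_coeff c a b (m + 2)) \<le> 2 * (M * K * A ^ m)" .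
    moreover have "2 * cmod (ode_coeff c a b (m + 2)) \<le> real (m + 2) * real (m + 1) * cmod (ode_coeff c a b (m + 2))"
      by (intro mult_right_mono) (auto simp: algebra_simps)
    moreover have "M * (K * A ^ m) \<le> A^2 * (K * A ^ m)"
    proof (intro mult_right_mono mult_nonneg_nonneg K0)
      have "M \<le> A" using A by simp
      also have "\<dots> \<le> A^2" using A by (simp add: power2_eq_square)
      finally show "M \<le> A^2" .
    qed (use A in auto)
    ultimately show ?thesis using 3 by (simp add: power_add mult_ac power2_eq_square)
  qed
qed

text \<open>The radius \<open>e\<close> is fixed before the initial values \<open>a\<close> and
  \<open>b\<close>: later two solutions with different data are divided by each other on one common
  ball.\<close>

lemma holomorphic_linear_ode2:
  assumes q: "q holomorphic_on ball z0 R" and R: "R > 0"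
  obtains e where "e > 0" "e \<le> R"
    "\<And>a b. \<exists>Y Y'. Y z0 = a \<and> Y' z0 = b \<and>
        (\<forall>z\<in>ball z0 e. (Y has_field_derivative Y' z) (at z) \<and>
                      (Y' has_field_derivative q z * Y z) (at z))"
proof -
  define c where "c = (\<lambda>n. (deriv ^^ n) q z0 / fact n)"
  have sums: "(\<lambda>n. c n * (w - z0) ^ n) sums q w" if "w \<in> ball z0 R" for w
    unfolding c_def using holomorphic_power_series[OF q that] .
  \<comment> \<open>Convergence of the Taylor series of \<open>q\<close> at distance
    \<open>R / 2\<close> bounds its terms there, hence the coefficients by
    \<open>M * (2 / R) ^ j\<close>.\<close>
  define B where "B = 2 / R"
  have B: "B > 0" using R by (simp add: B_def)
  have "summable (\<lambda>n. c n * (complex_of_real (R/2)) ^ n)"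
    using sums[of "z0 + complex_of_real (R/2)"] R by (auto simp: dist_norm sums_iff)
  then have "Bseq (\<lambda>n. c n * (complex_of_real (R/2)) ^ n)"
    using summable_LIMSEQ_zero convergentI Bseq_eq_bounded convergent_imp_Bseq by blast
  then obtain M where M: "M > 0" "\<And>n. cmod (c n * (complex_of_real (R/2)) ^ n) \<le> M"
    by (meson BseqE)
  have cb: "cmod (c j) \<le> M * B ^ j" for j
  proof -
    have "cmod (c j) * (R/2) ^ j \<le> M"
      using M(2)[of j] R by (simp add: norm_mult norm_power norm_divide power_divide)
    then have "cmod (c j) \<le> M / (R/2)^j" using R by (simp add: pos_le_divide_eq)
    also have "\<dots> = M * B ^ j" by (simp add: B_def power_divide)
    finally show ?thesis .
  qed
  define A where "A = 2 * B + M + 1"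
  have A: "A \<ge> 2 * B" "A \<ge> M + 1" "A \<ge> 1" "A > 0" using B M by (auto simp: A_def)
  define F where "F = Abs_fps c"
  have radF: "fps_conv_radius F \<ge> ereal R"
    unfolding fps_conv_radius_def F_def fps_nth_Abs_fps
  proof (rule conv_radius_geI_ex)
    fix r :: real assume r: "0 < r" "ereal r < ereal R"
    then have "(\<lambda>n. c n * (complex_of_real r) ^ n) sums q (z0 + of_real r)"
      using sums[of "z0 + complex_of_real r"] by (auto simp: dist_norm)
    then show "\<exists>z. norm z = r \<and> summable (\<lambda>n. c n * z ^ n)"
      using r by (intro exI[of _ "complex_of_real r"]) (auto simp: sums_iff)
  qed
  define e where "e = min R (1 / A)"
  show ?thesis
  proof (rule that[of e])
    show "e > 0" "e \<le> R" using R A by (auto simp: e_def)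
    fix a b :: complex
    define K where "K = max (cmod a) (cmod b)"
    define G where "G = Abs_fps (ode_coeff c a b)"
    have bd: "cmod (ode_coeff c a b n) \<le> K * A ^ n" for n
      by (rule ode_coeff_bound[OF cb B _ A(1-3)]) (use M in \<open>auto simp: K_def\<close>)
    have K0: "K \<ge> 0" by (simp add: K_def le_max_iff_disj)
    have radG: "fps_conv_radius G \<ge> ereal (1 / A)"
      unfolding fps_conv_radius_def G_def fps_nth_Abs_fps
    proof (rule conv_radius_geI_ex)
      fix r :: real assume r: "0 < r" "ereal r < ereal (1 / A)"
      then have rA: "r * A < 1" using A by (simp add: field_simps)
      have "summable (\<lambda>n. K * (A * r) ^ n)"
        using rA r A by (intro summable_mult summable_geometric) (auto simp: mult_ac)
      then have "summable (\<lambda>n. ode_coeff c a b n * complex_of_real r ^ n)"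
      proof (rule summable_comparison_test'[where N = 0])
        fix n
        have "cmod (ode_coeff c a b n) * r ^ n \<le> K * A ^ n * r ^ n"
          using bd r by (intro mult_right_mono) auto
        then show "norm (ode_coeff c a b n * complex_of_real r ^ n) \<le> K * (A * r) ^ n"
          using r by (simp add: norm_mult norm_power power_mult_distrib mult_ac)
      qed
      then show "\<exists>z. norm z = r \<and> summable (\<lambda>n. ode_coeff c a b n * z ^ n)"
        using r by (intro exI[of _ "complex_of_real r"]) auto
    qed
    have GF: "fps_deriv (fps_deriv G) = F * G"
    proof (rule fps_ext)
      fix n
      have "fps_deriv (fps_deriv G) $ n = of_nat (n + 2) * of_nat (n + 1) * ode_coeff c a b (n + 2)"
        by (simp add: G_def algebra_simps)
      also have "\<dots> = (F * G) $ n"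
        unfolding ode_coeff_Suc_Suc by (simp add: fps_mult_nth F_def G_def atMost_atLeast0)
      finally show "fps_deriv (fps_deriv G) $ n = (F * G) $ n" .
    qed
    define Y where "Y = (\<lambda>z. eval_fps G (z - z0))"
    define Y' where "Y' = (\<lambda>z. eval_fps (fps_deriv G) (z - z0))"
    have "Y z0 = a" "Y' z0 = b"
      by (simp_all add: Y_def Y'_def eval_fps_at_0 G_def ode_coeff.simps)
    moreover have "(Y has_field_derivative Y' z) (at z) \<and> (Y' has_field_derivative q z * Y z) (at z)"
      if z: "z \<in> ball z0 e" for z
    proof -
      have shift: "((\<lambda>z. z - z0) has_field_derivative 1) (at z)"
        by (auto intro!: derivative_eq_intros)
      have zR: "cmod (z - z0) < R" "cmod (z - z0) < 1 / A"
        using z by (auto simp: e_def dist_norm norm_minus_commute)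
      have rG: "ereal (cmod (z - z0)) < fps_conv_radius G" and rF: "ereal (cmod (z - z0)) < fps_conv_radius F"
        using zR radG radF by (meson ereal_less_eq(3) less_ereal.simps(1) order_less_le_trans)+
      have rG': "ereal (cmod (z - z0)) < fps_conv_radius (fps_deriv G)"
        using rG fps_conv_radius_deriv[of G] by (rule order_less_le_trans)
      have 1: "(Y has_field_derivative Y' z) (at z)"
        unfolding Y_def Y'_def
        using DERIV_chain'[of "\<lambda>z. z - z0" 1 z UNIV, OF _ has_field_derivative_eval_fps[OF rG, of UNIV]]
        by (simp add: shift)
      have "(Y' has_field_derivative eval_fps (fps_deriv (fps_deriv G)) (z - z0)) (at z)"
        unfolding Y'_def
        using DERIV_chain'[of "\<lambda>z. z - z0" 1 z UNIV, OF _ has_field_derivative_eval_fps[OF rG', of UNIV]]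
        by (simp add: shift)
      moreover have "eval_fps (fps_deriv (fps_deriv G)) (z - z0) = q z * Y z"
      proof -
        have "eval_fps F (z - z0) = q z"
          using sums[of z] zR by (simp add: eval_fps_def F_def sums_iff dist_norm norm_minus_commute)
        then show ?thesis
          by (simp add: GF eval_fps_mult[OF rF rG] Y_def)
      qed
      ultimately show ?thesis using 1 by simp
    qed
    ultimately show "\<exists>Y Y'. Y z0 = a \<and> Y' z0 = b \<and>
        (\<forall>z\<in>ball z0 e. (Y has_field_derivative Y' z) (at z) \<and>
                      (Y' has_field_derivative q z * Y z) (at z))" by blast
  qed
qed

section \<open>Calculus of smooth functions of two real variables\<close>

text \<open>\<open>Ck_on\<close> differentiates with \<open>at x\<close>, so the two functions must
  agree on a full neighbourhood of each point; openness of \<open>S\<close> provides it.\<close>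

lemma Ck_on_cong:
  assumes "open S" "\<And>x. x \<in> S \<Longrightarrow> f x = g x" "Ck_on k S f"
  shows "Ck_on k S g"
  using assms(2,3)
proof (induction k arbitrary: f g)
  case 0 then show ?case by (auto cong: continuous_on_cong)
next
  case (Suc k)
  have fd: "f differentiable (at x)" if "x \<in> S" for x
    using Suc.prems(2) that at_within_open[OF that assms(1)] by (metis Ck_on.simps(2) differentiable_on_def)
  have "g differentiable_on S"
    unfolding differentiable_on_def
  proof
    fix x assume x: "x \<in> S"
    then obtain D where "(f has_derivative D) (at x within S)"
      using Suc.prems(2) by (auto simp: differentiable_on_def differentiable_def)
    then have "(g has_derivative D) (at x within S)"
      by (rule has_derivative_transform[rotated 2]) (use x Suc.prems(1) in auto)
    then show "g differentiable at x within S" by (auto simp: differentiable_def)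
  qed
  moreover have "Ck_on k S (\<lambda>x. frechet_derivative g (at x) h)" for h
  proof (rule Suc.IH)
    show "Ck_on k S (\<lambda>x. frechet_derivative f (at x) h)" using Suc.prems by simp
    show "frechet_derivative f (at x) h = frechet_derivative g (at x) h" if "x \<in> S" for x
      using frechet_derivative_transform_within_open[OF fd[OF that] assms(1) that Suc.prems(1)] by metis
  qed
  ultimately show ?case by simp
qed

lemma Ck_on_SucD: "Ck_on (Suc k) S f \<Longrightarrow> Ck_on k S f"
proof (induction k arbitrary: f)
  case 0 then show ?case by (auto intro: differentiable_imp_continuous_on)
next
  case (Suc k) then show ?case by simp
qed

lemma Ck_on_antimono: "Ck_on k S f \<Longrightarrow> j \<le> k \<Longrightarrow> Ck_on j S f"
proof (induction k)
  case (Suc k) then show ?case using Ck_on_SucD[of k S f] by (cases "j = Suc k") (auto simp del: Ck_on.simps)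
qed auto

lemma Ck_on_Suc_has_derivative:
  assumes "open S" "Ck_on (Suc k) S f" "x \<in> S"
  shows "(f has_derivative frechet_derivative f (at x)) (at x)"
proof -
  have "f differentiable (at x within S)" using assms by (simp add: differentiable_on_def)
  then show ?thesis unfolding at_within_open[OF assms(3,1)] frechet_derivative_works .
qed

text \<open>Lets an explicit derivative stand in for \<open>frechet_derivative\<close>; the closure
  properties under sums, products, inverses and composition all pass through this rule.\<close>

lemma Ck_on_SucI:
  assumes "open S" "\<And>x. x \<in> S \<Longrightarrow> (f has_derivative f' x) (at x)" "\<And>h. Ck_on k S (\<lambda>x. f' x h)"
  shows "Ck_on (Suc k) S f"
proof -
  have "f differentiable_on S"
    unfolding differentiable_on_def differentiable_def
    using assms(2) has_derivative_at_withinI by blast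
  moreover have "Ck_on k S (\<lambda>x. frechet_derivative f (at x) h)" for h
  proof (rule Ck_on_cong[OF assms(1) _ assms(3)[of h]])
    show "f' x h = frechet_derivative f (at x) h" if "x \<in> S" for x
      using frechet_derivative_at[OF assms(2)[OF that]] by simp
  qed
  ultimately show ?thesis by simp
qed

lemma Ck_on_add:
  assumes "open S" "Ck_on k S f" "Ck_on k S g"
  shows "Ck_on k S (\<lambda>x. f x + g x)"
  using assms(2,3)
proof (induction k arbitrary: f g)
  case 0 then show ?case by (auto intro: continuous_intros)
next
  case (Suc k)
  show ?case
    by (rule Ck_on_SucI[OF assms(1) has_derivative_add[OF
          Ck_on_Suc_has_derivative[OF assms(1) Suc.prems(1)]
          Ck_on_Suc_has_derivative[OF assms(1) Suc.prems(2)]]])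
       (use Suc in auto)
qed

lemma Ck_on_mult:
  fixes f g :: "_ \<Rightarrow> 'b::real_normed_algebra"
  assumes "open S" "Ck_on k S f" "Ck_on k S g"
  shows "Ck_on k S (\<lambda>x. f x * g x)"
  using assms(2,3)
proof (induction k arbitrary: f g)
  case 0 then show ?case by (auto intro: continuous_intros)
next
  case (Suc k)
  show ?case
  proof (rule Ck_on_SucI[OF assms(1) has_derivative_mult[OF
          Ck_on_Suc_has_derivative[OF assms(1) Suc.prems(1)]
          Ck_on_Suc_has_derivative[OF assms(1) Suc.prems(2)]]])
    fix h
    show "Ck_on k S (\<lambda>x. f x * frechet_derivative g (at x) h + frechet_derivative f (at x) h * g x)"
      using Suc.prems Ck_on_SucD[OF Suc.prems(1)] Ck_on_SucD[OF Suc.prems(2)]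
      by (intro Ck_on_add assms(1) Suc.IH) auto
  qed
qed

lemma Ck_on_const: "Ck_on k S (\<lambda>x. c)"
  by (induction k arbitrary: c) auto

lemma Ck_on_inverse:
  fixes f :: "_ \<Rightarrow> real"
  assumes "open S" "Ck_on k S f" "\<And>x. x \<in> S \<Longrightarrow> f x \<noteq> 0"
  shows "Ck_on k S (\<lambda>x. inverse (f x))"
  using assms(2)
proof (induction k)
  case 0 then show ?case using assms(3) by (auto intro: continuous_intros)
next
  case (Suc k)
  show ?case
  proof (rule Ck_on_SucI[OF assms(1)])
    show "((\<lambda>x. inverse (f x)) has_derivative
        (\<lambda>h. - (inverse (f x) * frechet_derivative f (at x) h * inverse (f x)))) (at x)" if "x \<in> S" for x
      by (rule Deriv.has_derivative_inverse[OF assms(3)[OF that] Ck_on_Suc_has_derivative[OF assms(1) Suc.prems that]])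
    fix h
    have i: "Ck_on k S (\<lambda>x. inverse (f x))" by (rule Suc.IH[OF Ck_on_SucD[OF Suc.prems]])
    have "Ck_on k S (\<lambda>x. -1 * (inverse (f x) * frechet_derivative f (at x) h * inverse (f x)))"
      by (intro Ck_on_mult Ck_on_const assms(1) i) (use Suc.prems in auto)
    then show "Ck_on k S (\<lambda>x. - (inverse (f x) * frechet_derivative f (at x) h * inverse (f x)))"
      by simp
  qed
qed

lemma Ck_on_pdx: "Ck_on (Suc k) S f \<Longrightarrow> Ck_on k S (pdx f)"
  and Ck_on_pdy: "Ck_on (Suc k) S f \<Longrightarrow> Ck_on k S (pdy f)"
  by (auto simp: pdx_def pdy_def)

lemma has_derivative_pdx_pdy:
  assumes "open S" "Ck_on (Suc k) S f" "x \<in> S"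
  shows "(f has_derivative (\<lambda>v. Re v *\<^sub>R pdx f x + Im v *\<^sub>R pdy f x)) (at x)"
proof -
  note D = Ck_on_Suc_has_derivative[OF assms]
  have lin: "linear (frechet_derivative f (at x))"
    using D has_derivative_linear by blast
  have "frechet_derivative f (at x) v = Re v *\<^sub>R pdx f x + Im v *\<^sub>R pdy f x" for v
  proof -
    have "frechet_derivative f (at x) (Re v *\<^sub>R 1 + Im v *\<^sub>R \<i>) = Re v *\<^sub>R pdx f x + Im v *\<^sub>R pdy f x"
      by (simp only: pdx_def pdy_def linear_add[OF lin] linear_cmul[OF lin])
    moreover have "Re v *\<^sub>R 1 + Im v *\<^sub>R \<i> = v" by (simp add: complex_eq_iff)
    ultimately show ?thesis by simp
  qed
  then have "frechet_derivative f (at x) = (\<lambda>v. Re v *\<^sub>R pdx f x + Im v *\<^sub>R pdy f x)" by (rule ext)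
  with D show ?thesis by simp
qed

lemma pdx_eqI: "(f has_derivative f') (at x) \<Longrightarrow> pdx f x = f' 1"
  and pdy_eqI: "(f has_derivative f') (at x) \<Longrightarrow> pdy f x = f' \<i>"
  unfolding pdx_def pdy_def using frechet_derivative_at[of f f' x] by simp_all

text \<open>Two mean value theorems, first in direction \<open>u\<close>, then in direction
  \<open>v\<close>. The left-hand side is symmetric in \<open>u\<close> and \<open>v\<close>, which
  is the whole point; \<open>2 * s < e\<close> keeps the small square inside the ball.\<close>

lemma mixed_difference_mvt:
  fixes h :: "complex \<Rightarrow> real"
  assumes "open S" "Ck_on 2 S h" "ball z e \<subseteq> S" "0 < s" "2 * s < e"
    and pv: "(u = 1 \<and> v = \<i>) \<or> (u = \<i> \<and> v = 1)"
  shows "\<exists>\<xi>\<in>ball z e. h (z + of_real s * u + of_real s * v) - h (z + of_real s * u)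
            - (h (z + of_real s * v) - h z)
     = s\<^sup>2 * frechet_derivative (\<lambda>w. frechet_derivative h (at w) u) (at \<xi>) v"
proof -
  have nuv: "cmod u = 1" "cmod v = 1" using pv by auto
  have inb: "z + of_real a * u + of_real b * v \<in> ball z e" if "0 \<le> a" "a \<le> s" "0 \<le> b" "b \<le> s" for a b
  proof -
    have "cmod (of_real a * u + of_real b * v) \<le> a + b"
      using that nuv by (intro norm_triangle_le) (simp add: norm_mult)
    moreover have "dist z (z + of_real a * u + of_real b * v) = cmod (of_real a * u + of_real b * v)"
      by (simp add: dist_norm norm_minus_commute add.commute add.left_commute)
    ultimately show ?thesis using that assms(4,5) by simp
  qed
  have C2: "Ck_on (Suc 1) S h" using assms(2) by (simp add: numeral_2_eq_2)
  have dh: "(h has_derivative frechet_derivative h (at w)) (at w)" if "w \<in> ball z e" for w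
    by (rule Ck_on_Suc_has_derivative[OF assms(1) C2]) (use that assms(3) in auto)
  let ?hu = "\<lambda>w. frechet_derivative h (at w) u"
  have C1: "Ck_on (Suc 0) S ?hu" using C2 by simp
  have dhu: "(?hu has_derivative frechet_derivative ?hu (at w)) (at w)" if "w \<in> ball z e" for w
    by (rule Ck_on_Suc_has_derivative[OF assms(1) C1]) (use that assms(3) in auto)
  define p where "p = (\<lambda>a. h (z + of_real a * u + of_real s * v) - h (z + of_real a * u))"
  have dlin: "((\<lambda>a. f (c + of_real a * d)) has_real_derivative f' d) (at x)"
    if "(f has_derivative f') (at (c + of_real x * d))" for f :: "complex \<Rightarrow> real" and f' c d x
  proof -
    have 1: "((\<lambda>a. c + of_real a * d) has_derivative (\<lambda>t. of_real t * d)) (at x)"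
      by (auto intro!: derivative_eq_intros)
    have "((\<lambda>a. f (c + of_real a * d)) has_derivative (\<lambda>t. f' (of_real t * d))) (at x)"
      using has_derivative_compose[OF 1 that] .
    moreover have "f' (of_real t * d) = f' d * t" for t
      using linear_cmul[OF has_derivative_linear[OF that], of t d] by (simp add: scaleR_conv_of_real)
    ultimately show ?thesis by (simp add: has_field_derivative_def)
  qed
  have "\<exists>a. 0 < a \<and> a < s \<and> p s - p 0 = (s - 0) * (?hu (z + of_real a * u + of_real s * v) - ?hu (z + of_real a * u))"
  proof (rule MVT2[OF assms(4)])
    fix a assume a: "0 \<le> a" "a \<le> s"
    have 1: "((\<lambda>a. h ((z + of_real s * v) + of_real a * u)) has_real_derivative ?hu ((z + of_real s * v) + of_real a * u)) (at a)"
      by (rule dlin[OF dh]) (use inb[of a s] a assms(4) in \<open>auto simp: algebra_simps\<close>)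
    have 2: "((\<lambda>a. h (z + of_real a * u)) has_real_derivative ?hu (z + of_real a * u)) (at a)"
      by (rule dlin[OF dh]) (use inb[of a 0] a assms(4) in \<open>auto simp: algebra_simps\<close>)
    show "(p has_real_derivative (?hu (z + of_real a * u + of_real s * v) - ?hu (z + of_real a * u))) (at a)"
      using DERIV_diff[OF 1 2] unfolding p_def by (simp add: add_ac)
  qed
  then obtain a where a: "0 < a" "a < s"
    "p s - p 0 = s * (?hu (z + of_real a * u + of_real s * v) - ?hu (z + of_real a * u))" by auto
  have "\<exists>b. 0 < b \<and> b < s \<and> ?hu (z + of_real a * u + of_real s * v) - ?hu (z + of_real a * u + of_real 0 * v)
      = (s - 0) * frechet_derivative ?hu (at (z + of_real a * u + of_real b * v)) v"
    by (rule MVT2[OF assms(4)], rule dlin[OF dhu]) (use inb[of a] a in auto)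
  then obtain b where b: "0 < b" "b < s" "?hu (z + of_real a * u + of_real s * v) - ?hu (z + of_real a * u)
      = s * frechet_derivative ?hu (at (z + of_real a * u + of_real b * v)) v" by auto
  have "p s - p 0 = s\<^sup>2 * frechet_derivative ?hu (at (z + of_real a * u + of_real b * v)) v"
    using a(3) b(3) by (simp add: power2_eq_square)
  then show ?thesis
    by (intro bexI[of _ "z + of_real a * u + of_real b * v"] inb) (use a b in \<open>auto simp: p_def\<close>)
qed

lemma pdx_pdy_commute:
  fixes h :: "complex \<Rightarrow> real"
  assumes S: "open S" and C: "Ck_on 2 S h" and z: "z \<in> S"
  shows "pdx (pdy h) z = pdy (pdx h) z"
proof (rule ccontr)
  assume ne: "pdx (pdy h) z \<noteq> pdy (pdx h) z"
  define d where "d = \<bar>pdx (pdy h) z - pdy (pdx h) z\<bar>"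
  have d: "d > 0" using ne by (simp add: d_def)
  have c: "continuous_on S (pdx (pdy h))" "continuous_on S (pdy (pdx h))"
    using C by (auto simp: numeral_2_eq_2 pdx_def pdy_def)
  obtain e0 where e0: "e0 > 0" "ball z e0 \<subseteq> S" using S z openE by blast
  obtain e1 where e1: "e1 > 0" "\<And>w. w \<in> S \<Longrightarrow> dist w z < e1 \<Longrightarrow> \<bar>pdx (pdy h) w - pdx (pdy h) z\<bar> < d/2"
    using c(1) z d unfolding continuous_on_iff dist_real_def by (meson half_gt_zero)
  obtain e2 where e2: "e2 > 0" "\<And>w. w \<in> S \<Longrightarrow> dist w z < e2 \<Longrightarrow> \<bar>pdy (pdx h) w - pdy (pdx h) z\<bar> < d/2"
    using c(2) z d unfolding continuous_on_iff dist_real_def by (meson half_gt_zero)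
  define e where "e = min e0 (min e1 e2)"
  have e: "e > 0" "ball z e \<subseteq> S" using e0 e1 e2 by (auto simp: e_def)
  define s where "s = e / 3"
  have s: "0 < s" "2 * s < e" using e by (auto simp: s_def)
  obtain \<xi> where x: "\<xi> \<in> ball z e" "h (z + of_real s * 1 + of_real s * \<i>) - h (z + of_real s * 1)
            - (h (z + of_real s * \<i>) - h z) = s\<^sup>2 * pdy (pdx h) \<xi>"
    using mixed_difference_mvt[OF S C e(2) s, of 1 \<i>] unfolding pdx_def pdy_def by blast
  obtain \<eta> where y: "\<eta> \<in> ball z e" "h (z + of_real s * \<i> + of_real s * 1) - h (z + of_real s * \<i>)
            - (h (z + of_real s * 1) - h z) = s\<^sup>2 * pdx (pdy h) \<eta>"
    using mixed_difference_mvt[OF S C e(2) s, of \<i> 1] unfolding pdx_def pdy_def by blast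
  \<comment> \<open>The second differences in the two orders coincide, so the two mixed derivatives
    take a common value at points of the ball; by the choice of \<open>e\<close> both are closer
    than \<open>d / 2\<close> to their values at \<open>z\<close>.\<close>
  have "h (z + of_real s * \<i> + of_real s * 1) = h (z + of_real s * 1 + of_real s * \<i>)"
    by (simp add: add_ac)
  with x(2) y(2) have "s\<^sup>2 * pdy (pdx h) \<xi> = s\<^sup>2 * pdx (pdy h) \<eta>" by linarith
  then have eq: "pdy (pdx h) \<xi> = pdx (pdy h) \<eta>" using s by simp
  have "\<bar>pdy (pdx h) \<xi> - pdy (pdx h) z\<bar> < d/2"
    using x(1) e(2) by (intro e2) (auto simp: e_def dist_commute)
  moreover have "\<bar>pdx (pdy h) \<eta> - pdx (pdy h) z\<bar> < d/2"
    using y(1) e(2) by (intro e1) (auto simp: e_def dist_commute)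
  ultimately have "\<bar>pdx (pdy h) z - pdy (pdx h) z\<bar> < d" using eq by arith
  then show False by (simp add: d_def)
qed

section \<open>Local uniformization of metrics of curvature -1\<close>

text \<open>To the right of \<open>t0\<close> the product of \<open>E\<close> with a decaying
  exponential does not increase, to the left the product with a growing one does not decrease; both
  vanish at \<open>t0\<close>.\<close>

lemma gronwall_zero:
  fixes E E' :: "real \<Rightarrow> real"
  assumes d: "\<And>t. \<bar>t - t0\<bar> < d \<Longrightarrow> (E has_real_derivative E' t) (at t)"
    and b: "\<And>t. \<bar>t - t0\<bar> < d \<Longrightarrow> \<bar>E' t\<bar> \<le> K * E t"
    and nn: "\<And>t. \<bar>t - t0\<bar> < d \<Longrightarrow> E t \<ge> 0" and z: "E t0 = 0"
    and t: "\<bar>t - t0\<bar> < d"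
  shows "E t = 0"
proof (cases "t0 \<le> t")
  case True
  have "E t * exp (- K * (t - t0)) \<le> E t0 * exp (- K * (t0 - t0))"
  proof (rule DERIV_nonpos_imp_nonincreasing[OF True, where f = "\<lambda>t. E t * exp (- K * (t - t0))"])
    fix x assume x: "t0 \<le> x" "x \<le> t"
    then have "((\<lambda>t. E t * exp (- K * (t - t0))) has_real_derivative
        (E' x - K * E x) * exp (- K * (x - t0))) (at x)"
      using t by (auto intro!: derivative_eq_intros d simp: algebra_simps)
    moreover have "(E' x - K * E x) * exp (- K * (x - t0)) \<le> 0"
      using b[of x] x t by (intro mult_nonpos_nonneg) auto
    ultimately show "\<exists>y. ((\<lambda>t. E t * exp (- K * (t - t0))) has_real_derivative y) (at x) \<and> y \<le> 0"
      by blast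
  qed
  then have "E t * exp (- K * (t - t0)) \<le> 0" using z by simp
  then show ?thesis using nn[OF t] by (simp add: mult_le_0_iff)
next
  case False
  have "E t * exp (K * (t - t0)) \<le> E t0 * exp (K * (t0 - t0))"
  proof (rule DERIV_nonneg_imp_nondecreasing[where f = "\<lambda>t. E t * exp (K * (t - t0))"])
    show "t \<le> t0" using False by simp
    fix x assume x: "t \<le> x" "x \<le> t0"
    then have "((\<lambda>t. E t * exp (K * (t - t0))) has_real_derivative
        (E' x + K * E x) * exp (K * (x - t0))) (at x)"
      using t by (auto intro!: derivative_eq_intros d simp: algebra_simps)
    moreover have "(E' x + K * E x) * exp (K * (x - t0)) \<ge> 0"
      using b[of x] x t by (intro mult_nonneg_nonneg) auto
    ultimately show "\<exists>y. ((\<lambda>t. E t * exp (K * (t - t0))) has_real_derivative y) (at x) \<and> y \<ge> 0"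
      by blast
  qed
  then have "E t * exp (K * (t - t0)) \<le> 0" using z by simp
  then show ?thesis using nn[OF t] by (simp add: mult_le_0_iff)
qed

lemma has_derivative_line:
  fixes f :: "complex \<Rightarrow> 'b::real_normed_vector"
  assumes "(f has_derivative f') (at (c + of_real x * d))"
  shows "((\<lambda>a. f (c + of_real a * d)) has_vector_derivative f' d) (at x)"
proof -
  have 1: "((\<lambda>a. c + of_real a * d) has_derivative (\<lambda>t. of_real t * d)) (at x)"
    by (auto intro!: derivative_eq_intros)
  have "((\<lambda>a. f (c + of_real a * d)) has_derivative (\<lambda>t. f' (of_real t * d))) (at x)"
    using has_derivative_compose[OF 1 assms] .
  moreover have "f' (of_real t * d) = t *\<^sub>R f' d" for t
    using linear_cmul[OF has_derivative_linear[OF assms], of t d] by (simp add: scaleR_conv_of_real)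
  ultimately show ?thesis by (simp add: has_vector_derivative_def)
qed

text \<open>The triple \<open>(k, K, m)\<close> behaves like \<open>|Y|^2\<close>,
  \<open>Y' * cnj Y\<close>, \<open>|Y'|^2\<close> for a solution of \<open>Y'' = q * Y\<close>;
  these satisfy a closed linear system of first order. Along a segment from \<open>z0\<close> the
  sum of squares obeys a Gronwall inequality.\<close>

lemma hermitian_system_unique:
  fixes k m :: "complex \<Rightarrow> real" and K q :: "complex \<Rightarrow> complex"
  assumes dk: "\<And>z. z \<in> ball z0 e \<Longrightarrow> (k has_derivative (\<lambda>v. 2 * Re (K z * v))) (at z)"
    and dK: "\<And>z. z \<in> ball z0 e \<Longrightarrow>
      (K has_derivative (\<lambda>v. q z * of_real (k z) * v + of_real (m z) * cnj v)) (at z)"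
    and dm: "\<And>z. z \<in> ball z0 e \<Longrightarrow> (m has_derivative (\<lambda>v. 2 * Re (q z * cnj (K z) * v))) (at z)"
    and Q: "\<And>z. z \<in> ball z0 e \<Longrightarrow> cmod (q z) \<le> Q"
    and init: "k z0 = 0" "K z0 = 0" "m z0 = 0" and z: "z \<in> ball z0 e"
  shows "k z = 0"
proof (cases "z = z0")
  case False
  define v where "v = z - z0"
  have v: "cmod v > 0" "cmod v < e" using False z by (auto simp: v_def dist_norm norm_minus_commute)
  \<comment> \<open>Larger than 1, so that the end point \<open>t = 1\<close> of the segment lies
    inside the open interval on which Gronwall is applied.\<close>
  define d where "d = e / cmod v"
  have d: "d > 1" using v by (simp add: d_def)
  have inb: "z0 + of_real t * v \<in> ball z0 e" if "\<bar>t - 0\<bar> < d" for t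
    using that v by (simp add: dist_norm norm_mult d_def pos_less_divide_eq)
  let ?c = "\<lambda>t. z0 + of_real t * v"
  define E where "E = (\<lambda>t. (k (?c t))\<^sup>2 + (Re (K (?c t)))\<^sup>2 + (Im (K (?c t)))\<^sup>2 + (m (?c t))\<^sup>2)"
  define E' where "E' = (\<lambda>t. 2 * k (?c t) * (2 * Re (K (?c t) * v))
      + 2 * Re (cnj (K (?c t)) * (q (?c t) * of_real (k (?c t)) * v + of_real (m (?c t)) * cnj v))
      + 2 * m (?c t) * (2 * Re (q (?c t) * cnj (K (?c t)) * v)))"
  have Q0: "Q \<ge> 0" using Q[OF z] norm_ge_zero order_trans by blast
  have "E 1 = 0"
  proof (rule gronwall_zero[where E = E and E' = E' and ?t0.0 = 0 and d = d and K = "cmod v * (3 + 3 * Q)"])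
    fix t assume t: "\<bar>t - 0\<bar> < d"
    note i = inb[OF t]
    have 1: "((\<lambda>t. k (?c t)) has_real_derivative 2 * Re (K (?c t) * v)) (at t)"
      using has_derivative_line[OF dk[OF i]] by (simp add: has_real_derivative_iff_has_vector_derivative)
    have 2: "((\<lambda>t. m (?c t)) has_real_derivative 2 * Re (q (?c t) * cnj (K (?c t)) * v)) (at t)"
      using has_derivative_line[OF dm[OF i]] by (simp add: has_real_derivative_iff_has_vector_derivative)
    define W where "W = q (?c t) * of_real (k (?c t)) * v + of_real (m (?c t)) * cnj v"
    have 3: "((\<lambda>t. K (?c t)) has_vector_derivative W) (at t)"
      using has_derivative_line[OF dK[OF i]] by (simp add: W_def)
    have 4: "((\<lambda>t. Re (K (?c t))) has_real_derivative Re W) (at t)"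
            "((\<lambda>t. Im (K (?c t))) has_real_derivative Im W) (at t)"
      using 3 by (simp_all add: has_vector_derivative_complex_iff)
    show "(E has_real_derivative E' t) (at t)"
      unfolding E_def E'_def W_def[symmetric]
      by (rule derivative_eq_intros 1 2 4 refl)+ (simp add: algebra_simps)
    define kk KK mm where "kk = \<bar>k (?c t)\<bar>" and "KK = cmod (K (?c t))" and "mm = \<bar>m (?c t)\<bar>"
    have nn: "kk \<ge> 0" "KK \<ge> 0" "mm \<ge> 0" by (auto simp: kk_def KK_def mm_def)
    have qq: "cmod (q (?c t)) \<le> Q" by (rule Q[OF i])
    have Rb: "\<bar>Re w\<bar> \<le> cmod w" for w by (rule abs_Re_le_cmod)
    have b1: "\<bar>2 * k (?c t) * (2 * Re (K (?c t) * v))\<bar> \<le> cmod v * (4 * (kk * KK))"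
    proof -
      have "\<bar>Re (K (?c t) * v)\<bar> \<le> KK * cmod v" unfolding KK_def by (metis Rb norm_mult)
      then have "kk * \<bar>Re (K (?c t) * v)\<bar> \<le> kk * (KK * cmod v)" using nn by (intro mult_left_mono)
      then show ?thesis by (simp add: abs_mult kk_def mult_ac del: times_complex.sel)
    qed
    have b2: "\<bar>2 * Re (cnj (K (?c t)) * W)\<bar> \<le> cmod v * (2 * (Q * (kk * KK)) + 2 * (KK * mm))"
    proof -
      have "cmod W \<le> cmod (q (?c t)) * kk * cmod v + mm * cmod v"
        unfolding W_def kk_def mm_def by (rule norm_triangle_le) (simp add: norm_mult)
      also have "\<dots> \<le> Q * kk * cmod v + mm * cmod v"
        using qq nn by (intro add_mono mult_right_mono) auto
      finally have "KK * cmod W \<le> KK * (Q * kk * cmod v + mm * cmod v)" using nn by (intro mult_left_mono)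
      moreover have "\<bar>Re (cnj (K (?c t)) * W)\<bar> \<le> KK * cmod W"
        unfolding KK_def by (metis Rb norm_mult complex_mod_cnj)
      ultimately show ?thesis by (simp add: abs_mult algebra_simps del: times_complex.sel)
    qed
    have b3: "\<bar>2 * m (?c t) * (2 * Re (q (?c t) * cnj (K (?c t)) * v))\<bar> \<le> cmod v * (4 * (Q * (mm * KK)))"
    proof -
      have "\<bar>Re (q (?c t) * cnj (K (?c t)) * v)\<bar> \<le> cmod (q (?c t)) * KK * cmod v"
        unfolding KK_def by (metis Rb norm_mult complex_mod_cnj)
      also have "\<dots> \<le> Q * KK * cmod v" using qq nn by (intro mult_right_mono) auto
      finally have "mm * \<bar>Re (q (?c t) * cnj (K (?c t)) * v)\<bar> \<le> mm * (Q * KK * cmod v)"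
        using nn by (intro mult_left_mono)
      then show ?thesis by (simp add: abs_mult mm_def mult_ac del: times_complex.sel)
    qed
    have e: "E t = kk\<^sup>2 + KK\<^sup>2 + mm\<^sup>2"
      by (simp add: E_def kk_def KK_def mm_def cmod_power2)
    have "2 * (kk * KK) \<le> kk\<^sup>2 + KK\<^sup>2" "2 * (KK * mm) \<le> KK\<^sup>2 + mm\<^sup>2"
      using sum_squares_bound[of kk KK] sum_squares_bound[of KK mm] by (simp_all add: mult_ac)
    then have s: "2 * (kk * KK) \<le> E t" "2 * (KK * mm) \<le> E t" "2 * (mm * KK) \<le> E t"
      unfolding e mult.commute[of mm KK] using zero_le_power2[of kk] zero_le_power2[of mm] by linarith+
    have "\<bar>E' t\<bar> \<le> cmod v * (4 * (kk * KK)) + cmod v * (2 * (Q * (kk * KK)) + 2 * (KK * mm)) + cmod v * (4 * (Q * (mm * KK)))"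
      unfolding E'_def W_def[symmetric] using b1 b2 b3 by linarith
    also have "\<dots> = cmod v * (2 * (2 * (kk * KK)) + Q * (2 * (kk * KK)) + 2 * (KK * mm) + 2 * Q * (2 * (mm * KK)))"
      by (simp add: algebra_simps)
    also have "\<dots> \<le> cmod v * (2 * E t + Q * E t + E t + 2 * Q * E t)"
      using s Q0 by (intro mult_left_mono add_mono) auto
    finally show "\<bar>E' t\<bar> \<le> cmod v * (3 + 3 * Q) * E t" by (simp add: algebra_simps)
    show "E t \<ge> 0" by (simp add: E_def)
  qed (use init d in \<open>auto simp: E_def\<close>)
  moreover have "?c 1 = z" by (simp add: v_def)
  moreover have "(k (?c 1))\<^sup>2 \<le> E 1" by (simp add: E_def)
  ultimately show ?thesis by simp
qed (use init in simp)

text \<open>With \<open>h = 1 / r\<close>, the function \<open>K\<close> is the z-derivative of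
  \<open>h\<close>, \<open>m\<close> is a quarter of its Laplacian, and \<open>q = h_zz / h\<close>.
  The curvature equation reads \<open>h * (h_xx + h_yy) - h_x^2 - h_y^2 = -1\<close>, a quarter of
  which is the last relation; differentiated once, it says that \<open>q\<close> is holomorphic.
  Classically \<open>q\<close> is minus half the Schwarzian derivative of the developing
  map.\<close>

lemma constant_curvature_system:
  fixes r :: "complex \<Rightarrow> real"
  assumes Z: "open Z" and r: "smooth_on Z r" "\<And>z. z \<in> Z \<Longrightarrow> r z > 0"
    and cu: "\<And>z. z \<in> Z \<Longrightarrow> gaussian_curvature r z = -1"
  obtains K :: "complex \<Rightarrow> complex" and m :: "complex \<Rightarrow> real" and q :: "complex \<Rightarrow> complex"
  where "q holomorphic_on Z"
    "\<And>z. z \<in> Z \<Longrightarrow> ((\<lambda>z. inverse (r z)) has_derivative (\<lambda>v. 2 * Re (K z * v))) (at z)"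
    "\<And>z. z \<in> Z \<Longrightarrow>
      (K has_derivative (\<lambda>v. q z * of_real (inverse (r z)) * v + of_real (m z) * cnj v)) (at z)"
    "\<And>z. z \<in> Z \<Longrightarrow> (m has_derivative (\<lambda>v. 2 * Re (q z * cnj (K z) * v))) (at z)"
    "\<And>z. z \<in> Z \<Longrightarrow> inverse (r z) * m z - (cmod (K z))\<^sup>2 = -1/4"
proof -
  define h where "h = (\<lambda>z. inverse (r z))"
  have hpos: "h z > 0" if "z \<in> Z" for z using r(2)[OF that] by (simp add: h_def)
  have C: "Ck_on k Z h" for k
    unfolding h_def using r by (intro Ck_on_inverse Z) (auto simp: smooth_on_def less_le)
  define hx hy where "hx = pdx h" and "hy = pdy h"
  have C1: "Ck_on k Z hx" "Ck_on k Z hy" for k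
    using C[of "Suc k"] by (auto simp: hx_def hy_def intro: Ck_on_pdx Ck_on_pdy simp del: Ck_on.simps)
  define hxx hxy hyy where "hxx = pdx hx" and "hxy = pdy hx" and "hyy = pdy hy"
  have C2: "Ck_on k Z hxx" "Ck_on k Z hxy" "Ck_on k Z hyy" for k
    using C1[of "Suc k"] by (auto simp: hxx_def hxy_def hyy_def intro: Ck_on_pdx Ck_on_pdy simp del: Ck_on.simps)
  have comm: "pdx hy z = hxy z" if "z \<in> Z" for z
    using pdx_pdy_commute[OF Z C that] by (simp add: hxy_def hx_def hy_def)
  have D: "(f has_derivative (\<lambda>v. Re v * pdx f z + Im v * pdy f z)) (at z)"
    if "\<And>k. Ck_on k Z f" "z \<in> Z" for f :: "complex \<Rightarrow> real" and z
    using has_derivative_pdx_pdy[OF Z that(1)[of "Suc 0"] that(2)] by simp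
  have Dh: "(h has_derivative (\<lambda>v. Re v * hx z + Im v * hy z)) (at z)" if "z \<in> Z" for z
    using D[of h] C that by (simp add: hx_def hy_def)
  have Dhx: "(hx has_derivative (\<lambda>v. Re v * hxx z + Im v * hxy z)) (at z)" if "z \<in> Z" for z
    using D[of hx] C1 that by (simp add: hxx_def hxy_def)
  have Dhy: "(hy has_derivative (\<lambda>v. Re v * hxy z + Im v * hyy z)) (at z)" if "z \<in> Z" for z
    using D[OF C1(2) that] unfolding comm[OF that] hyy_def .
  \<comment> \<open>Symmetry of third derivatives. \<open>pdx hy\<close> agrees with
    \<open>hxy\<close> only on \<open>Z\<close>, hence the transfer of derivatives on an open
    set.\<close>
  have t1: "pdx hyy z = pdy hxy z" if "z \<in> Z" for z
  proof -
    have "pdx hyy z = pdy (pdx hy) z"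
      unfolding hyy_def by (rule pdx_pdy_commute[OF Z C1(2) that])
    also have "\<dots> = pdy hxy z"
    proof -
      have "(pdx hy has_derivative (\<lambda>v. Re v * pdx (pdx hy) z + Im v * pdy (pdx hy) z)) (at z)"
        using D[of "pdx hy" z] that C1(2) Ck_on_pdx by blast
      then have "(hxy has_derivative (\<lambda>v. Re v * pdx (pdx hy) z + Im v * pdy (pdx hy) z)) (at z)"
        by (rule has_derivative_transform_within_open[OF _ Z that]) (rule comm)
      from pdy_eqI[OF this] show ?thesis by simp
    qed
    finally show ?thesis .
  qed
  have t2: "pdx hxy z = pdy hxx z" if "z \<in> Z" for z
    unfolding hxy_def hxx_def by (rule pdx_pdy_commute[OF Z C1(1) that])
  have Dhxx: "(hxx has_derivative (\<lambda>v. Re v * pdx hxx z + Im v * pdy hxx z)) (at z)" if "z \<in> Z" for z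
    using D[of hxx] C2 that by simp
  have Dhyy: "(hyy has_derivative (\<lambda>v. Re v * pdx hyy z + Im v * pdy hyy z)) (at z)" if "z \<in> Z" for z
    using D[of hyy] C2 that by simp
  have Dhxy: "(hxy has_derivative (\<lambda>v. Re v * pdy hxx z + Im v * pdx hyy z)) (at z)" if "z \<in> Z" for z
    using D[OF C2(2) that] unfolding t1[OF that] t2[OF that] .
  \<comment> \<open>the curvature equation in terms of \<open>h = 1/r\<close>\<close>
  have L: "h z * (hxx z + hyy z) - (hx z)\<^sup>2 - (hy z)\<^sup>2 = -1" if z: "z \<in> Z" for z
  proof -
    have Dl: "((\<lambda>w. ln (r w)) has_derivative (\<lambda>v. - (Re v * hx w + Im v * hy w) / h w)) (at w)"
      if w: "w \<in> Z" for w
    proof -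
      have "((\<lambda>w. - ln (h w)) has_derivative (\<lambda>v. - (Re v * hx w + Im v * hy w) / h w)) (at w)"
        using Dh[OF w] hpos[OF w] by (auto intro!: derivative_eq_intros simp: divide_simps)
      then show ?thesis
        by (rule has_derivative_transform_within_open[OF _ Z w]) (use r(2) in \<open>auto simp: h_def ln_inverse\<close>)
    qed
    have lx: "pdx (\<lambda>w. ln (r w)) w = - hx w / h w" and ly: "pdy (\<lambda>w. ln (r w)) w = - hy w / h w"
      if "w \<in> Z" for w
      using pdx_eqI[OF Dl[OF that]] pdy_eqI[OF Dl[OF that]] by auto
    have "((\<lambda>w. - hx w / h w) has_derivative (\<lambda>v. - ((Re v * hxx z + Im v * hxy z) * h z
              - hx z * (Re v * hx z + Im v * hy z)) / (h z)\<^sup>2)) (at z)"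
      using Dh[OF z] Dhx[OF z] hpos[OF z]
      by (auto intro!: derivative_eq_intros simp: divide_simps power2_eq_square algebra_simps)
    then have "(pdx (\<lambda>w. ln (r w)) has_derivative (\<lambda>v. - ((Re v * hxx z + Im v * hxy z) * h z
              - hx z * (Re v * hx z + Im v * hy z)) / (h z)\<^sup>2)) (at z)"
      by (rule has_derivative_transform_within_open[OF _ Z z]) (simp add: lx)
    from pdx_eqI[OF this] have xx: "pdx (pdx (\<lambda>w. ln (r w))) z = - (hxx z * h z - hx z * hx z) / (h z)\<^sup>2" by simp
    have "((\<lambda>w. - hy w / h w) has_derivative (\<lambda>v. - ((Re v * hxy z + Im v * hyy z) * h z
              - hy z * (Re v * hx z + Im v * hy z)) / (h z)\<^sup>2)) (at z)"
      using Dh[OF z] Dhy[OF z] hpos[OF z]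
      by (auto intro!: derivative_eq_intros simp: divide_simps power2_eq_square algebra_simps)
    then have "(pdy (\<lambda>w. ln (r w)) has_derivative (\<lambda>v. - ((Re v * hxy z + Im v * hyy z) * h z
              - hy z * (Re v * hx z + Im v * hy z)) / (h z)\<^sup>2)) (at z)"
      by (rule has_derivative_transform_within_open[OF _ Z z]) (simp add: ly)
    from pdy_eqI[OF this] have yy: "pdy (pdy (\<lambda>w. ln (r w))) z = - (hyy z * h z - hy z * hy z) / (h z)\<^sup>2" by simp
    have "- (- (hxx z * h z - hx z * hx z) / (h z)\<^sup>2 + - (hyy z * h z - hy z * hy z) / (h z)\<^sup>2) / (r z)\<^sup>2 = -1"
      using cu[OF z] by (simp add: gaussian_curvature_def flat_laplacian_def xx yy)
    then have "(hxx z * h z - hx z * hx z) / (h z)\<^sup>2 + (hyy z * h z - hy z * hy z) / (h z)\<^sup>2 = - (r z)\<^sup>2"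
      using r(2)[OF z] by (simp only: minus_divide_left[symmetric] minus_add_distrib minus_minus) (simp add: divide_eq_eq)
    then have "(hxx z * h z - hx z * hx z) + (hyy z * h z - hy z * hy z) = - (r z)\<^sup>2 * (h z)\<^sup>2"
      using hpos[OF z] by (simp add: field_simps flip: add_divide_distrib)
    moreover have "(r z)\<^sup>2 * (h z)\<^sup>2 = 1" using r(2)[OF z] by (simp add: h_def power_inverse)
    ultimately show ?thesis by (simp add: algebra_simps power2_eq_square)
  qed
  define mm where "mm = (\<lambda>z. hxx z + hyy z)"
  \<comment> \<open>The derivative in direction \<open>v\<close> of the left-hand side of the
    curvature equation, which is constant on \<open>Z\<close>.\<close>
  have dL: "(Re v * hx z + Im v * hy z) * (hxx z + hyy z)
       + h z * (Re v * (pdx hxx z + pdx hyy z) + Im v * (pdy hxx z + pdy hyy z))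
       - 2 * hx z * (Re v * hxx z + Im v * hxy z) - 2 * hy z * (Re v * hxy z + Im v * hyy z) = 0"
    if z: "z \<in> Z" for z v
  proof -
    have "((\<lambda>z. h z * (hxx z + hyy z) - (hx z)\<^sup>2 - (hy z)\<^sup>2) has_derivative
      (\<lambda>v. (Re v * hx z + Im v * hy z) * (hxx z + hyy z)
       + h z * (Re v * (pdx hxx z + pdx hyy z) + Im v * (pdy hxx z + pdy hyy z))
       - 2 * hx z * (Re v * hxx z + Im v * hxy z) - 2 * hy z * (Re v * hxy z + Im v * hyy z))) (at z)"
      by (rule derivative_eq_intros Dh Dhx Dhy Dhxx Dhyy z refl)+ (simp add: fun_eq_iff algebra_simps)
    moreover have "((\<lambda>z. h z * (hxx z + hyy z) - (hx z)\<^sup>2 - (hy z)\<^sup>2) has_derivative (\<lambda>v. 0)) (at z)"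
      by (rule has_derivative_transform_within_open[OF has_derivative_const[of "-1"] Z z]) (simp add: L)
    ultimately show ?thesis using has_derivative_unique by (metis (no_types, lifting))
  qed
  have mx: "h z * (pdx hxx z + pdx hyy z) = hx z * (hxx z - hyy z) + 2 * hy z * hxy z"
    and my: "h z * (pdy hxx z + pdy hyy z) = 2 * hx z * hxy z - hy z * (hxx z - hyy z)" if "z \<in> Z" for z
    using dL[OF that, of 1] dL[OF that, of \<i>] by (auto simp: algebra_simps)
  define K where "K = (\<lambda>z. Complex (hx z / 2) (- hy z / 2))"
  define q where "q = (\<lambda>z. Complex ((hxx z - hyy z) / (4 * h z)) (- 2 * hxy z / (4 * h z)))"
  define m where "m = (\<lambda>z. (hxx z + hyy z) / 4)"
  have Dcomplex: "((\<lambda>z. Complex (f z) (g z)) has_derivative (\<lambda>v. Complex (f' v) (g' v))) (at z)"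
    if "(f has_derivative f') (at z)" "(g has_derivative g') (at z)" for f g f' g' and z :: complex
    unfolding Complex_eq using that by (auto intro!: derivative_eq_intros)
  show ?thesis
  proof (rule that[of q K m])
    show "q holomorphic_on Z"
    proof (rule holomorphic_onI)
      fix z assume z: "z \<in> Z"
      let ?ax = "(pdx hxx z - pdx hyy z) / (4 * h z) - (hxx z - hyy z) * hx z / (4 * (h z)\<^sup>2)"
      let ?ay = "(pdy hxx z - pdy hyy z) / (4 * h z) - (hxx z - hyy z) * hy z / (4 * (h z)\<^sup>2)"
      let ?bx = "- 2 * pdy hxx z / (4 * h z) + 2 * hxy z * hx z / (4 * (h z)\<^sup>2)"
      let ?by = "- 2 * pdx hyy z / (4 * h z) + 2 * hxy z * hy z / (4 * (h z)\<^sup>2)"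
      note hp = hpos[OF z]
      have 1: "((\<lambda>z. (hxx z - hyy z) / (4 * h z)) has_derivative (\<lambda>v. Re v * ?ax + Im v * ?ay)) (at z)"
        using Dh[OF z] Dhxx[OF z] Dhyy[OF z] hp
        by (auto intro!: derivative_eq_intros simp: fun_eq_iff divide_simps power2_eq_square)
           (auto simp: algebra_simps)
      have 2: "((\<lambda>z. - 2 * hxy z / (4 * h z)) has_derivative (\<lambda>v. Re v * ?bx + Im v * ?by)) (at z)"
        using Dh[OF z] Dhxy[OF z] hp
        by (auto intro!: derivative_eq_intros simp: fun_eq_iff divide_simps power2_eq_square)
           (auto simp: algebra_simps)
      \<comment> \<open>The Cauchy-Riemann equations for \<open>q\<close> are the differentiated
        curvature equations \<open>mx\<close> and \<open>my\<close>, divided by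
        \<open>h\<close>.\<close>
      have cr1: "?ax = ?by" using mx[OF z] hp by (simp add: divide_simps power2_eq_square) algebra
      have cr2: "?ay = - ?bx" using my[OF z] hp by (simp add: divide_simps power2_eq_square) algebra
      have "(q has_derivative (\<lambda>v. Complex (Re v * ?ax + Im v * ?ay) (Re v * ?bx + Im v * ?by))) (at z)"
        unfolding q_def by (rule Dcomplex[OF 1 2])
      also have "(\<lambda>v. Complex (Re v * ?ax + Im v * ?ay) (Re v * ?bx + Im v * ?by)) = (*) (Complex ?ax ?bx)"
        unfolding cr2 cr1[symmetric] by (simp add: fun_eq_iff complex_eq_iff) (simp add: algebra_simps)
      finally have "(q has_field_derivative Complex ?ax ?bx) (at z)" by (simp add: has_field_derivative_def)
      then show "q field_differentiable (at z within Z)"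
        using field_differentiable_at_within field_differentiable_def by blast
    qed
    fix z assume z: "z \<in> Z"
    note hp = hpos[OF z]
    show "((\<lambda>z. inverse (r z)) has_derivative (\<lambda>v. 2 * Re (K z * v))) (at z)"
      using Dh[OF z] by (simp add: h_def[symmetric] K_def algebra_simps)
    have "(K has_derivative (\<lambda>v. Complex ((Re v * hxx z + Im v * hxy z) / 2) (- (Re v * hxy z + Im v * hyy z) / 2))) (at z)"
      unfolding K_def by (rule Dcomplex) (auto intro!: derivative_eq_intros Dhx[OF z] Dhy[OF z] simp: fun_eq_iff field_simps)
    also have "(\<lambda>v. Complex ((Re v * hxx z + Im v * hxy z) / 2) (- (Re v * hxy z + Im v * hyy z) / 2))
       = (\<lambda>v. q z * of_real (inverse (r z)) * v + of_real (m z) * cnj v)"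
    proof -
      have hz: "inverse (r z) = h z" by (simp add: h_def)
      show ?thesis unfolding hz using hp by (simp add: fun_eq_iff complex_eq_iff q_def m_def field_simps)
    qed
    finally show "(K has_derivative (\<lambda>v. q z * of_real (inverse (r z)) * v + of_real (m z) * cnj v)) (at z)" .
    have "(m has_derivative (\<lambda>v. (Re v * (pdx hxx z + pdx hyy z) + Im v * (pdy hxx z + pdy hyy z)) / 4)) (at z)"
      unfolding m_def by (auto intro!: derivative_eq_intros Dhxx[OF z] Dhyy[OF z] simp: fun_eq_iff algebra_simps)
    also have "(\<lambda>v. (Re v * (pdx hxx z + pdx hyy z) + Im v * (pdy hxx z + pdy hyy z)) / 4)
        = (\<lambda>v. 2 * Re (q z * cnj (K z) * v))"
    proof
      fix v
      have e1: "pdx hxx z + pdx hyy z = (hx z * (hxx z - hyy z) + 2 * hy z * hxy z) / h z"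
        and e2: "pdy hxx z + pdy hyy z = (2 * hx z * hxy z - hy z * (hxx z - hyy z)) / h z"
        using mx[OF z] my[OF z] hp by (simp_all add: field_simps)
      show "(Re v * (pdx hxx z + pdx hyy z) + Im v * (pdy hxx z + pdy hyy z)) / 4 = 2 * Re (q z * cnj (K z) * v)"
        unfolding e1 e2 using hp by (simp add: q_def K_def field_simps)
    qed
    finally show "(m has_derivative (\<lambda>v. 2 * Re (q z * cnj (K z) * v))) (at z)" .
    show "inverse (r z) * m z - (cmod (K z))\<^sup>2 = - 1 / 4"
    proof -
      have hz: "inverse (r z) = h z" by (simp add: h_def)
      show ?thesis unfolding hz cmod_power2
        using L[OF z] by (simp add: m_def K_def power2_eq_square field_simps)
    qed
  qed
qed

text \<open>Linearization of Liouville's equation: \<open>1 / r = |Y1|^2 - |Y2|^2\<close> for two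
  solutions of \<open>Y'' = q * Y\<close>, and \<open>Y2 / Y1\<close> is the isometry. Positivity of
  \<open>1 / r\<close> puts the quotient in the disc; the constant Wronskian gives its derivative
  and thereby the metric.\<close>

lemma local_disc_isometry:
  fixes r :: "complex \<Rightarrow> real"
  assumes Z: "open Z" and r: "smooth_on Z r" "\<And>z. z \<in> Z \<Longrightarrow> r z > 0"
    and cu: "\<And>z. z \<in> Z \<Longrightarrow> gaussian_curvature r z = -1" and z0: "z0 \<in> Z"
  obtains e g g' where "e > 0" "ball z0 e \<subseteq> Z" "g z0 = 0"
    "\<And>z. z \<in> ball z0 e \<Longrightarrow> (g has_field_derivative g' z) (at z)"
    "\<And>z. z \<in> ball z0 e \<Longrightarrow> cmod (g z) < 1"
    "\<And>z. z \<in> ball z0 e \<Longrightarrow> 2 * cmod (g' z) / (1 - (cmod (g z))\<^sup>2) = r z"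
proof -
  define h where "h = (\<lambda>z. inverse (r z))"
  obtain K m q where q: "q holomorphic_on Z"
    and dh: "\<And>z. z \<in> Z \<Longrightarrow> (h has_derivative (\<lambda>v. 2 * Re (K z * v))) (at z)"
    and dK: "\<And>z. z \<in> Z \<Longrightarrow>
      (K has_derivative (\<lambda>v. q z * of_real (h z) * v + of_real (m z) * cnj v)) (at z)"
    and dm: "\<And>z. z \<in> Z \<Longrightarrow> (m has_derivative (\<lambda>v. 2 * Re (q z * cnj (K z) * v))) (at z)"
    and L: "\<And>z. z \<in> Z \<Longrightarrow> h z * m z - (cmod (K z))\<^sup>2 = -1/4"
    unfolding h_def by (rule constant_curvature_system[OF Z r cu]) blast+
  obtain R where R: "R > 0" "cball z0 R \<subseteq> Z" using Z z0 open_contains_cball by blast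
  have hp: "h z > 0" if "z \<in> Z" for z using r(2)[OF that] by (simp add: h_def)
  have "ball z0 R \<subseteq> Z" using R by (meson ball_subset_cball subset_trans)
  then have qR: "q holomorphic_on ball z0 R" using q holomorphic_on_subset by blast
  obtain Q where Q: "\<And>z. z \<in> cball z0 R \<Longrightarrow> cmod (q z) \<le> Q"
  proof -
    have "continuous_on (cball z0 R) q"
      using q R holomorphic_on_imp_continuous_on continuous_on_subset by blast
    then have "bounded (q ` cball z0 R)" by (intro compact_imp_bounded compact_continuous_image) auto
    then show ?thesis using that unfolding bounded_iff by blast
  qed
  obtain e where e: "e > 0" "e \<le> R" and sol:
    "\<And>a b. \<exists>Y Y'. Y z0 = a \<and> Y' z0 = b \<and>
        (\<forall>z\<in>ball z0 e. (Y has_field_derivative Y' z) (at z) \<and>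
                      (Y' has_field_derivative q z * Y z) (at z))"
    using holomorphic_linear_ode2[OF qR R(1)] by blast
  have bZ: "z \<in> Z" if "z \<in> ball z0 e" for z
    using that e R(2) by (meson ball_subset_cball subset_ball subsetD)
  define \<alpha> where "\<alpha> = h z0"
  have \<alpha>: "\<alpha> > 0" using hp[OF z0] by (simp add: \<alpha>_def)
  define s where "s = complex_of_real (sqrt \<alpha>)"
  have s: "s \<noteq> 0" "s * s = of_real \<alpha>" "cnj s = s" "cmod s = sqrt \<alpha>" "s^2 = of_real \<alpha>"
    using \<alpha> by (auto simp: s_def power2_eq_square simp flip: of_real_mult)
  \<comment> \<open>The data are chosen so that the Hermitian expressions in \<open>Y1\<close>,
    \<open>Y2\<close> match \<open>h\<close>, \<open>K\<close>, \<open>m\<close> at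
    \<open>z0\<close>: \<open>Y2\<close> vanishes there to give \<open>g z0 = 0\<close>, and its
    slope \<open>1 / (2 * s)\<close> makes the Wronskian 1/2.\<close>
  obtain Y1 Y1' where Y1: "Y1 z0 = s" "Y1' z0 = K z0 / s"
    "\<And>z. z \<in> ball z0 e \<Longrightarrow> (Y1 has_field_derivative Y1' z) (at z)"
    "\<And>z. z \<in> ball z0 e \<Longrightarrow> (Y1' has_field_derivative q z * Y1 z) (at z)"
    using sol[of s "K z0 / s"] by blast
  obtain Y2 Y2' where Y2: "Y2 z0 = 0" "Y2' z0 = 1 / (2 * s)"
    "\<And>z. z \<in> ball z0 e \<Longrightarrow> (Y2 has_field_derivative Y2' z) (at z)"
    "\<And>z. z \<in> ball z0 e \<Longrightarrow> (Y2' has_field_derivative q z * Y2 z) (at z)"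
    using sol[of 0 "1 / (2 * s)"] by blast
  have ReN: "Re (w * cnj w) = (cmod w)\<^sup>2" for w using cmod_power2[of w] by (simp add: power2_eq_square)
  define k0 where "k0 = (\<lambda>z. Re (Y1 z * cnj (Y1 z)) - Re (Y2 z * cnj (Y2 z)))"
  define K0 where "K0 = (\<lambda>z. Y1' z * cnj (Y1 z) - Y2' z * cnj (Y2 z))"
  define m0 where "m0 = (\<lambda>z. Re (Y1' z * cnj (Y1' z)) - Re (Y2' z * cnj (Y2' z)))"
  have d: "(Y1 has_derivative (*) (Y1' z)) (at z)" "(Y2 has_derivative (*) (Y2' z)) (at z)"
    "(Y1' has_derivative (*) (q z * Y1 z)) (at z)" "(Y2' has_derivative (*) (q z * Y2 z)) (at z)"
    if "z \<in> ball z0 e" for z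
    using Y1(3,4)[OF that] Y2(3,4)[OF that] by (auto simp: has_field_derivative_def)
  have dk0: "(k0 has_derivative (\<lambda>v. 2 * Re (K0 z * v))) (at z)" if "z \<in> ball z0 e" for z
    unfolding k0_def K0_def
    by (rule derivative_eq_intros d that refl)+ (simp add: fun_eq_iff algebra_simps)
  have dK0: "(K0 has_derivative (\<lambda>v. q z * of_real (k0 z) * v + of_real (m0 z) * cnj v)) (at z)"
    if "z \<in> ball z0 e" for z
    unfolding k0_def K0_def m0_def
    by (rule derivative_eq_intros d that refl)+ (simp add: fun_eq_iff complex_eq_iff algebra_simps)
  have dm0: "(m0 has_derivative (\<lambda>v. 2 * Re (q z * cnj (K0 z) * v))) (at z)" if "z \<in> ball z0 e" for z
    unfolding m0_def K0_def
    by (rule derivative_eq_intros d that refl)+ (simp add: fun_eq_iff algebra_simps)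
  \<comment> \<open>The differences of the two triples solve the same linear system. That the third
    one starts at 0 is the relation \<open>h * m - |K|^2 = -1/4\<close> at \<open>z0\<close>, the
    trace left by the curvature being exactly -1.\<close>
  have hk: "h z - k0 z = 0" if z: "z \<in> ball z0 e" for z
  proof (rule hermitian_system_unique[where k = "\<lambda>z. h z - k0 z" and K = "\<lambda>z. K z - K0 z"
          and m = "\<lambda>z. m z - m0 z" and q = q and Q = Q and e = e and ?z0.0 = z0])
    show "h z0 - k0 z0 = 0" using s by (simp add: k0_def Y1 Y2 \<alpha>_def complex_eq_iff)
    show "K z0 - K0 z0 = 0" using s by (simp add: K0_def Y1 Y2)
    have "Re (K z0 / s * cnj (K z0 / s)) = (cmod (K z0))\<^sup>2 / \<alpha>"
      using \<alpha> by (simp only: ReN norm_divide s(4) power_divide real_sqrt_pow2 less_imp_le)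
    moreover have "Re (1 / (2 * s) * cnj (1 / (2 * s))) = 1 / (4 * \<alpha>)"
      using \<alpha> by (simp only: ReN norm_divide s(4) power_divide norm_mult power_mult_distrib real_sqrt_pow2 less_imp_le norm_one norm_numeral) simp
    ultimately have "m0 z0 = (cmod (K z0))\<^sup>2 / \<alpha> - 1 / (4 * \<alpha>)"
      by (simp only: m0_def Y1 Y2)
    also have "\<dots> = m z0" using L[OF z0] \<alpha> by (simp add: \<alpha>_def[symmetric] field_simps)
    finally show "m z0 - m0 z0 = 0" by simp
    fix w assume w: "w \<in> ball z0 e"
    show "((\<lambda>z. h z - k0 z) has_derivative (\<lambda>v. 2 * Re ((K w - K0 w) * v))) (at w)"
      using has_derivative_diff[OF dh[OF bZ[OF w]] dk0[OF w]] by (simp add: algebra_simps)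
    show "((\<lambda>z. K z - K0 z) has_derivative (\<lambda>v. q w * of_real (h w - k0 w) * v + of_real (m w - m0 w) * cnj v)) (at w)"
      using has_derivative_diff[OF dK[OF bZ[OF w]] dK0[OF w]] by (simp add: algebra_simps)
    show "((\<lambda>z. m z - m0 z) has_derivative (\<lambda>v. 2 * Re (q w * cnj (K w - K0 w) * v))) (at w)"
      using has_derivative_diff[OF dm[OF bZ[OF w]] dm0[OF w]] by (simp add: algebra_simps)
    show "cmod (q w) \<le> Q" using w e by (intro Q) auto
  qed (rule z)
  have hY: "h z = (cmod (Y1 z))\<^sup>2 - (cmod (Y2 z))\<^sup>2" if "z \<in> ball z0 e" for z
    using hk[OF that] unfolding k0_def ReN by simp
  have Y1nz: "Y1 z \<noteq> 0" if "z \<in> ball z0 e" for z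
    using hY[OF that] hp[OF bZ[OF that]] by auto
  define W where "W = (\<lambda>z. Y1 z * Y2' z - Y1' z * Y2 z)"
  have W: "W z = 1/2" if "z \<in> ball z0 e" for z
  proof -
    have "\<exists>c. \<forall>w\<in>ball z0 e. W w = c"
    proof (rule has_field_derivative_zero_constant)
      show "(W has_field_derivative 0) (at w within ball z0 e)" if "w \<in> ball z0 e" for w
      proof (rule has_field_derivative_at_within)
        show "(W has_field_derivative 0) (at w)" unfolding W_def
          by (rule derivative_eq_intros Y1(3,4)[OF that] Y2(3,4)[OF that] refl)+ (simp add: algebra_simps)
      qed
    qed simp
    then have "W z = W z0" using that e by auto
    also have "W z0 = 1/2" using s by (simp add: W_def Y1 Y2)
    finally show ?thesis .
  qed
  show ?thesis
  proof (rule that[of e "\<lambda>z. Y2 z / Y1 z" "\<lambda>z. (1/2) / (Y1 z)\<^sup>2"])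
    show "ball z0 e \<subseteq> Z" using bZ by blast
    show "Y2 z0 / Y1 z0 = 0" by (simp add: Y2)
    fix z assume z: "z \<in> ball z0 e"
    note n = Y1nz[OF z]
    show "((\<lambda>z. Y2 z / Y1 z) has_field_derivative (1/2) / (Y1 z)\<^sup>2) (at z)"
      unfolding W[OF z, symmetric] W_def using Y1(3)[OF z] Y2(3)[OF z] n
      by (auto intro!: derivative_eq_intros simp: power2_eq_square algebra_simps)
    have lt: "(cmod (Y2 z))\<^sup>2 < (cmod (Y1 z))\<^sup>2" using hY[OF z] hp[OF bZ[OF z]] by simp
    then have "cmod (Y2 z) < cmod (Y1 z)" using power2_less_imp_less norm_ge_zero by blast
    then show "cmod (Y2 z / Y1 z) < 1" using n by (simp add: norm_divide)
    have "2 * cmod (1 / 2 / (Y1 z)\<^sup>2) / (1 - (cmod (Y2 z / Y1 z))\<^sup>2) = 1 / h z"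
      using n lt by (simp add: hY[OF z] norm_divide norm_power norm_mult power_divide divide_simps)
    also have "1 / h z = r z" by (simp add: h_def divide_inverse)
    finally show "2 * cmod (1 / 2 / (Y1 z)\<^sup>2) / (1 - (cmod (Y2 z / Y1 z))\<^sup>2) = r z" .
  qed (use e in auto)
qed

section \<open>Moebius transformations of the disc\<close>

definition disc_metric :: "complex \<Rightarrow> real"
  where "disc_metric w = 2 / (1 - (cmod w)\<^sup>2)"

text \<open>The disc automorphism taking 0 to \<open>a\<close>; its inverse is
  \<open>moeb (- a)\<close>, and \<open>cmod (moeb (- a) w)\<close> is the pseudo-hyperbolic
  distance of \<open>a\<close> and \<open>w\<close>.\<close>

definition moeb :: "complex \<Rightarrow> complex \<Rightarrow> complex"
  where "moeb a w = (w + a) / (1 + cnj a * w)"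

lemma moeb_denom: "cmod a < 1 \<Longrightarrow> cmod w < 1 \<Longrightarrow> 1 + cnj a * w \<noteq> 0"
proof
  assume a: "cmod a < 1" "cmod w < 1" and "1 + cnj a * w = 0"
  then have "cnj a * w = -1" by (simp add: add_eq_0_iff)
  then have "cmod a * cmod w = 1" by (metis complex_mod_cnj norm_minus_cancel norm_mult norm_one)
  moreover have "cmod a * cmod w < 1" using a mult_strict_mono'[of "cmod a" 1 "cmod w" 1] by simp
  ultimately show False by simp
qed

lemma moeb_0 [simp]: "moeb a 0 = a" "moeb 0 w = w"
  by (simp_all add: moeb_def)

lemma moeb_neg [simp]: "moeb (- a) a = 0"
  by (simp add: moeb_def)

lemma one_minus_cmod_moeb:
  assumes "cmod a < 1" "cmod w < 1"
  shows "1 - (cmod (moeb a w))\<^sup>2 = (1 - (cmod a)\<^sup>2) * (1 - (cmod w)\<^sup>2) / (cmod (1 + cnj a * w))\<^sup>2"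
proof -
  have n: "(cmod (1 + cnj a * w))\<^sup>2 \<noteq> 0" using moeb_denom[OF assms] by simp
  have "(cmod (1 + cnj a * w))\<^sup>2 - (cmod (w + a))\<^sup>2 = (1 - (cmod a)\<^sup>2) * (1 - (cmod w)\<^sup>2)"
    unfolding cmod_power2 by (simp add: power2_eq_square algebra_simps)
  then show ?thesis using n by (simp add: moeb_def norm_divide power_divide divide_simps)
qed

lemma cmod_moeb_less:
  assumes "cmod a < 1" "cmod w < 1" shows "cmod (moeb a w) < 1"
proof -
  have "(cmod w)\<^sup>2 < 1" "(cmod a)\<^sup>2 < 1" using assms by (simp_all add: power_less_one_iff)
  then have "1 - (cmod (moeb a w))\<^sup>2 > 0"
    unfolding one_minus_cmod_moeb[OF assms] using moeb_denom[OF assms] by (simp add: zero_less_mult_iff)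
  then show ?thesis by (simp add: power_less_one_iff)
qed

lemma moeb_inverse:
  assumes "cmod a < 1" "cmod w < 1" shows "moeb (- a) (moeb a w) = w"
proof -
  have n: "1 + cnj a * w \<noteq> 0" using moeb_denom[OF assms] .
  have m: "1 - cnj a * a \<noteq> 0" using moeb_denom[of a "-a"] assms by simp
  have "moeb a w - a = w * (1 - cnj a * a) / (1 + cnj a * w)" using n by (simp add: moeb_def field_simps)
  moreover have "1 - cnj a * moeb a w = (1 - cnj a * a) / (1 + cnj a * w)"
    using n by (simp add: moeb_def field_simps)
  ultimately show ?thesis using n m by (simp add: moeb_def[of "-a"])
qed

lemma moeb_deriv:
  assumes "cmod a < 1" "cmod w < 1"
  shows "(moeb a has_field_derivative (1 - cnj a * a) / (1 + cnj a * w)\<^sup>2) (at w)"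
  unfolding moeb_def using moeb_denom[OF assms]
  by (auto intro!: derivative_eq_intros simp: power2_eq_square field_simps)

lemma disc_metric_moeb:
  assumes "cmod a < 1" "cmod w < 1"
  shows "disc_metric (moeb a w) * cmod ((1 - cnj a * a) / (1 + cnj a * w)\<^sup>2) = disc_metric w"
proof -
  have s: "(cmod w)\<^sup>2 < 1" "(cmod a)\<^sup>2 < 1" using assms by (simp_all add: power_less_one_iff)
  have "1 - cnj a * a = of_real (1 - (cmod a)\<^sup>2)" by (simp add: complex_norm_square mult.commute del: of_real_power)
  then have "cmod (1 - cnj a * a) = 1 - (cmod a)\<^sup>2" using s by (simp only: norm_of_real)
  then show ?thesis
    using s moeb_denom[OF assms]
    by (simp add: disc_metric_def one_minus_cmod_moeb[OF assms] norm_divide norm_power divide_simps)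
qed

text \<open>Serves to fit a Euclidean ball into a pseudo-hyperbolic one: towards the boundary the
  radius has to shrink by the factor \<open>1 - cmod a\<close>.\<close>

lemma cmod_moeb_le:
  assumes "cmod a < 1" "cmod w < 1"
  shows "cmod (moeb (- a) w) * (1 - cmod a) \<le> cmod (w - a)"
proof -
  have "1 - cmod a \<le> cmod (1 - cnj a * w)"
  proof -
    have "cmod (cnj a * w) \<le> cmod a" using assms by (simp add: norm_mult mult_left_le)
    moreover have "1 - cmod (cnj a * w) \<le> cmod (1 - cnj a * w)" using norm_triangle_ineq2[of 1 "cnj a * w"] by simp
    ultimately show ?thesis by simp
  qed
  then have "cmod (moeb (- a) w) * (1 - cmod a) \<le> cmod (moeb (- a) w) * cmod (1 - cnj a * w)"
    by (intro mult_left_mono) auto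
  also have "\<dots> = cmod (w - a)"
    using moeb_denom[of "-a" w] assms by (simp add: moeb_def norm_divide)
  finally show ?thesis .
qed

text \<open>A crude triangle inequality for the pseudo-hyperbolic distance. The factor 4 is the one
  used when the surface is covered by discs of a quarter of their radius.\<close>

lemma moeb_small:
  assumes "e < 1" "cmod a < e / 4" "cmod w < e / 4"
  shows "cmod (moeb a w) < e"
proof -
  have l: "cmod a < 1" "cmod w < 1" using assms norm_ge_zero[of a] by linarith+
  have "cmod (cnj a * w) \<le> 1/4 * 1" unfolding norm_mult complex_mod_cnj
    using assms l by (intro mult_mono) auto
  then have d: "cmod (1 + cnj a * w) \<ge> 3/4" using norm_triangle_ineq4[of "1 + cnj a * w" "cnj a * w"] by simp
  have "cmod (w + a) < e / 2" using assms norm_triangle_ineq[of w a] by simp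
  also have "\<dots> \<le> e * cmod (1 + cnj a * w)"
    using mult_left_mono[OF d, of e] assms norm_ge_zero[of a] by linarith
  finally have "cmod (w + a) < e * cmod (1 + cnj a * w)" .
  moreover have "cmod (1 + cnj a * w) > 0" using d by linarith
  ultimately show ?thesis by (simp add: moeb_def norm_divide pos_divide_less_eq)
qed

text \<open>A curve in the disc is at hyperbolic distance from the origin at most its length;
  then the equality case of the Schwarz lemma applies.\<close>

lemma disc_isometry_fixing_0:
  assumes r: "r > 0" "r \<le> 1" and F0: "F 0 = 0"
    and dF: "\<And>w. w \<in> ball 0 r \<Longrightarrow> (F has_field_derivative F' w) (at w)"
    and F1: "\<And>w. w \<in> ball 0 r \<Longrightarrow> cmod (F w) < 1"
    and iso: "\<And>w. w \<in> ball 0 r \<Longrightarrow> disc_metric (F w) * cmod (F' w) = disc_metric w"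
  obtains \<tau> where "cmod \<tau> = 1" "\<And>w. w \<in> ball 0 r \<Longrightarrow> F w = \<tau> * w"
proof -
  have le: "cmod (F w) \<le> cmod w" if w: "w \<in> ball 0 r" for w
  proof -
    \<comment> \<open>A rotation that turns \<open>F w\<close> into its modulus, so that it suffices
      to follow one real function along the radius.\<close>
    define \<omega> where "\<omega> = (if F w = 0 then 1 else cnj (F w) / of_real (cmod (F w)))"
    have om: "cmod \<omega> = 1" by (simp add: \<omega>_def norm_divide)
    have omF: "\<omega> * F w = of_real (cmod (F w))"
    proof -
      have "cnj (F w) * F w = of_real (cmod (F w)) * of_real (cmod (F w))"
        by (metis complex_norm_square mult.commute power2_eq_square of_real_power)
      then show ?thesis by (auto simp: \<omega>_def)
    qed
    define p where "p = (\<lambda>t. Re (\<omega> * F (of_real t * w)))"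
    \<comment> \<open>\<open>artanh\<close> is half the hyperbolic distance from 0 on the diameter.
      \<open>G\<close> compares the image curve with the radius; the isometry property makes its
      derivative nonpositive.\<close>
    define G where "G = (\<lambda>t. artanh (p t) - artanh (t * cmod w))"
    have in_ball: "of_real t * w \<in> ball 0 r" "t * cmod w < 1" "- 1 < t * cmod w" if "0 \<le> t" "t \<le> 1" for t
    proof -
      have "t * cmod w \<le> 1 * cmod w" using that by (intro mult_right_mono) auto
      then show "of_real t * w \<in> ball 0 r" "t * cmod w < 1" using w that r by (auto simp: norm_mult)
      show "- 1 < t * cmod w" using mult_nonneg_nonneg[OF that(1) norm_ge_zero[of w]] by linarith
    qed
    have pF: "\<bar>p t\<bar> \<le> cmod (F (of_real t * w))" for t
      unfolding p_def using abs_Re_le_cmod[of "\<omega> * F (of_real t * w)"] om by (simp add: norm_mult)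
    have p1: "\<bar>p t\<bar> < 1" if "0 \<le> t" "t \<le> 1" for t
      using pF[of t] F1[OF in_ball(1)[OF that]] by simp
    have "G 1 \<le> G 0"
    proof (rule DERIV_nonpos_imp_nonincreasing[where f = G])
      fix t :: real assume t: "0 \<le> t" "t \<le> 1"
      note i = in_ball[OF t]
      have dp: "(p has_real_derivative Re (\<omega> * (F' (of_real t * w) * w))) (at t)"
      proof -
        have "((\<lambda>t. F (0 + of_real t * w)) has_vector_derivative F' (of_real t * w) * w) (at t)"
          by (rule has_derivative_line[where f' = "(*) (F' (of_real t * w))"]) (use dF[OF i(1)] in \<open>simp add: has_field_derivative_def\<close>)
        then have "((\<lambda>t. \<omega> * F (of_real t * w)) has_vector_derivative \<omega> * (F' (of_real t * w) * w)) (at t)"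
          by (intro has_vector_derivative_mult_right) simp
        then show ?thesis unfolding p_def by (simp add: has_vector_derivative_complex_iff)
      qed
      have "(p t)\<^sup>2 \<le> (cmod (F (of_real t * w)))\<^sup>2" using pF[of t] by (simp add: abs_le_square_iff[symmetric])
      then have q: "1 - (p t)\<^sup>2 \<ge> 1 - (cmod (F (of_real t * w)))\<^sup>2" by simp
      have q0: "1 - (cmod (F (of_real t * w)))\<^sup>2 > 0" using F1[OF i(1)] by (simp add: power_less_one_iff)
      have dG: "(G has_real_derivative (Re (\<omega> * (F' (of_real t * w) * w)) / (1 - (p t)\<^sup>2)
             - cmod w / (1 - (t * cmod w)\<^sup>2))) (at t)"
      proof -
        have 1: "((\<lambda>t. artanh (p t)) has_real_derivative 1 / (1 - (p t)\<^sup>2) * Re (\<omega> * (F' (of_real t * w) * w))) (at t)"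
          by (rule DERIV_chain2[OF artanh_real_has_field_derivative[OF p1[OF t]] dp])
        have "((\<lambda>t. t * cmod w) has_real_derivative cmod w) (at t)" by (auto intro!: derivative_eq_intros)
        then have 2: "((\<lambda>t. artanh (t * cmod w)) has_real_derivative 1 / (1 - (t * cmod w)\<^sup>2) * cmod w) (at t)"
          using i by (intro DERIV_chain2[OF artanh_real_has_field_derivative]) auto
        show ?thesis unfolding G_def using DERIV_diff[OF 1 2] by simp
      qed
      have "Re (\<omega> * (F' (of_real t * w) * w)) \<le> cmod (F' (of_real t * w)) * cmod w"
        using complex_Re_le_cmod[of "\<omega> * (F' (of_real t * w) * w)"] om by (simp add: norm_mult)
      then have "Re (\<omega> * (F' (of_real t * w) * w)) / (1 - (p t)\<^sup>2) \<le> cmod (F' (of_real t * w)) * cmod w / (1 - (p t)\<^sup>2)"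
        using q q0 by (intro divide_right_mono) auto
      also have "\<dots> \<le> cmod (F' (of_real t * w)) * cmod w / (1 - (cmod (F (of_real t * w)))\<^sup>2)"
        using q q0 by (intro divide_left_mono) auto
      also have "\<dots> = cmod w * (disc_metric (F (of_real t * w)) * cmod (F' (of_real t * w))) / 2"
        using q0 by (simp add: disc_metric_def field_simps)
      also have "\<dots> = cmod w / (1 - (t * cmod w)\<^sup>2)"
      proof -
        have "(t * cmod w)\<^sup>2 < 1" using i t by (simp add: abs_square_less_1)
        then show ?thesis unfolding iso[OF i(1)] using t by (simp add: disc_metric_def norm_mult field_simps)
      qed
      finally show "\<exists>y. (G has_real_derivative y) (at t) \<and> y \<le> 0" using dG by fastforce
    qed simp
    then have "artanh (p 1) \<le> artanh (cmod w)" by (simp add: G_def p_def F0)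
    moreover have "\<bar>p 1\<bar> < 1" "cmod w < 1" using p1[of 1] w r by auto
    ultimately have "p 1 \<le> cmod w"
    proof -
      assume le: "artanh (p 1) \<le> artanh (cmod w)" and p: "\<bar>p 1\<bar> < 1" and c: "cmod w < 1"
      have pos: "(1 + p 1) / (1 - p 1) > 0" "(1 + cmod w) / (1 - cmod w) > 0"
        using p c by (auto simp: abs_less_iff add_pos_nonneg)
      have "(1 + p 1) / (1 - p 1) \<le> (1 + cmod w) / (1 - cmod w)"
        using le ln_le_cancel_iff[OF pos] by (simp add: artanh_def)
      then have "(1 + p 1) / (1 - p 1) * ((1 - p 1) * (1 - cmod w)) \<le> (1 + cmod w) / (1 - cmod w) * ((1 - p 1) * (1 - cmod w))"
        using p c by (intro mult_right_mono) (auto simp: abs_less_iff)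
      then have "(1 + p 1) * (1 - cmod w) \<le> (1 + cmod w) * (1 - p 1)"
        using p c by (simp add: abs_less_iff)
      then show ?thesis by (simp add: algebra_simps)
    qed
    then show ?thesis by (simp add: p_def omF del: times_complex.sel)
  qed
  \<comment> \<open>Rescaled to the unit disc for the Schwarz lemma. Equality occurs because
    \<open>disc_metric\<close> has the same value at 0 and at \<open>F 0 = 0\<close>, so the
    derivative there has modulus 1.\<close>
  define f where "f = (\<lambda>z. F (of_real r * z) / of_real r)"
  have rz: "of_real r * z \<in> ball 0 r" if "cmod z < 1" for z
    using that r by (simp add: norm_mult)
  have df: "(f has_field_derivative F' (of_real r * z)) (at z)" if "cmod z < 1" for z
  proof -
    have "((\<lambda>z. of_real r * z) has_field_derivative of_real r) (at z)"
      by (auto intro!: derivative_eq_intros)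
    from DERIV_cdivide[OF DERIV_chain'[OF this dF[OF rz[OF that]]], of "of_real r"]
    show ?thesis using r unfolding f_def by simp
  qed
  have hol: "f holomorphic_on ball 0 1"
    unfolding holomorphic_on_open[OF open_ball]
  proof
    fix x :: complex assume "x \<in> ball 0 1"
    then show "\<exists>f'. (f has_field_derivative f') (at x)" using df[of x] by auto
  qed
  have fle: "cmod (f z) \<le> cmod z" if "cmod z < 1" for z
    using le[OF rz[OF that]] r by (simp add: f_def norm_divide norm_mult field_simps)
  have "deriv f 0 = F' 0" using DERIV_imp_deriv[OF df[of 0]] by simp
  moreover have "cmod (F' 0) = 1" using iso[of 0] r by (simp add: F0 disc_metric_def)
  ultimately obtain \<tau> where tau: "\<And>z. cmod z < 1 \<Longrightarrow> f z = \<tau> * z" "cmod \<tau> = 1"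
    using Schwarz_Lemma(3)[OF hol, of 0] fle F0 by (force simp: f_def intro: le_less_trans)
  show ?thesis
  proof (rule that[OF tau(2)])
    fix w :: complex assume w: "w \<in> ball 0 r"
    have "f (w / of_real r) = \<tau> * (w / of_real r)" using w r by (intro tau) (auto simp: norm_divide)
    then show "F w = \<tau> * w" using r by (simp add: f_def)
  qed
qed

section \<open>Local isometries into the surface\<close>

text \<open>Phrased pointwise so that restriction and gluing are immediate; on an open set it makes
  \<open>\<Phi>\<close> holomorphic in every chart. The function \<open>m\<close> is the density of
  the metric on the source.\<close>

definition local_isometry ::
    "'a::t2_space chart set \<Rightarrow> ('a chart \<Rightarrow> complex \<Rightarrow> real) \<Rightarrow> (complex \<Rightarrow> real) \<Rightarrow> complex set \<Rightarrow> (complex \<Rightarrow> 'a) \<Rightarrow> bool"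
  where "local_isometry A \<rho> m \<Omega> \<Phi> \<longleftrightarrow>
    (\<forall>w\<in>\<Omega>. isCont \<Phi> w \<and>
      (\<forall>c\<in>A. \<Phi> w \<in> cdom c \<longrightarrow>
        (\<exists>D. ((cmap c \<circ> \<Phi>) has_field_derivative D) (at w) \<and> \<rho> c (cmap c (\<Phi> w)) * cmod D = m w)))"

lemma local_isometry_subset: "local_isometry A \<rho> m \<Omega> \<Phi> \<Longrightarrow> \<Omega>' \<subseteq> \<Omega> \<Longrightarrow> local_isometry A \<rho> m \<Omega>' \<Phi>"
  by (auto simp: local_isometry_def)

lemma local_isometry_locally:
  assumes "\<And>w. w \<in> \<Omega> \<Longrightarrow> \<exists>e>0. \<exists>\<Psi>. local_isometry A \<rho> m (ball w e) \<Psi> \<and> (\<forall>z\<in>ball w e. \<Phi> z = \<Psi> z)"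
  shows "local_isometry A \<rho> m \<Omega> \<Phi>"
  unfolding local_isometry_def
proof (intro ballI conjI impI)
  fix w assume "w \<in> \<Omega>"
  then obtain e \<Psi> where e: "e > 0" "local_isometry A \<rho> m (ball w e) \<Psi>" "\<And>z. z \<in> ball w e \<Longrightarrow> \<Phi> z = \<Psi> z"
    using assms by blast
  have ev: "\<forall>\<^sub>F z in nhds w. \<Psi> z = \<Phi> z"
    using e by (auto simp: eventually_nhds intro!: exI[of _ "ball w e"])
  have w: "w \<in> ball w e" using e by simp
  show "isCont \<Phi> w" using e(2) w ev isCont_cong[of \<Psi> \<Phi> w] by (auto simp: local_isometry_def)
  fix c assume c: "c \<in> A" "\<Phi> w \<in> cdom c"
  then obtain D where "((cmap c \<circ> \<Psi>) has_field_derivative D) (at w)" "\<rho> c (cmap c (\<Psi> w)) * cmod D = m w"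
    using e w unfolding local_isometry_def by metis
  moreover have "((cmap c \<circ> \<Psi>) has_field_derivative D) (at w) = ((cmap c \<circ> \<Phi>) has_field_derivative D) (at w)"
    by (rule DERIV_cong_ev) (use ev in \<open>auto elim: eventually_mono\<close>)
  ultimately show "\<exists>D. ((cmap c \<circ> \<Phi>) has_field_derivative D) (at w) \<and> \<rho> c (cmap c (\<Phi> w)) * cmod D = m w"
    using e(3)[OF w] by auto
qed

lemma isCont_ball_subset:
  fixes f :: "'b::metric_space \<Rightarrow> 'a::topological_space"
  assumes "isCont f w" "open U" "f w \<in> U"
  obtains e where "e > 0" "\<And>z. z \<in> ball w e \<Longrightarrow> f z \<in> U"
proof -
  have "\<forall>\<^sub>F z in nhds w. f z \<in> U"
    using topological_tendstoD[OF assms(1)[unfolded isCont_def] assms(2,3)] assms(3)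
    by (simp add: eventually_nhds_conv_at)
  then show ?thesis using that unfolding eventually_nhds_metric by (auto simp: dist_commute)
qed

locale hyperbolic_surface =
  fixes A :: "'a::t2_space chart set" and \<rho> :: "'a chart \<Rightarrow> complex \<Rightarrow> real"
  assumes chs: "compact_hyperbolic_surface A \<rho>"
begin

lemma chart_cover: obtains c where "c \<in> A" "p \<in> cdom c"
  using chs unfolding compact_hyperbolic_surface_def riemann_surface_def by blast

lemma open_cdom: "c \<in> A \<Longrightarrow> open (cdom c)"
  and open_cimg: "c \<in> A \<Longrightarrow> open (cimg c)"
  and chart_homeo: "c \<in> A \<Longrightarrow> homeomorphism (cdom c) (cimg c) (cmap c) (cinv c)"
  and chart_change: "c \<in> A \<Longrightarrow> d \<in> A \<Longrightarrow> (cmap d \<circ> cinv c) holomorphic_on (cmap c ` (cdom c \<inter> cdom d))"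
  and metric_change: "c \<in> A \<Longrightarrow> d \<in> A \<Longrightarrow> p \<in> cdom c \<Longrightarrow> p \<in> cdom d \<Longrightarrow>
       \<rho> c (cmap c p) = \<rho> d (cmap d p) * cmod (deriv (cmap d \<circ> cinv c) (cmap c p))"
  and metric_pos: "c \<in> A \<Longrightarrow> \<zeta> \<in> cimg c \<Longrightarrow> \<rho> c \<zeta> > 0"
  and metric_smooth: "c \<in> A \<Longrightarrow> smooth_on (cimg c) (\<rho> c)"
  and metric_curvature: "c \<in> A \<Longrightarrow> \<zeta> \<in> cimg c \<Longrightarrow> gaussian_curvature (\<rho> c) \<zeta> = -1"
  and compact_surface: "compact (UNIV :: 'a set)"
  using chs unfolding compact_hyperbolic_surface_def riemann_surface_def conformal_metric_def
  by - (elim conjE, blast)+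

lemma cinv_cmap: "c \<in> A \<Longrightarrow> p \<in> cdom c \<Longrightarrow> cinv c (cmap c p) = p"
  and cmap_cinv: "c \<in> A \<Longrightarrow> z \<in> cimg c \<Longrightarrow> cmap c (cinv c z) = z"
  and cont_cmap: "c \<in> A \<Longrightarrow> continuous_on (cdom c) (cmap c)"
  and cont_cinv: "c \<in> A \<Longrightarrow> continuous_on (cimg c) (cinv c)"
  using chart_homeo[of c] unfolding homeomorphism_def by (auto dest: f_inv_into_f)

lemma cinv_in: "c \<in> A \<Longrightarrow> z \<in> cimg c \<Longrightarrow> cinv c z \<in> cdom c"
  by (rule inv_into_into)

lemma open_cmap_image:
  assumes "c \<in> A" "open U" "U \<subseteq> cdom c" shows "open (cmap c ` U)"
proof -
  have "cmap c ` U = cimg c \<inter> cinv c -` U"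
    using assms cinv_cmap[OF assms(1)] cmap_cinv[OF assms(1)] by (force simp: image_iff)
  then show ?thesis
    using continuous_open_preimage[OF cont_cinv[OF assms(1)] open_cimg[OF assms(1)] assms(2)] by simp
qed

lemma open_cinv_image:
  assumes "c \<in> A" "open U" "U \<subseteq> cimg c" shows "open (cinv c ` U)"
proof -
  have "cinv c ` U = cdom c \<inter> cmap c -` U"
  proof (intro equalityI subsetI)
    fix x assume "x \<in> cinv c ` U"
    then show "x \<in> cdom c \<inter> cmap c -` U"
      using assms cinv_in[OF assms(1)] cmap_cinv[OF assms(1)] by auto
  next
    fix x assume "x \<in> cdom c \<inter> cmap c -` U"
    then show "x \<in> cinv c ` U" using cinv_cmap[OF assms(1), of x] by (metis IntE image_eqI vimageE)
  qed
  then show ?thesis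
    using continuous_open_preimage[OF cont_cmap[OF assms(1)] open_cdom[OF assms(1)] assms(2)] by simp
qed

section \<open>Local isometries under chart changes and composition, and their identity
  theorem\<close>

abbreviation LI :: "(complex \<Rightarrow> real) \<Rightarrow> complex set \<Rightarrow> (complex \<Rightarrow> 'a) \<Rightarrow> bool"
  where "LI \<equiv> local_isometry A \<rho>"

text \<open>Coordinate changes are holomorphic and the densities transform by the modulus of their
  derivative, so the isometry condition in one chart implies it in every other.\<close>

lemma chart_change_derivative:
  assumes cA: "c \<in> A" and dA: "d \<in> A" and cont: "isCont \<Phi> w"
    and p: "\<Phi> w \<in> cdom c" "\<Phi> w \<in> cdom d"
    and D: "((cmap c \<circ> \<Phi>) has_field_derivative D) (at w)" "\<rho> c (cmap c (\<Phi> w)) * cmod D = M"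
  shows "\<exists>D'. ((cmap d \<circ> \<Phi>) has_field_derivative D') (at w) \<and> \<rho> d (cmap d (\<Phi> w)) * cmod D' = M"
proof -
  let ?T = "cmap d \<circ> cinv c"
  have op: "open (cmap c ` (cdom c \<inter> cdom d))"
    by (rule open_cmap_image) (auto simp: cA dA open_cdom)
  have T: "(?T has_field_derivative deriv ?T (cmap c (\<Phi> w))) (at (cmap c (\<Phi> w)))"
    by (rule holomorphic_derivI[OF chart_change[OF cA dA] op]) (use p in auto)
  have "(?T \<circ> (cmap c \<circ> \<Phi>) has_field_derivative deriv ?T (cmap c (\<Phi> w)) * D) (at w)"
    by (rule DERIV_chain[OF _ D(1)]) (use T in simp)
  moreover have "\<forall>\<^sub>F z in nhds w. (?T \<circ> (cmap c \<circ> \<Phi>)) z = (cmap d \<circ> \<Phi>) z"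
  proof -
    obtain e where "e > 0" "\<And>z. z \<in> ball w e \<Longrightarrow> \<Phi> z \<in> cdom c"
      using isCont_ball_subset[OF cont open_cdom[OF cA] p(1)] by blast
    then show ?thesis using cinv_cmap[OF cA]
      by (auto simp: eventually_nhds intro!: exI[of _ "ball w e"])
  qed
  ultimately have "((cmap d \<circ> \<Phi>) has_field_derivative deriv ?T (cmap c (\<Phi> w)) * D) (at w)"
    using DERIV_cong_ev[OF refl _ refl] by blast
  moreover have "\<rho> d (cmap d (\<Phi> w)) * cmod (deriv ?T (cmap c (\<Phi> w)) * D) = M"
    using D(2) metric_change[OF cA dA p] by (simp add: norm_mult mult_ac)
  ultimately show ?thesis by blast
qed

lemma LI_I:
  assumes "\<And>w. w \<in> \<Omega> \<Longrightarrow> isCont \<Phi> w"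
    and "\<And>w. w \<in> \<Omega> \<Longrightarrow> \<exists>c\<in>A. \<Phi> w \<in> cdom c \<and>
       (\<exists>D. ((cmap c \<circ> \<Phi>) has_field_derivative D) (at w) \<and> \<rho> c (cmap c (\<Phi> w)) * cmod D = m w)"
  shows "LI m \<Omega> \<Phi>"
  unfolding local_isometry_def using assms chart_change_derivative by metis

lemma LI_compose:
  assumes L: "LI m \<Omega> \<Phi>" and F: "\<And>w. w \<in> \<Omega>' \<Longrightarrow> F w \<in> \<Omega>"
    "\<And>w. w \<in> \<Omega>' \<Longrightarrow> (F has_field_derivative F' w) (at w)"
    "\<And>w. w \<in> \<Omega>' \<Longrightarrow> m (F w) * cmod (F' w) = m' w"
  shows "LI m' \<Omega>' (\<Phi> \<circ> F)"
  unfolding local_isometry_def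
proof (intro ballI conjI impI)
  fix w assume w: "w \<in> \<Omega>'"
  show "isCont (\<Phi> \<circ> F) w"
    using continuous_at_compose[OF DERIV_isCont[OF F(2)[OF w]]] L F(1)[OF w] by (auto simp: local_isometry_def)
  fix c assume c: "c \<in> A" "(\<Phi> \<circ> F) w \<in> cdom c"
  then obtain D where D: "((cmap c \<circ> \<Phi>) has_field_derivative D) (at (F w))" "\<rho> c (cmap c (\<Phi> (F w))) * cmod D = m (F w)"
    using L F(1)[OF w] unfolding local_isometry_def by auto
  have "((cmap c \<circ> \<Phi>) \<circ> F has_field_derivative D * F' w) (at w)"
    by (rule DERIV_chain[OF D(1) F(2)[OF w]])
  moreover have "\<rho> c (cmap c (\<Phi> (F w))) * cmod (D * F' w) = m' w"
    using D(2) F(3)[OF w] by (simp add: norm_mult flip: mult.assoc)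
  ultimately show "\<exists>D. ((cmap c \<circ> (\<Phi> \<circ> F)) has_field_derivative D) (at w) \<and> \<rho> c (cmap c ((\<Phi> \<circ> F) w)) * cmod D = m' w"
    by (auto simp: comp_assoc)
qed

text \<open>By continuity the maps also agree at the limit point \<open>w0\<close>, so near it both
  take values in one chart, where the identity theorem for holomorphic functions applies.\<close>

lemma LI_identity_local:
  assumes f: "LI m \<Omega> f" and g: "LI n \<Omega> g" and \<Omega>: "open \<Omega>" "w0 \<in> \<Omega>"
    and U: "w0 islimpt U" "U \<subseteq> \<Omega>" "\<And>w. w \<in> U \<Longrightarrow> f w = g w"
  shows "\<exists>e>0. ball w0 e \<subseteq> \<Omega> \<and> (\<forall>w\<in>ball w0 e. f w = g w)"
proof -
  have fc: "isCont f w0" and gc: "isCont g w0" using f g \<Omega> by (auto simp: local_isometry_def)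
  have fg: "f w0 = g w0"
  proof (rule tendsto_unique)
    show "at w0 within U \<noteq> bot" using U(1) by (simp add: trivial_limit_within)
    show "(f \<longlongrightarrow> f w0) (at w0 within U)"
      using fc by (metis continuous_at_imp_continuous_at_within continuous_within)
    have "(g \<longlongrightarrow> g w0) (at w0 within U)"
      using gc by (metis continuous_at_imp_continuous_at_within continuous_within)
    then show "(f \<longlongrightarrow> g w0) (at w0 within U)"
      by (rule Lim_transform_eventually) (use U(3) in \<open>auto simp: eventually_at_filter\<close>)
  qed
  obtain c where c: "c \<in> A" "f w0 \<in> cdom c" using chart_cover by blast
  obtain e1 where e1: "e1 > 0" "\<And>z. z \<in> ball w0 e1 \<Longrightarrow> f z \<in> cdom c"
    using isCont_ball_subset[OF fc open_cdom[OF c(1)] c(2)] by blast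
  obtain e2 where e2: "e2 > 0" "\<And>z. z \<in> ball w0 e2 \<Longrightarrow> g z \<in> cdom c"
    using isCont_ball_subset[OF gc open_cdom[OF c(1)]] c(2) fg by metis
  obtain e3 where e3: "e3 > 0" "ball w0 e3 \<subseteq> \<Omega>" using \<Omega> openE by blast
  define e where "e = min e1 (min e2 e3)"
  have e: "e > 0" "ball w0 e \<subseteq> \<Omega>" "\<And>z. z \<in> ball w0 e \<Longrightarrow> f z \<in> cdom c \<and> g z \<in> cdom c"
    using e1 e2 e3 by (auto simp: e_def)
  have hf: "(cmap c \<circ> f) holomorphic_on ball w0 e" and hg: "(cmap c \<circ> g) holomorphic_on ball w0 e"
    using f g e c(1) unfolding local_isometry_def holomorphic_on_def field_differentiable_def
    by (meson subsetD has_field_derivative_at_within)+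
  have lim: "w0 islimpt (U \<inter> ball w0 e)"
    unfolding islimpt_approachable
  proof (intro allI impI)
    fix d :: real assume "d > 0"
    then obtain x where "x \<in> U" "x \<noteq> w0" "dist x w0 < min d e"
      using U(1) e(1) unfolding islimpt_approachable by (metis min_less_iff_conj)
    then show "\<exists>x'\<in>U \<inter> ball w0 e. x' \<noteq> w0 \<and> dist x' w0 < d" by (auto simp: dist_commute)
  qed
  have "(cmap c \<circ> f) w - (cmap c \<circ> g) w = 0" if "w \<in> ball w0 e" for w
    by (rule analytic_continuation[of _ "ball w0 e" "U \<inter> ball w0 e" w0])
       (use that e U lim in \<open>auto intro!: holomorphic_intros hf[unfolded o_def] hg[unfolded o_def]\<close>)
  then have "f w = g w" if "w \<in> ball w0 e" for w
  proof -
    have "cmap c (f w) = cmap c (g w)" using \<open>\<And>w. w \<in> ball w0 e \<Longrightarrow> (cmap c \<circ> f) w - (cmap c \<circ> g) w = 0\<close>[OF that] by simp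
    then have "cinv c (cmap c (f w)) = cinv c (cmap c (g w))" by simp
    then show ?thesis using e(3)[OF that] cinv_cmap[OF c(1)] by simp
  qed
  then show ?thesis using e by blast
qed

text \<open>The set of points near which the two maps coincide is open by definition, and closed
  because the local version turns a limit point of agreement into a ball of agreement.\<close>

lemma LI_identity:
  assumes f: "LI m \<Omega> f" and g: "LI n \<Omega> g" and \<Omega>: "open \<Omega>" "connected \<Omega>" "w0 \<in> \<Omega>"
    and U: "w0 islimpt U" "U \<subseteq> \<Omega>" "\<And>w. w \<in> U \<Longrightarrow> f w = g w" and w: "w \<in> \<Omega>"
  shows "f w = g w"
proof -
  define S where "S = {w \<in> \<Omega>. \<exists>e>0. ball w e \<subseteq> \<Omega> \<and> (\<forall>z\<in>ball w e. f z = g z)}"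
  have op: "open S"
    unfolding open_contains_ball
  proof
    fix x assume "x \<in> S"
    then obtain e where e: "e > 0" "ball x e \<subseteq> \<Omega>" "\<forall>z\<in>ball x e. f z = g z" by (auto simp: S_def)
    have "ball x e \<subseteq> S"
    proof
      fix y assume y: "y \<in> ball x e"
      then obtain d where "d > 0" "ball y d \<subseteq> ball x e" using open_ball openE by blast
      then show "y \<in> S" using y e by (auto simp: S_def)
    qed
    then show "\<exists>e>0. ball x e \<subseteq> S" using e by blast
  qed
  have "closedin (top_of_set \<Omega>) S"
    unfolding closedin_limpt
  proof (intro conjI allI impI)
    show "S \<subseteq> \<Omega>" by (auto simp: S_def)
    fix x assume x: "x islimpt S \<and> x \<in> \<Omega>"
    have "\<exists>e>0. ball x e \<subseteq> \<Omega> \<and> (\<forall>w\<in>ball x e. f w = g w)"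
      by (rule LI_identity_local[OF f g \<Omega>(1), of x S]) (use x in \<open>auto simp: S_def\<close>)
    then show "x \<in> S" using x by (auto simp: S_def)
  qed
  moreover have "openin (top_of_set \<Omega>) S"
  proof -
    have "S = \<Omega> \<inter> S" by (auto simp: S_def)
    then show ?thesis using op by (auto simp: openin_open)
  qed
  moreover have "w0 \<in> S"
    using LI_identity_local[OF f g \<Omega>(1,3) U] \<Omega>(3) by (auto simp: S_def)
  ultimately have "S = \<Omega>" using \<Omega>(2) unfolding connected_clopen by blast
  then show ?thesis using w by (force simp: S_def)
qed

lemma LI_identity_eventually:
  assumes "LI m \<Omega> f" "LI n \<Omega> g" "open \<Omega>" "connected \<Omega>" "w0 \<in> \<Omega>"
    "\<forall>\<^sub>F w in nhds w0. f w = g w" "w \<in> \<Omega>"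
  shows "f w = g w"
proof -
  obtain U where U: "open U" "w0 \<in> U" "\<And>w. w \<in> U \<Longrightarrow> f w = g w"
    using assms(6) by (auto simp: eventually_nhds)
  have "open (U \<inter> \<Omega>)" "w0 \<in> U \<inter> \<Omega>" using U assms by auto
  then have "w0 islimpt (U \<inter> \<Omega>)" using interior_limit_point interior_open by blast
  then show ?thesis using LI_identity[OF assms(1-5), of "U \<inter> \<Omega>"] U assms(7) by blast
qed

end

context hyperbolic_surface
begin

section \<open>Continuation of local isometries over the disc\<close>

text \<open>A parametrization near \<open>\<Psi> 0\<close> by a hyperbolic disc. The last clause
  says that every local isometry hitting the image factors near \<open>w0\<close> through an
  isometry \<open>F\<close> between pieces of the disc. It hides the chart used in the construction,
  so that a parametrization can be recentred.\<close>

definition normal_param :: "real \<Rightarrow> (complex \<Rightarrow> 'a) \<Rightarrow> bool"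
  where "normal_param \<epsilon> \<Psi> \<longleftrightarrow> LI disc_metric (ball 0 \<epsilon>) \<Psi> \<and> inj_on \<Psi> (ball 0 \<epsilon>) \<and>
    (\<forall>\<Phi> \<Omega> w0. open \<Omega> \<longrightarrow> LI disc_metric \<Omega> \<Phi> \<longrightarrow> w0 \<in> \<Omega> \<longrightarrow> \<Phi> w0 \<in> \<Psi> ` ball 0 \<epsilon> \<longrightarrow>
      (\<exists>F r F'. r > 0 \<and> ball w0 r \<subseteq> \<Omega> \<and> (\<forall>w\<in>ball w0 r. F w \<in> ball 0 \<epsilon> \<and> \<Phi> w = \<Psi> (F w) \<and>
          (F has_field_derivative F' w) (at w) \<and> disc_metric (F w) * cmod (F' w) = disc_metric w)))"

text \<open>The inverse of the isometry from \<open>local_disc_isometry\<close>, followed by the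
  inverse chart. Openness of images is recorded for the compactness argument below.\<close>

lemma normal_param_exists:
  obtains \<epsilon> \<Psi> where "\<epsilon> > 0" "\<epsilon> < 1" "normal_param \<epsilon> \<Psi>" "\<Psi> 0 = p"
    "\<And>S. open S \<Longrightarrow> S \<subseteq> ball 0 \<epsilon> \<Longrightarrow> open (\<Psi> ` S)"
proof -
  obtain c where c: "c \<in> A" "p \<in> cdom c" using chart_cover by blast
  define z0 where "z0 = cmap c p"
  have z0: "z0 \<in> cimg c" using c by (simp add: z0_def)
  obtain e g g' where e: "e > 0" "ball z0 e \<subseteq> cimg c" and g0: "g z0 = 0"
    and dg: "\<And>z. z \<in> ball z0 e \<Longrightarrow> (g has_field_derivative g' z) (at z)"
    and g1: "\<And>z. z \<in> ball z0 e \<Longrightarrow> cmod (g z) < 1"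
    and iso: "\<And>z. z \<in> ball z0 e \<Longrightarrow> 2 * cmod (g' z) / (1 - (cmod (g z))\<^sup>2) = \<rho> c z"
    using local_disc_isometry[OF open_cimg[OF c(1)] metric_smooth[OF c(1)] metric_pos[OF c(1)]
        metric_curvature[OF c(1)] z0] by blast
  have hol: "g holomorphic_on ball z0 e"
    using dg unfolding holomorphic_on_open[OF open_ball] by blast
  have dgd: "deriv g z = g' z" if "z \<in> ball z0 e" for z
    using DERIV_imp_deriv[OF dg[OF that]] .
  have g'nz: "g' z \<noteq> 0" if "z \<in> ball z0 e" for z
    using iso[OF that] metric_pos[OF c(1)] e that by fastforce
  have "deriv g z0 \<noteq> 0" using g'nz[of z0] dgd[of z0] e by simp
  then obtain r where r: "r > 0" "ball z0 r \<subseteq> ball z0 e" "open (g ` ball z0 r)" "inj_on g (ball z0 r)"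
    using has_complex_derivative_locally_invertible[OF hol _ open_ball, of z0] e by auto
  define B where "B = ball z0 r"
  have Be: "z \<in> ball z0 e" "z \<in> cimg c" if "z \<in> B" for z using that r e by (auto simp: B_def)
  obtain k where k: "k holomorphic_on (g ` B)" "\<And>z. z \<in> B \<Longrightarrow> deriv g z * deriv k (g z) = 1"
    "\<And>z. z \<in> B \<Longrightarrow> k (g z) = z"
    using holomorphic_has_inverse[OF holomorphic_on_subset[OF hol r(2)] open_ball r(4)] unfolding B_def by metis
  have "0 \<in> g ` B" using g0 r(1) by (force simp: B_def)
  then obtain e1 where e1: "e1 > 0" "ball 0 e1 \<subseteq> g ` B" using r(3) openE unfolding B_def by blast
  define \<epsilon> where "\<epsilon> = min e1 (1/2)"
  have eps: "\<epsilon> > 0" "\<epsilon> < 1" "ball 0 \<epsilon> \<subseteq> g ` B" using e1 by (auto simp: \<epsilon>_def)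
  define \<Psi> where "\<Psi> = (\<lambda>w. cinv c (k w))"
  have kB: "k w \<in> B" "g (k w) = w" if "w \<in> ball 0 \<epsilon>" for w :: complex
    using that eps(3) k(3) by fastforce+
  have cPsi: "\<Psi> w \<in> cdom c" "cmap c (\<Psi> w) = k w" if "w \<in> ball 0 \<epsilon>" for w :: complex
    using kB[OF that] Be cmap_cinv[OF c(1)] cinv_in[OF c(1)] by (auto simp: \<Psi>_def)
  have opB: "open (g ` B)" using r(3) by (simp add: B_def)
  have dk: "(k has_field_derivative deriv k w) (at w)" if "w \<in> ball 0 \<epsilon>" for w :: complex
    by (rule holomorphic_derivI[OF k(1) opB]) (use that eps in auto)
  have imopen: "open (\<Psi> ` S)" if S: "open S" "S \<subseteq> ball 0 \<epsilon>" for S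
  proof -
    have "k ` S = B \<inter> g -` S"
    proof (intro equalityI subsetI)
      fix x assume "x \<in> k ` S" then show "x \<in> B \<inter> g -` S" using S kB by auto
    next
      fix x assume "x \<in> B \<inter> g -` S" then show "x \<in> k ` S" using k(3) by force
    qed
    moreover have "continuous_on B g"
      using holomorphic_on_imp_continuous_on[OF hol] r(2) continuous_on_subset unfolding B_def by blast
    ultimately have "open (k ` S)" using continuous_open_preimage[of B g S] S by (simp add: B_def)
    moreover have "k ` S \<subseteq> cimg c" using S kB Be by blast
    ultimately have "open (cinv c ` k ` S)" by (rule open_cinv_image[OF c(1)])
    then show ?thesis by (simp add: \<Psi>_def image_image)
  qed
  have LIP: "LI disc_metric (ball 0 \<epsilon>) \<Psi>"
  proof (rule LI_I)
    fix w :: complex assume w: "w \<in> ball 0 \<epsilon>"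
    have kw: "k w \<in> cimg c" using kB[OF w] Be by blast
    have "isCont (cinv c) (k w)"
      using cont_cinv[OF c(1)] kw unfolding continuous_on_eq_continuous_at[OF open_cimg[OF c(1)]] by (rule bspec)
    then show "isCont \<Psi> w"
      unfolding \<Psi>_def using continuous_at_compose[OF DERIV_isCont[OF dk[OF w]], of "cinv c"] by (simp add: o_def)
    have ev: "\<forall>\<^sub>F z in nhds w. k z = (cmap c \<circ> \<Psi>) z"
      unfolding eventually_nhds by (rule exI[of _ "ball 0 \<epsilon>"]) (use w cPsi in auto)
    have D: "((cmap c \<circ> \<Psi>) has_field_derivative deriv k w) (at w)"
      using DERIV_cong_ev[OF refl ev refl] dk[OF w] by blast
    define z where "z = k w"
    have z: "z \<in> B" "g z = w" using kB[OF w] by (auto simp: z_def)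
    have one: "cmod (g' z) * cmod (deriv k w) = 1"
      using k(2)[OF z(1)] dgd[OF Be(1)[OF z(1)]] z(2) by (metis norm_mult norm_one)
    have "\<rho> c z * cmod (deriv k w) = 2 * (cmod (g' z) * cmod (deriv k w)) / (1 - (cmod w)\<^sup>2)"
      using iso[OF Be(1)[OF z(1)]] z(2) by (simp flip: \<open>_ = \<rho> c z\<close>)
    then have "\<rho> c (cmap c (\<Psi> w)) * cmod (deriv k w) = disc_metric w"
      unfolding one cPsi(2)[OF w] z_def[symmetric] by (simp add: disc_metric_def)
    then show "\<exists>c\<in>A. \<Psi> w \<in> cdom c \<and> (\<exists>D. ((cmap c \<circ> \<Psi>) has_field_derivative D) (at w) \<and>
        \<rho> c (cmap c (\<Psi> w)) * cmod D = disc_metric w)"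
      using c(1) cPsi(1)[OF w] D by blast
  qed
  have inj: "inj_on \<Psi> (ball 0 \<epsilon>)"
    by (rule inj_on_inverseI[of _ "\<lambda>x. g (cmap c x)"]) (simp add: cPsi kB)
  \<comment> \<open>The lift is \<open>g\<close> after the chart, the inverse of
    \<open>\<Psi>\<close>; continuity of \<open>\<Phi>\<close> keeps it in the disc near
    \<open>w0\<close>.\<close>
  have lift: "\<exists>F r F'. r > 0 \<and> ball w0 r \<subseteq> \<Omega> \<and> (\<forall>w\<in>ball w0 r. F w \<in> ball 0 \<epsilon> \<and> \<Phi> w = \<Psi> (F w) \<and>
          (F has_field_derivative F' w) (at w) \<and> disc_metric (F w) * cmod (F' w) = disc_metric w)"
    if \<Omega>: "open \<Omega>" and L: "LI disc_metric \<Omega> \<Phi>" and w0: "w0 \<in> \<Omega>" "\<Phi> w0 \<in> \<Psi> ` ball 0 \<epsilon>" for \<Phi> \<Omega> w0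
  proof -
    have "isCont \<Phi> w0" using L w0 by (auto simp: local_isometry_def)
    moreover have "open (\<Psi> ` ball 0 \<epsilon>)" by (rule imopen) auto
    ultimately obtain r1 where r1: "r1 > 0" "\<And>w. w \<in> ball w0 r1 \<Longrightarrow> \<Phi> w \<in> \<Psi> ` ball 0 \<epsilon>"
      using isCont_ball_subset w0(2) by blast
    obtain r2 where r2: "r2 > 0" "ball w0 r2 \<subseteq> \<Omega>" using \<Omega> w0 openE by blast
    define r where "r = min r1 r2"
    define F where "F = (\<lambda>w. g (cmap c (\<Phi> w)))"
    have "F w \<in> ball 0 \<epsilon> \<and> \<Phi> w = \<Psi> (F w) \<and>
       (\<exists>D. (F has_field_derivative D) (at w) \<and> disc_metric (F w) * cmod D = disc_metric w)"
      if w: "w \<in> ball w0 r" for w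
    proof -
      have "w \<in> ball w0 r1" "w \<in> \<Omega>" using w r2 by (auto simp: r_def)
      then obtain a where a: "a \<in> ball 0 \<epsilon>" "\<Phi> w = \<Psi> a" using r1(2) by blast
      have ca: "cmap c (\<Phi> w) = k a" "\<Phi> w \<in> cdom c" using a cPsi by auto
      have Fa: "F w = a" using kB[OF a(1)] by (simp add: F_def ca)
      obtain D where D: "((cmap c \<circ> \<Phi>) has_field_derivative D) (at w)" "\<rho> c (cmap c (\<Phi> w)) * cmod D = disc_metric w"
        using L \<open>w \<in> \<Omega>\<close> c(1) ca(2) unfolding local_isometry_def by blast
      have kae: "k a \<in> ball z0 e" using kB[OF a(1)] Be by blast
      have "(g \<circ> (cmap c \<circ> \<Phi>) has_field_derivative g' (k a) * D) (at w)"
        by (rule DERIV_chain[OF _ D(1)]) (use dg[OF kae] ca in simp)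
      then have "(F has_field_derivative g' (k a) * D) (at w)" by (simp add: F_def o_def)
      moreover have "disc_metric (F w) * cmod (g' (k a) * D) = disc_metric w"
      proof -
        have i: "disc_metric a * cmod (g' (k a)) = \<rho> c (k a)"
          using iso[OF kae] kB(2)[OF a(1)] by (simp add: disc_metric_def)
        show ?thesis using D(2) unfolding Fa norm_mult ca(1) mult.assoc[symmetric] i .
      qed
      ultimately show ?thesis using a Fa by auto
    qed
    then obtain F' where "\<forall>w\<in>ball w0 r. F w \<in> ball 0 \<epsilon> \<and> \<Phi> w = \<Psi> (F w) \<and>
       (F has_field_derivative F' w) (at w) \<and> disc_metric (F w) * cmod (F' w) = disc_metric w"
      by metis
    then show ?thesis using r1 r2 by (intro exI[of _ F] exI[of _ r] exI[of _ F']) (auto simp: r_def)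
  qed
  show ?thesis
  proof (rule that[OF eps(1,2) _ _ imopen])
    show "normal_param \<epsilon> \<Psi>" unfolding normal_param_def using LIP inj lift by blast
    show "\<Psi> 0 = p" using k(3)[of z0] r(1) g0 cinv_cmap[OF c] by (simp add: \<Psi>_def B_def z0_def)
  qed
qed

text \<open>Recentring at \<open>\<Psi> a\<close>: a lift for \<open>\<Psi>\<close> is followed by
  \<open>moeb (- a)\<close>. Injectivity of \<open>\<Psi>\<close> determines the old lift at
  \<open>w0\<close>, and continuity then keeps the new one inside the disc of radius
  \<open>\<delta>\<close>.\<close>

lemma normal_param_moeb:
  assumes N: "normal_param \<epsilon> \<Psi>" and a: "cmod a < 1" and d: "0 < \<delta>" "\<delta> \<le> 1" and e1: "\<epsilon> \<le> 1"
    and sub: "\<And>w. w \<in> ball 0 \<delta> \<Longrightarrow> moeb a w \<in> ball 0 \<epsilon>"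
  shows "normal_param \<delta> (\<Psi> \<circ> moeb a)"
proof -
  have b1: "cmod w < 1" if "w \<in> ball 0 \<delta>" for w using that d by simp
  have "LI disc_metric (ball 0 \<delta>) (\<Psi> \<circ> moeb a)"
    by (rule LI_compose[where F = "moeb a" and \<Omega> = "ball 0 \<epsilon>" and m = disc_metric])
       (use N sub b1 a disc_metric_moeb moeb_deriv in \<open>auto simp: normal_param_def\<close>)
  moreover have "inj_on (\<Psi> \<circ> moeb a) (ball 0 \<delta>)"
  proof (rule comp_inj_on)
    show "inj_on (moeb a) (ball 0 \<delta>)"
      by (rule inj_on_inverseI[of _ "moeb (- a)"]) (use moeb_inverse a b1 in auto)
    show "inj_on \<Psi> (moeb a ` ball 0 \<delta>)"
      using N sub by (auto simp: normal_param_def intro: inj_on_subset)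
  qed
  moreover have "\<exists>F r F'. r > 0 \<and> ball w0 r \<subseteq> \<Omega> \<and> (\<forall>w\<in>ball w0 r. F w \<in> ball 0 \<delta> \<and> \<Phi> w = (\<Psi> \<circ> moeb a) (F w) \<and>
          (F has_field_derivative F' w) (at w) \<and> disc_metric (F w) * cmod (F' w) = disc_metric w)"
    if \<Omega>: "open \<Omega>" and L: "LI disc_metric \<Omega> \<Phi>" and w0: "w0 \<in> \<Omega>" "\<Phi> w0 \<in> (\<Psi> \<circ> moeb a) ` ball 0 \<delta>" for \<Phi> \<Omega> w0
  proof -
    obtain b where b: "b \<in> ball 0 \<delta>" "\<Phi> w0 = \<Psi> (moeb a b)" using w0 by auto
    then have "\<Phi> w0 \<in> \<Psi> ` ball 0 \<epsilon>" using sub by blast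
    then obtain F r F' where r: "r > 0" "ball w0 r \<subseteq> \<Omega>" and F: "\<And>w. w \<in> ball w0 r \<Longrightarrow> F w \<in> ball 0 \<epsilon> \<and> \<Phi> w = \<Psi> (F w) \<and>
          (F has_field_derivative F' w) (at w) \<and> disc_metric (F w) * cmod (F' w) = disc_metric w"
      using N \<Omega> L w0 unfolding normal_param_def by metis
    define G where "G = (\<lambda>w. moeb (- a) (F w))"
    define G' where "G' = (\<lambda>w. (1 - cnj (-a) * (-a)) / (1 + cnj (-a) * F w)\<^sup>2 * F' w)"
    have Fl: "cmod (F w) < 1" if "w \<in> ball w0 r" for w using F[OF that] e1 by auto
    have dG: "(G has_field_derivative G' w) (at w)" if "w \<in> ball w0 r" for w
      unfolding G_def G'_def
      by (rule DERIV_chain2[OF moeb_deriv]) (use a Fl F that in auto)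
    have "F w0 = moeb a b"
      using F[of w0] r(1) b sub[OF b(1)] N unfolding normal_param_def inj_on_def by auto
    then have G0: "G w0 = b" using moeb_inverse[OF a b1[OF b(1)]] by (simp add: G_def)
    have "isCont G w0" using dG[of w0] r(1) DERIV_isCont by auto
    then obtain r1 where r1: "r1 > 0" "\<And>w. w \<in> ball w0 r1 \<Longrightarrow> G w \<in> ball 0 \<delta>"
      using isCont_ball_subset[OF \<open>isCont G w0\<close> open_ball, of 0 \<delta>] b(1) G0 by auto
    have "\<forall>w\<in>ball w0 (min r r1). G w \<in> ball 0 \<delta> \<and> \<Phi> w = (\<Psi> \<circ> moeb a) (G w) \<and>
          (G has_field_derivative G' w) (at w) \<and> disc_metric (G w) * cmod (G' w) = disc_metric w"
    proof (intro ballI conjI)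
      fix w assume w: "w \<in> ball w0 (min r r1)"
      then have w': "w \<in> ball w0 r" by simp
      show "G w \<in> ball 0 \<delta>" using r1 w by auto
      have "moeb a (G w) = F w"
        using moeb_inverse[of "- a" "F w"] a Fl[OF w'] by (simp add: G_def)
      then show "\<Phi> w = (\<Psi> \<circ> moeb a) (G w)" using F[OF w'] by simp
      show "(G has_field_derivative G' w) (at w)" by (rule dG[OF w'])
      have "disc_metric (G w) * cmod ((1 - cnj (-a) * (-a)) / (1 + cnj (-a) * F w)\<^sup>2) = disc_metric (F w)"
        unfolding G_def by (rule disc_metric_moeb) (use a Fl[OF w'] in auto)
      then show "disc_metric (G w) * cmod (G' w) = disc_metric w"
        using F[OF w'] by (simp only: G'_def norm_mult flip: mult.assoc)
    qed
    then show ?thesis using r r1 by (intro exI[of _ G] exI[of _ "min r r1"] exI[of _ G']) auto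
  qed
  ultimately show ?thesis unfolding normal_param_def by blast
qed

text \<open>A Lebesgue number argument. Finitely many discs of a quarter of their radius cover the
  compact surface, and by \<open>moeb_small\<close> each of their points can be recentred with the
  smallest of these quarters as radius. This uniform radius plays the role of completeness.\<close>

lemma uniform_normal_param:
  obtains \<epsilon> where "\<epsilon> > 0" "\<epsilon> < 1" "\<And>p. \<exists>\<Psi>. normal_param \<epsilon> \<Psi> \<and> \<Psi> 0 = p"
proof -
  have "\<forall>p. \<exists>\<epsilon> \<Psi>. \<epsilon> > 0 \<and> \<epsilon> < 1 \<and> normal_param \<epsilon> \<Psi> \<and> \<Psi> 0 = p \<and> open (\<Psi> ` ball 0 (\<epsilon>/4))"
  proof
    fix p
    obtain \<epsilon> \<Psi> where n: "\<epsilon> > 0" "\<epsilon> < 1" "normal_param \<epsilon> \<Psi>" "\<Psi> 0 = p"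
      "\<And>S. open S \<Longrightarrow> S \<subseteq> ball 0 \<epsilon> \<Longrightarrow> open (\<Psi> ` S)"
      using normal_param_exists[of p] by metis
    have "open (\<Psi> ` ball 0 (\<epsilon>/4))" by (rule n(5)) (use n in auto)
    then show "\<exists>\<epsilon> \<Psi>. \<epsilon> > 0 \<and> \<epsilon> < 1 \<and> normal_param \<epsilon> \<Psi> \<and> \<Psi> 0 = p \<and> open (\<Psi> ` ball 0 (\<epsilon>/4))"
      using n by blast
  qed
  then obtain ep Ps where P: "\<And>p. ep p > 0" "\<And>p. ep p < 1" "\<And>p. normal_param (ep p) (Ps p)" "\<And>p. Ps p 0 = p"
    "\<And>p. open (Ps p ` ball 0 (ep p/4))" by metis
  define U where "U = (\<lambda>p. Ps p ` ball 0 (ep p / 4))"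
  have "p \<in> U p" for p using P(1,4)[of p] by (force simp: U_def image_iff intro!: bexI[of _ 0])
  then have "UNIV \<subseteq> (\<Union>p\<in>UNIV. U p)" by blast
  moreover have "\<And>p. p \<in> UNIV \<Longrightarrow> open (U p)" using P(5) by (simp add: U_def)
  ultimately obtain T where T: "finite T" "UNIV \<subseteq> (\<Union>p\<in>T. U p)"
    using compactE_image[OF compact_surface, of UNIV U] by metis
  have Tne: "T \<noteq> {}" using T by auto
  define \<epsilon> where "\<epsilon> = Min ((\<lambda>p. ep p / 4) ` T)"
  have eps: "\<epsilon> > 0" using T(1) Tne P(1) by (auto simp: \<epsilon>_def)
  have eps2: "\<epsilon> \<le> ep p / 4" if "p \<in> T" for p unfolding \<epsilon>_def by (rule Min_le) (use T that in auto)
  obtain q where "q \<in> T" using Tne by blast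
  then have e1: "\<epsilon> < 1" using eps2[of q] P(2)[of q] by linarith
  show ?thesis
  proof (rule that[OF eps e1])
    fix p
    obtain q where q: "q \<in> T" "p \<in> U q" using T by blast
    then obtain a where a: "cmod a < ep q / 4" "p = Ps q a" by (auto simp: U_def)
    have "normal_param \<epsilon> (Ps q \<circ> moeb a)"
    proof (rule normal_param_moeb[OF P(3)[of q]])
      show "cmod a < 1" using a P(2)[of q] by linarith
      show "moeb a w \<in> ball 0 (ep q)" if "w \<in> ball 0 \<epsilon>" for w :: complex
        using moeb_small[OF P(2)[of q] a(1), of w] that eps2[OF q(1)] by simp
    qed (use eps e1 P(2)[of q] in \<open>auto intro: less_imp_le\<close>)
    then show "\<exists>\<Psi>. normal_param \<epsilon> \<Psi> \<and> \<Psi> 0 = p" using a by (intro exI[of _ "Ps q \<circ> moeb a"]) simp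
  qed
qed

text \<open>The pseudo-hyperbolic disc about \<open>x\<close>; for \<open>\<epsilon> \<le> 1\<close>
  it is the image under \<open>moeb x\<close> of the Euclidean disc about 0.\<close>

definition hball :: "real \<Rightarrow> complex \<Rightarrow> complex set"
  where "hball \<epsilon> x = {w \<in> ball 0 1. cmod (moeb (- x) w) < \<epsilon>}"

lemma hball_image:
  assumes "cmod x < 1" "\<epsilon> \<le> 1" shows "hball \<epsilon> x = moeb x ` ball 0 \<epsilon>"
proof (intro equalityI subsetI)
  fix w assume w: "w \<in> hball \<epsilon> x"
  then have "w = moeb x (moeb (- x) w)" using moeb_inverse[of "-x" w] assms by (simp add: hball_def)
  then show "w \<in> moeb x ` ball 0 \<epsilon>" using w by (auto simp: hball_def)
next
  fix w assume "w \<in> moeb x ` ball 0 \<epsilon>"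
  then show "w \<in> hball \<epsilon> x"
    using assms by (auto simp: hball_def moeb_inverse intro!: cmod_moeb_less)
qed

lemma connected_hball:
  assumes "cmod x < 1" "\<epsilon> \<le> 1" shows "connected (hball \<epsilon> x)"
  unfolding hball_image[OF assms]
proof (rule connected_continuous_image)
  show "continuous_on (ball 0 \<epsilon>) (moeb x)"
    by (intro continuous_at_imp_continuous_on ballI DERIV_isCont[OF moeb_deriv]) (use assms in auto)
qed auto

lemma open_hball:
  assumes "cmod x < 1" shows "open (hball \<epsilon> x)"
proof -
  have "continuous_on (ball 0 1) (moeb (- x))"
    by (intro continuous_at_imp_continuous_on ballI DERIV_isCont[OF moeb_deriv]) (use assms in auto)
  then have "open (ball 0 1 \<inter> moeb (- x) -` ball 0 \<epsilon>)"
    by (intro continuous_open_preimage) auto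
  moreover have "hball \<epsilon> x = ball 0 1 \<inter> moeb (- x) -` ball 0 \<epsilon>" by (auto simp: hball_def)
  ultimately show ?thesis by simp
qed

lemma ball_subset_hball:
  assumes "cmod x < 1" "0 < \<epsilon>" "\<epsilon> \<le> 1" shows "ball x (\<epsilon> * (1 - cmod x)) \<subseteq> hball \<epsilon> x"
proof
  fix w assume w: "w \<in> ball x (\<epsilon> * (1 - cmod x))"
  have "\<epsilon> * (1 - cmod x) \<le> 1 * (1 - cmod x)" using assms by (intro mult_right_mono) auto
  then have "cmod (w - x) < 1 - cmod x" using w by (simp add: dist_norm norm_minus_commute)
  then have w1: "cmod w < 1" using norm_triangle_ineq2[of w x] by linarith
  have "cmod (moeb (- x) w) * (1 - cmod x) < \<epsilon> * (1 - cmod x)"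
    using cmod_moeb_le[OF assms(1) w1] w by (simp add: dist_norm norm_minus_commute)
  then show "w \<in> hball \<epsilon> x" using w1 assms by (simp add: hball_def)
qed

text \<open>After recentring at \<open>x\<close>, the map lifts through a normal parametrization to
  a disc isometry fixing 0, hence to a rotation. A rotation makes sense on the whole disc of radius
  \<open>\<epsilon>\<close>, so the germ at \<open>x\<close> extends to
  \<open>hball \<epsilon> x\<close> however small \<Omega> is, and injectively.\<close>

lemma LI_extend:
  assumes eps: "\<epsilon> > 0" "\<epsilon> < 1" "\<And>p. \<exists>\<Psi>. normal_param \<epsilon> \<Psi> \<and> \<Psi> 0 = p"
    and \<Omega>: "open \<Omega>" "\<Omega> \<subseteq> ball 0 1" and L: "LI disc_metric \<Omega> \<Phi>" and x: "x \<in> \<Omega>"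
  obtains E where "LI disc_metric (hball \<epsilon> x) E" "inj_on E (hball \<epsilon> x)" "\<forall>\<^sub>F w in nhds x. \<Phi> w = E w"
proof -
  have x1: "cmod x < 1" using x \<Omega> by auto
  obtain \<Psi> where N: "normal_param \<epsilon> \<Psi>" "\<Psi> 0 = \<Phi> x" using eps(3) by blast
  have "continuous_on (ball 0 1) (moeb x)"
    by (intro continuous_at_imp_continuous_on ballI DERIV_isCont[OF moeb_deriv]) (use x1 in auto)
  then have opn: "open (ball 0 1 \<inter> moeb x -` \<Omega>)" using \<Omega>(1) by (intro continuous_open_preimage) auto
  define N1 where "N1 = ball 0 1 \<inter> moeb x -` \<Omega>"
  have LM: "LI disc_metric N1 (\<Phi> \<circ> moeb x)"
    by (rule LI_compose[OF L, where F = "moeb x"])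
       (use x1 disc_metric_moeb moeb_deriv in \<open>auto simp: N1_def\<close>)
  have "0 \<in> N1" using x by (simp add: N1_def)
  moreover have "(\<Phi> \<circ> moeb x) 0 \<in> \<Psi> ` ball 0 \<epsilon>" using N(2) eps(1) by (auto intro!: image_eqI[of _ _ 0])
  ultimately obtain F r F' where r: "r > 0" "ball 0 r \<subseteq> N1" and F: "\<And>w. w \<in> ball 0 r \<Longrightarrow>
      F w \<in> ball 0 \<epsilon> \<and> (\<Phi> \<circ> moeb x) w = \<Psi> (F w) \<and>
      (F has_field_derivative F' w) (at w) \<and> disc_metric (F w) * cmod (F' w) = disc_metric w"
    using N(1) LM opn unfolding normal_param_def N1_def by metis
  have F0: "F 0 = 0"
    using F[of 0] r(1) N eps(1) unfolding normal_param_def inj_on_def by auto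
  have r1: "r \<le> 1"
  proof (rule ccontr)
    assume "\<not> r \<le> 1"
    then have "(1::complex) \<in> ball 0 r" by simp
    then have "(1::complex) \<in> N1" using r(2) by blast
    then show False by (simp add: N1_def)
  qed
  obtain \<tau> where \<tau>: "cmod \<tau> = 1" "\<And>w. w \<in> ball 0 r \<Longrightarrow> F w = \<tau> * w"
    by (rule disc_isometry_fixing_0[of r F F']) (use r r1 F F0 eps(2) in force)+
  define E where "E = \<Psi> \<circ> (\<lambda>w. \<tau> * moeb (- x) w)"
  have inE: "\<tau> * moeb (- x) w \<in> ball 0 \<epsilon>" if "w \<in> hball \<epsilon> x" for w
    using that \<tau>(1) by (simp add: hball_def norm_mult)
  have LE: "LI disc_metric (hball \<epsilon> x) E"
    unfolding E_def
  proof (rule LI_compose[where \<Omega> = "ball 0 \<epsilon>" and m = disc_metric])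
    show "LI disc_metric (ball 0 \<epsilon>) \<Psi>" using N by (simp add: normal_param_def)
    fix w assume w: "w \<in> hball \<epsilon> x"
    then have w1: "cmod w < 1" by (simp add: hball_def)
    show "\<tau> * moeb (- x) w \<in> ball 0 \<epsilon>" by (rule inE[OF w])
    show "((\<lambda>w. \<tau> * moeb (- x) w) has_field_derivative \<tau> * ((1 - cnj (- x) * (- x)) / (1 + cnj (- x) * w)\<^sup>2)) (at w)"
      by (intro DERIV_cmult moeb_deriv) (use x1 w1 in auto)
    have "disc_metric (moeb (- x) w) * cmod ((1 - cnj (- x) * (- x)) / (1 + cnj (- x) * w)\<^sup>2) = disc_metric w"
      by (rule disc_metric_moeb) (use x1 w1 in auto)
    then show "disc_metric (\<tau> * moeb (- x) w) * cmod (\<tau> * ((1 - cnj (- x) * (- x)) / (1 + cnj (- x) * w)\<^sup>2)) = disc_metric w"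
      by (simp only: disc_metric_def norm_mult \<tau>(1) mult_1_left)
  qed
  have "inj_on E (hball \<epsilon> x)"
  proof (rule inj_onI)
    fix u v assume u: "u \<in> hball \<epsilon> x" and v: "v \<in> hball \<epsilon> x" and "E u = E v"
    moreover have "inj_on \<Psi> (ball 0 \<epsilon>)" using N(1) by (simp add: normal_param_def)
    ultimately have "\<tau> * moeb (- x) u = \<tau> * moeb (- x) v"
      using inj_onD[OF _ _ inE[OF u] inE[OF v]] by (simp add: E_def)
    then have "moeb (- x) u = moeb (- x) v" using \<tau>(1) by auto
    moreover have "moeb x (moeb (- x) u) = u" "moeb x (moeb (- x) v) = v"
      using moeb_inverse[of "- x" u] moeb_inverse[of "- x" v] u v x1 by (simp_all add: hball_def)
    ultimately show "u = v" by metis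
  qed
  moreover have "\<forall>\<^sub>F w in nhds x. \<Phi> w = E w"
  proof -
    have "open (hball r x)" "x \<in> hball r x" using open_hball[OF x1] x1 r(1) by (auto simp: hball_def)
    moreover have "\<Phi> w = E w" if w: "w \<in> hball r x" for w
    proof -
      have i: "moeb (- x) w \<in> ball 0 r" "moeb x (moeb (- x) w) = w"
        using w x1 moeb_inverse[of "- x" w] by (auto simp: hball_def)
      have "\<Phi> w = \<Psi> (F (moeb (- x) w))" using F[OF i(1)] i(2) by simp
      then show ?thesis using \<tau>(2)[OF i(1)] by (simp add: E_def)
    qed
    ultimately show ?thesis unfolding eventually_nhds by blast
  qed
  ultimately show ?thesis using that LE by blast
qed

text \<open>Each step gains a fixed fraction of the gap \<open>1 - R\<close>. The new value at
  \<open>z\<close> comes from the extension centred at the contracted point \<open>c * z\<close>.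
  Euclidean balls replace the discs \<open>hball\<close> because their intersections are convex,
  hence connected, and the identity theorem then makes all choices agree.\<close>

lemma LI_continue_step:
  assumes eps: "\<epsilon> > 0" "\<epsilon> < 1" "\<And>p. \<exists>\<Psi>. normal_param \<epsilon> \<Psi> \<and> \<Psi> 0 = p"
    and R: "0 < R" "R < 1" and L: "LI disc_metric (ball 0 R) \<Phi>"
  shows "\<exists>\<Phi>'. LI disc_metric (ball 0 (R + \<epsilon> / 2 * (1 - R))) \<Phi>' \<and> (\<forall>w\<in>ball 0 R. \<Phi>' w = \<Phi> w)"
proof -
  define R' where "R' = R + \<epsilon> / 2 * (1 - R)"
  have "\<epsilon> / 2 * (1 - R) > 0" using eps R by simp
  then have R': "R < R'" "R' > 0" using R unfolding R'_def by linarith+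
  \<comment> \<open>Contracts the disc of radius \<open>R'\<close> onto that of radius
    \<open>R\<close> and moves each point by less than \<open>R' - R\<close>, which is half of
    \<open>\<eta>\<close>.\<close>
  define c where "c = R / R'"
  have c: "0 < c" "c < 1" using R R' by (auto simp: c_def)
  have bR: "ball 0 R \<subseteq> ball (0::complex) 1" using R by auto
  have "\<forall>x\<in>ball 0 R. \<exists>E. LI disc_metric (hball \<epsilon> x) E \<and> (\<forall>\<^sub>F w in nhds x. \<Phi> w = E w)"
    using LI_extend[OF eps open_ball bR L] by metis
  then obtain E where E: "\<And>x. x \<in> ball 0 R \<Longrightarrow> LI disc_metric (hball \<epsilon> x) (E x)"
    "\<And>x. x \<in> ball 0 R \<Longrightarrow> \<forall>\<^sub>F w in nhds x. \<Phi> w = E x w" by metis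
  \<comment> \<open>A single Euclidean radius valid for all centres in the disc of radius
    \<open>R\<close>, since \<open>cmod x < R\<close> there.\<close>
  define \<eta> where "\<eta> = \<epsilon> * (1 - R)"
  have \<eta>: "\<eta> > 0" using eps R by (simp add: \<eta>_def)
  have EB: "LI disc_metric (ball x \<eta>) (E x)" if x: "x \<in> ball 0 R" for x
  proof (rule local_isometry_subset[OF E(1)[OF x]])
    have "\<eta> \<le> \<epsilon> * (1 - cmod x)" unfolding \<eta>_def using x eps by (intro mult_left_mono) auto
    then show "ball x \<eta> \<subseteq> hball \<epsilon> x"
      using ball_subset_hball[of x \<epsilon>] x R eps by (meson subset_ball subset_trans less_imp_le mem_ball_0 order_less_trans)
  qed
  have agree: "E x w = \<Phi> w" if x: "x \<in> ball 0 R" and w: "w \<in> ball x \<eta> \<inter> ball 0 R" for x w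
  proof (rule LI_identity_eventually[where \<Omega> = "ball x \<eta> \<inter> ball 0 R" and ?w0.0 = x])
    show "LI disc_metric (ball x \<eta> \<inter> ball 0 R) (E x)" "LI disc_metric (ball x \<eta> \<inter> ball 0 R) \<Phi>"
      using local_isometry_subset EB[OF x] L by blast+
    show "connected (ball x \<eta> \<inter> ball 0 R)" by (intro convex_connected convex_Int) auto
    show "\<forall>\<^sub>F w in nhds x. E x w = \<Phi> w" using E(2)[OF x] by (rule eventually_mono) simp
  qed (use x w \<eta> in auto)
  define \<Phi>' where "\<Phi>' = (\<lambda>z. E (of_real c * z) z)"
  have cz: "of_real c * z \<in> ball 0 R" "z \<in> ball (of_real c * z) \<eta>" if "z \<in> ball 0 R'" for z :: complex
  proof -
    have "c * cmod z < c * R'" using that c by simp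
    moreover have "c * R' = R" using R' by (simp add: c_def)
    ultimately show "of_real c * z \<in> ball 0 R" using c by (simp add: norm_mult)
    have "dist (of_real c * z) z = (1 - c) * cmod z"
    proof -
      have "z - of_real c * z = of_real (1 - c) * z" by (simp add: algebra_simps)
      then show ?thesis using c by (simp add: dist_norm norm_minus_commute norm_mult del: of_real_diff)
    qed
    also have "\<dots> \<le> (1 - c) * R'" using that c by (intro mult_left_mono) auto
    also have "\<dots> = R' - R" using R' by (simp add: c_def field_simps)
    also have "\<dots> < \<eta>" using eps R by (simp add: R'_def \<eta>_def)
    finally show "z \<in> ball (of_real c * z) \<eta>" by simp
  qed
  have "LI disc_metric (ball 0 R') \<Phi>'"
  proof (rule local_isometry_locally)
    fix z0 :: complex assume z0: "z0 \<in> ball 0 R'"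
    define x0 where "x0 = of_real c * z0"
    have x0: "x0 \<in> ball 0 R" "z0 \<in> ball x0 \<eta>" using cz[OF z0] by (auto simp: x0_def)
    obtain e1 where e1: "e1 > 0" "ball z0 e1 \<subseteq> ball 0 R'" using z0 open_ball openE by blast
    obtain e2 where e2: "e2 > 0" "ball z0 e2 \<subseteq> ball x0 \<eta>" using x0 open_ball openE by blast
    define e where "e = min e1 (min e2 \<eta>)"
    have e: "e > 0" "ball z0 e \<subseteq> ball 0 R'" "ball z0 e \<subseteq> ball x0 \<eta>" "e \<le> \<eta>"
      using e1 e2 \<eta> by (auto simp: e_def)
    have "\<Phi>' z = E x0 z" if z: "z \<in> ball z0 e" for z
    proof -
      define x where "x = of_real c * z"
      have zR: "z \<in> ball 0 R'" using e z by blast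
      have x: "x \<in> ball 0 R" "z \<in> ball x \<eta>" using cz[OF zR] by (auto simp: x_def)
      have "x - x0 = of_real c * (z - z0)" by (simp add: x_def x0_def algebra_simps)
      then have "dist x x0 = c * dist z z0" using c by (simp add: dist_norm norm_mult)
      then have "dist x0 x = c * dist z0 z" by (simp add: dist_commute)
      also have "\<dots> \<le> 1 * dist z0 z" using c by (intro mult_right_mono) auto
      also have "\<dots> < \<eta>" using z e by simp
      finally have xx: "x \<in> ball x0 \<eta>" by simp
      have "E x z = E x0 z"
      proof (rule LI_identity_eventually[where \<Omega> = "ball x \<eta> \<inter> ball x0 \<eta>" and ?w0.0 = x])
        show "LI disc_metric (ball x \<eta> \<inter> ball x0 \<eta>) (E x)" "LI disc_metric (ball x \<eta> \<inter> ball x0 \<eta>) (E x0)"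
          using local_isometry_subset EB x x0 by blast+
        show "connected (ball x \<eta> \<inter> ball x0 \<eta>)" by (intro convex_connected convex_Int) auto
        have "\<forall>\<^sub>F w in nhds x. w \<in> ball x0 \<eta> \<inter> ball 0 R"
          using xx x by (intro eventually_nhds_in_open) auto
        then show "\<forall>\<^sub>F w in nhds x. E x w = E x0 w"
          using E(2)[OF x(1)] by eventually_elim (metis agree[OF x0(1)])
      qed (use x xx z e \<eta> in auto)
      then show ?thesis by (simp add: \<Phi>'_def x_def)
    qed
    moreover have "LI disc_metric (ball z0 e) (E x0)"
      using local_isometry_subset EB[OF x0(1)] e by blast
    ultimately show "\<exists>e>0. \<exists>\<Psi>. LI disc_metric (ball z0 e) \<Psi> \<and> (\<forall>z\<in>ball z0 e. \<Phi>' z = \<Psi> z)"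
      using e(1) by blast
  qed
  moreover have "\<Phi>' w = \<Phi> w" if "w \<in> ball 0 R" for w
  proof -
    have "w \<in> ball 0 R'" using that R' by simp
    from cz[OF this] show ?thesis using agree that by (simp add: \<Phi>'_def)
  qed
  ultimately show ?thesis unfolding R'_def by blast
qed

text \<open>The gap \<open>1 - R n\<close> is multiplied by \<open>1 - \<epsilon> / 2\<close> in
  each step, so the discs exhaust the unit disc. The continuations are consistent because all of
  them equal \<open>\<Psi>\<close> on the first disc.\<close>

lemma disc_developing:
  assumes eps: "\<epsilon> > 0" "\<epsilon> < 1" "\<And>p. \<exists>\<Psi>. normal_param \<epsilon> \<Psi> \<and> \<Psi> 0 = p"
  obtains \<Phi> where "LI disc_metric (ball 0 1) \<Phi>" "\<Phi> 0 = p"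
proof -
  obtain \<Psi> where N: "normal_param \<epsilon> \<Psi>" "\<Psi> 0 = p" using eps(3) by blast
  define R where "R = (\<lambda>n. 1 - (1 - \<epsilon>/2) ^ n * (1 - \<epsilon>))"
  have R0: "R 0 = \<epsilon>" by (simp add: R_def)
  have RS: "R (Suc n) = R n + \<epsilon> / 2 * (1 - R n)" for n by (simp add: R_def algebra_simps)
  have p0: "0 < (1 - \<epsilon>/2) ^ n * (1 - \<epsilon>)" for n using eps by simp
  have R1: "R n < 1" for n using p0[of n] by (simp add: R_def)
  have Rm: "R n \<le> R (Suc n)" for n unfolding RS using eps R1[of n] by simp
  have Rmono: "R n \<le> R m" if "n \<le> m" for n m using lift_Suc_mono_le[of R, OF Rm that] .
  have Rpos: "0 < R n" "\<epsilon> \<le> R n" for n using Rmono[of 0 n] R0 eps by auto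
  have Rlim: "R \<longlonglongrightarrow> 1"
  proof -
    have "(\<lambda>n. (1 - \<epsilon>/2) ^ n) \<longlonglongrightarrow> 0" using eps by (intro LIMSEQ_realpow_zero) auto
    then have "(\<lambda>n. 1 - (1 - \<epsilon>/2) ^ n * (1 - \<epsilon>)) \<longlonglongrightarrow> 1 - 0 * (1 - \<epsilon>)"
      by (intro tendsto_diff tendsto_mult tendsto_const)
    then show ?thesis by (simp add: R_def)
  qed
  have "\<exists>\<Phi>. LI disc_metric (ball 0 (R n)) \<Phi> \<and> (\<forall>w\<in>ball 0 \<epsilon>. \<Phi> w = \<Psi> w)" for n
  proof (induction n)
    case 0 then show ?case using N by (auto simp: R0 normal_param_def)
  next
    case (Suc n)
    then obtain \<Phi> where "LI disc_metric (ball 0 (R n)) \<Phi>" "\<forall>w\<in>ball 0 \<epsilon>. \<Phi> w = \<Psi> w" by blast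
    moreover have "ball 0 \<epsilon> \<subseteq> ball (0::complex) (R n)" using Rpos(2) by (intro subset_ball)
    ultimately show ?case
      using LI_continue_step[OF eps Rpos(1)[of n] R1[of n]] unfolding RS by (metis subsetD)
  qed
  then obtain \<Phi> where \<Phi>: "\<And>n. LI disc_metric (ball 0 (R n)) (\<Phi> n)" "\<And>n w. w \<in> ball 0 \<epsilon> \<Longrightarrow> \<Phi> n w = \<Psi> w"
    by metis
  have ag: "\<Phi> n w = \<Phi> m w" if "n \<le> m" "w \<in> ball 0 (R n)" for n m w
  proof (rule LI_identity_eventually[where \<Omega> = "ball 0 (R n)" and ?w0.0 = 0])
    show "LI disc_metric (ball 0 (R n)) (\<Phi> m)"
      by (rule local_isometry_subset[OF \<Phi>(1)]) (use Rmono[OF that(1)] in \<open>auto intro: subset_ball\<close>)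
    have "\<forall>\<^sub>F w in nhds 0. w \<in> ball (0::complex) \<epsilon>" using eps by (intro eventually_nhds_in_open) auto
    then show "\<forall>\<^sub>F w in nhds 0. \<Phi> n w = \<Phi> m w" by eventually_elim (simp add: \<Phi>(2))
  qed (use \<Phi>(1) Rpos that in auto)
  \<comment> \<open>The first stage whose disc contains \<open>w\<close>; by \<open>ag\<close> every
    later stage gives the same value.\<close>
  define N where "N = (\<lambda>w::complex. LEAST n. w \<in> ball 0 (R n))"
  have Nin: "w \<in> ball 0 (R (N w))" if "w \<in> ball 0 1" for w
  proof -
    have "\<forall>\<^sub>F n in sequentially. cmod w < R n" using that order_tendstoD(1)[OF Rlim, of "cmod w"] by simp
    then obtain n where "w \<in> ball 0 (R n)" by (auto simp: eventually_sequentially)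
    then show ?thesis unfolding N_def by (rule LeastI)
  qed
  define F where "F = (\<lambda>w. \<Phi> (N w) w)"
  have FN: "F w = \<Phi> n w" if "w \<in> ball 0 (R n)" for w n
  proof -
    have w1: "w \<in> ball 0 1" using that R1[of n] by simp
    have "N w \<le> n" unfolding N_def by (rule Least_le) (rule that)
    then show ?thesis using ag Nin[OF w1] by (simp add: F_def)
  qed
  show ?thesis
  proof (rule that[of F])
    show "LI disc_metric (ball 0 1) F"
    proof (rule local_isometry_locally)
      fix w assume "w \<in> ball (0::complex) 1"
      then have w: "w \<in> ball 0 (R (N w))" by (rule Nin)
      then obtain e where e: "e > 0" "ball w e \<subseteq> ball 0 (R (N w))" using open_ball openE by blast
      have "LI disc_metric (ball w e) (\<Phi> (N w))" by (rule local_isometry_subset[OF \<Phi>(1) e(2)])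
      moreover have "\<forall>z\<in>ball w e. F z = \<Phi> (N w) z" using FN e by blast
      ultimately show "\<exists>e>0. \<exists>\<Psi>. LI disc_metric (ball w e) \<Psi> \<and> (\<forall>z\<in>ball w e. F z = \<Psi> z)"
        using e(1) by blast
    qed
    show "F 0 = p" using FN[of 0 0] \<Phi>(2)[of 0 0] N(2) eps R0 by simp
  qed
qed

text \<open>The germ at \<open>x\<close> extends injectively to \<open>hball \<epsilon> x\<close>,
  and by the identity theorem this extension is the developing map itself. This is a uniform
  injectivity radius.\<close>

lemma LI_inj_on_hball:
  assumes eps: "\<epsilon> > 0" "\<epsilon> < 1" "\<And>p. \<exists>\<Psi>. normal_param \<epsilon> \<Psi> \<and> \<Psi> 0 = p"
    and L: "LI disc_metric (ball 0 1) \<Phi>" and x: "cmod x < 1"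
  shows "inj_on \<Phi> (hball \<epsilon> x)"
proof -
  obtain E where E: "LI disc_metric (hball \<epsilon> x) E" "inj_on E (hball \<epsilon> x)" "\<forall>\<^sub>F w in nhds x. \<Phi> w = E w"
    by (rule LI_extend[OF eps open_ball subset_refl L]) (use x in auto)
  have "\<Phi> w = E w" if "w \<in> hball \<epsilon> x" for w
  proof (rule LI_identity_eventually[where \<Omega> = "hball \<epsilon> x" and ?w0.0 = x])
    show "LI disc_metric (hball \<epsilon> x) \<Phi>" by (rule local_isometry_subset[OF L]) (auto simp: hball_def)
  qed (use E that x eps open_hball connected_hball in \<open>auto simp: hball_def\<close>)
  then show ?thesis using E(2) by (simp add: inj_on_def)
qed

end

section \<open>The strip model of the hyperbolic plane\<close>

definition strip :: "complex set"
  where "strip = {w. \<bar>Im w\<bar> < pi / 2}"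

definition strip_metric :: "complex \<Rightarrow> real"
  where "strip_metric w = 1 / cos (Im w)"

text \<open>A conformal map from the strip to the disc that sends the real axis to the diameter
  through 0, a geodesic; translations of the axis become hyperbolic translations.\<close>

definition strip_map :: "complex \<Rightarrow> complex"
  where "strip_map w = tanh (w / 2)"

lemma open_strip: "open strip"
proof -
  have "strip = (\<lambda>w. \<bar>Im w\<bar>) -` {..<pi/2}" by (auto simp: strip_def)
  moreover have "open ((\<lambda>w. \<bar>Im w\<bar>) -` {..<pi/2})"
    by (intro open_vimage continuous_intros)
  ultimately show ?thesis by simp
qed

lemma convex_strip: "convex strip"
proof -
  have "strip = {w. Im w < pi/2} \<inter> {w. Im w > - (pi/2)}" by (auto simp: strip_def abs_less_iff)
  show ?thesis unfolding \<open>strip = _\<close> by (intro convex_Int convex_halfspace_Im_lt convex_halfspace_Im_gt)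
qed

lemma cos_Im_strip: "w \<in> strip \<Longrightarrow> cos (Im w) > 0"
  by (intro cos_gt_zero_pi) (auto simp: strip_def abs_less_iff)

lemma real_in_strip [simp]: "of_real x \<in> strip" "0 \<in> strip"
  by (auto simp: strip_def)

lemma cmod_cosh_sinh:
  fixes z :: complex shows "(cmod (cosh z))\<^sup>2 - (cmod (sinh z))\<^sup>2 = cos (2 * Im z)"
proof -
  have "(cmod (cosh z))\<^sup>2 - (cmod (sinh z))\<^sup>2 = Re (exp z * cnj (exp (- z)))"
    unfolding cosh_def sinh_def cmod_power2
    by (simp add: power2_eq_square field_simps)
  also have "exp z * cnj (exp (- z)) = exp (z - cnj z)" by (simp add: exp_cnj exp_diff exp_minus divide_inverse)
  also have "z - cnj z = \<i> * of_real (2 * Im z)" by (simp add: complex_eq_iff)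
  also have "Re (exp (\<i> * of_real (2 * Im z))) = cos (2 * Im z)" by (simp add: Re_exp)
  finally show ?thesis .
qed

lemma cosh_half_strip_nz:
  assumes "w \<in> strip" shows "cosh (w / 2) \<noteq> (0::complex)"
proof
  assume "cosh (w / 2) = 0"
  then have "- (cmod (sinh (w/2)))\<^sup>2 = cos (Im w)" using cmod_cosh_sinh[of "w/2"] by simp
  then show False using cos_Im_strip[OF assms] by (metis neg_0_less_iff_less not_less zero_le_power2)
qed

lemma one_minus_cmod_strip_map:
  assumes "w \<in> strip" shows "1 - (cmod (strip_map w))\<^sup>2 = cos (Im w) / (cmod (cosh (w / 2)))\<^sup>2"
  using cmod_cosh_sinh[of "w/2"] cosh_half_strip_nz[OF assms]
  by (simp add: strip_map_def tanh_def norm_divide power_divide divide_simps)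

lemma cmod_strip_map_less:
  assumes "w \<in> strip" shows "cmod (strip_map w) < 1"
proof -
  have "1 - (cmod (strip_map w))\<^sup>2 > 0"
    unfolding one_minus_cmod_strip_map[OF assms] using cos_Im_strip[OF assms] cosh_half_strip_nz[OF assms] by simp
  then show ?thesis by (simp add: power_less_one_iff)
qed

lemma strip_map_deriv:
  assumes "w \<in> strip"
  shows "(strip_map has_field_derivative 1 / (2 * (cosh (w / 2))\<^sup>2)) (at w)"
proof -
  note nz = cosh_half_strip_nz[OF assms]
  have "1 - (tanh (w/2))\<^sup>2 = ((cosh (w/2))\<^sup>2 - (sinh (w/2))\<^sup>2) / (cosh (w / 2))\<^sup>2"
    using nz by (simp add: tanh_def power_divide diff_divide_distrib)
  then have "1 - (tanh (w/2))\<^sup>2 = 1 / (cosh (w / 2))\<^sup>2" by (simp only: hyperbolic_pythagoras)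
  then show ?thesis
    unfolding strip_map_def using nz by (auto intro!: derivative_eq_intros simp: field_simps)
qed

lemma disc_metric_strip_map:
  assumes "w \<in> strip"
  shows "disc_metric (strip_map w) * cmod (1 / (2 * (cosh (w / 2))\<^sup>2)) = strip_metric w"
  using cosh_half_strip_nz[OF assms] cos_Im_strip[OF assms]
  by (simp add: disc_metric_def one_minus_cmod_strip_map[OF assms] strip_metric_def norm_divide norm_mult norm_power)

text \<open>\<open>exp w\<close> is a Moebius function of \<open>tanh (w / 2)\<close>, and
  \<open>exp\<close> is injective on the strip because its height \<open>pi\<close> is below
  \<open>2 * pi\<close>.\<close>

lemma inj_on_strip_map: "inj_on strip_map strip"
proof (rule inj_onI)
  fix u v assume u: "u \<in> strip" and v: "v \<in> strip" and eq: "strip_map u = strip_map v"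
  have e: "exp w * (1 - strip_map w) = 1 + strip_map w \<and> strip_map w \<noteq> 1" if "w \<in> strip" for w
  proof -
    have nz: "exp (w/2) + exp (- (w/2)) \<noteq> 0" using cosh_half_strip_nz[OF that] by (simp add: cosh_field_def)
    have "exp w = exp (w/2) * exp (w/2)" by (simp flip: exp_add)
    then have "exp w * exp (- (w/2)) = exp (w/2)" by (simp flip: exp_add)
    then have "exp w * (2 * exp (- (w/2))) = 2 * exp (w/2)" by simp
    moreover have "1 - strip_map w = 2 * exp (- (w/2)) / (exp (w/2) + exp (- (w/2)))"
      using nz by (simp add: strip_map_def tanh_altdef field_simps)
    moreover have "1 + strip_map w = 2 * exp (w/2) / (exp (w/2) + exp (- (w/2)))"
      using nz by (simp add: strip_map_def tanh_altdef field_simps)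
    ultimately show ?thesis using cmod_strip_map_less[OF that] by auto
  qed
  have "exp u * (1 - strip_map u) = exp v * (1 - strip_map u)" using e[OF u] e[OF v] eq by simp
  then have "exp u = exp v" using conjunct2[OF e[OF u]] by simp
  have "\<bar>Im u\<bar> < pi / 2" "\<bar>Im v\<bar> < pi / 2" using u v by (simp_all add: strip_def)
  then have "\<bar>Im u - Im v\<bar> < 2 * pi" by arith
  then show "u = v" using \<open>exp u = exp v\<close> by (rule exp_complex_eqI)
qed

text \<open>The Gudermannian: a point at signed distance \<open>s\<close> from the axis has
  imaginary part \<open>gd s\<close>. In the coordinates \<open>(u, s)\<close> the strip metric is
  \<open>ds^2 + (cosh s)^2 du^2\<close>.\<close>

definition gd :: "real \<Rightarrow> real"
  where "gd s = arctan (sinh s)"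

lemma cos_gd: "cos (gd s) = 1 / cosh s" and sin_gd: "sin (gd s) = tanh s"
proof -
  have "sqrt (1 + (sinh s)\<^sup>2) = cosh s"
    using cosh_square_eq[of s] by (metis add.commute cosh_real_nonneg real_sqrt_unique)
  then show "cos (gd s) = 1 / cosh s" "sin (gd s) = tanh s"
    by (simp_all add: gd_def cos_arctan sin_arctan tanh_def)
qed

lemma gd_bounds: "- (pi / 2) < gd s" "gd s < pi / 2"
  unfolding gd_def by (rule arctan_lbound, rule arctan_ubound)

lemma gd_in_strip: "Complex u (gd s) \<in> strip"
  using gd_bounds[of s] by (simp add: strip_def abs_less_iff)

lemma gd_0 [simp]: "gd 0 = 0" by (simp add: gd_def)

lemma gd_minus: "gd (- s) = - gd s" by (simp add: gd_def arctan_minus)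

lemma gd_deriv: "(gd has_real_derivative 1 / cosh s) (at s)"
proof -
  have "(gd has_real_derivative inverse (1 + (sinh s)\<^sup>2) * cosh s) (at s)"
    unfolding gd_def by (auto intro!: derivative_eq_intros)
  also have "inverse (1 + (sinh s)\<^sup>2) * cosh s = 1 / cosh s"
  proof -
    have "1 + (sinh s)\<^sup>2 = (cosh s)\<^sup>2" using cosh_square_eq[of s] by simp
    then show ?thesis using cosh_real_pos[of s] by (simp only: power2_eq_square) (simp add: field_simps)
  qed
  finally show ?thesis .
qed

lemma cmod_sinh_sq: "(cmod (sinh (Complex p q)))\<^sup>2 = (cosh (2 * p) - cos (2 * q)) / 2"
  and cmod_cosh_sq: "(cmod (cosh (Complex p q)))\<^sup>2 = (cosh (2 * p) + cos (2 * q)) / 2"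
proof -
  let ?z = "Complex p q"
  have n: "(cmod (a + b))\<^sup>2 = (cmod a)\<^sup>2 + (cmod b)\<^sup>2 + 2 * Re (a * cnj b)" for a b
    unfolding cmod_power2 by (simp add: power2_eq_square algebra_simps)
  have e1: "(cmod (exp ?z))\<^sup>2 = exp (2 * p)" "(cmod (exp (- ?z)))\<^sup>2 = exp (- (2 * p))"
    by (simp_all add: norm_exp_eq_Re power2_eq_square flip: exp_add)
  have "exp ?z * cnj (exp (- ?z)) = exp (?z - cnj ?z)" by (simp add: exp_cnj exp_diff exp_minus divide_inverse)
  also have "?z - cnj ?z = \<i> * of_real (2 * q)" by (simp add: complex_eq_iff)
  finally have r: "Re (exp ?z * cnj (exp (- ?z))) = cos (2 * q)" by (simp add: Re_exp)
  have "(cmod (exp ?z + exp (- ?z)))\<^sup>2 = exp (2 * p) + exp (- (2 * p)) + 2 * cos (2 * q)"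
    by (simp only: n e1 r)
  then show "(cmod (cosh ?z))\<^sup>2 = (cosh (2 * p) + cos (2 * q)) / 2"
    unfolding cosh_field_def norm_divide power_divide by (simp add: add_divide_distrib)
  have "(cmod (exp ?z + (- exp (- ?z))))\<^sup>2 = exp (2 * p) + exp (- (2 * p)) - 2 * cos (2 * q)"
    unfolding n by (simp only: norm_minus_cancel e1 complex_cnj_minus mult_minus_right uminus_complex.sel r)
  then show "(cmod (sinh ?z))\<^sup>2 = (cosh (2 * p) - cos (2 * q)) / 2"
    unfolding sinh_field_def cosh_field_def norm_divide power_divide by (simp add: add_divide_distrib diff_divide_distrib)
qed

text \<open>With \<open>d\<close> the hyperbolic distance, the left-hand side is \<open>tanh\<^sup>2 (d/2)\<close> and the bracket on the
  right-hand side is \<open>cosh d - 1\<close>.\<close>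

lemma pseudo_distance_bound:
  "(cmod (moeb (- strip_map (Complex u0 (gd s0))) (strip_map (Complex u (gd s)))))\<^sup>2
     \<le> ((cosh (u - u0) - 1) * (cosh s * cosh s0) + (cosh (s - s0) - 1)) / 2"
proof -
  define A B where "A = Complex u (gd s) / 2" and "B = Complex u0 (gd s0) / 2"
  have nz: "cosh A \<noteq> 0" "cosh B \<noteq> 0"
    using cosh_half_strip_nz[OF gd_in_strip] by (auto simp: A_def B_def)
  have cB: "cnj (cosh B) = cosh (cnj B)" "cnj (sinh B) = sinh (cnj B)"
    by (simp_all add: cosh_def sinh_def exp_cnj)
  have nzB: "cosh (cnj B) \<noteq> 0" using nz(2) cB(1) by (metis complex_cnj_zero_iff)
  have 1: "tanh A - tanh B = sinh (A - B) / (cosh A * cosh B)"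
    using nz by (simp add: sinh_diff tanh_def field_simps)
  have 2: "1 - cnj (tanh B) * tanh A = cosh (A - cnj B) / (cosh A * cosh (cnj B))"
    using nz nzB by (simp add: cosh_diff tanh_def cB field_simps)
  have "cmod (moeb (- tanh B) (tanh A)) = cmod (tanh A - tanh B) / cmod (1 - cnj (tanh B) * tanh A)"
    by (simp add: moeb_def norm_divide)
  also have "\<dots> = cmod (sinh (A - B)) / cmod (cosh (A - cnj B))"
  proof -
    have "cmod (cosh (cnj B)) = cmod (cosh B)" by (metis cB(1) complex_mod_cnj)
    then show ?thesis unfolding 1 2 using nz nzB by (simp add: norm_divide norm_mult)
  qed
  finally have "(cmod (moeb (- tanh B) (tanh A)))\<^sup>2 = (cmod (sinh (A - B)))\<^sup>2 / (cmod (cosh (A - cnj B)))\<^sup>2"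
    by (simp add: power_divide)
  have h2: "2 * (x / 2) = (x::real)" for x by simp
  note \<open>(cmod (moeb (- tanh B) (tanh A)))\<^sup>2 = (cmod (sinh (A - B)))\<^sup>2 / (cmod (cosh (A - cnj B)))\<^sup>2\<close>
  also have "A - B = Complex ((u - u0) / 2) ((gd s - gd s0) / 2)" by (simp add: A_def B_def complex_eq_iff field_simps)
  also have "A - cnj B = Complex ((u - u0) / 2) ((gd s + gd s0) / 2)" by (simp add: A_def B_def complex_eq_iff field_simps)
  also have "(cmod (sinh (Complex ((u - u0) / 2) ((gd s - gd s0) / 2))))\<^sup>2 = (cosh (u - u0) - cos (gd s - gd s0)) / 2"
    unfolding cmod_sinh_sq h2 ..
  also have "(cmod (cosh (Complex ((u - u0) / 2) ((gd s + gd s0) / 2))))\<^sup>2 = (cosh (u - u0) + cos (gd s + gd s0)) / 2"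
    unfolding cmod_cosh_sq h2 ..
  also have "cos (gd s - gd s0) = (1 + sinh s * sinh s0) / (cosh s * cosh s0)"
    by (simp add: cos_diff cos_gd sin_gd tanh_def add_divide_distrib)
  also have "cos (gd s + gd s0) = (1 - sinh s * sinh s0) / (cosh s * cosh s0)"
    by (simp add: cos_add cos_gd sin_gd tanh_def diff_divide_distrib)
  finally have m: "(cmod (moeb (- tanh B) (tanh A)))\<^sup>2 =
     (cosh (u - u0) - (1 + sinh s * sinh s0) / (cosh s * cosh s0)) / 2
     / ((cosh (u - u0) + (1 - sinh s * sinh s0) / (cosh s * cosh s0)) / 2)" .
  define P where "P = cosh s * cosh s0"
  have P: "P > 0" by (simp add: P_def)
  have cd: "cosh (s - s0) = P - sinh s * sinh s0" by (simp add: cosh_diff P_def)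
  \<comment> \<open>\<open>N\<close> is \<open>cosh d - 1\<close>, and \<open>N / (N + 2)\<close> is
    the half-angle formula for the square of \<open>tanh (d / 2)\<close>.\<close>
  define N where "N = (cosh (u - u0) - 1) * P + (cosh (s - s0) - 1)"
  have N0: "N \<ge> 0" unfolding N_def using P cosh_real_ge_1 by (intro add_nonneg_nonneg mult_nonneg_nonneg) (auto simp: )
  have "(cmod (moeb (- tanh B) (tanh A)))\<^sup>2 = N / (N + 2)"
  proof -
    have "cosh (u - u0) - (1 + sinh s * sinh s0) / P = N / P"
      using P by (simp add: N_def cd field_simps)
    moreover have "cosh (u - u0) + (1 - sinh s * sinh s0) / P = (N + 2) / P"
      using P by (simp add: N_def cd field_simps)
    ultimately show ?thesis using m P by (simp add: P_def[symmetric])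
  qed
  also have "\<dots> \<le> N / 2" using N0 by (intro divide_left_mono) auto
  finally show ?thesis by (simp add: strip_map_def A_def B_def N_def P_def)
qed

lemma moeb_rotate: "cmod \<tau> = 1 \<Longrightarrow> moeb (- (\<tau> * x)) (\<tau> * w) = \<tau> * moeb (- x) w"
proof -
  assume "cmod \<tau> = 1"
  then have "cnj \<tau> * \<tau> = 1" by (metis complex_norm_square mult.commute of_real_1 one_power2)
  then have "cnj (\<tau> * x) * (\<tau> * w) = cnj x * w" by (simp add: mult_ac)
  then show ?thesis by (simp add: moeb_def algebra_simps)
qed

section \<open>The geodesic in the strip\<close>

lemma has_derivative_pd:
  fixes f :: "complex \<Rightarrow> real"
  assumes "(f has_derivative f') (at z)"
  shows "f' v = Re v * pdx f z + Im v * pdy f z"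
proof -
  note lin = has_derivative_linear[OF assms]
  have "f' (Re v *\<^sub>R 1 + Im v *\<^sub>R \<i>) = Re v * f' 1 + Im v * f' \<i>"
    by (simp only: linear_add[OF lin] linear_cmul[OF lin] real_scaleR_def)
  moreover have "Re v *\<^sub>R 1 + Im v *\<^sub>R \<i> = v" by (simp add: complex_eq_iff)
  ultimately show ?thesis using pdx_eqI[OF assms] pdy_eqI[OF assms] by simp
qed

text \<open>Bounds the nonlinearity in the geodesic equation of the strip linearly, as Gronwall
  requires.\<close>

lemma abs_tan_le:
  assumes "\<bar>x::real\<bar> \<le> 1" shows "\<bar>tan x\<bar> \<le> 2 * \<bar>x\<bar>"
proof -
  have "1 - cos x = 2 * (sin (x/2))\<^sup>2" using cos_double_sin[of "x/2"] by simp
  also have "\<dots> \<le> 2 * (x/2)\<^sup>2" by (intro mult_left_mono iffD1[OF abs_le_square_iff abs_sin_x_le_abs_x]) simp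
  also have "\<dots> \<le> 1/2" using assms by (simp add: power_divide abs_square_le_1)
  finally have c: "cos x \<ge> 1/2" by simp
  have "\<bar>tan x\<bar> = \<bar>sin x\<bar> / cos x" using c by (simp add: tan_def)
  also have "\<dots> \<le> \<bar>x\<bar> / (1/2)" using c abs_sin_x_le_abs_x[of x] by (intro frac_le) auto
  finally show ?thesis by simp
qed

context hyperbolic_surface
begin

text \<open>Transformation law of the Christoffel symbol under a holomorphic coordinate change.
  Differentiating \<open>r (f w) * cmod (f' w) * cos (Im w) = 1\<close> in a direction
  \<open>v\<close> gives the real part of the identity times \<open>v\<close>; all \<open>v\<close>
  together give the identity. The right-hand side is the symbol of the strip metric.\<close>

lemma christoffel_pullback:
  assumes r: "open Z" "smooth_on Z r" "\<And>z. z \<in> Z \<Longrightarrow> r z > 0"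
    and B: "open B" "B \<subseteq> strip" "w \<in> B"
    and f: "\<And>w. w \<in> B \<Longrightarrow> f w \<in> Z" "\<And>w. w \<in> B \<Longrightarrow> (f has_field_derivative f' w) (at w)"
      "(f' has_field_derivative f'' w) (at w)"
    and iso: "\<And>w. w \<in> B \<Longrightarrow> r (f w) * cmod (f' w) = strip_metric w"
  shows "f'' w / f' w + Complex (pdx (\<lambda>\<zeta>. ln (r \<zeta>)) (f w)) (- pdy (\<lambda>\<zeta>. ln (r \<zeta>)) (f w)) * f' w
      = - \<i> * of_real (tan (Im w))"
proof -
  define R where "R = r (f w)"
  define C where "C = cos (Im w)"
  have R: "R > 0" using r(3) f(1) B(3) by (simp add: R_def)
  have C: "C > 0" using cos_Im_strip B by (auto simp: C_def)
  have nz: "f' w \<noteq> 0" using iso[OF B(3)] C by (auto simp: strip_metric_def C_def)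
  have Dr: "(r has_derivative frechet_derivative r (at (f w))) (at (f w))"
    by (rule Ck_on_Suc_has_derivative[OF r(1), where k = 0]) (use r(2) f(1) B(3) in \<open>auto simp: smooth_on_def simp del: Ck_on.simps\<close>)
  define d where "d = frechet_derivative r (at (f w))"
  have Dl: "((\<lambda>\<zeta>. ln (r \<zeta>)) has_derivative (\<lambda>v. d v / R)) (at (f w))"
    using Dr R unfolding R_def d_def by (auto intro!: derivative_eq_intros simp: divide_inverse mult.commute)
  define G where "G = Complex (pdx (\<lambda>\<zeta>. ln (r \<zeta>)) (f w)) (- pdy (\<lambda>\<zeta>. ln (r \<zeta>)) (f w))"
  have dG: "d v = R * Re (G * v)" for v
    using has_derivative_pd[OF Dl, of v] R by (simp add: G_def field_simps)
  have Df: "(f has_derivative (*) (f' w)) (at w)" and Df': "(f' has_derivative (*) (f'' w)) (at w)"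
    using f(2)[OF B(3)] f(3) by (auto simp: has_field_derivative_def)
  have Drf: "((\<lambda>w. r (f w)) has_derivative (\<lambda>v. d (f' w * v))) (at w)"
    using has_derivative_compose[OF Df Dr] by (simp add: d_def)
  define N where "N = Re (f' w * cnj (f' w))"
  have N: "N = (cmod (f' w))\<^sup>2" "N > 0"
  proof -
    show "N = (cmod (f' w))\<^sup>2" unfolding N_def cmod_power2 by (simp add: power2_eq_square)
    then show "N > 0" using nz by simp
  qed
  \<comment> \<open>The square of the isometry relation, free of moduli, so that it can be
    differentiated in real directions.\<close>
  define P where "P = (\<lambda>w. (r (f w))\<^sup>2 * Re (f' w * cnj (f' w)) * (cos (Im w))\<^sup>2)"
  have P1: "P x = 1" if "x \<in> B" for x
  proof -
    have "P x = (r (f x) * cmod (f' x) * cos (Im x))\<^sup>2"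
      unfolding P_def power_mult_distrib cmod_power2 by (simp add: power2_eq_square)
    also have "r (f x) * cmod (f' x) * cos (Im x) = 1"
      using iso[OF that] cos_Im_strip that B by (force simp: strip_metric_def)
    finally show ?thesis by simp
  qed
  have DP: "(P has_derivative (\<lambda>v. 2 * R * d (f' w * v) * N * C\<^sup>2
       + R\<^sup>2 * (2 * Re (f'' w * v * cnj (f' w))) * C\<^sup>2 - R\<^sup>2 * N * (2 * C * sin (Im w) * Im v))) (at w)"
    unfolding P_def R_def N_def C_def
    by (rule derivative_eq_intros Drf Df' refl)+ (simp add: fun_eq_iff algebra_simps power2_eq_square)
  have "(P has_derivative (\<lambda>v. 0)) (at w)"
    by (rule has_derivative_transform_within_open[OF has_derivative_const[of 1] B(1,3)]) (simp add: P1)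
  then have "(\<lambda>v. 2 * R * d (f' w * v) * N * C\<^sup>2
       + R\<^sup>2 * (2 * Re (f'' w * v * cnj (f' w))) * C\<^sup>2 - R\<^sup>2 * N * (2 * C * sin (Im w) * Im v)) = (\<lambda>v. 0)"
    using has_derivative_unique[OF DP] by blast
  then have "2 * R * d (f' w * v) * N * C\<^sup>2
       + R\<^sup>2 * (2 * Re (f'' w * v * cnj (f' w))) * C\<^sup>2 - R\<^sup>2 * N * (2 * C * sin (Im w) * Im v) = 0" for v
    by metis
  note E0 = this
  have E: "2 * R\<^sup>2 * C * (Re (G * (f' w * v)) * N * C + Re (f'' w * v * cnj (f' w)) * C - N * sin (Im w) * Im v) = 0" for v
    using E0[of v] unfolding dG by (simp add: algebra_simps power2_eq_square del: times_complex.sel)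
  have E2: "Re (G * (f' w * v)) * N * C + Re (f'' w * v * cnj (f' w)) * C - N * sin (Im w) * Im v = 0" for v
    using E[of v] R C by simp
  have E3: "Re ((f'' w / f' w + G * f' w + \<i> * of_real (tan (Im w))) * v) = 0" for v
  proof -
    have q: "f'' w / f' w = f'' w * cnj (f' w) / of_real N"
      using nz N(1) by (simp add: complex_norm_square field_simps del: of_real_power)
    have "Re ((f'' w / f' w + G * f' w + \<i> * of_real (tan (Im w))) * v)
        = Re (f'' w * v * cnj (f' w)) / N + Re (G * (f' w * v)) - tan (Im w) * Im v"
    proof -
      have "(f'' w / f' w + G * f' w + \<i> * of_real (tan (Im w))) * v
          = f'' w * v * cnj (f' w) / of_real N + G * (f' w * v) + \<i> * of_real (tan (Im w)) * v"
        unfolding q by (simp add: algebra_simps)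
      then show ?thesis by (simp only: plus_complex.sel Re_divide_of_real) simp
    qed
    also have "\<dots> = (Re (G * (f' w * v)) * N * C + Re (f'' w * v * cnj (f' w)) * C - N * sin (Im w) * Im v) / (N * C)"
      using N(2) C by (simp add: tan_def C_def[symmetric] field_simps del: times_complex.sel)
    finally show ?thesis using E2 by simp
  qed
  have "f'' w / f' w + G * f' w + \<i> * of_real (tan (Im w)) = 0"
    using E3[of 1] E3[of \<i>] by (intro complex_eqI) auto
  then show ?thesis by (simp add: G_def add_eq_0_iff2)
qed

lemma geodesic_chart:
  assumes cg: "closed_geodesic A \<rho> l t" and c: "c \<in> A"
  defines "z \<equiv> cmap c \<circ> t" and "z' \<equiv> \<lambda>\<theta>. vector_derivative (cmap c \<circ> t) (at \<theta>)"
  shows "open (t -` cdom c)"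
    "\<And>\<theta>. t \<theta> \<in> cdom c \<Longrightarrow> (z has_vector_derivative z' \<theta>) (at \<theta>)"
    "\<And>\<theta>. t \<theta> \<in> cdom c \<Longrightarrow> (z' has_vector_derivative vector_derivative z' (at \<theta>)) (at \<theta>)"
    "\<And>\<theta>. t \<theta> \<in> cdom c \<Longrightarrow> \<rho> c (z \<theta>) * cmod (z' \<theta>) = l"
    "\<And>\<theta>. t \<theta> \<in> cdom c \<Longrightarrow> vector_derivative z' (at \<theta>) +
      Complex (pdx (\<lambda>\<zeta>. ln (\<rho> c \<zeta>)) (z \<theta>)) (- pdy (\<lambda>\<zeta>. ln (\<rho> c \<zeta>)) (z \<theta>)) * (z' \<theta>)\<^sup>2 = 0"
proof -
  have tc: "continuous_on UNIV t" and C2: "Ck_on 2 (t -` cdom c) z"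
    using cg c by (auto simp: closed_geodesic_def z_def)
  show op: "open (t -` cdom c)" using open_vimage[OF open_cdom[OF c] tc] .
  have C2': "Ck_on (Suc (Suc 0)) (t -` cdom c) z" using C2 by (simp only: numeral_2_eq_2)
  show d1: "(z has_vector_derivative z' \<theta>) (at \<theta>)" if "t \<theta> \<in> cdom c" for \<theta>
  proof -
    have "z differentiable at \<theta>"
      using Ck_on_Suc_has_derivative[OF op C2', of \<theta>] that by (auto simp: differentiable_def)
    then show ?thesis unfolding z'_def z_def[symmetric] using vector_derivative_works by blast
  qed
  have z'eq: "z' \<theta> = frechet_derivative z (at \<theta>) 1" if "t \<theta> \<in> cdom c" for \<theta>
    using frechet_derivative_at[OF d1[OF that, unfolded has_vector_derivative_def]] by (metis scaleR_one)
  have C1: "Ck_on (Suc 0) (t -` cdom c) z'"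
    by (rule Ck_on_cong[OF op, of "\<lambda>\<theta>. frechet_derivative z (at \<theta>) 1"]) (use C2' z'eq in auto)
  show "(z' has_vector_derivative vector_derivative z' (at \<theta>)) (at \<theta>)" if "t \<theta> \<in> cdom c" for \<theta>
  proof -
    have "z' differentiable at \<theta>"
      using Ck_on_Suc_has_derivative[OF op C1, of \<theta>] that by (auto simp: differentiable_def)
    then show ?thesis using vector_derivative_works by blast
  qed
  show "\<rho> c (z \<theta>) * cmod (z' \<theta>) = l" if "t \<theta> \<in> cdom c" for \<theta>
    using cg c that by (auto simp: closed_geodesic_def z_def z'_def)
  show "vector_derivative z' (at \<theta>) +
      Complex (pdx (\<lambda>\<zeta>. ln (\<rho> c \<zeta>)) (z \<theta>)) (- pdy (\<lambda>\<zeta>. ln (\<rho> c \<zeta>)) (z \<theta>)) * (z' \<theta>)\<^sup>2 = 0"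
    if "t \<theta> \<in> cdom c" for \<theta>
    using cg c that unfolding closed_geodesic_def covariant_acceleration_def z_def z'_def by auto
qed

text \<open>In the strip coordinate the geodesic equation is
  \<open>w'' = \<i> * tan (Im w) * w'^2\<close>. The squares of \<open>Im w\<close> and
  \<open>Im w'\<close> satisfy a Gronwall inequality, so a geodesic tangent to the axis stays on it;
  there the right-hand side vanishes and the motion is linear.\<close>

lemma geodesic_local:
  assumes cg: "closed_geodesic A \<rho> l t" and L: "LI strip_metric strip \<Phi>"
    and c: "c \<in> A" "t \<theta>0 \<in> cdom c" and eq: "t \<theta>0 = \<Phi> (of_real (l * \<theta>0))"
    and D: "((cmap c \<circ> \<Phi>) has_field_derivative D) (at (of_real (l * \<theta>0)))"
    and vel: "vector_derivative (cmap c \<circ> t) (at \<theta>0) = of_real l * D"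
  shows "\<exists>e>0. \<forall>\<theta>. \<bar>\<theta> - \<theta>0\<bar> < e \<longrightarrow> t \<theta> = \<Phi> (of_real (l * \<theta>))"
proof -
  define z where "z = cmap c \<circ> t"
  define z' where "z' = (\<lambda>\<theta>. vector_derivative (cmap c \<circ> t) (at \<theta>))"
  define z'' where "z'' = (\<lambda>\<theta>. vector_derivative z' (at \<theta>))"
  have G: "open (t -` cdom c)"
    "\<And>\<theta>. t \<theta> \<in> cdom c \<Longrightarrow> (z has_vector_derivative z' \<theta>) (at \<theta>)"
    "\<And>\<theta>. t \<theta> \<in> cdom c \<Longrightarrow> (z' has_vector_derivative z'' \<theta>) (at \<theta>)"
    "\<And>\<theta>. t \<theta> \<in> cdom c \<Longrightarrow> \<rho> c (z \<theta>) * cmod (z' \<theta>) = l"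
    "\<And>\<theta>. t \<theta> \<in> cdom c \<Longrightarrow> z'' \<theta> +
      Complex (pdx (\<lambda>\<zeta>. ln (\<rho> c \<zeta>)) (z \<theta>)) (- pdy (\<lambda>\<zeta>. ln (\<rho> c \<zeta>)) (z \<theta>)) * (z' \<theta>)\<^sup>2 = 0"
    unfolding z''_def z'_def z_def using geodesic_chart[OF cg c(1)] by blast+
  define w0 where "w0 = complex_of_real (l * \<theta>0)"
  define f where "f = cmap c \<circ> \<Phi>"
  have w0: "w0 \<in> strip" unfolding w0_def by (rule real_in_strip)
  have contw0: "isCont \<Phi> w0" using L w0 by (auto simp: local_isometry_def)
  have "\<Phi> w0 \<in> cdom c" using c(2) eq by (simp add: w0_def)
  from isCont_ball_subset[OF contw0 open_cdom[OF c(1)] this]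
  obtain e1 where e1: "e1 > 0" "\<And>w. w \<in> ball w0 e1 \<Longrightarrow> \<Phi> w \<in> cdom c" by blast
  obtain e2 where e2: "e2 > 0" "ball w0 e2 \<subseteq> strip" using open_strip w0 openE by blast
  \<comment> \<open>A radius of at most 1 gives \<open>\<bar>Im w\<bar> \<le> 1\<close>, the range
    of \<open>abs_tan_le\<close>.\<close>
  define e where "e = min e1 (min e2 1)"
  have e: "e > 0" "e \<le> 1" "\<And>w. w \<in> ball w0 e \<Longrightarrow> \<Phi> w \<in> cdom c \<and> w \<in> strip"
    using e1 e2 by (auto simp: e_def)
  have "\<forall>w\<in>ball w0 e. \<exists>D. (f has_field_derivative D) (at w) \<and> \<rho> c (f w) * cmod D = strip_metric w"
    using L e(3) c(1) unfolding local_isometry_def f_def by auto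
  then obtain f' where f': "\<And>w. w \<in> ball w0 e \<Longrightarrow> (f has_field_derivative f' w) (at w)"
    "\<And>w. w \<in> ball w0 e \<Longrightarrow> \<rho> c (f w) * cmod (f' w) = strip_metric w" by metis
  have hol: "f holomorphic_on ball w0 e" unfolding holomorphic_on_open[OF open_ball] using f'(1) by blast
  have fin: "f w \<in> cimg c" if "w \<in> ball w0 e" for w using e(3)[OF that] by (simp add: f_def)
  have f'd: "f' w = deriv f w" if "w \<in> ball w0 e" for w using DERIV_imp_deriv[OF f'(1)[OF that]] by simp
  have f'nz: "f' w \<noteq> 0" if "w \<in> ball w0 e" for w
    using f'(2)[OF that] cos_Im_strip e(3)[OF that] by (fastforce simp: strip_metric_def)
  define f'' where "f'' = deriv (deriv f)"
  have f'': "(f' has_field_derivative f'' w) (at w)" if w: "w \<in> ball w0 e" for w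
  proof -
    have "(deriv f has_field_derivative f'' w) (at w)"
      unfolding f''_def by (rule holomorphic_derivI[OF holomorphic_deriv[OF hol open_ball] open_ball w])
    then show ?thesis
      by (rule has_field_derivative_transform_within_open[OF _ open_ball w]) (simp add: f'd)
  qed
  have "deriv f w0 \<noteq> 0" using f'nz[of w0] f'd[of w0] e by simp
  then obtain r where r: "r > 0" "ball w0 r \<subseteq> ball w0 e" "open (f ` ball w0 r)" "inj_on f (ball w0 r)"
    using has_complex_derivative_locally_invertible[OF hol _ open_ball, of w0] e by auto
  define B where "B = ball w0 r"
  have Be: "w \<in> ball w0 e" if "w \<in> B" for w using that r by (auto simp: B_def)
  obtain k where k: "k holomorphic_on (f ` B)" "\<And>w. w \<in> B \<Longrightarrow> deriv f w * deriv k (f w) = 1"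
    "\<And>w. w \<in> B \<Longrightarrow> k (f w) = w"
    using holomorphic_has_inverse[OF holomorphic_on_subset[OF hol r(2)] open_ball r(4)] unfolding B_def by metis
  have zw0: "z \<theta>0 = f w0" using eq by (simp add: z_def f_def w0_def)
  have "isCont z \<theta>0" using G(2)[OF c(2)] has_vector_derivative_continuous by blast
  moreover have "z \<theta>0 \<in> f ` B" using zw0 r(1) by (simp add: B_def)
  ultimately obtain d1 where d1: "d1 > 0" "\<And>\<theta>. \<theta> \<in> ball \<theta>0 d1 \<Longrightarrow> z \<theta> \<in> f ` B"
    using isCont_ball_subset[of \<theta>0 z "f ` B"] r(3) unfolding B_def by blast
  obtain d2 where d2: "d2 > 0" "ball \<theta>0 d2 \<subseteq> t -` cdom c" using G(1) c(2) openE by (metis vimageI2)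
  define d where "d = min d1 d2"
  have d: "d > 0" and dt: "\<And>\<theta>. \<bar>\<theta> - \<theta>0\<bar> < d \<Longrightarrow> t \<theta> \<in> cdom c" and dz: "\<And>\<theta>. \<bar>\<theta> - \<theta>0\<bar> < d \<Longrightarrow> z \<theta> \<in> f ` B"
    using d1 d2 by (auto simp: d_def dist_real_def subset_eq abs_minus_commute)
  define w where "w = (\<lambda>\<theta>. k (z \<theta>))"
  have wB: "w \<theta> \<in> B" "f (w \<theta>) = z \<theta>" if "\<bar>\<theta> - \<theta>0\<bar> < d" for \<theta>
    using dz[OF that] k(3) by (auto simp: w_def)
  define w' where "w' = (\<lambda>\<theta>. z' \<theta> / f' (w \<theta>))"
  have dw: "(w has_vector_derivative w' \<theta>) (at \<theta>)" if th: "\<bar>\<theta> - \<theta>0\<bar> < d" for \<theta>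
  proof -
    have "(k has_field_derivative deriv k (z \<theta>)) (at (z \<theta>))"
      by (rule holomorphic_derivI[OF k(1) _ dz[OF th]]) (use r(3) in \<open>simp add: B_def\<close>)
    from field_vector_diff_chain_at[OF G(2)[OF dt[OF th]] this]
    have "(k \<circ> z has_vector_derivative z' \<theta> * deriv k (z \<theta>)) (at \<theta>)" .
    moreover have "deriv k (z \<theta>) = 1 / f' (w \<theta>)"
      using k(2)[OF wB(1)[OF th]] wB(2)[OF th] f'd[OF Be[OF wB(1)[OF th]]] f'nz[OF Be[OF wB(1)[OF th]]]
      by (simp add: field_simps)
    ultimately show ?thesis by (simp add: w'_def w_def o_def)
  qed
  define w'' where "w'' = (\<lambda>\<theta>. \<i> * of_real (tan (Im (w \<theta>))) * (w' \<theta>)\<^sup>2)"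
  have dw': "(w' has_vector_derivative w'' \<theta>) (at \<theta>)" if th: "\<bar>\<theta> - \<theta>0\<bar> < d" for \<theta>
  proof -
    note b = Be[OF wB(1)[OF th]]
    define v where "v = w \<theta>"
    have 1: "(f' \<circ> w has_vector_derivative w' \<theta> * f'' v) (at \<theta>)"
      by (rule field_vector_diff_chain_at[OF dw[OF th]]) (use f''[OF b] in \<open>simp add: v_def\<close>)
    have nz: "f' v \<noteq> 0" using f'nz[OF b] by (simp add: v_def)
    have 2: "((\<lambda>x. inverse (f' (w x))) has_vector_derivative (w' \<theta> * f'' v) * (- (inverse (f' v) * inverse (f' v)))) (at \<theta>)"
    proof -
      have "(inverse has_field_derivative - (inverse (f' v) * inverse (f' v))) (at ((f' \<circ> w) \<theta>))"
        using DERIV_inverse'[OF DERIV_ident, of "f' v" UNIV] nz by (simp add: v_def power2_eq_square)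
      from field_vector_diff_chain_at[OF 1 this] show ?thesis by (simp add: o_def)
    qed
    have "(w' has_vector_derivative z' \<theta> * ((w' \<theta> * f'' v) * (- (inverse (f' v) * inverse (f' v)))) + z'' \<theta> * inverse (f' v)) (at \<theta>)"
      unfolding w'_def divide_inverse
      using has_vector_derivative_mult[OF G(3)[OF dt[OF th]] 2] by (simp add: v_def w'_def divide_inverse)
    moreover have "z' \<theta> * ((w' \<theta> * f'' v) * (- (inverse (f' v) * inverse (f' v)))) + z'' \<theta> * inverse (f' v) = w'' \<theta>"
    proof -
      define \<Gamma> where "\<Gamma> = Complex (pdx (\<lambda>\<zeta>. ln (\<rho> c \<zeta>)) (z \<theta>)) (- pdy (\<lambda>\<zeta>. ln (\<rho> c \<zeta>)) (z \<theta>))"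
      have z': "z' \<theta> = f' v * w' \<theta>" using nz by (simp add: w'_def v_def)
      have z'': "z'' \<theta> = - \<Gamma> * (z' \<theta>)\<^sup>2" using G(5)[OF dt[OF th]] by (simp add: \<Gamma>_def add_eq_0_iff2)
      have "f'' v / f' v + Complex (pdx (\<lambda>\<zeta>. ln (\<rho> c \<zeta>)) (f v)) (- pdy (\<lambda>\<zeta>. ln (\<rho> c \<zeta>)) (f v)) * f' v = - \<i> * of_real (tan (Im v))"
        by (rule christoffel_pullback[OF open_cimg[OF c(1)] metric_smooth[OF c(1)] metric_pos[OF c(1)] open_ball, of w0 e])
           (use e(3) b f' f'' fin in \<open>auto simp: v_def\<close>)
      then have m: "f'' v / f' v + \<Gamma> * f' v = - \<i> * of_real (tan (Im v))"
        using wB(2)[OF th] by (simp add: \<Gamma>_def v_def)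
      have "z' \<theta> * ((w' \<theta> * f'' v) * (- (inverse (f' v) * inverse (f' v)))) + z'' \<theta> * inverse (f' v)
          = - (f'' v / f' v + \<Gamma> * f' v) * (w' \<theta>)\<^sup>2"
        unfolding z'' z' using nz by (simp add: field_simps power2_eq_square)
      also have "\<dots> = w'' \<theta>" unfolding m by (simp add: w''_def v_def)
      finally show ?thesis .
    qed
    ultimately show ?thesis by simp
  qed
  \<comment> \<open>Constant speed \<open>l\<close> measured in the strip metric; it yields the
    bound \<open>l\<close> for \<open>cmod w'\<close> in the Gronwall estimate.\<close>
  have cw': "cmod (w' \<theta>) = l * cos (Im (w \<theta>))" if th: "\<bar>\<theta> - \<theta>0\<bar> < d" for \<theta>
  proof -
    note b = Be[OF wB(1)[OF th]]
    have C: "cos (Im (w \<theta>)) > 0" using cos_Im_strip e(3)[OF b] by blast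
    have p: "\<rho> c (z \<theta>) > 0" using metric_pos[OF c(1)] dt[OF th] by (simp add: z_def)
    have "\<rho> c (z \<theta>) * cmod (f' (w \<theta>)) * cos (Im (w \<theta>)) = 1"
      using f'(2)[OF b] wB(2)[OF th] C by (simp add: strip_metric_def field_simps)
    moreover have "\<rho> c (z \<theta>) * cmod (z' \<theta>) = l" by (rule G(4)[OF dt[OF th]])
    moreover have "cmod (z' \<theta>) = cmod (f' (w \<theta>)) * cmod (w' \<theta>)" using f'nz[OF b] by (simp add: w'_def norm_divide)
    ultimately have "\<rho> c (z \<theta>) * cmod (f' (w \<theta>)) * (l * cos (Im (w \<theta>))) = \<rho> c (z \<theta>) * cmod (f' (w \<theta>)) * cmod (w' \<theta>)"
      by (simp add: mult_ac)
    then show ?thesis using p f'nz[OF b] by simp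
  qed
  have l: "l > 0" using cg by (simp add: closed_geodesic_def)
  have w0eq: "w \<theta>0 = w0" using k(3)[of w0] zw0 r(1) by (simp add: w_def B_def)
  have w'0: "w' \<theta>0 = of_real l"
  proof -
    have "f' w0 = D" using DERIV_unique[OF f'(1)[of w0]] D e(1) by (simp add: f_def w0_def)
    then show ?thesis using vel f'nz[of w0] e(1) w0eq by (simp add: w'_def z'_def)
  qed
  define E where "E = (\<lambda>\<theta>. (Im (w \<theta>))\<^sup>2 + (Im (w' \<theta>))\<^sup>2)"
  define E' where "E' = (\<lambda>\<theta>. 2 * Im (w \<theta>) * Im (w' \<theta>) + 2 * Im (w' \<theta>) * Im (w'' \<theta>))"
  have E0: "E \<theta> = 0" if "\<bar>\<theta> - \<theta>0\<bar> < d" for \<theta>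
  proof (rule gronwall_zero[where E = E and E' = E' and ?t0.0 = \<theta>0 and d = d and K = "1 + 2 * l\<^sup>2"])
    fix \<theta> assume th: "\<bar>\<theta> - \<theta>0\<bar> < d"
    have 1: "((\<lambda>t. Im (w t)) has_real_derivative Im (w' \<theta>)) (at \<theta>)" "((\<lambda>t. Im (w' t)) has_real_derivative Im (w'' \<theta>)) (at \<theta>)"
      using dw[OF th] dw'[OF th] by (simp_all add: has_vector_derivative_complex_iff)
    show "(E has_real_derivative E' \<theta>) (at \<theta>)"
      unfolding E_def E'_def by (rule derivative_eq_intros 1 refl)+ simp
    have "\<bar>Im (w \<theta> - w0)\<bar> \<le> cmod (w \<theta> - w0)" by (rule abs_Im_le_cmod)
    also have "\<dots> < 1" using Be[OF wB(1)[OF th]] e(2) by (simp add: dist_norm norm_minus_commute)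
    finally have s1: "\<bar>Im (w \<theta>)\<bar> \<le> 1" by (simp add: w0_def)
    have wl: "(cmod (w' \<theta>))\<^sup>2 \<le> l\<^sup>2"
    proof (rule power_mono)
      show "cmod (w' \<theta>) \<le> l" using cw'[OF th] l cos_le_one[of "Im (w \<theta>)"] by (simp add: mult_left_le)
    qed simp
    have "Im (w'' \<theta>) = tan (Im (w \<theta>)) * Re ((w' \<theta>)\<^sup>2)" by (simp add: w''_def)
    then have "\<bar>Im (w'' \<theta>)\<bar> = \<bar>tan (Im (w \<theta>))\<bar> * \<bar>Re ((w' \<theta>)\<^sup>2)\<bar>" by (simp add: abs_mult)
    also have "\<dots> \<le> (2 * \<bar>Im (w \<theta>)\<bar>) * l\<^sup>2"
    proof (rule mult_mono[OF abs_tan_le[OF s1]])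
      have "\<bar>Re ((w' \<theta>)\<^sup>2)\<bar> \<le> (cmod (w' \<theta>))\<^sup>2" using abs_Re_le_cmod[of "(w' \<theta>)\<^sup>2"] by (simp add: norm_power)
      then show "\<bar>Re ((w' \<theta>)\<^sup>2)\<bar> \<le> l\<^sup>2" using wl by linarith
    qed auto
    finally have i: "\<bar>Im (w'' \<theta>)\<bar> \<le> 2 * l\<^sup>2 * \<bar>Im (w \<theta>)\<bar>" by (simp add: mult_ac)
    define a b where "a = \<bar>Im (w \<theta>)\<bar>" and "b = \<bar>Im (w' \<theta>)\<bar>"
    have "\<bar>E' \<theta>\<bar> \<le> 2 * a * b + 2 * b * \<bar>Im (w'' \<theta>)\<bar>"
      unfolding E'_def a_def b_def by (rule order_trans[OF abs_triangle_ineq]) (simp add: abs_mult)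
    also have "\<dots> \<le> 2 * a * b + 2 * b * (2 * l\<^sup>2 * a)"
      using i by (intro add_left_mono mult_left_mono) (auto simp: a_def b_def)
    also have "\<dots> = (1 + 2 * l\<^sup>2) * (2 * a * b)" by (simp add: algebra_simps)
    also have "\<dots> \<le> (1 + 2 * l\<^sup>2) * E \<theta>"
      using sum_squares_bound[of a b] by (intro mult_left_mono) (auto simp: E_def a_def b_def)
    finally show "\<bar>E' \<theta>\<bar> \<le> (1 + 2 * l\<^sup>2) * E \<theta>" .
    show "E \<theta> \<ge> 0" by (simp add: E_def)
  qed (use w0eq w'0 that in \<open>auto simp: E_def w0_def\<close>)
  have im0: "Im (w \<theta>) = 0" if "\<bar>\<theta> - \<theta>0\<bar> < d" for \<theta>
    using E0[OF that] by (simp add: E_def sum_power2_eq_zero_iff)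
  have bd: "\<theta> \<in> ball \<theta>0 d \<longleftrightarrow> \<bar>\<theta> - \<theta>0\<bar> < d" for \<theta> by (simp add: dist_real_def abs_minus_commute)
  have "w' \<theta> = w' \<theta>0" if "\<theta> \<in> ball \<theta>0 d" for \<theta>
  proof -
    have "\<exists>c. \<forall>x\<in>ball \<theta>0 d. w' x = c"
    proof (rule has_vector_derivative_zero_constant)
      show "(w' has_vector_derivative 0) (at x within ball \<theta>0 d)" if "x \<in> ball \<theta>0 d" for x
        using dw'[of x] im0[of x] that unfolding bd by (auto simp: w''_def intro: has_vector_derivative_at_within)
    qed (blast | simp)+
    then show ?thesis using that d by auto
  qed
  then have wl: "w' \<theta> = of_real l" if "\<theta> \<in> ball \<theta>0 d" for \<theta> using that w'0 by simp
  have wlin: "w \<theta> = of_real (l * \<theta>)" if "\<theta> \<in> ball \<theta>0 d" for \<theta>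
  proof -
    have "\<exists>c. \<forall>x\<in>ball \<theta>0 d. w x - of_real (l * x) = c"
    proof (rule has_vector_derivative_zero_constant)
      fix x assume x: "x \<in> ball \<theta>0 d"
      have 1: "((\<lambda>x. complex_of_real (l * x)) has_vector_derivative of_real l) (at x)"
        by (auto intro!: derivative_eq_intros has_vector_derivative_of_real simp: has_real_derivative_iff_has_vector_derivative[symmetric])
      have "(w has_vector_derivative of_real l) (at x)" using dw[OF x[unfolded bd]] wl[OF x] by simp
      from has_vector_derivative_diff[OF this 1]
      show "((\<lambda>x. w x - of_real (l * x)) has_vector_derivative 0) (at x within ball \<theta>0 d)"
        by (auto intro: has_vector_derivative_at_within)
    qed (blast | simp)+
    then have "w \<theta> - of_real (l * \<theta>) = w \<theta>0 - of_real (l * \<theta>0)" using that d by auto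
    then show ?thesis using w0eq by (simp add: w0_def)
  qed
  show ?thesis
  proof (intro exI[of _ d] conjI allI impI d)
    fix \<theta> assume th: "\<bar>\<theta> - \<theta>0\<bar> < d"
    have wt: "w \<theta> = of_real (l * \<theta>)" using wlin[of \<theta>] th unfolding bd .
    have "\<Phi> (w \<theta>) \<in> cdom c" using e(3) Be[OF wB(1)[OF th]] by blast
    then have "\<Phi> (w \<theta>) = cinv c (f (w \<theta>))" using cinv_cmap[OF c(1)] by (simp add: f_def)
    also have "\<dots> = cinv c (cmap c (t \<theta>))" using wB(2)[OF th] by (simp add: z_def)
    also have "\<dots> = t \<theta>" using cinv_cmap[OF c(1)] dt[OF th] by simp
    finally show "t \<theta> = \<Phi> (of_real (l * \<theta>))" by (simp add: wt)
  qed
qed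

text \<open>Open-closed argument on the parameter line. At a limit point both position and velocity
  have to be matched, since the local uniqueness statement starts from both.\<close>

lemma geodesic_in_strip:
  assumes cg: "closed_geodesic A \<rho> l t" and L: "LI strip_metric strip \<Phi>"
    and c: "c \<in> A" "t 0 \<in> cdom c" and eq: "t 0 = \<Phi> 0"
    and D: "((cmap c \<circ> \<Phi>) has_field_derivative D) (at 0)"
    and vel: "vector_derivative (cmap c \<circ> t) (at 0) = of_real l * D"
  shows "t \<theta> = \<Phi> (of_real (l * \<theta>))"
proof -
  define S where "S = {\<theta>. \<exists>e>0. \<forall>\<theta>'. \<bar>\<theta>' - \<theta>\<bar> < e \<longrightarrow> t \<theta>' = \<Phi> (of_real (l * \<theta>'))}"
  have tc: "isCont t \<theta>" for \<theta>
    using cg by (auto simp: closed_geodesic_def continuous_on_eq_continuous_at)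
  have Phic: "isCont (\<lambda>\<theta>. \<Phi> (of_real (l * \<theta>))) \<theta>" for \<theta>
  proof -
    have "isCont \<Phi> (of_real (l * \<theta>))" using L real_in_strip(1)[of "l * \<theta>"] unfolding local_isometry_def by blast
    then show ?thesis by (intro isCont_o2[where g = \<Phi> and f = "\<lambda>\<theta>. of_real (l * \<theta>)"] continuous_intros)
  qed
  have agS: "t x = \<Phi> (of_real (l * x))" if "x \<in> S" for x using that by (force simp: S_def)
  have "0 \<in> S"
    using geodesic_local[OF cg L c, of D] eq D vel by (simp add: S_def)
  moreover have op: "open S"
    unfolding open_dist
  proof
    fix x assume "x \<in> S"
    then obtain e where e: "e > 0" "\<And>y. \<bar>y - x\<bar> < e \<Longrightarrow> t y = \<Phi> (of_real (l * y))" by (auto simp: S_def)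
    have "y \<in> S" if "dist y x < e" for y
      unfolding S_def mem_Collect_eq
      by (rule exI[of _ "e - \<bar>y - x\<bar>"]) (use that e(2) in \<open>auto simp: dist_real_def\<close>)
    then show "\<exists>e>0. \<forall>y. dist y x < e \<longrightarrow> y \<in> S" using e(1) by blast
  qed
  moreover have "closed S"
    unfolding closed_limpt
  proof (intro allI impI)
    fix x assume lim: "x islimpt S"
    then have nb: "at x within S \<noteq> bot" by (simp add: trivial_limit_within)
    have eqx: "t x = \<Phi> (of_real (l * x))"
    proof (rule tendsto_unique[OF nb])
      show "(t \<longlongrightarrow> t x) (at x within S)"
        using tc by (metis continuous_at_imp_continuous_at_within continuous_within)
      have "((\<lambda>\<theta>. \<Phi> (of_real (l * \<theta>))) \<longlongrightarrow> \<Phi> (of_real (l * x))) (at x within S)"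
        using Phic by (metis (mono_tags, lifting) continuous_at_imp_continuous_at_within continuous_within)
      then show "(t \<longlongrightarrow> \<Phi> (of_real (l * x))) (at x within S)"
        by (rule Lim_transform_eventually) (use agS in \<open>auto simp: eventually_at_filter\<close>)
    qed
    obtain d where d: "d \<in> A" "t x \<in> cdom d" using chart_cover by blast
    define z' where "z' = (\<lambda>\<theta>. vector_derivative (cmap d \<circ> t) (at \<theta>))"
    note G = geodesic_chart[OF cg d(1), folded z'_def]
    define f where "f = cmap d \<circ> \<Phi>"
    define w0 where "w0 = complex_of_real (l * x)"
    have contw0: "isCont \<Phi> w0" using L real_in_strip(1)[of "l * x"] unfolding local_isometry_def w0_def by blast
    have "\<Phi> w0 \<in> cdom d" using d(2) eqx by (simp add: w0_def)
    from isCont_ball_subset[OF contw0 open_cdom[OF d(1)] this]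
    obtain e1 where e1: "e1 > 0" "\<And>w. w \<in> ball w0 e1 \<Longrightarrow> \<Phi> w \<in> cdom d" by blast
    obtain e2 where e2: "e2 > 0" "ball w0 e2 \<subseteq> strip" using open_strip openE real_in_strip(1) unfolding w0_def by blast
    define e where "e = min e1 e2"
    have e: "e > 0" "\<And>w. w \<in> ball w0 e \<Longrightarrow> \<Phi> w \<in> cdom d \<and> w \<in> strip" using e1 e2 by (auto simp: e_def)
    have hol: "f holomorphic_on ball w0 e"
      unfolding holomorphic_on_open[OF open_ball]
      using L e(2) d(1) unfolding local_isometry_def f_def by blast
    have fd: "(f has_field_derivative deriv f w) (at w)" if "w \<in> ball w0 e" for w
      by (rule holomorphic_derivI[OF hol open_ball that])
    have dfc: "isCont (deriv f) w0"
      using holomorphic_on_imp_continuous_on[OF holomorphic_deriv[OF hol open_ball]] e(1)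
      by (simp add: continuous_on_eq_continuous_at)
    \<comment> \<open>Both sides are limits along \<open>S\<close> of functions that agree on
      \<open>S\<close>: the velocity of the curve and the derivative of the developing map are
      continuous.\<close>
    have vel: "z' x = of_real l * deriv f w0"
    proof (rule tendsto_unique[OF nb])
      have "isCont z' x" using G(3)[OF d(2)] has_vector_derivative_continuous by blast
      then show "(z' \<longlongrightarrow> z' x) (at x within S)"
        by (metis continuous_at_imp_continuous_at_within continuous_within)
      have "isCont (\<lambda>\<theta>. of_real l * deriv f (of_real (l * \<theta>))) x"
        by (intro continuous_intros isCont_o2[where g = "deriv f" and f = "\<lambda>\<theta>. of_real (l * \<theta>)"])
           (use dfc in \<open>simp add: w0_def\<close>)
      then have lim2: "((\<lambda>\<theta>. of_real l * deriv f (of_real (l * \<theta>))) \<longlongrightarrow> of_real l * deriv f w0) (at x within S)"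
        unfolding w0_def by (metis (mono_tags, lifting) continuous_at_imp_continuous_at_within continuous_within)
      have "\<forall>\<^sub>F y in nhds x. t y \<in> cdom d \<and> complex_of_real (l * y) \<in> ball w0 e"
      proof (rule eventually_conj)
        show "\<forall>\<^sub>F y in nhds x. t y \<in> cdom d"
          using G(1) d(2) eventually_nhds_in_open[of "t -` cdom d" x] by simp
        have "((\<lambda>y. complex_of_real (l * y)) \<longlongrightarrow> of_real (l * x)) (nhds x)"
          by (intro tendsto_intros filterlim_ident)
        then show "\<forall>\<^sub>F y in nhds x. complex_of_real (l * y) \<in> ball w0 e"
          by (rule topological_tendstoD) (use e(1) in \<open>auto simp: w0_def\<close>)
      qed
      then have "\<forall>\<^sub>F y in at x within S. of_real l * deriv f (of_real (l * y)) = z' y"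
        unfolding eventually_at_filter
      proof eventually_elim
        case (elim y)
        show ?case
        proof (intro impI)
          assume "y \<in> S"
          then obtain b where b: "b > 0" "\<And>\<theta>. \<theta> \<in> ball y b \<Longrightarrow> f (of_real (l * \<theta>)) = (cmap d \<circ> t) \<theta>"
            by (force simp: S_def f_def dist_real_def abs_minus_commute)
          have "((\<lambda>\<theta>. complex_of_real (l * \<theta>)) has_vector_derivative of_real l) (at y)"
            by (auto intro!: derivative_eq_intros has_vector_derivative_of_real simp: has_real_derivative_iff_has_vector_derivative[symmetric])
          from field_vector_diff_chain_at[OF this fd]
          have "((\<lambda>\<theta>. f (of_real (l * \<theta>))) has_vector_derivative of_real l * deriv f (of_real (l * y))) (at y)"
            using elim by (simp add: o_def)
          then have "((cmap d \<circ> t) has_vector_derivative of_real l * deriv f (of_real (l * y))) (at y)"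
            by (rule has_vector_derivative_transform_within_open[OF _ open_ball, of _ _ y y b]) (use b in auto)
          then show "of_real l * deriv f (of_real (l * y)) = z' y"
            unfolding z'_def by (metis vector_derivative_at)
        qed
      qed
      then show "(z' \<longlongrightarrow> of_real l * deriv f w0) (at x within S)"
        by (rule Lim_transform_eventually[OF lim2])
    qed
    have "\<exists>e>0. \<forall>\<theta>. \<bar>\<theta> - x\<bar> < e \<longrightarrow> t \<theta> = \<Phi> (of_real (l * \<theta>))"
      by (rule geodesic_local[OF cg L d eqx, of "deriv f w0"])
         (use fd[of w0] e(1) vel in \<open>auto simp: f_def w0_def z'_def\<close>)
    then show "x \<in> S" by (simp add: S_def)
  qed
  ultimately have "S = UNIV" using clopen by blast
  then show ?thesis using agS by auto
qed

text \<open>The disc map is rotated so that the axis starts in the direction of the geodesic, which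
  then follows the axis. Periodicity under \<open>l\<close> holds on the real axis because
  \<open>t\<close> has period 1, and it spreads to the strip by the identity theorem.\<close>

theorem strip_developing:
  assumes cg: "closed_geodesic A \<rho> l t"
  obtains \<Phi> \<epsilon> where "\<epsilon> > 0" "LI strip_metric strip \<Phi>" "\<And>\<theta>. \<Phi> (of_real (l * \<theta>)) = t \<theta>"
    "\<And>w. w \<in> strip \<Longrightarrow> \<Phi> (w + of_real l) = \<Phi> w"
    "\<And>x. x \<in> strip \<Longrightarrow> inj_on \<Phi> {w \<in> strip. cmod (moeb (- strip_map x) (strip_map w)) < \<epsilon>}"
proof -
  have l: "l > 0" and per: "\<And>\<theta>. t (\<theta> + 1) = t \<theta>" using cg by (auto simp: closed_geodesic_def)
  obtain \<epsilon> where eps: "\<epsilon> > 0" "\<epsilon> < 1" "\<And>p. \<exists>\<Psi>. normal_param \<epsilon> \<Psi> \<and> \<Psi> 0 = p"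
    using uniform_normal_param by metis
  obtain F where F: "LI disc_metric (ball 0 1) F" "F 0 = t 0"
    using disc_developing[OF eps, of "t 0"] by metis
  obtain c where c: "c \<in> A" "t 0 \<in> cdom c" using chart_cover by blast
  obtain D1 where D1: "((cmap c \<circ> F) has_field_derivative D1) (at 0)" "\<rho> c (cmap c (F 0)) * cmod D1 = disc_metric 0"
    using F c unfolding local_isometry_def by force
  define V where "V = vector_derivative (cmap c \<circ> t) (at 0)"
  have V: "\<rho> c (cmap c (t 0)) * cmod V = l" using geodesic_chart(4)[OF cg c(1), of 0] c(2) by (simp add: V_def)
  have p: "\<rho> c (cmap c (t 0)) > 0" using metric_pos c by simp
  have D1': "\<rho> c (cmap c (t 0)) * cmod D1 = 2" using D1(2) F(2) by (simp add: disc_metric_def)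
  then have D1nz: "D1 \<noteq> 0" by auto
  \<comment> \<open>\<open>strip_map\<close> has derivative 1/2 at 0, whence the factor 2. The
    modulus is 1 because the metric fixes the lengths of \<open>V\<close> and
    \<open>D1\<close>.\<close>
  define \<tau> where "\<tau> = 2 * V / (of_real l * D1)"
  have \<tau>: "cmod \<tau> = 1"
  proof -
    have "\<rho> c (cmap c (t 0)) * (2 * cmod V) = \<rho> c (cmap c (t 0)) * (l * cmod D1)" using V D1' by (simp add: algebra_simps)
    then have "2 * cmod V = l * cmod D1" using p by simp
    then show ?thesis using l D1nz by (simp add: \<tau>_def norm_divide norm_mult)
  qed
  define \<Phi> where "\<Phi> = F \<circ> (\<lambda>w. \<tau> * strip_map w)"
  have in_disc: "\<tau> * strip_map w \<in> ball 0 1" if "w \<in> strip" for w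
    using cmod_strip_map_less[OF that] \<tau> by (simp add: norm_mult)
  have dsm: "((\<lambda>w. \<tau> * strip_map w) has_field_derivative \<tau> * (1 / (2 * (cosh (w / 2))\<^sup>2))) (at w)" if "w \<in> strip" for w
    by (intro DERIV_cmult strip_map_deriv that)
  have L: "LI strip_metric strip \<Phi>"
    unfolding \<Phi>_def
  proof (rule LI_compose[OF F(1) in_disc dsm])
    fix w assume w: "w \<in> strip"
    have "disc_metric (\<tau> * strip_map w) = disc_metric (strip_map w)" using \<tau> by (simp add: disc_metric_def norm_mult)
    moreover have "cmod (\<tau> * (1 / (2 * (cosh (w / 2))\<^sup>2))) = cmod (1 / (2 * (cosh (w / 2))\<^sup>2))"
      by (simp only: norm_mult \<tau> mult_1_left)
    ultimately show "disc_metric (\<tau> * strip_map w) * cmod (\<tau> * (1 / (2 * (cosh (w / 2))\<^sup>2))) = strip_metric w"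
      using disc_metric_strip_map[OF w] by simp
  qed
  have Phi0: "t 0 = \<Phi> 0" using F(2) by (simp add: \<Phi>_def strip_map_def)
  have "((cmap c \<circ> F) \<circ> (\<lambda>w. \<tau> * strip_map w) has_field_derivative D1 * (\<tau> * (1 / (2 * (cosh (0 / 2))\<^sup>2)))) (at 0)"
    by (rule DERIV_chain[OF _ dsm]) (use D1(1) in \<open>auto simp: strip_map_def\<close>)
  then have DPhi: "((cmap c \<circ> \<Phi>) has_field_derivative V / of_real l) (at 0)"
    using D1nz by (simp add: \<Phi>_def comp_assoc \<tau>_def)
  have axis: "t \<theta> = \<Phi> (of_real (l * \<theta>))" for \<theta>
    by (rule geodesic_in_strip[OF cg L c Phi0 DPhi]) (use l in \<open>simp add: V_def\<close>)
  have shift: "\<Phi> (w + of_real l) = \<Phi> w" if w: "w \<in> strip" for w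
  proof (rule LI_identity[where f = "\<lambda>w. \<Phi> (w + of_real l)" and g = \<Phi> and \<Omega> = strip and U = "range complex_of_real" and ?w0.0 = 0])
    show "LI strip_metric strip (\<lambda>w. \<Phi> (w + of_real l))"
    proof -
      have "LI strip_metric strip (\<Phi> \<circ> (\<lambda>w. w + of_real l))"
      proof (rule LI_compose[OF L, where F' = "\<lambda>w. 1"])
        show "((\<lambda>w. w + of_real l) has_field_derivative 1) (at w)" for w :: complex
          by (auto intro!: derivative_eq_intros)
      qed (auto simp: strip_def strip_metric_def)
      then show ?thesis by (simp add: o_def)
    qed
    show "0 islimpt range complex_of_real"
      unfolding islimpt_approachable
    proof (intro allI impI)
      fix e :: real assume "e > 0"
      then show "\<exists>x'\<in>range complex_of_real. x' \<noteq> 0 \<and> dist x' 0 < e"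
        by (intro bexI[OF _ rangeI[of complex_of_real "e/2"]]) auto
    qed
    fix x assume "x \<in> range complex_of_real"
    then obtain y where y: "x = of_real y" by auto
    have "t (y / l + 1) = t (y / l)" by (rule per)
    then show "\<Phi> (x + of_real l) = \<Phi> x" using l unfolding axis y by (simp add: distrib_left)
  qed (use w L open_strip convex_connected[OF convex_strip] in auto)
  have inj: "inj_on \<Phi> {w \<in> strip. cmod (moeb (- strip_map x) (strip_map w)) < \<epsilon>}" if x: "x \<in> strip" for x
  proof -
    have "inj_on F (hball \<epsilon> (\<tau> * strip_map x))"
      by (rule LI_inj_on_hball[OF eps F(1)]) (use in_disc[OF x] in simp)
    moreover have "inj_on (\<lambda>w. \<tau> * strip_map w) strip"
      using inj_on_strip_map \<tau> by (auto simp: inj_on_def)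
    ultimately show ?thesis
      unfolding \<Phi>_def
      by (intro comp_inj_on)
         (auto intro!: in_disc simp: hball_def moeb_rotate[OF \<tau>] norm_mult \<tau> cmod_strip_map_less elim!: inj_on_subset)
  qed
  show ?thesis by (rule that[OF eps(1) L axis[symmetric] shift inj])
qed

end

section \<open>Change of variables under holomorphic maps\<close>

text \<open>Identifies the plane with \<open>real^2\<close>, where the change of variables theorem
  and determinants are stated.\<close>

definition cvec :: "complex \<Rightarrow> real^2"
  where "cvec z = vector [Re z, Im z]"

definition vecc :: "real^2 \<Rightarrow> complex"
  where "vecc x = Complex (x $ 1) (x $ 2)"

lemma vecc_cvec [simp]: "vecc (cvec z) = z" and cvec_vecc [simp]: "cvec (vecc x) = x"
  by (simp_all add: cvec_def vecc_def vec_eq_iff forall_2)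

lemma cvec_image: "cvec ` Y = vecc -` Y"
proof (intro equalityI subsetI)
  fix x assume "x \<in> vecc -` Y"
  then show "x \<in> cvec ` Y" using imageI[of "vecc x" Y cvec] by simp
qed auto

lemma cvec_nth: "cvec z $ 1 = Re z" "cvec z $ 2 = Im z"
  by (simp_all add: cvec_def)

lemma bounded_linear_cvec: "bounded_linear cvec"
proof -
  have "linear cvec" by (rule linearI) (simp_all add: vec_eq_iff forall_2 cvec_nth)
  then show ?thesis by (simp add: linear_conv_bounded_linear)
qed

lemma bounded_linear_vecc: "bounded_linear vecc"
proof -
  have "linear vecc" by (rule linearI) (simp_all add: vecc_def complex_eq_iff)
  then show ?thesis by (simp add: linear_conv_bounded_linear)
qed

lemma cvec_measurable [measurable]: "cvec \<in> borel_measurable borel"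
  by (intro borel_measurable_continuous_onI linear_continuous_on bounded_linear_cvec)

lemma vecc_measurable [measurable]: "vecc \<in> borel_measurable borel"
  by (intro borel_measurable_continuous_onI linear_continuous_on bounded_linear_vecc)

lemma lborel_distr_cvec: "(lborel :: (real^2) measure) = distr lborel borel cvec"
proof (rule lborel_eqI)
  fix l u :: "real^2" assume le: "\<And>b. b \<in> Basis \<Longrightarrow> l \<bullet> b \<le> u \<bullet> b"
  have B: "Basis = {axis 1 1, axis 2 1 :: real^2}" by (auto simp: Basis_vec_def UNIV_2)
  have ne: "axis 1 1 \<noteq> (axis 2 1 :: real^2)" by (simp add: axis_eq_axis)
  have ab: "l $ 1 \<le> u $ 1" "l $ 2 \<le> u $ 2"
    using le[of "axis 1 1"] le[of "axis 2 1"] by (simp_all add: B inner_axis)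
  have "cvec -` box l u \<inter> space lborel = box (vecc l) (vecc u)"
    by (auto simp: mem_box B inner_axis Basis_complex_def cvec_nth vecc_def)
  then have "emeasure (distr lborel borel cvec) (box l u) = emeasure lborel (box (vecc l) (vecc u))"
    by (subst emeasure_distr) auto
  also have "\<dots> = (\<Prod>b\<in>Basis. (vecc u - vecc l) \<bullet> b)"
    by (rule emeasure_lborel_box) (use ab in \<open>auto simp: Basis_complex_def vecc_def\<close>)
  also have "(\<Prod>b\<in>Basis. (vecc u - vecc l) \<bullet> b) = (\<Prod>b\<in>Basis. (u - l) \<bullet> b)"
    using ne by (simp add: B Basis_complex_def vecc_def inner_axis)
  finally show "emeasure (distr lborel borel cvec) (box l u) = (\<Prod>b\<in>Basis. (u - l) \<bullet> b)" .
qed simp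

lemma det_complex_mult: "det (matrix (\<lambda>v. cvec (c * vecc v))) = (cmod c)\<^sup>2"
  by (simp add: det_2 matrix_def cvec_nth vecc_def axis_def cmod_power2) (simp add: power2_eq_square)

text \<open>The Jacobian determinant of a holomorphic map is the squared modulus of its derivative.
  As an inequality the statement is trivial for an infinite right-hand side; otherwise the integrand
  on the image is integrable and the change of variables theorem applies.\<close>

lemma holomorphic_image_nn_integral_le:
  fixes h :: "complex \<Rightarrow> real"
  assumes U: "open U" and F: "F holomorphic_on U" and X: "X \<in> sets borel" "X \<subseteq> U" "inj_on F X"
    and FX: "F ` X \<in> sets borel" and h: "h \<in> borel_measurable borel" "\<And>z. h z \<ge> 0"
  shows "(\<integral>\<^sup>+w. ennreal (h (F w) * (cmod (deriv F w))\<^sup>2) * indicator X w \<partial>lborel)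
           \<le> (\<integral>\<^sup>+z. ennreal (h z) * indicator (F ` X) z \<partial>lborel)"
proof (cases "(\<integral>\<^sup>+z. ennreal (h z) * indicator (F ` X) z \<partial>lborel) = \<infinity>")
  case False
  define H where "H = (\<lambda>z. h z * indicator (F ` X) z)"
  have Hm: "H \<in> borel_measurable borel" unfolding H_def using h FX by measurable
  have eH: "(\<integral>\<^sup>+z. ennreal (h z) * indicator (F ` X) z \<partial>lborel) = (\<integral>\<^sup>+z. ennreal (H z) \<partial>lborel)"
    by (intro nn_integral_cong) (auto simp: H_def indicator_def)
  have H0: "H z \<ge> 0" for z using h by (simp add: H_def)
  have intH: "integrable lborel H"
    by (rule integrableI_nonneg) (use Hm H0 False eH in \<open>auto simp: less_top\<close>)
  define b where "b = integral\<^sup>L lborel H"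
  have RH: "(\<integral>\<^sup>+z. ennreal (H z) \<partial>lborel) = ennreal b"
    unfolding b_def by (rule nn_integral_eq_integral[OF intH]) (use H0 in auto)
  define S where "S = cvec ` X"
  have SX: "S = vecc -` X" by (simp add: S_def cvec_image)
  have TX: "cvec ` F ` X = vecc -` (F ` X)" by (rule cvec_image)
  have Sb: "S \<in> sets borel" unfolding SX using measurable_sets[OF vecc_measurable X(1)] by simp
  define g where "g = (\<lambda>x. cvec (F (vecc x)))"
  have gS: "g ` S = cvec ` F ` X" by (auto simp: g_def S_def image_image)
  have dF: "(F has_derivative (*) (deriv F w)) (at w)" if "w \<in> X" for w
    using holomorphic_derivI[OF F U, of w] that X(2) by (auto simp: has_field_derivative_def)
  have dg: "(g has_derivative (\<lambda>v. cvec (deriv F (vecc x) * vecc v))) (at x within S)" if "x \<in> S" for x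
  proof -
    have "vecc x \<in> X" using that by (simp add: SX)
    note d1 = has_derivative_compose[OF bounded_linear_imp_has_derivative[OF bounded_linear_vecc] dF[OF this]]
    show ?thesis unfolding g_def
      by (rule has_derivative_at_withinI) (rule has_derivative_compose[OF d1 bounded_linear_imp_has_derivative[OF bounded_linear_cvec]])
  qed
  have injg: "inj_on g S"
    using X(3) by (auto simp: inj_on_def g_def S_def) (metis vecc_cvec)
  have i2: "integrable (lborel :: (real^2) measure) (\<lambda>x. H (vecc x))"
    unfolding lborel_distr_cvec by (subst integrable_distr_eq) (use Hm intH in auto)
  have v2: "integral\<^sup>L (lborel :: (real^2) measure) (\<lambda>x. H (vecc x)) = b"
    unfolding lborel_distr_cvec by (subst integral_distr) (use Hm in \<open>auto simp: b_def\<close>)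
  have mH: "(\<lambda>x. H (vecc x)) \<in> borel_measurable lborel" using Hm by measurable
  have ind: "indicator (g ` S) x *\<^sub>R h (vecc x) = H (vecc x)" for x
    unfolding gS TX H_def by (simp add: indicator_def)
  have ai: "(\<lambda>x. h (vecc x)) absolutely_integrable_on (g ` S)"
    unfolding set_integrable_def ind using i2 integrable_completion[OF mH] by simp
  have iv: "integral (g ` S) (\<lambda>x. h (vecc x)) = b"
  proof -
    have "integral (g ` S) (\<lambda>x. h (vecc x)) = (LINT x:g ` S|lebesgue. h (vecc x))"
      using set_lebesgue_integral_eq_integral(2)[OF ai] by simp
    also have "\<dots> = b" unfolding set_lebesgue_integral_def ind using v2 integral_completion[OF mH] by simp
    finally show ?thesis .
  qed
  let ?D = "\<lambda>x. (cmod (deriv F (vecc x)))\<^sup>2 * h (F (vecc x))"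
  \<comment> \<open>The real integrands are wrapped as vectors of length 1, the form in which the
    change of variables theorem takes its integrands.\<close>
  have "(\<lambda>x. \<bar>det (matrix (\<lambda>v. cvec (deriv F (vecc x) * vecc v)))\<bar> *\<^sub>R (vec (h (vecc (g x))) :: real^1)) absolutely_integrable_on S \<and>
        integral S (\<lambda>x. \<bar>det (matrix (\<lambda>v. cvec (deriv F (vecc x) * vecc v)))\<bar> *\<^sub>R (vec (h (vecc (g x))) :: real^1)) = vec b
      \<longleftrightarrow> (\<lambda>x. vec (h (vecc x)) :: real^1) absolutely_integrable_on (g ` S) \<and> integral (g ` S) (\<lambda>x. vec (h (vecc x)) :: real^1) = vec b"
    by (rule has_absolute_integral_change_of_variables) (use Sb dg injg in auto)
  then have cv: "?D absolutely_integrable_on S" "integral S ?D = b"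
    using ai iv by (simp_all add: det_complex_mult absolutely_integrable_on_1_iff integral_on_1_eq g_def)
  define L where "L = (\<lambda>w. h (F w) * (cmod (deriv F w))\<^sup>2 * indicator X w)"
  have Lm: "L \<in> borel_measurable borel"
  proof -
    have Ub: "U \<in> sets borel" using U by simp
    have 1: "(\<lambda>w. if w \<in> U then F w else 0) \<in> borel_measurable borel"
      by (rule borel_measurable_continuous_on_if[OF Ub holomorphic_on_imp_continuous_on[OF F]]) auto
    have 2: "(\<lambda>w. if w \<in> U then deriv F w else 0) \<in> borel_measurable borel"
      by (rule borel_measurable_continuous_on_if[OF Ub holomorphic_on_imp_continuous_on[OF holomorphic_deriv[OF F U]]]) auto
    have "(\<lambda>w. h (if w \<in> U then F w else 0) * (cmod (if w \<in> U then deriv F w else 0))\<^sup>2 * indicator X w) \<in> borel_measurable borel"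
      using 1 2 h(1) X(1) by measurable
    also have "(\<lambda>w. h (if w \<in> U then F w else 0) * (cmod (if w \<in> U then deriv F w else 0))\<^sup>2 * indicator X w) = L"
      using X(2) by (auto simp: L_def fun_eq_iff indicator_def)
    finally show ?thesis .
  qed
  have L0: "L w \<ge> 0" for w using h by (simp add: L_def)
  have indL: "indicator S x *\<^sub>R ?D x = L (vecc x)" for x
    unfolding SX L_def by (simp add: indicator_def)
  have "(\<integral>\<^sup>+w. ennreal (h (F w) * (cmod (deriv F w))\<^sup>2) * indicator X w \<partial>lborel) = (\<integral>\<^sup>+w. ennreal (L w) \<partial>lborel)"
    by (intro nn_integral_cong) (auto simp: L_def indicator_def)
  also have "\<dots> = (\<integral>\<^sup>+x. ennreal (L (vecc x)) \<partial>(lborel :: (real^2) measure))"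
    unfolding lborel_distr_cvec by (subst nn_integral_distr) (use Lm in auto)
  also have "\<dots> = (\<integral>\<^sup>+x. ennreal (L (vecc x)) \<partial>lebesgue)" by (simp add: nn_integral_completion)
  also have "\<dots> = ennreal (integral\<^sup>L lebesgue (\<lambda>x. L (vecc x)))"
    by (rule nn_integral_eq_integral[OF cv(1)[unfolded set_integrable_def indL]]) (simp add: L0)
  also have "integral\<^sup>L lebesgue (\<lambda>x. L (vecc x)) = integral S ?D"
    using set_lebesgue_integral_eq_integral(2)[OF cv(1)] unfolding set_lebesgue_integral_def indL .
  finally show ?thesis using cv(2) RH eH by simp
qed (simp only: top_greatest infinity_ennreal_def)

lemma nn_integral_mono_measure:
  assumes "sets M = sets N" "\<And>X. X \<in> sets M \<Longrightarrow> emeasure M X \<le> emeasure N X"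
  shows "integral\<^sup>N M f \<le> integral\<^sup>N N f"
  unfolding nn_integral_def
proof (rule SUP_mono)
  fix g assume g: "g \<in> {g. simple_function M g \<and> g \<le> f}"
  have sf: "simple_function N g = simple_function M g"
    by (rule simple_function_cong_algebra) (use assms(1) sets_eq_imp_space_eq[OF assms(1)] in auto)
  have "integral\<^sup>S M g \<le> integral\<^sup>S N g"
    unfolding simple_integral_def sets_eq_imp_space_eq[OF assms(1)]
  proof (intro sum_mono mult_left_mono)
    fix x
    have "g -` {x} \<inter> space M \<in> sets M" using g by (intro simple_functionD(2)) simp
    from assms(2)[OF this] show "emeasure M (g -` {x} \<inter> space N) \<le> emeasure N (g -` {x} \<inter> space N)"
      by (simp only: sets_eq_imp_space_eq[OF assms(1)])
  qed simp
  then show "\<exists>m\<in>{g. simple_function N g \<and> g \<le> f}. integral\<^sup>S M g \<le> integral\<^sup>S N m"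
    using g sf by blast
qed

context hyperbolic_surface
begin

lemma LI_local_chart:
  assumes L: "LI m \<Omega> \<Phi>" and \<Omega>: "open \<Omega>" "w0 \<in> \<Omega>" and m: "\<And>w. w \<in> \<Omega> \<Longrightarrow> m w > 0"
  obtains c r where "c \<in> A" "r > 0" "ball w0 r \<subseteq> \<Omega>" "\<And>w. w \<in> ball w0 r \<Longrightarrow> \<Phi> w \<in> cdom c"
    "(cmap c \<circ> \<Phi>) holomorphic_on ball w0 r" "inj_on (cmap c \<circ> \<Phi>) (ball w0 r)"
    "\<And>w. w \<in> ball w0 r \<Longrightarrow> \<rho> c (cmap c (\<Phi> w)) * cmod (deriv (cmap c \<circ> \<Phi>) w) = m w"
proof -
  obtain c where c: "c \<in> A" "\<Phi> w0 \<in> cdom c" using chart_cover by blast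
  have "isCont \<Phi> w0" using L \<Omega> by (auto simp: local_isometry_def)
  from isCont_ball_subset[OF this open_cdom[OF c(1)] c(2)]
  obtain e1 where e1: "e1 > 0" "\<And>w. w \<in> ball w0 e1 \<Longrightarrow> \<Phi> w \<in> cdom c" by blast
  obtain e2 where e2: "e2 > 0" "ball w0 e2 \<subseteq> \<Omega>" using \<Omega> openE by blast
  define e where "e = min e1 e2"
  have e: "e > 0" "\<And>w. w \<in> ball w0 e \<Longrightarrow> \<Phi> w \<in> cdom c \<and> w \<in> \<Omega>" using e1 e2 by (auto simp: e_def)
  have ex: "\<exists>D. ((cmap c \<circ> \<Phi>) has_field_derivative D) (at w) \<and> \<rho> c (cmap c (\<Phi> w)) * cmod D = m w"
    if "w \<in> ball w0 e" for w
    using L e(2)[OF that] c(1) unfolding local_isometry_def by blast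
  have hol: "(cmap c \<circ> \<Phi>) holomorphic_on ball w0 e"
    unfolding holomorphic_on_open[OF open_ball] using ex by blast
  have iso: "\<rho> c (cmap c (\<Phi> w)) * cmod (deriv (cmap c \<circ> \<Phi>) w) = m w" if "w \<in> ball w0 e" for w
    using ex[OF that] DERIV_imp_deriv by metis
  have "deriv (cmap c \<circ> \<Phi>) w0 \<noteq> 0" using iso[of w0] m[OF \<Omega>(2)] e(1) by auto
  then obtain r where r: "r > 0" "ball w0 r \<subseteq> ball w0 e" "inj_on (cmap c \<circ> \<Phi>) (ball w0 r)"
    using has_complex_derivative_locally_invertible[OF hol _ open_ball, of w0] e(1) by (metis centre_in_ball)
  show ?thesis
    by (rule that[OF c(1) r(1) _ _ holomorphic_on_subset[OF hol r(2)] r(3)]) (use r(2) e(2) iso in auto)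
qed

text \<open>Inside one chart the volume is defined by the density \<open>\<rho> c\<close>, which the
  isometry property turns into \<open>m\<close> after a holomorphic change of variables. Images are
  Borel because the holomorphic map has a continuous inverse on its open image.\<close>

lemma pullback_emeasure_le:
  assumes vol: "volume_measure A \<rho> v" and c: "c \<in> A" and U: "open U"
    and \<Phi>: "\<And>w. w \<in> U \<Longrightarrow> \<Phi> w \<in> cdom c" "(cmap c \<circ> \<Phi>) holomorphic_on U" "inj_on (cmap c \<circ> \<Phi>) U"
    and iso: "\<And>w. w \<in> U \<Longrightarrow> \<rho> c (cmap c (\<Phi> w)) * cmod (deriv (cmap c \<circ> \<Phi>) w) = m w"
    and X: "X \<in> sets borel" "X \<subseteq> U"
  shows "\<Phi> ` X \<in> sets borel"
    "(\<integral>\<^sup>+w. ennreal ((m w)\<^sup>2) * indicator X w \<partial>lborel) \<le> emeasure v (\<Phi> ` X)"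
proof -
  define F where "F = cmap c \<circ> \<Phi>"
  obtain k where k: "k holomorphic_on (F ` U)" "\<And>z. z \<in> U \<Longrightarrow> k (F z) = z"
    using holomorphic_has_inverse[OF \<Phi>(2) U \<Phi>(3)] unfolding F_def by metis
  have opFU: "open (F ` U)" by (rule open_mapping_thm3) (use \<Phi> U in \<open>auto simp: F_def\<close>)
  have FX: "F ` X \<in> sets borel"
  proof -
    have m1: "(\<lambda>z. if z \<in> F ` U then k z else 0) \<in> borel_measurable borel"
      by (rule borel_measurable_continuous_on_if[OF _ holomorphic_on_imp_continuous_on[OF k(1)]]) (use opFU in auto)
    have "F ` X = F ` U \<inter> (\<lambda>z. if z \<in> F ` U then k z else 0) -` X"
    proof (intro equalityI subsetI)
      fix y assume "y \<in> F ` X"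
      then obtain x where "x \<in> X" "y = F x" by blast
      then show "y \<in> F ` U \<inter> (\<lambda>z. if z \<in> F ` U then k z else 0) -` X"
        using X(2) k(2)[of x] imageI[of x U F] by auto
    next
      fix y assume y: "y \<in> F ` U \<inter> (\<lambda>z. if z \<in> F ` U then k z else 0) -` X"
      then obtain x where "x \<in> U" "y = F x" by blast
      then show "y \<in> F ` X" using y k(2)[of x] by simp
    qed
    moreover have "(\<lambda>z. if z \<in> F ` U then k z else 0) -` X \<in> sets borel"
      using measurable_sets[OF m1 X(1)] by simp
    ultimately show ?thesis using opFU by (metis borel_open sets.Int)
  qed
  have FXc: "F ` X \<subseteq> cimg c" using \<Phi>(1) X(2) by (auto simp: F_def)
  have PX: "\<Phi> ` X = cdom c \<inter> cmap c -` (F ` X)"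
  proof (intro equalityI subsetI)
    fix p assume "p \<in> cdom c \<inter> cmap c -` (F ` X)"
    then obtain x where x: "x \<in> X" "cmap c p = cmap c (\<Phi> x)" "p \<in> cdom c" by (auto simp: F_def)
    then have "p = \<Phi> x" using cinv_cmap[OF c] \<Phi>(1) X(2) by (metis subsetD)
    then show "p \<in> \<Phi> ` X" using x by simp
  qed (use \<Phi>(1) X(2) in \<open>auto simp: F_def\<close>)
  show PXb: "\<Phi> ` X \<in> sets borel"
  proof -
    have "cmap c \<in> borel_measurable (restrict_space borel (cdom c))"
      by (rule borel_measurable_continuous_on_restrict[OF cont_cmap[OF c]])
    from measurable_sets[OF this FX]
    have "cdom c \<inter> cmap c -` (F ` X) \<in> sets (restrict_space borel (cdom c))"
      by (simp add: space_restrict_space Int_commute)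
    then show ?thesis unfolding PX using open_cdom[OF c]
      by (subst (asm) sets_restrict_space_iff) auto
  qed
  have "emeasure v (\<Phi> ` X) = (\<integral>\<^sup>+\<zeta>\<in>cmap c ` (\<Phi> ` X). ennreal ((\<rho> c \<zeta>)\<^sup>2) \<partial>lborel)"
    using vol c PXb \<Phi>(1) X(2) unfolding volume_measure_def by blast
  also have "cmap c ` (\<Phi> ` X) = F ` X" by (simp add: F_def image_comp)
  finally have E: "emeasure v (\<Phi> ` X) = (\<integral>\<^sup>+\<zeta>. ennreal ((\<rho> c \<zeta>)\<^sup>2) * indicator (F ` X) \<zeta> \<partial>lborel)" .
  define h where "h = (\<lambda>\<zeta>. if \<zeta> \<in> cimg c then (\<rho> c \<zeta>)\<^sup>2 else 0)"
  have rc: "continuous_on (cimg c) (\<rho> c)"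
    using metric_smooth[OF c] unfolding smooth_on_def by (metis Ck_on.simps(1))
  have hm: "h \<in> borel_measurable borel"
    unfolding h_def by (rule borel_measurable_continuous_on_if) (use open_cimg[OF c] rc in \<open>auto intro!: continuous_intros\<close>)
  have "(\<integral>\<^sup>+w. ennreal ((m w)\<^sup>2) * indicator X w \<partial>lborel)
      = (\<integral>\<^sup>+w. ennreal (h (F w) * (cmod (deriv F w))\<^sup>2) * indicator X w \<partial>lborel)"
  proof (rule nn_integral_cong)
    fix w
    show "ennreal ((m w)\<^sup>2) * indicator X w = ennreal (h (F w) * (cmod (deriv F w))\<^sup>2) * indicator X w"
    proof (cases "w \<in> X")
      case True
      then have "F w \<in> cimg c" using FXc by blast
      then show ?thesis using iso[of w] True X(2) by (auto simp: h_def F_def power_mult_distrib[symmetric] subset_eq)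
    qed simp
  qed
  also have "\<dots> \<le> (\<integral>\<^sup>+z. ennreal (h z) * indicator (F ` X) z \<partial>lborel)"
    by (rule holomorphic_image_nn_integral_le[OF U \<Phi>(2)[folded F_def] X _ FX hm])
       (use \<Phi>(3) X(2) in \<open>auto simp: F_def h_def intro: inj_on_subset\<close>)
  also have "\<dots> = emeasure v (\<Phi> ` X)" unfolding E
    by (rule nn_integral_cong) (use FXc in \<open>auto simp: h_def indicator_def\<close>)
  finally show "(\<integral>\<^sup>+w. ennreal ((m w)\<^sup>2) * indicator X w \<partial>lborel) \<le> emeasure v (\<Phi> ` X)" .
qed

text \<open>An embedded piece carries at most the total mass. The push-forward of the measure with
  density \<open>m^2\<close> on \<open>B\<close> is dominated by \<open>v\<close> set by set: a
  countable cover by chart balls is made disjoint, and injectivity on \<open>B\<close> keeps the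
  images disjoint.\<close>

lemma pullback_nn_integral_le:
  assumes vol: "volume_measure A \<rho> v" and L: "LI m \<Omega> \<Phi>" and \<Omega>: "open \<Omega>" and m: "\<And>w. w \<in> \<Omega> \<Longrightarrow> m w > 0"
    and mc: "continuous_on \<Omega> m"
    and B: "B \<in> sets borel" "B \<subseteq> \<Omega>" "inj_on \<Phi> B" and g: "g \<in> borel_measurable borel"
  shows "(\<integral>\<^sup>+w. ennreal ((m w)\<^sup>2) * g (\<Phi> w) * indicator B w \<partial>lborel) \<le> (\<integral>\<^sup>+p. g p \<partial>v)"
proof -
  define good where "good = (\<lambda>U. open U \<and> U \<subseteq> \<Omega> \<and> (\<exists>c\<in>A. (\<forall>w\<in>U. \<Phi> w \<in> cdom c) \<and>
      (cmap c \<circ> \<Phi>) holomorphic_on U \<and> inj_on (cmap c \<circ> \<Phi>) U \<and>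
      (\<forall>w\<in>U. \<rho> c (cmap c (\<Phi> w)) * cmod (deriv (cmap c \<circ> \<Phi>) w) = m w)))"
  have ex: "\<exists>r>0. good (ball w r)" if w\<Omega>: "w \<in> \<Omega>" for w
  proof -
    obtain c r where "c \<in> A" "r > 0" "ball w r \<subseteq> \<Omega>" "\<And>z. z \<in> ball w r \<Longrightarrow> \<Phi> z \<in> cdom c"
      "(cmap c \<circ> \<Phi>) holomorphic_on ball w r" "inj_on (cmap c \<circ> \<Phi>) (ball w r)"
      "\<And>z. z \<in> ball w r \<Longrightarrow> \<rho> c (cmap c (\<Phi> z)) * cmod (deriv (cmap c \<circ> \<Phi>) z) = m z"
      using LI_local_chart[OF L \<Omega> w\<Omega> m] by metis
    then have "r > 0 \<and> good (ball w r)" unfolding good_def by blast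
    then show ?thesis by blast
  qed
  obtain \<U> where \<U>: "\<U> \<subseteq> Collect good" "countable \<U>" "\<Union>\<U> = \<Union>(Collect good)"
    using Lindelof[of "Collect good"] by (auto simp: good_def)
  have cov: "\<Omega> \<subseteq> \<Union>\<U>"
  proof
    fix w assume "w \<in> \<Omega>"
    then obtain r where "r > 0" "good (ball w r)" using ex by blast
    then show "w \<in> \<Union>\<U>" unfolding \<U>(3) by (intro UnionI[of "ball w r"]) auto
  qed
  show ?thesis
  proof (cases "\<Omega> = {}")
    case True then show ?thesis using B by simp
  next
    case False
    then have "\<U> \<noteq> {}" using cov by auto
    then obtain U :: "nat \<Rightarrow> complex set" where U: "\<U> = range U" using \<U>(2) by (metis uncountable_def)
    have Ug: "good (U i)" for i using \<U>(1) U by auto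
    define V where "V = disjointed U"
    have Vd: "disjoint_family V" unfolding V_def by (rule disjoint_family_disjointed)
    have VU: "(\<Union>i. V i) = (\<Union>i. U i)" unfolding V_def by (rule UN_disjointed_eq)
    have Vsub: "V i \<subseteq> U i" for i unfolding V_def by (rule disjointed_subset)
    have Vb: "V i \<in> sets borel" for i
    proof -
      have "range U \<subseteq> sets borel" using Ug by (auto simp: good_def)
      then have "range (disjointed U) \<subseteq> sets borel" by (rule sets.range_disjointed_sets)
      then show ?thesis by (auto simp: V_def)
    qed
    \<comment> \<open>An arbitrary value outside \<open>B\<close>, so that the modified map is Borel
      measurable on the whole plane.\<close>
    obtain p0 :: 'a where True by blast
    define \<Phi>B where "\<Phi>B = (\<lambda>w. if w \<in> B then \<Phi> w else p0)"
    have Phic: "continuous_on \<Omega> \<Phi>"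
      using L by (auto simp: local_isometry_def intro: continuous_at_imp_continuous_on)
    have mB: "\<Phi>B \<in> measurable borel borel"
    proof (rule borel_measurableI)
      fix S :: "'a set" assume S: "open S"
      have "\<Phi>B -` S \<inter> space borel = (B \<inter> (\<Omega> \<inter> \<Phi> -` S)) \<union> (if p0 \<in> S then - B else {})"
        using B(2) by (auto simp: \<Phi>B_def split: if_splits)
      moreover have "open (\<Omega> \<inter> \<Phi> -` S)" by (rule continuous_open_preimage[OF Phic \<Omega> S])
      ultimately show "\<Phi>B -` S \<inter> space borel \<in> sets borel" using B(1) by auto
    qed
    define mm where "mm = (\<lambda>w. ennreal ((m w)\<^sup>2) * indicator B w)"
    have mmm: "mm \<in> borel_measurable borel"
    proof -
      have "(\<lambda>w. if w \<in> \<Omega> then m w else 0) \<in> borel_measurable borel"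
        by (rule borel_measurable_continuous_on_if[OF _ mc]) (use \<Omega> in auto)
      then have "(\<lambda>w. ennreal ((if w \<in> \<Omega> then m w else 0)\<^sup>2) * indicator B w) \<in> borel_measurable borel"
        using B(1) by measurable
      also have "(\<lambda>w. ennreal ((if w \<in> \<Omega> then m w else 0)\<^sup>2) * indicator B w) = mm"
        using B(2) by (auto simp: mm_def fun_eq_iff indicator_def)
      finally show ?thesis .
    qed
    define \<nu> where "\<nu> = distr (density lborel mm) borel \<Phi>B"
    have sv: "sets v = sets borel" using vol by (simp add: volume_measure_def)
    have le: "emeasure \<nu> E \<le> emeasure v E" if E: "E \<in> sets borel" for E
    proof -
      define X where "X = (\<lambda>i. V i \<inter> (B \<inter> \<Phi>B -` E))"
      have Bb: "B \<inter> \<Phi>B -` E \<in> sets borel" using B(1) measurable_sets[OF mB E] by (auto intro: sets.Int)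
      have Xb: "X i \<in> sets borel" for i using Vb Bb by (auto simp: X_def)
      have XU: "X i \<subseteq> U i" for i using Vsub by (auto simp: X_def)
      have P: "\<Phi> ` X i \<in> sets borel \<and>
         (\<integral>\<^sup>+w. ennreal ((m w)\<^sup>2) * indicator (X i) w \<partial>lborel) \<le> emeasure v (\<Phi> ` X i)" for i
      proof -
        obtain c where c: "c \<in> A" "open (U i)" "\<And>w. w \<in> U i \<Longrightarrow> \<Phi> w \<in> cdom c"
          "(cmap c \<circ> \<Phi>) holomorphic_on U i" "inj_on (cmap c \<circ> \<Phi>) (U i)"
          "\<And>w. w \<in> U i \<Longrightarrow> \<rho> c (cmap c (\<Phi> w)) * cmod (deriv (cmap c \<circ> \<Phi>) w) = m w"
          using Ug[of i] unfolding good_def by blast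
        show ?thesis
          using pullback_emeasure_le[OF vol c Xb XU] by blast
      qed
      have Xeq: "(\<Union>i. X i) = B \<inter> \<Phi>B -` E" using B(2) cov VU U by (auto simp: X_def)
      have dX: "disjoint_family X" using Vd by (auto simp: X_def disjoint_family_on_def)
      have "emeasure \<nu> E = emeasure (density lborel mm) (\<Phi>B -` E)"
        unfolding \<nu>_def by (subst emeasure_distr) (use mB E in auto)
      also have "\<dots> = (\<integral>\<^sup>+w. mm w * indicator (\<Phi>B -` E) w \<partial>lborel)"
        by (rule emeasure_density) (use mmm measurable_sets[OF mB E] in auto)
      also have "\<dots> = (\<integral>\<^sup>+w. (\<Sum>i. ennreal ((m w)\<^sup>2) * indicator (X i) w) \<partial>lborel)"
      proof (rule nn_integral_cong)
        fix w
        have "mm w * indicator (\<Phi>B -` E) w = ennreal ((m w)\<^sup>2) * indicator (\<Union>i. X i) w"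
          unfolding Xeq by (auto simp: mm_def indicator_def)
        also have "\<dots> = (\<Sum>i. ennreal ((m w)\<^sup>2) * indicator (X i) w)"
          using suminf_indicator[OF dX, of w] by (simp add: ennreal_suminf_cmult)
        finally show "mm w * indicator (\<Phi>B -` E) w = (\<Sum>i. ennreal ((m w)\<^sup>2) * indicator (X i) w)" .
      qed
      also have "\<dots> = (\<Sum>i. \<integral>\<^sup>+w. ennreal ((m w)\<^sup>2) * indicator (X i) w \<partial>lborel)"
      proof (rule nn_integral_suminf)
        fix i
        have "(\<lambda>w. mm w * indicator (X i) w) \<in> borel_measurable borel" using mmm Xb[of i] by measurable
        also have "(\<lambda>w. mm w * indicator (X i) w) = (\<lambda>w. ennreal ((m w)\<^sup>2) * indicator (X i) w)"
          by (auto simp: mm_def X_def indicator_def fun_eq_iff)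
        finally show "(\<lambda>w. ennreal ((m w)\<^sup>2) * indicator (X i) w) \<in> borel_measurable lborel" by simp
      qed
      also have "\<dots> \<le> (\<Sum>i. emeasure v (\<Phi> ` X i))" by (rule suminf_le) (use P in auto)
      also have "\<dots> = emeasure v (\<Union>i. \<Phi> ` X i)"
      proof (rule suminf_emeasure)
        show "range (\<lambda>i. \<Phi> ` X i) \<subseteq> sets v" using P sv by auto
        show "disjoint_family (\<lambda>i. \<Phi> ` X i)"
          unfolding disjoint_family_on_def
        proof (intro ballI impI)
          fix i j :: nat assume "i \<noteq> j"
          then have "X i \<inter> X j = {}" using dX by (auto simp: disjoint_family_on_def)
          moreover have "X i \<subseteq> B" "X j \<subseteq> B" by (auto simp: X_def)
          ultimately show "\<Phi> ` X i \<inter> \<Phi> ` X j = {}" using inj_on_image_Int[OF B(3), of "X i" "X j"] by simp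
        qed
      qed
      also have "\<dots> \<le> emeasure v E"
        by (rule emeasure_mono) (use E sv in \<open>auto simp: X_def \<Phi>B_def\<close>)
      finally show ?thesis .
    qed
    have "(\<integral>\<^sup>+w. ennreal ((m w)\<^sup>2) * g (\<Phi> w) * indicator B w \<partial>lborel) = (\<integral>\<^sup>+w. mm w * g (\<Phi>B w) \<partial>lborel)"
      by (rule nn_integral_cong) (auto simp: mm_def \<Phi>B_def indicator_def)
    also have "\<dots> = (\<integral>\<^sup>+w. g (\<Phi>B w) \<partial>density lborel mm)"
      by (rule nn_integral_density[symmetric]) (use mmm mB g in measurable)
    also have "\<dots> = (\<integral>\<^sup>+p. g p \<partial>\<nu>)"
      unfolding \<nu>_def by (rule nn_integral_distr[symmetric]) (use mB g in auto)
    also have "\<dots> \<le> (\<integral>\<^sup>+p. g p \<partial>v)"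
      by (rule nn_integral_mono_measure) (use le sv in \<open>auto simp: \<nu>_def\<close>)
    finally show ?thesis .
  qed
qed

end

section \<open>Pulling back eigenfunctions to the strip\<close>

lemma Ck_on_locally:
  assumes "\<And>x. x \<in> S \<Longrightarrow> \<exists>U. open U \<and> x \<in> U \<and> Ck_on k U f"
  shows "Ck_on k S f"
  using assms
proof (induction k arbitrary: f)
  case 0
  show ?case unfolding Ck_on.simps
  proof (rule continuous_at_imp_continuous_on, rule ballI)
    fix x assume "x \<in> S"
    then obtain U where "open U" "x \<in> U" "continuous_on U f" using 0 by auto
    then show "isCont f x" by (simp add: continuous_on_eq_continuous_at)
  qed
next
  case (Suc k)
  have "f differentiable_on S"
    unfolding differentiable_on_def
  proof
    fix x assume "x \<in> S"
    then obtain U where "open U" "x \<in> U" "Ck_on (Suc k) U f" using Suc.prems by blast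
    then have "f differentiable (at x)" using Ck_on_Suc_has_derivative by (metis differentiable_def)
    then show "f differentiable (at x within S)" by (rule differentiable_at_withinI)
  qed
  moreover have "Ck_on k S (\<lambda>x. frechet_derivative f (at x) h)" for h
    by (rule Suc.IH) (use Suc.prems in \<open>metis Ck_on.simps(2)\<close>)
  ultimately show ?case by simp
qed

text \<open>The factor \<open>h\<close> closes the induction: a derivative has the same form with
  \<open>deriv g\<close> for \<open>g\<close> and a multiple of \<open>h\<close> for
  \<open>h\<close>. Multiplying \<open>h\<close> by \<open>- \<i>\<close> covers imaginary parts as
  well.\<close>

lemma Ck_on_Re_holomorphic:
  assumes B: "open B" and g: "g holomorphic_on B"
  shows "Ck_on k B (\<lambda>w. complex_of_real (Re (g w * h)))"
  using g
proof (induction k arbitrary: g h)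
  case 0
  then have "continuous_on B g" by (rule holomorphic_on_imp_continuous_on)
  then show ?case by (auto intro!: continuous_intros)
next
  case (Suc k)
  show ?case
  proof (rule Ck_on_SucI[OF B])
    fix w assume w: "w \<in> B"
    have "(g has_derivative (*) (deriv g w)) (at w)"
      using holomorphic_derivI[OF Suc.prems B w] by (simp add: has_field_derivative_def)
    then show "((\<lambda>w. complex_of_real (Re (g w * h))) has_derivative
        (\<lambda>v. complex_of_real (Re (deriv g w * (v * h))))) (at w)"
      by (auto intro!: derivative_eq_intros simp: mult.assoc simp del: times_complex.sel)
  qed (rule Suc.IH[OF holomorphic_deriv[OF Suc.prems B]])
qed

lemma has_derivative_compose_holomorphic:
  fixes f :: "complex \<Rightarrow> complex"
  assumes V: "open V" "Ck_on (Suc k) V f" "F w \<in> V" and F: "(F has_field_derivative F') (at w)"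
  shows "((\<lambda>w. f (F w)) has_derivative
     (\<lambda>v. of_real (Re (F' * v)) * pdx f (F w) + of_real (Im (F' * v)) * pdy f (F w))) (at w)"
proof -
  have "(F has_derivative (*) F') (at w)" using F by (simp add: has_field_derivative_def)
  from has_derivative_compose[OF this has_derivative_pdx_pdy[OF V]]
  show ?thesis by (simp only: scaleR_conv_of_real)
qed

lemma Ck_on_compose_holomorphic:
  fixes f :: "complex \<Rightarrow> complex"
  assumes V: "open V" and B: "open B" and F: "F holomorphic_on B" "\<And>w. w \<in> B \<Longrightarrow> F w \<in> V"
    and f: "Ck_on k V f"
  shows "Ck_on k B (\<lambda>w. f (F w))"
  using f
proof (induction k arbitrary: f)
  case 0
  then show ?case
    using continuous_on_compose2[OF _ holomorphic_on_imp_continuous_on[OF F(1)]] F(2) by auto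
next
  case (Suc k)
  show ?case
  proof (rule Ck_on_SucI[OF B])
    fix w assume w: "w \<in> B"
    show "((\<lambda>w. f (F w)) has_derivative (\<lambda>v. of_real (Re (deriv F w * v)) * pdx f (F w)
        + of_real (Re (deriv F w * (- \<i> * v))) * pdy f (F w))) (at w)"
    proof -
      have "Re (deriv F w * (- \<i> * v)) = Im (deriv F w * v)" for v by (simp add: algebra_simps)
      then show ?thesis
        using has_derivative_compose_holomorphic[OF V Suc.prems F(2)[OF w] holomorphic_derivI[OF F(1) B w]]
        by (simp only:)
    qed
  next
    fix h
    note dF = holomorphic_deriv[OF F(1) B]
    show "Ck_on k B (\<lambda>w. of_real (Re (deriv F w * h)) * pdx f (F w)
        + of_real (Re (deriv F w * (- \<i> * h))) * pdy f (F w))"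
      by (intro Ck_on_add Ck_on_mult Ck_on_Re_holomorphic B dF Suc.IH Ck_on_pdx Ck_on_pdy Suc.prems)
  qed
qed

text \<open>Conformal covariance of the Laplacian. By the Cauchy-Riemann equations the mixed terms
  and the terms with the second derivative of \<open>F\<close> cancel when the two second
  derivatives are added.\<close>

lemma flat_laplacian_compose_holomorphic:
  fixes f :: "complex \<Rightarrow> complex"
  assumes V: "open V" and B: "open B" "w \<in> B" and F: "F holomorphic_on B" "\<And>w. w \<in> B \<Longrightarrow> F w \<in> V"
    and f: "Ck_on 2 V f"
  shows "flat_laplacian (\<lambda>w. f (F w)) w = of_real ((cmod (deriv F w))\<^sup>2) * flat_laplacian f (F w)"
proof -
  have f2: "Ck_on (Suc (Suc 0)) V f" using f by (simp only: numeral_2_eq_2)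
  note fx = Ck_on_pdx[OF f2] and fy = Ck_on_pdy[OF f2]
  have dF: "(F has_field_derivative deriv F z) (at z)" if "z \<in> B" for z
    by (rule holomorphic_derivI[OF F(1) B(1) that])
  have px: "pdx (\<lambda>w. f (F w)) z = of_real (Re (deriv F z)) * pdx f (F z) + of_real (Im (deriv F z)) * pdy f (F z)"
    and py: "pdy (\<lambda>w. f (F w)) z = of_real (- Im (deriv F z)) * pdx f (F z) + of_real (Re (deriv F z)) * pdy f (F z)"
    if "z \<in> B" for z
    using pdx_eqI[OF has_derivative_compose_holomorphic[OF V f2 F(2)[OF that] dF[OF that]]]
      pdy_eqI[OF has_derivative_compose_holomorphic[OF V f2 F(2)[OF that] dF[OF that]]] by simp_all
  define D where "D = deriv F w"
  define E where "E = deriv (deriv F) w"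
  have "(deriv F has_field_derivative E) (at w)"
    unfolding E_def by (rule holomorphic_derivI[OF holomorphic_deriv[OF F(1) B(1)] B])
  then have dD: "(deriv F has_derivative (*) E) (at w)" by (simp add: has_field_derivative_def)
  note Dx = has_derivative_compose_holomorphic[OF V fx F(2)[OF B(2)] dF[OF B(2)], folded D_def]
  note Dy = has_derivative_compose_holomorphic[OF V fy F(2)[OF B(2)] dF[OF B(2)], folded D_def]
  define fxx fxy fyx fyy where "fxx = pdx (pdx f) (F w)" and "fxy = pdy (pdx f) (F w)"
    and "fyx = pdx (pdy f) (F w)" and "fyy = pdy (pdy f) (F w)"
  define X Y where "X = pdx f (F w)" and "Y = pdy f (F w)"
  have "((\<lambda>z. of_real (Re (deriv F z)) * pdx f (F z) + of_real (Im (deriv F z)) * pdy f (F z)) has_derivative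
     (\<lambda>v. of_real (Re D) * (of_real (Re (D * v)) * fxx + of_real (Im (D * v)) * fxy) + of_real (Re (E * v)) * X
       + (of_real (Im D) * (of_real (Re (D * v)) * fyx + of_real (Im (D * v)) * fyy) + of_real (Im (E * v)) * Y))) (at w)"
    unfolding fxx_def fxy_def fyx_def fyy_def X_def Y_def D_def[symmetric]
    by (rule derivative_eq_intros Dx Dy dD refl)+ (simp add: D_def)
  then have "(pdx (\<lambda>w. f (F w)) has_derivative
     (\<lambda>v. of_real (Re D) * (of_real (Re (D * v)) * fxx + of_real (Im (D * v)) * fxy) + of_real (Re (E * v)) * X
       + (of_real (Im D) * (of_real (Re (D * v)) * fyx + of_real (Im (D * v)) * fyy) + of_real (Im (E * v)) * Y))) (at w)"
    by (rule has_derivative_transform_within_open[OF _ B]) (simp add: px)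
  from pdx_eqI[OF this] have 1: "pdx (pdx (\<lambda>w. f (F w))) w =
       of_real (Re D) * (of_real (Re D) * fxx + of_real (Im D) * fxy) + of_real (Re E) * X
       + (of_real (Im D) * (of_real (Re D) * fyx + of_real (Im D) * fyy) + of_real (Im E) * Y)" by simp
  have "((\<lambda>z. of_real (- Im (deriv F z)) * pdx f (F z) + of_real (Re (deriv F z)) * pdy f (F z)) has_derivative
     (\<lambda>v. of_real (- Im D) * (of_real (Re (D * v)) * fxx + of_real (Im (D * v)) * fxy) + of_real (- Im (E * v)) * X
       + (of_real (Re D) * (of_real (Re (D * v)) * fyx + of_real (Im (D * v)) * fyy) + of_real (Re (E * v)) * Y))) (at w)"
    unfolding fxx_def fxy_def fyx_def fyy_def X_def Y_def D_def[symmetric]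
    by (rule derivative_eq_intros Dx Dy dD refl)+ (simp add: D_def)
  then have "(pdy (\<lambda>w. f (F w)) has_derivative
     (\<lambda>v. of_real (- Im D) * (of_real (Re (D * v)) * fxx + of_real (Im (D * v)) * fxy) + of_real (- Im (E * v)) * X
       + (of_real (Re D) * (of_real (Re (D * v)) * fyx + of_real (Im (D * v)) * fyy) + of_real (Re (E * v)) * Y))) (at w)"
    by (rule has_derivative_transform_within_open[OF _ B]) (simp add: py)
  from pdy_eqI[OF this] have 2: "pdy (pdy (\<lambda>w. f (F w))) w =
       of_real (- Im D) * (of_real (- Im D) * fxx + of_real (Re D) * fxy) + of_real (- Re E) * X
       + (of_real (Re D) * (of_real (- Im D) * fyx + of_real (Re D) * fyy) + of_real (- Im E) * Y)" by simp
  have "flat_laplacian (\<lambda>w. f (F w)) w = (of_real (Re D) * of_real (Re D) + of_real (Im D) * of_real (Im D)) * (fxx + fyy)"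
    unfolding flat_laplacian_def 1 2 of_real_minus by (simp only: algebra_simps) simp
  also have "\<dots> = of_real ((cmod D)\<^sup>2) * (fxx + fyy)"
  proof -
    have "(cmod D)\<^sup>2 = Re D * Re D + Im D * Im D" unfolding cmod_power2 by (simp add: power2_eq_square)
    then show ?thesis by (simp only: of_real_add of_real_mult)
  qed
  finally show ?thesis by (simp add: flat_laplacian_def fxx_def fyy_def D_def)
qed

lemma flat_laplacian_cong:
  fixes f g :: "complex \<Rightarrow> complex"
  assumes S: "open S" "z \<in> S" and eq: "\<And>x. x \<in> S \<Longrightarrow> f x = g x" and f: "Ck_on 2 S f"
  shows "flat_laplacian f z = flat_laplacian g z"
proof -
  have f2: "Ck_on (Suc (Suc 0)) S f" using f by (simp only: numeral_2_eq_2)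
  have e: "frechet_derivative f (at x) = frechet_derivative g (at x)" if "x \<in> S" for x
    by (rule frechet_derivative_transform_within_open[OF _ S(1) that eq])
       (use Ck_on_Suc_has_derivative[OF S(1) f2 that] in \<open>auto simp: differentiable_def\<close>)
  have d: "h differentiable at z" if "Ck_on (Suc 0) S h" for h :: "complex \<Rightarrow> complex"
    using Ck_on_Suc_has_derivative[OF S(1) that S(2)] by (auto simp: differentiable_def)
  have "pdx (pdx f) z = pdx (pdx g) z" "pdy (pdy f) z = pdy (pdy g) z"
    unfolding pdx_def[of "pdx _"] pdy_def[of "pdy _"]
    using frechet_derivative_transform_within_open[OF d[OF Ck_on_pdx[OF f2]] S, of "pdx g"]
      frechet_derivative_transform_within_open[OF d[OF Ck_on_pdy[OF f2]] S, of "pdy g"] e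
    by (simp_all add: pdx_def pdy_def)
  then show ?thesis by (simp add: flat_laplacian_def)
qed

context hyperbolic_surface
begin

text \<open>The factor \<open>(cmod (deriv F w0))^2\<close> of the Laplacian combines with the
  density of the chart to the square of \<open>strip_metric\<close>; this is the isometry
  property.\<close>

lemma pullback_eigenfunction:
  assumes L: "LI strip_metric strip \<Phi>" and ef: "laplace_eigenfunction A \<rho> \<mu> \<phi>"
  shows "Ck_on 2 strip (\<lambda>w. \<phi> (\<Phi> w))"
    "\<And>w. w \<in> strip \<Longrightarrow> flat_laplacian (\<lambda>w. \<phi> (\<Phi> w)) w = - of_real (\<mu> * (strip_metric w)\<^sup>2) * \<phi> (\<Phi> w)"
proof -
  have sp: "strip_metric w > 0" if "w \<in> strip" for w
    using cos_Im_strip[OF that] by (simp add: strip_metric_def)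
  have P: "\<exists>U. open U \<and> w0 \<in> U \<and> Ck_on 2 U (\<lambda>w. \<phi> (\<Phi> w)) \<and>
      flat_laplacian (\<lambda>w. \<phi> (\<Phi> w)) w0 = - of_real (\<mu> * (strip_metric w0)\<^sup>2) * \<phi> (\<Phi> w0)"
    if w0: "w0 \<in> strip" for w0
  proof -
    obtain c r where c: "c \<in> A" and r: "r > 0" "ball w0 r \<subseteq> strip" and dom: "\<And>w. w \<in> ball w0 r \<Longrightarrow> \<Phi> w \<in> cdom c"
      and hol: "(cmap c \<circ> \<Phi>) holomorphic_on ball w0 r" and iso: "\<And>w. w \<in> ball w0 r \<Longrightarrow>
         \<rho> c (cmap c (\<Phi> w)) * cmod (deriv (cmap c \<circ> \<Phi>) w) = strip_metric w"
      using LI_local_chart[OF L open_strip w0 sp] by metis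
    define F where "F = cmap c \<circ> \<Phi>"
    define f where "f = \<phi> \<circ> cinv c"
    have Fin: "F w \<in> cimg c" if "w \<in> ball w0 r" for w using dom[OF that] by (simp add: F_def)
    have f2: "Ck_on 2 (cimg c) f" using ef c by (simp add: laplace_eigenfunction_def f_def)
    have eq: "f (F w) = \<phi> (\<Phi> w)" if "w \<in> ball w0 r" for w
      using cinv_cmap[OF c dom[OF that]] by (simp add: f_def F_def)
    have C: "Ck_on 2 (ball w0 r) (\<lambda>w. f (F w))"
      by (rule Ck_on_compose_holomorphic[OF open_cimg[OF c] open_ball hol[folded F_def] Fin f2])
    have C': "Ck_on 2 (ball w0 r) (\<lambda>w. \<phi> (\<Phi> w))"
      by (rule Ck_on_cong[OF open_ball eq C])
    have wb: "w0 \<in> ball w0 r" using r by simp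
    have "flat_laplacian (\<lambda>w. \<phi> (\<Phi> w)) w0 = flat_laplacian (\<lambda>w. f (F w)) w0"
      by (rule flat_laplacian_cong[OF open_ball wb eq C, symmetric])
    also have "\<dots> = of_real ((cmod (deriv F w0))\<^sup>2) * flat_laplacian f (F w0)"
      by (rule flat_laplacian_compose_holomorphic[OF open_cimg[OF c] open_ball wb hol[folded F_def] Fin f2])
    also have "flat_laplacian f (F w0) = - of_real \<mu> * \<phi> (\<Phi> w0) * of_real ((\<rho> c (F w0))\<^sup>2)"
    proof -
      have "laplace_beltrami \<rho> c \<phi> (\<Phi> w0) = complex_of_real \<mu> * \<phi> (\<Phi> w0)"
        using ef c dom[OF wb] by (auto simp: laplace_eigenfunction_def)
      then have "- flat_laplacian f (F w0) / of_real ((\<rho> c (F w0))\<^sup>2) = of_real \<mu> * \<phi> (\<Phi> w0)"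
        by (simp add: laplace_beltrami_def f_def F_def)
      moreover have "\<rho> c (F w0) > 0" using metric_pos[OF c Fin[OF wb]] .
      ultimately have "- flat_laplacian f (F w0) = of_real \<mu> * \<phi> (\<Phi> w0) * of_real ((\<rho> c (F w0))\<^sup>2)"
        by (simp add: field_simps)
      then have "flat_laplacian f (F w0) = - (of_real \<mu> * \<phi> (\<Phi> w0) * of_real ((\<rho> c (F w0))\<^sup>2))"
        by (metis minus_minus)
      then show ?thesis by simp
    qed
    also have "of_real ((cmod (deriv F w0))\<^sup>2) * (- of_real \<mu> * \<phi> (\<Phi> w0) * of_real ((\<rho> c (F w0))\<^sup>2))
        = - of_real (\<mu> * (\<rho> c (F w0) * cmod (deriv F w0))\<^sup>2) * \<phi> (\<Phi> w0)"
      by (simp add: power_mult_distrib mult_ac)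
    also have "\<rho> c (F w0) * cmod (deriv F w0) = strip_metric w0" using iso[OF wb] by (simp add: F_def)
    finally show ?thesis using C' wb by blast
  qed
  show "Ck_on 2 strip (\<lambda>w. \<phi> (\<Phi> w))" by (rule Ck_on_locally) (use P in blast)
  show "\<And>w. w \<in> strip \<Longrightarrow> flat_laplacian (\<lambda>w. \<phi> (\<Phi> w)) w = - of_real (\<mu> * (strip_metric w)\<^sup>2) * \<phi> (\<Phi> w)"
    using P by blast
qed

lemma eigenfunction_continuous:
  assumes ef: "laplace_eigenfunction A \<rho> \<mu> \<phi>" shows "continuous_on UNIV \<phi>"
proof (rule continuous_at_imp_continuous_on, rule ballI)
  fix p
  obtain c where c: "c \<in> A" "p \<in> cdom c" using chart_cover by blast
  have "Ck_on 0 (cimg c) (\<phi> \<circ> cinv c)"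
  proof (rule Ck_on_antimono[of 2])
    show "Ck_on 2 (cimg c) (\<phi> \<circ> cinv c)" using ef c(1) unfolding laplace_eigenfunction_def by blast
  qed simp
  then have "continuous_on (cdom c) ((\<phi> \<circ> cinv c) \<circ> cmap c)"
    by (intro continuous_on_compose[OF cont_cmap[OF c(1)]]) simp
  then have "continuous_on (cdom c) \<phi>"
    by (rule continuous_on_eq) (simp add: cinv_cmap[OF c(1)])
  then show "isCont \<phi> p" using open_cdom[OF c(1)] c(2) by (simp add: continuous_on_eq_continuous_at)
qed

end

section \<open>Covering a window of the strip by injective boxes\<close>

lemma gd_mono: "s \<le> s' \<Longrightarrow> gd s \<le> gd s'"
  by (simp add: gd_def arctan_le_iff)

lemma gd_surj:
  assumes "gd a \<le> x" "x \<le> gd b" obtains s where "a \<le> s" "s \<le> b" "x = gd s"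
proof -
  have x: "- (pi/2) < x" "x < pi/2" using assms gd_bounds[of a] gd_bounds[of b] by linarith+
  define s where "s = arsinh (tan x)"
  have xs: "x = gd s" using x by (simp add: s_def gd_def sinh_arsinh_real arctan_tan)
  have "a \<le> s" "s \<le> b" using assms unfolding xs gd_def by (simp_all add: arctan_le_iff)
  then show ?thesis using that xs by blast
qed

lemma cosh_minus_one_le:
  fixes x :: real assumes "\<bar>x\<bar> \<le> 1" shows "cosh x - 1 \<le> x\<^sup>2"
proof -
  have e: "exp y \<le> 1 + y + y\<^sup>2" if "0 \<le> y" "y \<le> 1" for y :: real using exp_bound[OF that] .
  have e2: "exp (- y) \<le> 1 - y + y\<^sup>2" if "0 \<le> y" "y \<le> 1" for y :: real
  proof -
    have "1 \<le> (1 - y + y\<^sup>2) * (1 + y)"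
      using that by (simp add: algebra_simps power2_eq_square)
    also have "\<dots> \<le> (1 - y + y\<^sup>2) * exp y"
    proof (rule mult_left_mono)
      have "0 \<le> (1 - y) + y\<^sup>2" using that by (intro add_nonneg_nonneg) auto
      then show "0 \<le> 1 - y + y\<^sup>2" by simp
    qed (rule exp_ge_add_one_self)
    finally show ?thesis by (simp add: exp_minus inverse_eq_divide divide_le_eq)
  qed
  have c: "cosh y - 1 \<le> y\<^sup>2" if "0 \<le> y" "y \<le> 1" for y :: real
    using add_mono[OF e[OF that] e2[OF that]] by (simp add: cosh_field_def field_simps)
  have "cosh \<bar>x\<bar> - 1 \<le> \<bar>x\<bar>\<^sup>2" by (rule c[OF abs_ge_zero assms])
  then show ?thesis by (metis cosh_real_abs power2_abs)
qed

text \<open>\<open>a\<close>, \<open>b\<close> limit the coordinate along the axis,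
  \<open>c\<close>, \<open>d\<close> the distance from it, and \<open>\<sigma>\<close>, which is 1
  or -1, selects the side.\<close>

definition window_box :: "real \<Rightarrow> real \<Rightarrow> real \<Rightarrow> real \<Rightarrow> real \<Rightarrow> complex set"
  where "window_box \<sigma> a b c d = {w. a \<le> Re w \<and> Re w \<le> b \<and> gd c \<le> \<sigma> * Im w \<and> \<sigma> * Im w \<le> gd d}"

lemma window_box_borel [measurable]: "window_box \<sigma> a b c d \<in> sets borel"
proof -
  have "closed (window_box \<sigma> a b c d)"
    unfolding window_box_def by (intro closed_Collect_conj closed_Collect_le continuous_intros)
  then show ?thesis by simp
qed

lemma window_box_gd:
  assumes "\<sigma> = 1 \<or> \<sigma> = -1" "w \<in> window_box \<sigma> a b c d"
  obtains u s where "a \<le> u" "u \<le> b" "c \<le> s" "s \<le> d" "w = Complex u (gd (\<sigma> * s))"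
proof -
  obtain s where s: "c \<le> s" "s \<le> d" "\<sigma> * Im w = gd s"
    using gd_surj[of c "\<sigma> * Im w" d] assms(2) by (auto simp: window_box_def)
  have "Im w = gd (\<sigma> * s)" using assms(1) s(3) by (auto simp: gd_minus)
  then show ?thesis using that[of "Re w" s] s assms(2) by (simp add: window_box_def complex_eq_iff)
qed

text \<open>Cells are closed, and the right end \<open>L\<close> goes to the last one,
  \<open>N - 1\<close>. Shared end points do no harm in an upper bound.\<close>

lemma unit_interval_cell:
  fixes x L :: real and N :: nat
  assumes "N > 0" "0 \<le> x" "x \<le> L" "L > 0"
  obtains i where "i < N" "real i * (L / N) \<le> x" "x \<le> real (Suc i) * (L / N)"
proof (cases "x = L")
  case True
  then show ?thesis using that[of "N - 1"] assms by (simp add: field_simps of_nat_diff)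
next
  case False
  define i where "i = nat \<lfloor>x * N / L\<rfloor>"
  have q: "0 \<le> x * N / L" using assms by simp
  have i1: "real i \<le> x * N / L" "x * N / L < real i + 1"
    using q by (simp_all add: i_def of_nat_nat)
  have "x * N / L < N" using assms False by (simp add: field_simps)
  then have "i < N" using i1(1) by linarith
  moreover have "real i * (L / N) \<le> x" "x \<le> real (Suc i) * (L / N)"
    using i1 assms by (simp_all add: field_simps)
  ultimately show ?thesis using that by blast
qed

context hyperbolic_surface
begin

text \<open>Lengths along the axis are stretched by \<open>cosh s \<le> exp (S + 1)\<close> in the
  window. Boxes of height \<open>1 / N1 < e\<close> and width below \<open>e / exp (S + 1)\<close>
  thus fit into injectivity discs, and each carries at most the total mass; only their number grows,
  like \<open>exp S\<close>.\<close>

lemma window_bound: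
  assumes vol: "volume_measure A \<rho> v" and L: "LI strip_metric strip \<Phi>" and eps: "\<epsilon> > 0" and l: "l > 0"
    and inj: "\<And>x. x \<in> strip \<Longrightarrow> inj_on \<Phi> {w \<in> strip. cmod (moeb (- strip_map x) (strip_map w)) < \<epsilon>}"
  obtains C where "C > 0" "\<And>S \<sigma> g. S \<ge> 0 \<Longrightarrow> \<sigma> = 1 \<or> \<sigma> = -1 \<Longrightarrow> g \<in> borel_measurable borel \<Longrightarrow>
     (\<integral>\<^sup>+w. ennreal ((strip_metric w)\<^sup>2) * g (\<Phi> w) * indicator (window_box \<sigma> 0 l S (S + 1)) w \<partial>lborel)
        \<le> ennreal (C * exp S) * (\<integral>\<^sup>+p. g p \<partial>v)"
proof -
  define e where "e = min \<epsilon> 1"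
  have e: "0 < e" "e \<le> 1" "e \<le> \<epsilon>" using eps by (auto simp: e_def)
  obtain N1 :: nat where N1: "N1 > 0" "1 / N1 < e"
    using real_arch_inverse[of e] e(1) by (auto simp: inverse_eq_divide)
  define N2 where "N2 = (\<lambda>S. Suc (nat \<lfloor>l * exp (S + 1) / e\<rfloor>))"
  have N2: "l * exp (S + 1) / e < N2 S" "N2 S \<le> l * exp (S + 1) / e + 1" for S
  proof -
    have "0 \<le> l * exp (S + 1) / e" using l e by simp
    then have "real (nat \<lfloor>l * exp (S + 1) / e\<rfloor>) = of_int \<lfloor>l * exp (S + 1) / e\<rfloor>" by simp
    then show "l * exp (S + 1) / e < N2 S" "N2 S \<le> l * exp (S + 1) / e + 1"
      unfolding N2_def of_nat_Suc by linarith+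
  qed
  \<comment> \<open>The number of boxes divided by \<open>exp S\<close>: \<open>N1\<close> layers of
    at most \<open>l * exp (S + 1) / e + 1\<close> columns, where the summand 1 is absorbed by
    \<open>1 \<le> exp S\<close>.\<close>
  define C where "C = N1 * (l * exp 1 / e + 1)"
  have C0: "C > 0" using N1 l e by (auto simp: C_def intro!: mult_pos_pos add_pos_pos)
  show ?thesis
  proof (rule that[OF C0])
    fix S \<sigma> :: real and g :: "'a \<Rightarrow> ennreal"
    assume S: "S \<ge> 0" and \<sigma>: "\<sigma> = 1 \<or> \<sigma> = -1" and g: "g \<in> borel_measurable borel"
    define M where "M = N2 S"
    have M: "M > 0" by (simp add: M_def N2_def)
    define box where "box = (\<lambda>(i, j). window_box \<sigma> (real j * (l / M)) (real (Suc j) * (l / M))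
        (S + real i * (1 / N1)) (S + real (Suc i) * (1 / N1)))"
    define I where "I = {..<N1} \<times> {..<M}"
    have cov: "window_box \<sigma> 0 l S (S + 1) \<subseteq> (\<Union>ij\<in>I. box ij)"
    proof
      fix w assume w: "w \<in> window_box \<sigma> 0 l S (S + 1)"
      obtain u s where us: "0 \<le> u" "u \<le> l" "S \<le> s" "s \<le> S + 1" "w = Complex u (gd (\<sigma> * s))"
        using window_box_gd[OF \<sigma> w] by metis
      obtain j where j: "j < M" "real j * (l / M) \<le> u" "u \<le> real (Suc j) * (l / M)"
        using unit_interval_cell[OF M us(1,2) l] by metis
      obtain i where i: "i < N1" "real i * (1 / N1) \<le> s - S" "s - S \<le> real (Suc i) * (1 / N1)"
        using unit_interval_cell[OF N1(1), of "s - S" 1] us by auto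
      have "gd (S + real i * (1 / N1)) \<le> gd s" "gd s \<le> gd (S + real (Suc i) * (1 / N1))"
        by (rule gd_mono, use i in linarith)+
      moreover have "\<sigma> * gd (\<sigma> * s) = gd s" using \<sigma> by (auto simp: gd_minus)
      ultimately have "w \<in> box (i, j)" using j us(5) by (simp add: box_def window_box_def)
      then show "w \<in> (\<Union>ij\<in>I. box ij)" using i j by (auto simp: I_def)
    qed
    have boxb: "box ij \<in> sets borel" for ij by (cases ij) (simp add: box_def)
    have small: "box (i, j) \<subseteq> strip \<and> inj_on \<Phi> (box (i, j))" if ij: "i < N1" "j < M" for i j
    proof -
      define u0 s0 where "u0 = real j * (l / M)" and "s0 = S + real i * (1 / N1)"
      define x where "x = Complex u0 (gd (\<sigma> * s0))"
      have "box (i, j) \<subseteq> {w \<in> strip. cmod (moeb (- strip_map x) (strip_map w)) < \<epsilon>}"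
      proof
        fix w assume "w \<in> box (i, j)"
        then obtain u s where us: "u0 \<le> u" "u \<le> real (Suc j) * (l / M)" "s0 \<le> s" "s \<le> S + real (Suc i) * (1 / N1)"
          "w = Complex u (gd (\<sigma> * s))"
          unfolding box_def prod.case u0_def s0_def by (rule window_box_gd[OF \<sigma>])
        have lM: "l / M < e / exp (S + 1)"
          using N2(1)[of S] e(1) l M by (simp add: M_def field_simps)
        have "e / exp (S + 1) \<le> 1" using e S by (simp add: divide_le_eq) (meson one_le_exp_iff add_nonneg_nonneg order_trans zero_le_one)
        have sc: "real (Suc j) * y = real j * y + y" "real (Suc i) * y = real i * y + y" for y
          by (simp_all add: distrib_right)
        have du: "0 \<le> u - u0" "u - u0 \<le> l / M" using us unfolding u0_def sc by linarith+
        have ds: "0 \<le> s - s0" "s - s0 \<le> 1 / N1" using us unfolding s0_def sc by linarith+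
        have sS: "0 \<le> s0" "s \<le> S + 1"
        proof -
          have "real (Suc i) * (1 / N1) \<le> 1" using ij(1) N1(1) by (simp add: field_simps)
          then show "s \<le> S + 1" using us by linarith
          show "0 \<le> s0" using S by (simp add: s0_def)
        qed
        have ch: "cosh y \<le> exp (S + 1)" if "0 \<le> y" "y \<le> S + 1" for y
        proof -
          have "cosh y \<le> exp y" using that(1) by (simp add: cosh_field_def)
          also have "\<dots> \<le> exp (S + 1)" using that by simp
          finally show ?thesis .
        qed
        have "cosh (u - u0) - 1 \<le> (u - u0)\<^sup>2"
        proof (rule cosh_minus_one_le)
          show "\<bar>u - u0\<bar> \<le> 1" using du lM \<open>e / exp (S + 1) \<le> 1\<close> by linarith
        qed
        also have "\<dots> < (e / exp (S + 1))\<^sup>2" using du lM by (intro power_strict_mono) auto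
        finally have "(cosh (u - u0) - 1) * (cosh (\<sigma> * s) * cosh (\<sigma> * s0)) \<le> (e / exp (S + 1))\<^sup>2 * (exp (S + 1) * exp (S + 1))"
        proof (intro mult_mono)
          have a: "cosh (\<sigma> * y) = cosh y" for y using \<sigma> by auto
          show "cosh (\<sigma> * s) \<le> exp (S + 1)" "cosh (\<sigma> * s0) \<le> exp (S + 1)"
            unfolding a using ch sS ds by auto
        qed (auto simp: less_imp_le)
        also have "\<dots> = e\<^sup>2" by (simp add: power2_eq_square)
        finally have A1: "(cosh (u - u0) - 1) * (cosh (\<sigma> * s) * cosh (\<sigma> * s0)) \<le> e\<^sup>2" .
        have "cosh (\<sigma> * s - \<sigma> * s0) = cosh (s - s0)"
          using \<sigma> by (auto simp: minus_diff_eq[of s s0, symmetric] simp del: minus_diff_eq)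
        moreover have "cosh (s - s0) - 1 \<le> (s - s0)\<^sup>2" using ds N1 e by (intro cosh_minus_one_le) auto
        moreover have "(s - s0)\<^sup>2 < e\<^sup>2" using ds N1 by (intro power_strict_mono) auto
        ultimately have A2: "cosh (\<sigma> * s - \<sigma> * s0) - 1 < e\<^sup>2" by linarith
        \<comment> \<open>Both terms of \<open>pseudo_distance_bound\<close> are controlled by
          \<open>e^2\<close>, one of them strictly, and the bound halves their sum.\<close>
        have "(cmod (moeb (- strip_map x) (strip_map w)))\<^sup>2 < e\<^sup>2"
          unfolding x_def us(5)
        proof (rule le_less_trans[OF pseudo_distance_bound])
          have "(cosh (u - u0) - 1) * (cosh (\<sigma> * s) * cosh (\<sigma> * s0)) + (cosh (\<sigma> * s - \<sigma> * s0) - 1) < 2 * e\<^sup>2"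
            using A1 A2 by linarith
          then show "((cosh (u - u0) - 1) * (cosh (\<sigma> * s) * cosh (\<sigma> * s0)) + (cosh (\<sigma> * s - \<sigma> * s0) - 1)) / 2 < e\<^sup>2"
            by simp
        qed
        then have "cmod (moeb (- strip_map x) (strip_map w)) < e" using e(1) by (simp add: power_less_imp_less_base)
        then show "w \<in> {w \<in> strip. cmod (moeb (- strip_map x) (strip_map w)) < \<epsilon>}"
          using e(3) gd_in_strip us(5) by simp
      qed
      moreover have "x \<in> strip" by (simp add: x_def gd_in_strip)
      ultimately show ?thesis using inj inj_on_subset by blast
    qed
    have sp: "strip_metric w > 0" if "w \<in> strip" for w
      using cos_Im_strip[OF that] by (simp add: strip_metric_def)
    have sc: "continuous_on strip strip_metric"
      unfolding strip_metric_def using cos_Im_strip by (intro continuous_intros) fastforce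
    define h where "h = (\<lambda>w. ennreal ((strip_metric w)\<^sup>2) * g (\<Phi> w))"
    have one: "(\<integral>\<^sup>+w. h w * indicator (box ij) w \<partial>lborel) \<le> (\<integral>\<^sup>+p. g p \<partial>v)" if ijI: "ij \<in> I" for ij
    proof -
      obtain i j where ij: "ij = (i, j)" "i < N1" "j < M" using ijI by (auto simp: I_def)
      show ?thesis unfolding h_def ij(1)
        by (rule pullback_nn_integral_le[OF vol L open_strip sp sc boxb _ _ g]) (use small[OF ij(2,3)] in auto)
    qed
    have hm: "(\<lambda>w. h w * indicator (box ij) w) \<in> borel_measurable lborel" if ijI: "ij \<in> I" for ij
    proof -
      obtain i j where ij: "ij = (i, j)" "i < N1" "j < M" using ijI by (auto simp: I_def)
      have sub: "box ij \<subseteq> strip" using small[OF ij(2,3)] ij(1) by blast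
      have Phic: "continuous_on strip \<Phi>"
        using L by (auto simp: local_isometry_def intro: continuous_at_imp_continuous_on)
      have m1: "\<Phi> \<in> measurable (restrict_space borel strip) borel"
        by (rule borel_measurable_continuous_on_restrict[OF Phic])
      have m2: "strip_metric \<in> measurable (restrict_space borel strip) borel"
        by (rule borel_measurable_continuous_on_restrict[OF sc])
      have "h \<in> borel_measurable (restrict_space borel strip)"
        unfolding h_def using m1 m2 g by measurable
      then have "(\<lambda>w. h w * indicator strip w) \<in> borel_measurable borel"
        by (subst (asm) borel_measurable_restrict_space_iff_ennreal) (use open_strip in auto)
      then have "(\<lambda>w. h w * indicator strip w * indicator (box ij) w) \<in> borel_measurable borel"
        using boxb[of ij] by measurable
      also have "(\<lambda>w. h w * indicator strip w * indicator (box ij) w) = (\<lambda>w. h w * indicator (box ij) w)"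
        using sub by (auto simp: fun_eq_iff indicator_def)
      finally show ?thesis by simp
    qed
    have "(\<integral>\<^sup>+w. h w * indicator (window_box \<sigma> 0 l S (S + 1)) w \<partial>lborel)
        \<le> (\<integral>\<^sup>+w. (\<Sum>ij\<in>I. h w * indicator (box ij) w) \<partial>lborel)"
    proof (rule nn_integral_mono)
      fix w
      show "h w * indicator (window_box \<sigma> 0 l S (S + 1)) w \<le> (\<Sum>ij\<in>I. h w * indicator (box ij) w)"
      proof (cases "w \<in> window_box \<sigma> 0 l S (S + 1)")
        case True
        then obtain ij where ij: "ij \<in> I" "w \<in> box ij" using cov by blast
        have "h w * indicator (box ij) w \<le> (\<Sum>ij\<in>I. h w * indicator (box ij) w)"
          by (rule member_le_sum) (use ij in \<open>auto simp: I_def\<close>)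
        then show ?thesis using True ij by simp
      qed simp
    qed
    also have "\<dots> = (\<Sum>ij\<in>I. \<integral>\<^sup>+w. h w * indicator (box ij) w \<partial>lborel)"
      by (rule nn_integral_sum) (rule hm)
    also have "\<dots> \<le> (\<Sum>ij\<in>I. \<integral>\<^sup>+p. g p \<partial>v)" by (intro sum_mono one)
    also have "\<dots> = ennreal (real (card I)) * (\<integral>\<^sup>+p. g p \<partial>v)" by (simp add: ennreal_of_nat_eq_real_of_nat)
    also have "\<dots> \<le> ennreal (C * exp S) * (\<integral>\<^sup>+p. g p \<partial>v)"
    proof (intro mult_right_mono ennreal_leI)
      have "real M \<le> l * exp (S + 1) / e + 1" using N2(2) by (simp add: M_def)
      also have "\<dots> \<le> (l * exp 1 / e + 1) * exp S"
        using S one_le_exp_iff[of S] by (simp add: exp_add algebra_simps)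
      finally have "real N1 * real M \<le> real N1 * ((l * exp 1 / e + 1) * exp S)" by (intro mult_left_mono) auto
      then show "real (card I) \<le> C * exp S" by (simp add: I_def C_def mult.assoc)
    qed simp
    finally show "(\<integral>\<^sup>+w. ennreal ((strip_metric w)\<^sup>2) * g (\<Phi> w) * indicator (window_box \<sigma> 0 l S (S + 1)) w \<partial>lborel)
        \<le> ennreal (C * exp S) * (\<integral>\<^sup>+p. g p \<partial>v)" unfolding h_def .
  qed
qed

end

section \<open>Fourier modes along the geodesic\<close>

lemma lborel_complex_prod: "(lborel :: complex measure) = distr (lborel \<Otimes>\<^sub>M lborel) borel (\<lambda>(x, y). Complex x y)"
proof (rule lborel_eqI)
  have m: "(\<lambda>(x, y). Complex x y) \<in> measurable (lborel \<Otimes>\<^sub>M lborel) borel"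
    unfolding Complex_eq by measurable
  fix l u :: complex assume le: "\<And>b. b \<in> Basis \<Longrightarrow> l \<bullet> b \<le> u \<bullet> b"
  have ab: "Re l \<le> Re u" "Im l \<le> Im u" using le[of 1] le[of \<i>] by (simp_all add: Basis_complex_def)
  have "(\<lambda>(x, y). Complex x y) -` box l u \<inter> space (lborel \<Otimes>\<^sub>M lborel) = {Re l<..<Re u} \<times> {Im l<..<Im u}"
    by (auto simp: mem_box Basis_complex_def space_pair_measure)
  then have "emeasure (distr (lborel \<Otimes>\<^sub>M lborel) borel (\<lambda>(x, y). Complex x y)) (box l u)
      = emeasure (lborel \<Otimes>\<^sub>M lborel) ({Re l<..<Re u} \<times> {Im l<..<Im u})"
    using m by (subst emeasure_distr) auto
  also have "\<dots> = ennreal (Re u - Re l) * ennreal (Im u - Im l)"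
    using ab by (subst lborel.emeasure_pair_measure_Times) auto
  also have "\<dots> = (\<Prod>b\<in>Basis. (u - l) \<bullet> b)"
    using ab by (simp add: Basis_complex_def ennreal_mult)
  finally show "emeasure (distr (lborel \<Otimes>\<^sub>M lborel) borel (\<lambda>(x, y). Complex x y)) (box l u)
      = (\<Prod>b\<in>Basis. (u - l) \<bullet> b)" .
qed simp

lemma nn_integral_complex:
  assumes "F \<in> borel_measurable borel"
  shows "(\<integral>\<^sup>+w. F w \<partial>(lborel :: complex measure)) = (\<integral>\<^sup>+y. \<integral>\<^sup>+x. F (Complex x y) \<partial>lborel \<partial>lborel)"
proof -
  have m: "(\<lambda>(x, y). Complex x y) \<in> measurable (lborel \<Otimes>\<^sub>M lborel) borel"
    unfolding Complex_eq by measurable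
  have "(\<integral>\<^sup>+w. F w \<partial>(lborel :: complex measure)) = (\<integral>\<^sup>+p. F (case p of (x, y) \<Rightarrow> Complex x y) \<partial>(lborel \<Otimes>\<^sub>M lborel))"
    unfolding lborel_complex_prod by (subst nn_integral_distr) (use m assms in auto)
  also have "\<dots> = (\<integral>\<^sup>+y. \<integral>\<^sup>+x. F (case (x, y) of (x, y) \<Rightarrow> Complex x y) \<partial>lborel \<partial>lborel)"
    by (rule lborel_pair.nn_integral_snd[symmetric]) (use m assms in measurable)
  finally show ?thesis by simp
qed

lemma nn_integral_eq_integral_Icc:
  fixes f :: "real \<Rightarrow> real"
  assumes "continuous_on {a..b} f" "\<And>x. x \<in> {a..b} \<Longrightarrow> f x \<ge> 0"
  shows "(\<integral>\<^sup>+x. ennreal (f x) * indicator {a..b} x \<partial>lborel) = ennreal (integral {a..b} f)"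
proof -
  have si: "set_integrable lborel {a..b} f" by (rule borel_integrable_atLeastAtMost'[OF assms(1)])
  have "(\<integral>\<^sup>+x. ennreal (f x) * indicator {a..b} x \<partial>lborel) = (\<integral>\<^sup>+x. ennreal (indicator {a..b} x *\<^sub>R f x) \<partial>lborel)"
    by (intro nn_integral_cong) (auto simp: indicator_def)
  also have "\<dots> = ennreal (\<integral>x. indicator {a..b} x *\<^sub>R f x \<partial>lborel)"
    by (rule nn_integral_eq_integral) (use si assms(2) in \<open>auto simp: set_integrable_def indicator_def\<close>)
  also have "(\<integral>x. indicator {a..b} x *\<^sub>R f x \<partial>lborel) = integral {a..b} f"
    using set_borel_integral_eq_integral(2)[OF si] by (simp add: set_lebesgue_integral_def)
  finally show ?thesis .
qed

lemma integral_exp_periodic: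
  assumes l: "l > 0" and n: "(n::int) \<noteq> 0"
  shows "integral {0..l} (\<lambda>u. exp (2 * of_real pi * \<i> * of_int n * of_real u / of_real l)) = (0::complex)"
proof -
  define a where "a = 2 * of_real pi * \<i> * complex_of_int n / of_real l"
  have a0: "a \<noteq> 0" using l n by (simp add: a_def)
  have "((\<lambda>u. exp (a * of_real u)) has_integral exp (a * of_real l) / a - exp (a * of_real 0) / a) {0..l}"
  proof (rule fundamental_theorem_of_calculus)
    fix x assume "x \<in> {0..l}"
    have "((\<lambda>u. exp (a * u) / a) has_field_derivative exp (a * of_real x)) (at (of_real x))"
      using a0 by (auto intro!: derivative_eq_intros)
    from has_vector_derivative_real_field[OF this]
    show "((\<lambda>u. exp (a * of_real u) / a) has_vector_derivative exp (a * of_real x)) (at x within {0..l})" .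
  qed (use l in simp)
  moreover have "exp (a * of_real l) = 1"
  proof -
    have "a * of_real l = of_int (2 * n) * (of_real pi * \<i>)" using l by (simp add: a_def)
    then show ?thesis using exp_integer_2pi[of "of_int n"] by (simp add: mult_ac)
  qed
  ultimately have "integral {0..l} (\<lambda>u. exp (a * of_real u)) = 0" by (simp add: integral_unique)
  moreover have "2 * of_real pi * \<i> * of_int n * of_real u / of_real l = a * of_real u" for u
    by (simp add: a_def)
  ultimately show ?thesis by (simp only:)
qed

text \<open>Expand the integral of \<open>|g - p|^2\<close> for the Fourier sum \<open>p\<close>:
  its pairings with \<open>g\<close> and with itself both equal \<open>Q\<close>, leaving the
  integral of \<open>|g|^2\<close> minus \<open>Q\<close>. The factor \<open>l\<close> is the
  squared norm of the exponentials.\<close>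

lemma bessel_inequality:
  fixes g :: "real \<Rightarrow> complex"
  assumes l: "l > 0" and g: "continuous_on {0..l} g" and N: "finite N"
  defines "e \<equiv> \<lambda>(n::int) u. exp (2 * of_real pi * \<i> * of_int n * of_real u / of_real l :: complex)"
  shows "(\<Sum>n\<in>N. (cmod (integral {0..l} (\<lambda>u. g u * cnj (e n u))))\<^sup>2) \<le> l * integral {0..l} (\<lambda>u. (cmod (g u))\<^sup>2)"
proof -
  define c where "c = (\<lambda>n. integral {0..l} (\<lambda>u. g u * cnj (e n u)))"
  define p where "p = (\<lambda>u. \<Sum>n\<in>N. c n / of_real l * e n u)"
  have ec: "continuous_on {0..l} (e n)" for n unfolding e_def by (intro continuous_intros) (use l in auto)
  have pc: "continuous_on {0..l} p" unfolding p_def by (intro continuous_intros ec) (use l in auto)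
  have orth: "integral {0..l} (\<lambda>u. e n u * cnj (e m u)) = (if n = m then of_real l else 0)" for n m
  proof -
    have "e n u * cnj (e m u) = e (n - m) u" for u
      by (simp add: e_def exp_cnj diff_divide_distrib left_diff_distrib right_diff_distrib flip: exp_add)
    then have "integral {0..l} (\<lambda>u. e n u * cnj (e m u)) = integral {0..l} (e (n - m))" by simp
    also have "\<dots> = (if n = m then of_real l else 0)"
      using integral_exp_periodic[OF l, of "n - m"] l by (auto simp: e_def scaleR_conv_of_real)
    finally show ?thesis .
  qed
  have gi: "(\<lambda>u. g u * cnj (e n u)) integrable_on {0..l}" for n
    by (intro integrable_continuous_interval continuous_intros g ec)
  have pe: "integral {0..l} (\<lambda>u. p u * cnj (e m u)) = c m" if m: "m \<in> N" for m
  proof -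
    have "integral {0..l} (\<lambda>u. p u * cnj (e m u)) = integral {0..l} (\<lambda>u. \<Sum>n\<in>N. c n / of_real l * (e n u * cnj (e m u)))"
      by (simp add: p_def sum_distrib_right mult.assoc)
    also have "\<dots> = (\<Sum>n\<in>N. integral {0..l} (\<lambda>u. c n / of_real l * (e n u * cnj (e m u))))"
      by (rule integral_sum[OF N]) (intro integrable_continuous_interval continuous_intros ec, use l in auto)
    also have "\<dots> = (\<Sum>n\<in>N. c n / of_real l * (if n = m then of_real l else 0))"
      by (simp only: integral_mult_right orth)
    also have "\<dots> = c m" using m N l by (simp add: if_distrib cong: if_cong)
    finally show ?thesis .
  qed
  have expand: "integral {0..l} (\<lambda>u. q u * cnj (p u)) = (\<Sum>n\<in>N. cnj (c n) / of_real l * integral {0..l} (\<lambda>u. q u * cnj (e n u)))"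
    if q: "continuous_on {0..l} q" for q
  proof -
    have "integral {0..l} (\<lambda>u. q u * cnj (p u)) = integral {0..l} (\<lambda>u. \<Sum>n\<in>N. cnj (c n) / of_real l * (q u * cnj (e n u)))"
      by (simp add: p_def sum_distrib_left mult_ac)
    also have "\<dots> = (\<Sum>n\<in>N. integral {0..l} (\<lambda>u. cnj (c n) / of_real l * (q u * cnj (e n u))))"
      by (rule integral_sum[OF N]) (intro integrable_continuous_interval continuous_intros ec q, use l in auto)
    finally show ?thesis by (simp only: integral_mult_right)
  qed
  define Q where "Q = (\<Sum>n\<in>N. (cmod (c n))\<^sup>2) / l"
  have cc: "cnj z / of_real l * z = of_real ((cmod z)\<^sup>2 / l)" for z
    by (simp add: complex_norm_square mult.commute del: of_real_power)
  have cn: "integral {0..l} (\<lambda>u. g u * cnj (e n u)) = c n" for n by (simp add: c_def)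
  have gp: "integral {0..l} (\<lambda>u. g u * cnj (p u)) = of_real Q"
    unfolding expand[OF g] cn cc by (simp add: Q_def sum_divide_distrib)
  have pp: "integral {0..l} (\<lambda>u. p u * cnj (p u)) = of_real Q"
  proof -
    have "(\<Sum>n\<in>N. cnj (c n) / of_real l * integral {0..l} (\<lambda>u. p u * cnj (e n u))) = (\<Sum>n\<in>N. of_real ((cmod (c n))\<^sup>2 / l))"
      by (rule sum.cong) (simp_all only: pe cc)
    then show ?thesis unfolding expand[OF pc] by (simp add: Q_def sum_divide_distrib)
  qed
  have int: "(\<lambda>u. g u * cnj (p u)) integrable_on {0..l}" "(\<lambda>u. p u * cnj (p u)) integrable_on {0..l}"
    "(\<lambda>u. (cmod (g u))\<^sup>2) integrable_on {0..l}"
    by (intro integrable_continuous_interval continuous_intros g pc)+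
  have Reint: "integral {0..l} (\<lambda>u. Re (f u)) = Re (integral {0..l} f)" "(\<lambda>u. Re (f u)) integrable_on {0..l}"
    if "f integrable_on {0..l}" for f
    using integral_linear[OF that bounded_linear_Re] integrable_linear[OF that bounded_linear_Re] by (simp_all add: o_def)
  have "0 \<le> integral {0..l} (\<lambda>u. (cmod (g u - p u))\<^sup>2)"
    by (rule integral_nonneg) (intro integrable_continuous_interval continuous_intros g pc, simp)
  also have "(\<lambda>u. (cmod (g u - p u))\<^sup>2) = (\<lambda>u. (cmod (g u))\<^sup>2 - 2 * Re (g u * cnj (p u)) + Re (p u * cnj (p u)))"
    unfolding cmod_power2 by (simp add: fun_eq_iff power2_eq_square algebra_simps)
  also have "integral {0..l} \<dots> = integral {0..l} (\<lambda>u. (cmod (g u))\<^sup>2) - 2 * Q + Q"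
  proof -
    have 1: "integral {0..l} (\<lambda>u. 2 * Re (g u * cnj (p u))) = 2 * Q" "integral {0..l} (\<lambda>u. Re (p u * cnj (p u))) = Q"
      using Reint(1)[OF int(1)] Reint(1)[OF int(2)] by (simp_all add: gp pp del: times_complex.sel)
    have 2: "(\<lambda>u. 2 * Re (g u * cnj (p u))) integrable_on {0..l}" "(\<lambda>u. Re (p u * cnj (p u))) integrable_on {0..l}"
      using integrable_cmul[OF Reint(2)[OF int(1)], of 2] Reint(2)[OF int(2)] by simp_all
    show ?thesis
      by (subst integral_add[OF integrable_diff[OF int(3) 2(1)] 2(2)], subst integral_diff[OF int(3) 2(1)])
         (simp only: 1)
  qed
  finally have "Q \<le> integral {0..l} (\<lambda>u. (cmod (g u))\<^sup>2)" by simp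
  then show ?thesis using l by (simp add: Q_def c_def pos_divide_le_eq mult.commute)
qed

lemma vertical_derivative:
  fixes \<psi> :: "complex \<Rightarrow> complex"
  assumes "Ck_on (Suc k) strip \<psi>" "Complex u \<sigma> \<in> strip"
  shows "((\<lambda>\<sigma>. \<psi> (Complex u \<sigma>)) has_vector_derivative pdy \<psi> (Complex u \<sigma>)) (at \<sigma>)"
    "((\<lambda>u. \<psi> (Complex u \<sigma>)) has_vector_derivative pdx \<psi> (Complex u \<sigma>)) (at u)"
proof -
  note D = has_derivative_pdx_pdy[OF open_strip assms]
  have "Complex u \<sigma> = of_real u + of_real \<sigma> * \<i>" "Complex u \<sigma> = of_real \<sigma> * \<i> + of_real u * 1"
    by (simp_all add: complex_eq_iff)
  then show "((\<lambda>\<sigma>. \<psi> (Complex u \<sigma>)) has_vector_derivative pdy \<psi> (Complex u \<sigma>)) (at \<sigma>)"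
    "((\<lambda>u. \<psi> (Complex u \<sigma>)) has_vector_derivative pdx \<psi> (Complex u \<sigma>)) (at u)"
    using has_derivative_line[of \<psi> _ "of_real u" \<sigma> \<i>] has_derivative_line[of \<psi> _ "of_real \<sigma> * \<i>" u 1] D
    by (fastforce simp: Complex_eq mult.commute add.commute)+
qed

lemma Complex_in_strip: "Complex u \<sigma> \<in> strip \<longleftrightarrow> \<sigma> \<in> {- (pi/2)<..<pi/2}"
  by (auto simp: strip_def abs_less_iff)

text \<open>Differentiation under the integral gives the derivatives in \<open>\<sigma>\<close>. The
  eigenvalue equation replaces the second one by the derivative along the period, which integration
  by parts turns into \<open>- k^2\<close>.\<close>

lemma fourier_mode_ode:
  fixes \<psi> :: "complex \<Rightarrow> complex" and n :: int
  assumes C: "Ck_on 2 strip \<psi>" and l: "l > 0"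
    and ev: "\<And>w. w \<in> strip \<Longrightarrow> flat_laplacian \<psi> w = - of_real (\<mu> * (strip_metric w)\<^sup>2) * \<psi> w"
    and per: "\<And>w. w \<in> strip \<Longrightarrow> \<psi> (w + of_real l) = \<psi> w"
  defines "e \<equiv> \<lambda>u. exp (2 * of_real pi * \<i> * of_int n * of_real u / of_real l :: complex)"
  defines "h \<equiv> \<lambda>\<sigma>. integral {0..l} (\<lambda>u. \<psi> (Complex u \<sigma>) * cnj (e u))"
    and "h1 \<equiv> \<lambda>\<sigma>. integral {0..l} (\<lambda>u. pdy \<psi> (Complex u \<sigma>) * cnj (e u))"
  assumes \<sigma>: "\<sigma> \<in> {- (pi/2)<..<pi/2}"
  shows "(h has_vector_derivative h1 \<sigma>) (at \<sigma>)"
    "(h1 has_vector_derivative of_real ((2 * pi * of_int n / l)\<^sup>2 - \<mu> / (cos \<sigma>)\<^sup>2) * h \<sigma>) (at \<sigma>)"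
proof -
  let ?U = "{- (pi/2)<..<pi/2}"
  have C2: "Ck_on (Suc (Suc 0)) strip \<psi>" using C by (simp only: numeral_2_eq_2)
  note C1 = Ck_on_SucD[OF C2] and Cy = Ck_on_pdy[OF C2] and Cx = Ck_on_pdx[OF C2]
  have cont: "continuous_on (?U \<times> cbox 0 l) (\<lambda>(\<sigma>, u). F (Complex u \<sigma>) * cnj (e u))"
    if "continuous_on strip F" for F :: "complex \<Rightarrow> complex"
  proof -
    have "continuous_on (?U \<times> cbox 0 l) (\<lambda>x. F (Complex (snd x) (fst x)))"
      by (rule continuous_on_compose2[OF that]) (auto simp: Complex_eq strip_def abs_less_iff intro!: continuous_intros)
    moreover have "continuous_on (?U \<times> cbox 0 l) (\<lambda>x. cnj (e (snd x)))"
      unfolding e_def by (intro continuous_intros) (use l in auto)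
    ultimately show ?thesis by (auto simp: case_prod_unfold intro!: continuous_intros)
  qed
  have contu: "continuous_on {0..l} (\<lambda>u. F (Complex u s) * cnj (e u))"
    if "continuous_on strip F" "s \<in> ?U" for F :: "complex \<Rightarrow> complex" and s
  proof -
    have "continuous_on {0..l} (\<lambda>u. F (Complex u s))"
      by (rule continuous_on_compose2[OF that(1)]) (use that(2) in \<open>auto simp: Complex_eq strip_def abs_less_iff intro!: continuous_intros\<close>)
    moreover have "continuous_on {0..l} (\<lambda>u. cnj (e u))"
      unfolding e_def by (intro continuous_intros) (use l in auto)
    ultimately show ?thesis by (rule continuous_on_mult)
  qed
  have k0: "continuous_on strip \<psi>" "continuous_on strip (pdy \<psi>)" "continuous_on strip (pdx \<psi>)"
    "continuous_on strip (pdy (pdy \<psi>))" "continuous_on strip (pdx (pdx \<psi>))"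
    using Ck_on_SucD[OF C1] Ck_on_SucD[OF Cx] Ck_on_SucD[OF Cy] Ck_on_pdy[OF Cy] Ck_on_pdx[OF Cx] by simp_all
  have diff: "((\<lambda>s. integral {0..l} (\<lambda>u. F (Complex u s) * cnj (e u))) has_vector_derivative
      integral {0..l} (\<lambda>u. pdy F (Complex u \<sigma>) * cnj (e u))) (at \<sigma>)"
    if F: "Ck_on (Suc 0) strip F" "continuous_on strip F" "continuous_on strip (pdy F)" for F :: "complex \<Rightarrow> complex"
  proof -
    have "((\<lambda>s. integral (cbox 0 l) (\<lambda>u. F (Complex u s) * cnj (e u))) has_vector_derivative
      integral (cbox 0 l) (\<lambda>u. pdy F (Complex u \<sigma>) * cnj (e u))) (at \<sigma> within ?U)"
    proof (rule leibniz_rule_vector_derivative[OF _ _ cont[OF F(3)] \<sigma>])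
      fix s u assume "s \<in> ?U"
      then have "((\<lambda>s. F (Complex u s)) has_vector_derivative pdy F (Complex u s)) (at s)"
        by (intro vertical_derivative(1)[OF F(1)]) (simp add: Complex_in_strip)
      then show "((\<lambda>s. F (Complex u s) * cnj (e u)) has_vector_derivative pdy F (Complex u s) * cnj (e u)) (at s within ?U)"
        by (rule has_vector_derivative_at_within[OF has_vector_derivative_mult_left])
    next
      fix s assume "s \<in> ?U"
      then show "(\<lambda>u. F (Complex u s) * cnj (e u)) integrable_on cbox 0 l"
        using integrable_continuous_interval[OF contu[OF F(2)]] by simp
    qed simp
    then show ?thesis using at_within_open[OF \<sigma> open_greaterThanLessThan] by (simp add: cbox_interval)
  qed
  show "(h has_vector_derivative h1 \<sigma>) (at \<sigma>)"
    unfolding h_def h1_def by (rule diff[OF C1 k0(1,2)])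
  define k where "k = 2 * pi * of_int n / l"
  have ce: "cnj (e u) = exp (- (\<i> * of_real k * of_real u))" for u
    by (simp add: e_def k_def exp_cnj mult_ac)
  have dce: "((\<lambda>u. cnj (e u)) has_vector_derivative - (\<i> * of_real k) * cnj (e u)) (at u)" for u
  proof -
    have "((\<lambda>z. exp (- (\<i> * of_real k * z))) has_field_derivative - (\<i> * of_real k) * exp (- (\<i> * of_real k * of_real u))) (at (of_real u))"
      by (auto intro!: derivative_eq_intros)
    from has_vector_derivative_real_field[OF this] show ?thesis unfolding ce .
  qed
  have inst: "Complex u \<sigma> \<in> strip" for u using \<sigma> by (simp add: Complex_in_strip)
  \<comment> \<open>An antiderivative that performs both integrations by parts at once; its end
    values agree by periodicity of \<psi> and of the exponential.\<close>
  define T where "T = (\<lambda>u. (pdx \<psi> (Complex u \<sigma>) + \<i> * of_real k * \<psi> (Complex u \<sigma>)) * cnj (e u))"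
  have "((\<lambda>u. (pdx (pdx \<psi>) (Complex u \<sigma>) + (of_real k)\<^sup>2 * \<psi> (Complex u \<sigma>)) * cnj (e u)) has_integral T l - T 0) {0..l}"
  proof (rule fundamental_theorem_of_calculus)
    fix u assume "u \<in> {0..l}"
    have "(T has_vector_derivative (pdx \<psi> (Complex u \<sigma>) + \<i> * of_real k * \<psi> (Complex u \<sigma>)) * (- (\<i> * of_real k) * cnj (e u))
        + (pdx (pdx \<psi>) (Complex u \<sigma>) + \<i> * of_real k * pdx \<psi> (Complex u \<sigma>)) * cnj (e u)) (at u)"
      unfolding T_def
      by (intro has_vector_derivative_mult dce has_vector_derivative_add has_vector_derivative_mult_right
          vertical_derivative(2)[OF Cx inst] vertical_derivative(2)[OF C1 inst])
    also have "(pdx \<psi> (Complex u \<sigma>) + \<i> * of_real k * \<psi> (Complex u \<sigma>)) * (- (\<i> * of_real k) * cnj (e u))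
        + (pdx (pdx \<psi>) (Complex u \<sigma>) + \<i> * of_real k * pdx \<psi> (Complex u \<sigma>)) * cnj (e u)
        = (pdx (pdx \<psi>) (Complex u \<sigma>) + (of_real k)\<^sup>2 * \<psi> (Complex u \<sigma>)) * cnj (e u)"
      by (simp add: algebra_simps power2_eq_square)
    finally show "(T has_vector_derivative (pdx (pdx \<psi>) (Complex u \<sigma>) + (of_real k)\<^sup>2 * \<psi> (Complex u \<sigma>)) * cnj (e u)) (at u within {0..l})"
      by (rule has_vector_derivative_at_within)
  qed (use l in simp)
  moreover have "T l = T 0"
  proof -
    have sh: "Complex 0 \<sigma> + of_real l = Complex l \<sigma>" by (simp add: complex_eq_iff)
    have "pdx \<psi> (Complex l \<sigma>) = pdx \<psi> (Complex 0 \<sigma>)"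
    proof -
      have "((\<lambda>w. \<psi> (w + of_real l)) has_derivative (\<lambda>v. Re v *\<^sub>R pdx \<psi> (Complex 0 \<sigma> + of_real l) + Im v *\<^sub>R pdy \<psi> (Complex 0 \<sigma> + of_real l))) (at (Complex 0 \<sigma>))"
        by (rule has_derivative_compose[of "\<lambda>w. w + of_real l" "\<lambda>v. v"])
           (auto intro!: derivative_eq_intros has_derivative_pdx_pdy[OF open_strip C1] simp: sh inst)
      then have "(\<psi> has_derivative (\<lambda>v. Re v *\<^sub>R pdx \<psi> (Complex 0 \<sigma> + of_real l) + Im v *\<^sub>R pdy \<psi> (Complex 0 \<sigma> + of_real l))) (at (Complex 0 \<sigma>))"
        by (rule has_derivative_transform_within_open[OF _ open_strip inst]) (rule per)
      from pdx_eqI[OF this] show ?thesis by (simp add: sh)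
    qed
    moreover have "\<psi> (Complex l \<sigma>) = \<psi> (Complex 0 \<sigma>)" using per[OF inst[of 0]] by (simp add: sh)
    moreover have "e l = 1"
    proof -
      have "2 * of_real pi * \<i> * of_int n * of_real l / of_real l = of_int (2 * n) * (of_real pi * \<i>)" using l by simp
      then show ?thesis unfolding e_def using exp_integer_2pi[of "of_int n"] by (simp add: mult_ac)
    qed
    ultimately show ?thesis by (simp add: T_def e_def)
  qed
  ultimately have zero: "integral {0..l} (\<lambda>u. (pdx (pdx \<psi>) (Complex u \<sigma>) + (of_real k)\<^sup>2 * \<psi> (Complex u \<sigma>)) * cnj (e u)) = 0"
    by (simp add: integral_unique)
  have i0: "(\<lambda>u. \<psi> (Complex u \<sigma>) * cnj (e u)) integrable_on {0..l}"
    and i2: "(\<lambda>u. (pdx (pdx \<psi>) (Complex u \<sigma>) + (of_real k)\<^sup>2 * \<psi> (Complex u \<sigma>)) * cnj (e u)) integrable_on {0..l}"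
    by (intro integrable_continuous_interval contu[OF _ \<sigma>] k0 continuous_intros)+
  define a where "a = complex_of_real (k\<^sup>2 - \<mu> / (cos \<sigma>)\<^sup>2)"
  have "pdy (pdy \<psi>) (Complex u \<sigma>) * cnj (e u) = a * (\<psi> (Complex u \<sigma>) * cnj (e u))
      - (pdx (pdx \<psi>) (Complex u \<sigma>) + (of_real k)\<^sup>2 * \<psi> (Complex u \<sigma>)) * cnj (e u)" for u
  proof -
    have "pdy (pdy \<psi>) (Complex u \<sigma>) = - of_real (\<mu> * (strip_metric (Complex u \<sigma>))\<^sup>2) * \<psi> (Complex u \<sigma>) - pdx (pdx \<psi>) (Complex u \<sigma>)"
      using ev[OF inst[of u]] by (simp add: flat_laplacian_def algebra_simps)
    note S = this
    show ?thesis unfolding S by (simp add: strip_metric_def a_def power_divide algebra_simps)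
  qed
  then have "integral {0..l} (\<lambda>u. pdy (pdy \<psi>) (Complex u \<sigma>) * cnj (e u)) = a * h \<sigma>"
    using zero integral_diff[OF integrable_on_mult_right[OF i0, of a] i2] by (simp add: h_def)
  then show "(h1 has_vector_derivative of_real ((2 * pi * of_int n / l)\<^sup>2 - \<mu> / (cos \<sigma>)\<^sup>2) * h \<sigma>) (at \<sigma>)"
    using diff[OF Cy k0(2,4)] unfolding h1_def a_def k_def by simp
qed

lemma gd_in_interval: "gd s \<in> {- (pi/2)<..<pi/2}"
  using gd_bounds by simp

text \<open>Liouville normal form. The substitution \<open>\<sigma> = gd s\<close> creates a
  first-order term, which the factor \<open>sqrt (cosh s)\<close> removes; this shifts
  \<open>k^2\<close> by 1/4 and makes \<open>\<mu> - 1/4\<close> the squared frequency at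
  infinity.\<close>

lemma liouville_transform:
  fixes h h1 :: "real \<Rightarrow> complex"
  assumes h: "\<And>\<sigma>. \<sigma> \<in> {- (pi/2)<..<pi/2} \<Longrightarrow> (h has_vector_derivative h1 \<sigma>) (at \<sigma>)"
    and h1: "\<And>\<sigma>. \<sigma> \<in> {- (pi/2)<..<pi/2} \<Longrightarrow>
        (h1 has_vector_derivative of_real (k\<^sup>2 - \<mu> / (cos \<sigma>)\<^sup>2) * h \<sigma>) (at \<sigma>)"
  defines "H \<equiv> \<lambda>s. of_real (sqrt (cosh s)) * h (gd s)"
    and "H1 \<equiv> \<lambda>s. of_real (sinh s / (2 * sqrt (cosh s))) * h (gd s) + of_real (1 / sqrt (cosh s)) * h1 (gd s)"
  shows "(H has_vector_derivative H1 s) (at s)"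
    "(H1 has_vector_derivative of_real ((k\<^sup>2 + 1/4) / (cosh s)\<^sup>2 - (\<mu> - 1/4)) * H s) (at s)"
proof -
  define c where "c = sqrt (cosh s)"
  have c: "c > 0" "c\<^sup>2 = cosh s" by (simp_all add: c_def)
  have cc: "cosh s = c * c" using c by (simp add: power2_eq_square)
  have dc: "((\<lambda>s. sqrt (cosh s)) has_real_derivative sinh s / (2 * c)) (at s)"
    unfolding c_def by (auto intro!: derivative_eq_intros simp: field_simps) (use cosh_real_nonneg[of s] in linarith)
  have dh: "((\<lambda>s. h (gd s)) has_vector_derivative of_real (1 / cosh s) * h1 (gd s)) (at s)"
    using vector_diff_chain_at[OF gd_deriv[unfolded has_real_derivative_iff_has_vector_derivative] h[OF gd_in_interval]]
    by (simp add: o_def scaleR_conv_of_real)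
  have dh1: "((\<lambda>s. h1 (gd s)) has_vector_derivative of_real (1 / cosh s) * (of_real (k\<^sup>2 - \<mu> * (cosh s)\<^sup>2) * h (gd s))) (at s)"
    using vector_diff_chain_at[OF gd_deriv[unfolded has_real_derivative_iff_has_vector_derivative] h1[OF gd_in_interval]]
    by (simp add: o_def scaleR_conv_of_real cos_gd power_divide)
  have ofr: "((\<lambda>s. complex_of_real (f s)) has_vector_derivative of_real f') (at s)" if "(f has_real_derivative f') (at s)" for f f'
    using that by (rule has_vector_derivative_of_real)
  show "(H has_vector_derivative H1 s) (at s)"
  proof -
    have "(H has_vector_derivative of_real c * (of_real (1 / cosh s) * h1 (gd s)) + of_real (sinh s / (2 * c)) * h (gd s)) (at s)"
      unfolding H_def using has_vector_derivative_mult[OF ofr[OF dc] dh] by (simp add: c_def)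
    moreover have "of_real c * (of_real (1 / cosh s) * h1 (gd s)) + of_real (sinh s / (2 * c)) * h (gd s) = H1 s"
      unfolding H1_def c_def[symmetric] cc using c by (simp add: field_simps)
    ultimately show ?thesis by simp
  qed
  have d1: "((\<lambda>s. sinh s / (2 * sqrt (cosh s))) has_real_derivative (c / 2 - (sinh s)\<^sup>2 / (4 * c ^ 3))) (at s)"
  proof -
    have "((\<lambda>s. sinh s / (2 * sqrt (cosh s))) has_real_derivative
        (cosh s * (2 * c) - sinh s * (2 * (sinh s / (2 * c)))) / ((2 * c) * (2 * c))) (at s)"
    proof -
      have ds: "(sinh has_real_derivative cosh s) (at s)" by (auto intro!: derivative_eq_intros)
      show ?thesis using DERIV_divide[OF ds DERIV_cmult[OF dc, of 2]] c(1) by (simp add: c_def)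
    qed
    also have "(cosh s * (2 * c) - sinh s * (2 * (sinh s / (2 * c)))) / ((2 * c) * (2 * c)) = c / 2 - (sinh s)\<^sup>2 / (4 * c ^ 3)"
      unfolding cc using c(1) by (simp add: field_simps power2_eq_square power3_eq_cube)
    finally show ?thesis .
  qed
  have d2: "((\<lambda>s. 1 / sqrt (cosh s)) has_real_derivative - (sinh s / (2 * c ^ 3))) (at s)"
  proof -
    have "((\<lambda>s. 1 / sqrt (cosh s)) has_real_derivative (0 * c - 1 * (sinh s / (2 * c))) / (c * c)) (at s)"
      using DERIV_divide[OF DERIV_const dc, of 1] c(1) by (simp add: c_def)
    also have "(0 * c - 1 * (sinh s / (2 * c))) / (c * c) = - (sinh s / (2 * c ^ 3))"
      using c(1) by (simp add: field_simps power3_eq_cube)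
    finally show ?thesis .
  qed
  define X Y where "X = h (gd s)" and "Y = h1 (gd s)"
  have "(H1 has_vector_derivative
      (of_real (sinh s / (2 * c)) * (of_real (1 / cosh s) * Y) + of_real (c / 2 - (sinh s)\<^sup>2 / (4 * c ^ 3)) * X)
      + (of_real (1 / c) * (of_real (1 / cosh s) * (of_real (k\<^sup>2 - \<mu> * (cosh s)\<^sup>2) * X)) + of_real (- (sinh s / (2 * c ^ 3))) * Y)) (at s)"
    unfolding H1_def X_def Y_def
    using has_vector_derivative_add[OF has_vector_derivative_mult[OF ofr[OF d1] dh] has_vector_derivative_mult[OF ofr[OF d2] dh1]]
    by (simp add: c_def)
  moreover have "(of_real (sinh s / (2 * c)) * (of_real (1 / cosh s) * Y) + of_real (c / 2 - (sinh s)\<^sup>2 / (4 * c ^ 3)) * X)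
      + (of_real (1 / c) * (of_real (1 / cosh s) * (of_real (k\<^sup>2 - \<mu> * (cosh s)\<^sup>2) * X)) + of_real (- (sinh s / (2 * c ^ 3))) * Y)
      = of_real (sinh s / (2 * c) * (1 / cosh s) - sinh s / (2 * c ^ 3)) * Y
        + of_real (c / 2 - (sinh s)\<^sup>2 / (4 * c ^ 3) + 1 / c * (1 / cosh s) * (k\<^sup>2 - \<mu> * (cosh s)\<^sup>2)) * X"
    by (simp add: algebra_simps)
  moreover have "sinh s / (2 * c) * (1 / cosh s) - sinh s / (2 * c ^ 3) = 0"
    unfolding cc using c(1) by (simp add: power3_eq_cube)
  moreover have "c / 2 - (sinh s)\<^sup>2 / (4 * c ^ 3) + 1 / c * (1 / cosh s) * (k\<^sup>2 - \<mu> * (cosh s)\<^sup>2)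
      = ((k\<^sup>2 + 1/4) / (cosh s)\<^sup>2 - (\<mu> - 1/4)) * c"
  proof -
    have sq: "(sinh s)\<^sup>2 = (c * c)\<^sup>2 - 1" using cosh_square_eq[of s] cc by simp
    show ?thesis unfolding sq unfolding cc using c(1)
      by (simp add: field_simps power2_eq_square power3_eq_cube)
  qed
  ultimately have "(H1 has_vector_derivative of_real (((k\<^sup>2 + 1/4) / (cosh s)\<^sup>2 - (\<mu> - 1/4)) * c) * X) (at s)"
    by (simp only: of_real_0 mult_zero_left add_0_left)
  then show "(H1 has_vector_derivative of_real ((k\<^sup>2 + 1/4) / (cosh s)\<^sup>2 - (\<mu> - 1/4)) * H s) (at s)"
    unfolding H_def X_def c_def[symmetric] by (simp only: of_real_mult mult.assoc)
qed

lemma integral_gd_substitution: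
  assumes "a \<le> b" and q: "continuous_on {- (pi/2)<..<pi/2} (q :: real \<Rightarrow> real)"
  shows "integral {gd a..gd b} q = integral {a..b} (\<lambda>s. q (gd s) / cosh s)"
proof -
  have sub: "{gd a..gd b} \<subseteq> {- (pi/2)<..<pi/2}" using gd_bounds[of a] gd_bounds[of b] by auto
  have "((\<lambda>s. (1 / cosh s) *\<^sub>R q (gd s)) has_integral (integral {gd a..gd b} q)) {a..b}"
  proof (rule has_integral_substitution[OF assms(1) gd_mono[OF assms(1)]])
    show "gd ` {a..b} \<subseteq> {gd a..gd b}" using gd_mono by auto
    show "continuous_on {gd a..gd b} q" using q sub continuous_on_subset by blast
    show "(gd has_field_derivative 1 / cosh x) (at x within {a..b})" for x
      using gd_deriv by (rule has_field_derivative_at_within)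
  qed
  then show ?thesis by (simp add: integral_unique)
qed

context hyperbolic_surface
begin

text \<open>The constant is chosen before the eigenfunction, since it stems from the covering of the
  windows alone. The mode equation, the initial values and the window bound are all that the
  remaining analysis uses of the surface.\<close>

theorem geometric_bound:
  assumes cg: "closed_geodesic A \<rho> l t" and vol: "volume_measure A \<rho> v"
  obtains C where "C > 0"
    "\<And>\<mu> \<phi>. laplace_eigenfunction A \<rho> \<mu> \<phi> \<Longrightarrow> norm_L2 v \<phi> = 1 \<Longrightarrow>
      \<exists>f f'. \<forall>n::int. f n 0 = period l t \<phi> n \<and> f' n 0 = 0 \<and>
        (\<forall>s. (f n has_vector_derivative f' n s) (at s) \<and>
             (f' n has_vector_derivative
                of_real (((2 * pi * of_int n / l)\<^sup>2 + 1/4) / (cosh s)\<^sup>2 - (\<mu> - 1/4)) * f n s) (at s)) \<and>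
        (\<forall>S\<ge>0. \<forall>N. finite N \<longrightarrow>
            integral {S..S+1} (\<lambda>s. \<Sum>n\<in>N. (cmod (f n s))\<^sup>2) \<le> C * exp S)"
proof -
  have l: "l > 0" using cg by (simp add: closed_geodesic_def)
  obtain \<Phi> \<epsilon> where eps: "\<epsilon> > 0" and L: "LI strip_metric strip \<Phi>" and axis: "\<And>\<theta>. \<Phi> (of_real (l * \<theta>)) = t \<theta>"
    and per: "\<And>w. w \<in> strip \<Longrightarrow> \<Phi> (w + of_real l) = \<Phi> w"
    and inj: "\<And>x. x \<in> strip \<Longrightarrow> inj_on \<Phi> {w \<in> strip. cmod (moeb (- strip_map x) (strip_map w)) < \<epsilon>}"
    by (rule strip_developing[OF cg]) (rule that; assumption)
  obtain C where C: "C > 0" "\<And>S \<sigma> g. S \<ge> 0 \<Longrightarrow> \<sigma> = 1 \<or> \<sigma> = -1 \<Longrightarrow> g \<in> borel_measurable borel \<Longrightarrow>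
     (\<integral>\<^sup>+w. ennreal ((strip_metric w)\<^sup>2) * g (\<Phi> w) * indicator (window_box \<sigma> 0 l S (S + 1)) w \<partial>lborel)
        \<le> ennreal (C * exp S) * (\<integral>\<^sup>+p. g p \<partial>v)"
    by (rule window_bound[OF vol L eps l inj]) (assumption, blast)
  show ?thesis
  proof (rule that[of "l * C"])
    show "l * C > 0" using l C by simp
    fix \<mu> :: real and \<phi> :: "'a \<Rightarrow> complex"
    assume ef: "laplace_eigenfunction A \<rho> \<mu> \<phi>" and nm: "norm_L2 v \<phi> = 1"
    define \<psi> where "\<psi> = (\<lambda>w. \<phi> (\<Phi> w))"
    have C2: "Ck_on 2 strip \<psi>" and evl: "\<And>w. w \<in> strip \<Longrightarrow> flat_laplacian \<psi> w = - of_real (\<mu> * (strip_metric w)\<^sup>2) * \<psi> w"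
      using pullback_eigenfunction[OF L ef] by (auto simp: \<psi>_def)
    have perp: "\<psi> (w + of_real l) = \<psi> w" if "w \<in> strip" for w using per[OF that] by (simp add: \<psi>_def)
    have cpsi: "continuous_on strip \<psi>"
      using Ck_on_antimono[OF C2, of 0] by simp
    have phic: "continuous_on UNIV \<phi>" by (rule eigenfunction_continuous[OF ef])
    have sv: "sets v = sets borel" using vol by (simp add: volume_measure_def)
    define g where "g = (\<lambda>p. ennreal ((cmod (\<phi> p))\<^sup>2))"
    have gm: "g \<in> borel_measurable borel"
      unfolding g_def using borel_measurable_continuous_onI[OF phic] by measurable
    have g1: "(\<integral>\<^sup>+p. g p \<partial>v) = 1"
    proof -
      have i1: "(LINT p|v. (cmod (\<phi> p))\<^sup>2) = 1" using nm by (simp add: norm_L2_def)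
      \<comment> \<open>Norm 1 excludes non-integrability, because the integral would then have its
        default value 0.\<close>
      then have "integrable v (\<lambda>p. (cmod (\<phi> p))\<^sup>2)" using not_integrable_integral_eq by fastforce
      then have "(\<integral>\<^sup>+p. g p \<partial>v) = ennreal (LINT p|v. (cmod (\<phi> p))\<^sup>2)"
        unfolding g_def by (rule nn_integral_eq_integral) simp
      then show ?thesis using i1 by simp
    qed
    define e where "e = (\<lambda>(n::int) u. exp (2 * of_real pi * \<i> * of_int n * of_real u / of_real l :: complex))"
    define h where "h = (\<lambda>n \<sigma>. integral {0..l} (\<lambda>u. \<psi> (Complex u \<sigma>) * cnj (e n u)))"
    define h1 where "h1 = (\<lambda>n \<sigma>. integral {0..l} (\<lambda>u. pdy \<psi> (Complex u \<sigma>) * cnj (e n u)))"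
    have hd: "(h n has_vector_derivative h1 n \<sigma>) (at \<sigma>)"
      "(h1 n has_vector_derivative of_real ((2 * pi * of_int n / l)\<^sup>2 - \<mu> / (cos \<sigma>)\<^sup>2) * h n \<sigma>) (at \<sigma>)"
      if "\<sigma> \<in> {- (pi/2)<..<pi/2}" for n \<sigma>
      unfolding h_def h1_def e_def by (rule fourier_mode_ode[OF C2 l evl perp that], assumption+)+
    define H where "H = (\<lambda>n s. of_real (sqrt (cosh s)) * h n (gd s))"
    define H1 where "H1 = (\<lambda>n s. of_real (sinh s / (2 * sqrt (cosh s))) * h n (gd s) + of_real (1 / sqrt (cosh s)) * h1 n (gd s))"
    define pot where "pot = (\<lambda>(n::int) s. ((2 * pi * of_int n / l)\<^sup>2 + 1/4) / (cosh s)\<^sup>2 - (\<mu> - 1/4))"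
    have Hd: "(H n has_vector_derivative H1 n s) (at s)" "(H1 n has_vector_derivative of_real (pot n s) * H n s) (at s)" for n s
      unfolding H_def H1_def pot_def by (rule liouville_transform[OF hd], assumption+)+
    \<comment> \<open>The even part in \<open>s\<close> keeps the value at 0, which is the period,
      and has derivative 0 there; so the unknown normal derivative on the geodesic drops out of the
      Wronskian.\<close>
    define f where "f = (\<lambda>n s. (H n s + H n (- s)) / 2)"
    define f' where "f' = (\<lambda>n s. (H1 n s - H1 n (- s)) / 2)"
    have refl: "((\<lambda>s. F (- s)) has_vector_derivative - F') (at s)" if "(F has_vector_derivative F') (at (- s))" for F :: "real \<Rightarrow> complex" and F' s
    proof -
      have "((\<lambda>s::real. - s) has_vector_derivative - 1) (at s)" by (auto intro!: derivative_eq_intros)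
      from vector_diff_chain_at[OF this that] show ?thesis by (simp add: o_def)
    qed
    have fd: "(f n has_vector_derivative f' n s) (at s)" "(f' n has_vector_derivative of_real (pot n s) * f n s) (at s)" for n s
    proof -
      have "((\<lambda>s. H n s + H n (- s)) has_vector_derivative H1 n s + - H1 n (- s)) (at s)"
        by (intro has_vector_derivative_add Hd refl)
      from has_vector_derivative_divide[OF this, of 2] show "(f n has_vector_derivative f' n s) (at s)"
        by (simp add: f_def f'_def)
      have "((\<lambda>s. H1 n s - H1 n (- s)) has_vector_derivative of_real (pot n s) * H n s - - (of_real (pot n (- s)) * H n (- s))) (at s)"
        by (intro has_vector_derivative_diff Hd refl)
      from has_vector_derivative_divide[OF this, of 2] show "(f' n has_vector_derivative of_real (pot n s) * f n s) (at s)"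
        by (simp add: f_def f'_def pot_def distrib_left)
    qed
    have f0: "f n 0 = period l t \<phi> n" for n
    proof -
      have "continuous_on {0..l} (\<lambda>u. \<psi> (Complex u 0))"
        by (rule continuous_on_compose2[OF cpsi]) (auto simp: Complex_eq strip_def intro!: continuous_intros)
      then have "continuous_on {0..l} (\<lambda>u. \<psi> (Complex u 0) * cnj (e n u))"
        unfolding e_def by (intro continuous_intros) (use l in auto)
      then have "((\<lambda>u. \<psi> (Complex u 0) * cnj (e n u)) has_integral h n 0) {0..l}"
        unfolding h_def by (intro integrable_integral integrable_continuous_interval)
      then have "((\<lambda>x. \<psi> (Complex (l * x) 0) * cnj (e n (l * x))) has_integral (1 / \<bar>l\<bar>) *\<^sub>R h n 0) ((\<lambda>x. x / l) ` {0..l})"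
        using has_integral_stretch_real[of "\<lambda>u. \<psi> (Complex u 0) * cnj (e n u)" "h n 0" 0 l l] l by simp
      moreover have "(\<lambda>x. x / l) ` {0..l} = {0..1}"
        using l by (simp add: image_divide_atLeastAtMost)
      moreover have "\<psi> (Complex (l * x) 0) * cnj (e n (l * x)) = \<phi> (t x) * exp (- 2 * complex_of_real pi * \<i> * of_int n * of_real x)" for x
      proof -
        have "Complex (l * x) 0 = of_real (l * x)" by (simp add: complex_eq_iff)
        then have "\<psi> (Complex (l * x) 0) = \<phi> (t x)" using axis[of x] by (simp only: \<psi>_def)
        moreover have "cnj (e n (l * x)) = exp (- 2 * complex_of_real pi * \<i> * of_int n * of_real x)"
          using l by (simp add: e_def exp_cnj mult_ac)
        ultimately show ?thesis by simp
      qed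
      ultimately have "integral {0..1} (\<lambda>x. \<phi> (t x) * exp (- 2 * complex_of_real pi * \<i> * of_int n * of_real x)) = (1 / l) *\<^sub>R h n 0"
        using l by (simp add: integral_unique)
      then have "period l t \<phi> n = h n 0" using l by (simp add: period_def scaleR_conv_of_real)
      then show ?thesis by (simp add: f_def H_def)
    qed
    have hcont: "continuous_on {- (pi/2)<..<pi/2} (h n)" for n
      using hd(1)[of _ n] by (intro continuous_at_imp_continuous_on ballI has_vector_derivative_continuous)
    \<comment> \<open>The area element of the strip turns into \<open>cosh s\<close> under
      \<open>gd\<close>, and \<open>cosh s * |h|^2 = |H|^2\<close>. Hence the transformed modes are
      exactly what the mass of one side of the window controls.\<close>
    have one_side: "integral {a..b} (\<lambda>s. cosh s * (\<Sum>n\<in>N. (cmod (h n (gd s)))\<^sup>2)) \<le> l * (C * exp S)"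
      if S: "S \<ge> 0" and N: "finite N" and ab: "(\<sigma> = 1 \<and> a = S \<and> b = S + 1) \<or> (\<sigma> = -1 \<and> a = - (S + 1) \<and> b = - S)" for S N and \<sigma> a b :: real
    proof -
      have \<sigma>: "\<sigma> = 1 \<or> \<sigma> = -1" and aleb: "a \<le> b" using ab by auto
      define q where "q = (\<lambda>y. (1 / (cos y)\<^sup>2) * ((\<Sum>n\<in>N. (cmod (h n y))\<^sup>2) / l))"
      have cosp: "cos y > 0" if "y \<in> {- (pi/2)<..<pi/2}" for y using that by (intro cos_gt_zero_pi) auto
      have qc: "continuous_on {- (pi/2)<..<pi/2} q"
        unfolding q_def using cosp l by (intro continuous_intros hcont) (auto simp: less_le)
      have q0: "q y \<ge> 0" for y using l by (simp add: q_def sum_nonneg)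
      have sub: "{gd a..gd b} \<subseteq> {- (pi/2)<..<pi/2}" using gd_bounds[of a] gd_bounds[of b] by auto
      let ?W = "window_box \<sigma> 0 l S (S + 1)"
      have Wiff: "Complex x y \<in> ?W \<longleftrightarrow> x \<in> {0..l} \<and> y \<in> {gd a..gd b}" for x y
      proof -
        have gm: "gd (- x) = - gd x" for x by (rule gd_minus)
        show ?thesis using ab gm[of S] gm[of "S + 1"] by (auto simp: window_box_def)
      qed
      define F where "F = (\<lambda>w. ennreal ((strip_metric w)\<^sup>2) * g (\<Phi> w) * indicator ?W w)"
      have Wst: "?W \<subseteq> strip"
      proof
        fix w assume "w \<in> ?W"
        then have "Im w \<in> {gd a..gd b}" using Wiff[of "Re w" "Im w"] by simp
        then have "Im w \<in> {- (pi/2)<..<pi/2}" using sub by blast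
        then show "w \<in> strip" by (auto simp: strip_def)
      qed
      have Fm: "F \<in> borel_measurable borel"
      proof -
        have sc: "continuous_on strip (\<lambda>w. (strip_metric w)\<^sup>2 * (cmod (\<psi> w))\<^sup>2)"
          unfolding strip_metric_def using cos_Im_strip by (intro continuous_intros cpsi) fastforce
        have "(\<lambda>w. if w \<in> strip then (strip_metric w)\<^sup>2 * (cmod (\<psi> w))\<^sup>2 else 0) \<in> borel_measurable borel"
          by (rule borel_measurable_continuous_on_if[OF _ sc]) (use open_strip in auto)
        then have "(\<lambda>w. ennreal (if w \<in> strip then (strip_metric w)\<^sup>2 * (cmod (\<psi> w))\<^sup>2 else 0) * indicator ?W w) \<in> borel_measurable borel"
          by measurable
        also have "(\<lambda>w. ennreal (if w \<in> strip then (strip_metric w)\<^sup>2 * (cmod (\<psi> w))\<^sup>2 else 0) * indicator ?W w) = F"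
          using Wst by (auto simp: F_def g_def \<psi>_def fun_eq_iff indicator_def ennreal_mult)
        finally show ?thesis .
      qed
      have inner: "ennreal (q y) * indicator {gd a..gd b} y \<le> (\<integral>\<^sup>+x. F (Complex x y) \<partial>lborel)" for y
      proof (cases "y \<in> {gd a..gd b}")
        case True
        then have yU: "y \<in> {- (pi/2)<..<pi/2}" using sub by blast
        have c1: "continuous_on {0..l} (\<lambda>x. \<psi> (Complex x y))"
          by (rule continuous_on_compose2[OF cpsi]) (use yU in \<open>auto simp: Complex_eq strip_def abs_less_iff intro!: continuous_intros\<close>)
        have c2: "continuous_on {0..l} (\<lambda>x. (1 / (cos y)\<^sup>2) * (cmod (\<psi> (Complex x y)))\<^sup>2)"
          by (intro continuous_intros c1)
        have "(\<integral>\<^sup>+x. F (Complex x y) \<partial>lborel) = (\<integral>\<^sup>+x. ennreal ((1 / (cos y)\<^sup>2) * (cmod (\<psi> (Complex x y)))\<^sup>2) * indicator {0..l} x \<partial>lborel)"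
        proof (rule nn_integral_cong)
          fix x
          have "indicator ?W (Complex x y) = (indicator {0..l} x :: ennreal)"
            using True Wiff[of x y] by (simp add: indicator_def)
          moreover have "(strip_metric (Complex x y))\<^sup>2 = 1 / (cos y)\<^sup>2" by (simp add: strip_metric_def power_divide)
          ultimately show "F (Complex x y) = ennreal ((1 / (cos y)\<^sup>2) * (cmod (\<psi> (Complex x y)))\<^sup>2) * indicator {0..l} x"
            by (simp only: F_def g_def \<psi>_def) (simp add: ennreal_mult[symmetric])
        qed
        also have "\<dots> = ennreal (integral {0..l} (\<lambda>x. (1 / (cos y)\<^sup>2) * (cmod (\<psi> (Complex x y)))\<^sup>2))"
          by (rule nn_integral_eq_integral_Icc[OF c2]) simp
        also have "integral {0..l} (\<lambda>x. (1 / (cos y)\<^sup>2) * (cmod (\<psi> (Complex x y)))\<^sup>2) = (1 / (cos y)\<^sup>2) * integral {0..l} (\<lambda>x. (cmod (\<psi> (Complex x y)))\<^sup>2)"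
          by (rule integral_mult_right)
        also have "ennreal (q y) \<le> ennreal \<dots>"
        proof (rule ennreal_leI)
          have "(\<Sum>n\<in>N. (cmod (h n y))\<^sup>2) \<le> l * integral {0..l} (\<lambda>u. (cmod (\<psi> (Complex u y)))\<^sup>2)"
            unfolding h_def e_def by (rule bessel_inequality[OF l c1 N])
          then have "(\<Sum>n\<in>N. (cmod (h n y))\<^sup>2) / l \<le> integral {0..l} (\<lambda>u. (cmod (\<psi> (Complex u y)))\<^sup>2)"
            using l by (simp add: pos_divide_le_eq mult.commute)
          then show "q y \<le> (1 / (cos y)\<^sup>2) * integral {0..l} (\<lambda>x. (cmod (\<psi> (Complex x y)))\<^sup>2)"
            unfolding q_def by (intro mult_left_mono) auto
        qed
        finally show ?thesis using True by simp
      qed simp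
      have "ennreal (integral {gd a..gd b} q) = (\<integral>\<^sup>+y. ennreal (q y) * indicator {gd a..gd b} y \<partial>lborel)"
        by (rule nn_integral_eq_integral_Icc[symmetric]) (use continuous_on_subset[OF qc sub] q0 in auto)
      also have "\<dots> \<le> (\<integral>\<^sup>+y. \<integral>\<^sup>+x. F (Complex x y) \<partial>lborel \<partial>lborel)"
        by (rule nn_integral_mono) (rule inner)
      also have "\<dots> = (\<integral>\<^sup>+w. F w \<partial>lborel)" by (rule nn_integral_complex[OF Fm, symmetric])
      also have "\<dots> \<le> ennreal (C * exp S)" using C(2)[OF S \<sigma> gm] g1 by (simp add: F_def)
      finally have "integral {gd a..gd b} q \<le> C * exp S" using C(1) by (simp add: ennreal_le_iff)
      moreover have "integral {gd a..gd b} q = integral {a..b} (\<lambda>s. (1/l) * (cosh s * (\<Sum>n\<in>N. (cmod (h n (gd s)))\<^sup>2)))"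
      proof -
        have "q (gd s) / cosh s = (1/l) * (cosh s * (\<Sum>n\<in>N. (cmod (h n (gd s)))\<^sup>2))" for s
          by (simp add: q_def cos_gd power_divide power2_eq_square)
        then show ?thesis using integral_gd_substitution[OF aleb qc] by simp
      qed
      ultimately have "(1/l) * integral {a..b} (\<lambda>s. cosh s * (\<Sum>n\<in>N. (cmod (h n (gd s)))\<^sup>2)) \<le> C * exp S"
        by simp
      then show ?thesis using l by (simp add: pos_divide_le_eq mult.commute)
    qed
    have win: "integral {S..S+1} (\<lambda>s. \<Sum>n\<in>N. (cmod (f n s))\<^sup>2) \<le> l * C * exp S" if S: "S \<ge> 0" and N: "finite N" for S N
    proof -
      define G where "G = (\<lambda>s. cosh s * (\<Sum>n\<in>N. (cmod (h n (gd s)))\<^sup>2))"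
      have Hc: "continuous_on UNIV (H n)" for n
        by (rule continuous_at_imp_continuous_on, rule ballI, rule has_vector_derivative_continuous, rule Hd(1))
      have GH: "G = (\<lambda>s. \<Sum>n\<in>N. (cmod (H n s))\<^sup>2)"
        by (simp add: G_def H_def norm_mult power_mult_distrib sum_distrib_left fun_eq_iff)
      have Gc: "continuous_on T G" for T unfolding GH
        by (intro continuous_intros continuous_on_subset[OF Hc]) auto
      have Gmc: "continuous_on T (\<lambda>s. G (- s))" for T
        by (rule continuous_on_compose2[OF Gc[of UNIV]]) (auto intro!: continuous_intros)
      have "integral {S..S+1} (\<lambda>s. \<Sum>n\<in>N. (cmod (f n s))\<^sup>2) \<le> integral {S..S+1} (\<lambda>s. (1/2) * (G s + G (- s)))"
      proof (rule integral_le)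
        have fc: "continuous_on UNIV (f n)" for n
          by (rule continuous_at_imp_continuous_on, rule ballI, rule has_vector_derivative_continuous, rule fd(1))
        show "(\<lambda>s. \<Sum>n\<in>N. (cmod (f n s))\<^sup>2) integrable_on {S..S+1}"
          by (intro integrable_continuous_interval continuous_intros continuous_on_subset[OF fc]) auto
        show "(\<lambda>s. (1/2) * (G s + G (- s))) integrable_on {S..S+1}"
          by (intro integrable_continuous_interval continuous_intros Gc Gmc)
        fix s
        have "(cmod (f n s))\<^sup>2 \<le> (1/2) * ((cmod (H n s))\<^sup>2 + (cmod (H n (- s)))\<^sup>2)" for n
        proof -
          have "cmod (f n s) \<le> (cmod (H n s) + cmod (H n (- s))) / 2"
            unfolding f_def by (simp add: norm_divide norm_triangle_ineq)
          then have "(cmod (f n s))\<^sup>2 \<le> ((cmod (H n s) + cmod (H n (- s))) / 2)\<^sup>2" by (intro power_mono) auto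
          also have "\<dots> \<le> (1/2) * ((cmod (H n s))\<^sup>2 + (cmod (H n (- s)))\<^sup>2)"
            using sum_squares_bound[of "cmod (H n s)" "cmod (H n (- s))"]
            by (simp add: power_divide power2_eq_square algebra_simps)
          finally show ?thesis .
        qed
        then have "(\<Sum>n\<in>N. (cmod (f n s))\<^sup>2) \<le> (\<Sum>n\<in>N. (1/2) * ((cmod (H n s))\<^sup>2 + (cmod (H n (- s)))\<^sup>2))"
          by (intro sum_mono)
        then show "(\<Sum>n\<in>N. (cmod (f n s))\<^sup>2) \<le> (1/2) * (G s + G (- s))"
          unfolding GH by (simp only: sum_distrib_left[symmetric] sum.distrib)
      qed
      also have "\<dots> = (1/2) * (integral {S..S+1} G + integral {S..S+1} (\<lambda>s. G (- s)))"
      proof -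
        have "G integrable_on {S..S+1}" "(\<lambda>s. G (- s)) integrable_on {S..S+1}"
          by (intro integrable_continuous_interval Gc Gmc)+
        then show ?thesis by (simp only: integral_mult_right integral_add)
      qed
      also have "integral {S..S+1} (\<lambda>s. G (- s)) = integral {- (S+1)..- S} G"
        using Henstock_Kurzweil_Integration.integral_reflect_real[of "- S" "- (S+1)" G] by (simp only: minus_minus)
      also have "(1/2) * (integral {S..S+1} G + integral {- (S+1)..- S} G) \<le> (1/2) * (l * (C * exp S) + l * (C * exp S))"
        unfolding G_def using one_side[OF S N, of 1 S "S + 1"] one_side[OF S N, of "-1" "- (S + 1)" "- S"]
        by (intro mult_left_mono add_mono) simp_all
      finally show ?thesis by (simp add: mult_ac)
    qed
    show "\<exists>f f'. \<forall>n::int. f n 0 = period l t \<phi> n \<and> f' n 0 = 0 \<and>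
        (\<forall>s. (f n has_vector_derivative f' n s) (at s) \<and>
             (f' n has_vector_derivative
                of_real (((2 * pi * of_int n / l)\<^sup>2 + 1/4) / (cosh s)\<^sup>2 - (\<mu> - 1/4)) * f n s) (at s)) \<and>
        (\<forall>S\<ge>0. \<forall>N. finite N \<longrightarrow>
            integral {S..S+1} (\<lambda>s. \<Sum>n\<in>N. (cmod (f n s))\<^sup>2) \<le> l * C * exp S)"
      using f0 fd win unfolding pot_def by (intro exI[of _ f] exI[of _ f']) (auto simp: f'_def)
  qed
qed

end

section \<open>Gamma integrals and the model period\<close>

text \<open>The integrand of the Gamma function in the variable \<open>t = exp p\<close>; scaling of
  \<open>t\<close> becomes a shift of \<open>p\<close>.\<close>

definition gamma_kernel :: "complex \<Rightarrow> real \<Rightarrow> complex" where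
  "gamma_kernel z p = exp (z * of_real p - of_real (exp p))"

text \<open>The substitution theorem is applied to the real and imaginary parts, which are then
  recombined.\<close>

lemma absolutely_integrable_exp_substitution:
  fixes f :: "real \<Rightarrow> complex"
  assumes f: "f absolutely_integrable_on {0<..}"
  shows "(\<lambda>p. of_real (exp p) * f (exp p)) absolutely_integrable_on UNIV"
    and "integral UNIV (\<lambda>p. of_real (exp p) * f (exp p)) = integral {0<..} f"
proof -
  have im: "range exp = {0::real<..}" by (auto simp: image_iff) (metis exp_ln)
  have re: "(\<lambda>x. Re (f x)) absolutely_integrable_on {0<..}" and ji: "(\<lambda>x. Im (f x)) absolutely_integrable_on {0<..}"
    using f absolutely_integrable_linear[OF f bounded_linear_Re] absolutely_integrable_linear[OF f bounded_linear_Im]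
    by (auto simp: o_def)
  have cv: "(\<lambda>x. \<bar>exp x\<bar> * g (exp x)) absolutely_integrable_on UNIV \<and>
      integral UNIV (\<lambda>x. \<bar>exp x\<bar> * g (exp x)) = integral {0<..} g" if "g absolutely_integrable_on {0<..}" for g :: "real \<Rightarrow> real"
    using has_absolute_integral_change_of_variables_1'[of UNIV exp exp g "integral {0<..} g"] that im
    by (simp add: inj_on_def DERIV_exp)
  have a: "(\<lambda>x. exp x * Re (f (exp x))) absolutely_integrable_on UNIV"
    "integral UNIV (\<lambda>x. exp x * Re (f (exp x))) = integral {0<..} (\<lambda>x. Re (f x))"
    using cv[OF re] by simp_all
  have b: "(\<lambda>x. exp x * Im (f (exp x))) absolutely_integrable_on UNIV"
    "integral UNIV (\<lambda>x. exp x * Im (f (exp x))) = integral {0<..} (\<lambda>x. Im (f x))"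
    using cv[OF ji] by simp_all
  have eq: "(\<lambda>p. of_real (exp p) * f (exp p)) =
      (\<lambda>x. of_real (exp x * Re (f (exp x))) + \<i> * of_real (exp x * Im (f (exp x))))"
    by (auto simp: fun_eq_iff complex_eq_iff)
  have c1: "(\<lambda>x. complex_of_real (exp x * Re (f (exp x)))) absolutely_integrable_on UNIV"
    using absolutely_integrable_linear[OF a(1) bounded_linear_of_real[where 'a=complex]] by (simp add: o_def)
  have c2: "(\<lambda>x. \<i> * complex_of_real (exp x * Im (f (exp x)))) absolutely_integrable_on UNIV"
    using absolutely_integrable_linear[OF b(1) bounded_linear_compose[OF bounded_linear_mult_right[of \<i>] bounded_linear_of_real[where 'a=complex]]]
    by (simp add: o_def)
  show ai: "(\<lambda>p. of_real (exp p) * f (exp p)) absolutely_integrable_on UNIV"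
    unfolding eq by (rule set_integral_add(1)[OF c1 c2])
  have io: "(\<lambda>p. of_real (exp p) * f (exp p)) integrable_on UNIV" "f integrable_on {0<..}"
    using ai f set_lebesgue_integral_eq_integral(1) by blast+
  have "Re (integral UNIV (\<lambda>p. of_real (exp p) * f (exp p))) = Re (integral {0<..} f)"
    using integral_linear[OF io(1) bounded_linear_Re] integral_linear[OF io(2) bounded_linear_Re] a(2) by (simp add: o_def)
  moreover have "Im (integral UNIV (\<lambda>p. of_real (exp p) * f (exp p))) = Im (integral {0<..} f)"
    using integral_linear[OF io(1) bounded_linear_Im] integral_linear[OF io(2) bounded_linear_Im] b(2) by (simp add: o_def)
  ultimately show "integral UNIV (\<lambda>p. of_real (exp p) * f (exp p)) = integral {0<..} f"
    by (simp add: complex_eq_iff)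
qed

lemma lborel_integral_of_absolutely_integrable:
  fixes f :: "real \<Rightarrow> complex"
  assumes "f absolutely_integrable_on UNIV" "f \<in> borel_measurable borel"
  shows "integrable lborel f" "integral\<^sup>L lborel f = integral UNIV f"
proof -
  have "integrable lebesgue f" using assms(1) by (simp add: set_integrable_def)
  then show i: "integrable lborel f" using integrable_completion[of f lborel] assms(2) by simp
  have "integral\<^sup>L lborel f = integral\<^sup>L lebesgue f" using integral_completion[of f lborel] assms(2) by simp
  also have "\<dots> = integral UNIV f"
    using set_lebesgue_integral_eq_integral(2)[OF assms(1)] by (simp add: set_lebesgue_integral_def)
  finally show "integral\<^sup>L lborel f = integral UNIV f" .
qed

lemma gamma_kernel_measurable [measurable]: "gamma_kernel z \<in> borel_measurable borel"
  unfolding gamma_kernel_def by measurable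

lemma gamma_kernel_integral:
  assumes z: "Re z > 0"
  shows "integrable lborel (gamma_kernel z)" "integral\<^sup>L lborel (gamma_kernel z) = Gamma z"
proof -
  let ?f = "\<lambda>t. of_real t powr (z - 1) / of_real (exp t)"
  have ai: "?f absolutely_integrable_on {0<..}"
    using absolutely_integrable_Gamma_integral'[OF z] .
  have hi: "(?f has_integral Gamma z) {0<..}" by (rule Gamma_integral_complex'[OF z])
  have eq: "of_real (exp p) * ?f (exp p) = gamma_kernel z p" for p
  proof -
    have "of_real (exp p) * ?f (exp p) = exp (of_real p) * exp ((z - 1) * of_real p) / exp (of_real (exp p))"
      by (simp add: powr_def exp_of_real Ln_of_real)
    also have "\<dots> = exp (of_real p + (z - 1) * of_real p - of_real (exp p))" by (simp only: exp_add exp_diff)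
    also have "of_real p + (z - 1) * of_real p - of_real (exp p) = z * of_real p - of_real (exp p)" by (simp add: algebra_simps)
    finally show ?thesis by (simp add: gamma_kernel_def)
  qed
  have "gamma_kernel z absolutely_integrable_on UNIV"
    using absolutely_integrable_exp_substitution(1)[OF ai] unfolding eq by simp
  moreover have "integral UNIV (gamma_kernel z) = Gamma z"
    using absolutely_integrable_exp_substitution(2)[OF ai] hi unfolding eq by (simp add: integral_unique)
  ultimately show "integrable lborel (gamma_kernel z)" "integral\<^sup>L lborel (gamma_kernel z) = Gamma z"
    using lborel_integral_of_absolutely_integrable[of "gamma_kernel z"] by simp_all
qed

text \<open>A Beta integral. The base \<open>2 * cosh u\<close>, instead of \<open>cosh u\<close>,
  keeps powers of 2 out of its evaluation by Gamma values.\<close>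

definition cosh_transform :: "complex \<Rightarrow> real \<Rightarrow> complex" where
  "cosh_transform \<alpha> k = (LINT u|lborel. exp (\<i> * of_real (k * u)) * of_real (2 * cosh u) powr (- \<alpha>))"

lemma gamma_kernel_shift:
  assumes "c > 0"
  shows "exp (\<alpha> * of_real w - of_real (exp w * c)) = gamma_kernel \<alpha> (ln c + w) * of_real c powr (- \<alpha>)"
proof -
  have "exp (\<alpha> * of_real w - of_real (exp w * c)) = exp (\<alpha> * of_real (ln c + w) - of_real (exp (ln c + w)) + (- \<alpha>) * of_real (ln c))"
    using assms by (intro arg_cong[where f=exp]) (simp add: exp_add algebra_simps)
  also have "\<dots> = gamma_kernel \<alpha> (ln c + w) * of_real c powr (- \<alpha>)"
    using assms by (simp only: exp_add gamma_kernel_def) (simp add: powr_def Ln_of_real)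
  finally show ?thesis .
qed

text \<open>Write the product of the two Gamma integrals in the variables \<open>p = w + u\<close>
  and \<open>q = w - u\<close>, where \<open>exp p + exp q = 2 * exp w * cosh u\<close>. Integrating
  over \<open>u\<close> first gives half that product; integrating over \<open>p\<close> first gives
  \<open>Gamma \<alpha>\<close> times the transform.\<close>

lemma cosh_transform_integral:
  assumes a: "Re \<alpha> > 0"
  shows "integrable lborel (\<lambda>u. exp (\<i> * of_real (k * u)) * of_real (2 * cosh u) powr (- \<alpha>))" (is ?I)
    and "2 * Gamma \<alpha> * cosh_transform \<alpha> k = Gamma ((\<alpha> + \<i> * of_real k) / 2) * Gamma ((\<alpha> - \<i> * of_real k) / 2)" (is ?E)
proof -
  define b c where "b = (\<alpha> + \<i> * of_real k) / 2" and "c = (\<alpha> - \<i> * of_real k) / 2"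
  have b: "Re b > 0" and c: "Re c > 0" using a by (simp_all add: b_def c_def)
  note gb = gamma_kernel_integral[OF b] and gc = gamma_kernel_integral[OF c]
  define G where "G = (\<lambda>p u. gamma_kernel b p * gamma_kernel c (p - 2 * u))"
  have Feq: "G (u + 1 * w) u = exp (\<i> * of_real (k * u)) * exp (\<alpha> * of_real w - of_real (exp w * (2 * cosh u)))" for u w
  proof -
    have "G (u + 1 * w) u = exp (b * of_real (w + u) - of_real (exp (w + u)) + (c * of_real (w - u) - of_real (exp (w - u))))"
      by (simp only: G_def gamma_kernel_def exp_add split) (simp add: algebra_simps)
    also have "b * of_real (w + u) - of_real (exp (w + u)) + (c * of_real (w - u) - of_real (exp (w - u)))
        = \<i> * of_real (k * u) + (\<alpha> * of_real w - of_real (exp w * (2 * cosh u)))"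
    proof -
      have "exp (w + u) + exp (w - u) = exp w * (2 * cosh u)"
        by (simp add: cosh_field_def exp_add exp_diff exp_minus field_simps)
      then have "complex_of_real (exp (w + u)) + of_real (exp (w - u)) = of_real (exp w * (2 * cosh u))"
        by (metis of_real_add)
      moreover have "b * of_real (w + u) + c * of_real (w - u) = \<i> * of_real (k * u) + \<alpha> * of_real w"
        by (simp add: b_def c_def field_simps)
      ultimately show ?thesis by (simp add: algebra_simps)
    qed
    finally show ?thesis by (simp only: exp_add)
  qed
  have sh: "exp (\<alpha> * of_real w - of_real (exp w * (2 * cosh u))) = gamma_kernel \<alpha> (ln (2 * cosh u) + 1 * w) * of_real (2 * cosh u) powr (- \<alpha>)" for u w
    using gamma_kernel_shift[of "2 * cosh u" \<alpha> w] by (simp add: cosh_real_pos)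
  have Gm [measurable]: "(\<lambda>(p, u). G p u) \<in> borel_measurable (lborel \<Otimes>\<^sub>M lborel)"
    unfolding G_def by measurable
  have inner: "integrable lborel (\<lambda>u. G p u)" "(LINT u|lborel. norm (G p u)) = norm (gamma_kernel b p) * ((1/2) * (LINT q|lborel. norm (gamma_kernel c q)))"
      "(LINT u|lborel. G p u) = gamma_kernel b p * ((1/2) * Gamma c)" for p
  proof -
    have "integrable lborel (\<lambda>u. gamma_kernel c (p + (-2) * u))"
      by (rule lborel_integrable_real_affine[OF gc(1)]) simp
    then show "integrable lborel (\<lambda>u. G p u)" by (simp add: G_def)
    have "(LINT q|lborel. norm (gamma_kernel c q)) = 2 * (LINT u|lborel. norm (gamma_kernel c (p - 2 * u)))"
      using lborel_integral_real_affine[of "-2" "\<lambda>q. norm (gamma_kernel c q)" p] by simp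
    then show "(LINT u|lborel. norm (G p u)) = norm (gamma_kernel b p) * ((1/2) * (LINT q|lborel. norm (gamma_kernel c q)))"
      by (simp add: G_def norm_mult)
    have "Gamma c = 2 * (LINT u|lborel. gamma_kernel c (p - 2 * u))"
      using lborel_integral_real_affine[of "-2" "gamma_kernel c" p] gc(2) by (simp add: scaleR_conv_of_real)
    then show "(LINT u|lborel. G p u) = gamma_kernel b p * ((1/2) * Gamma c)"
      by (simp add: G_def)
  qed
  have Gi: "integrable (lborel \<Otimes>\<^sub>M lborel) (\<lambda>(p, u). G p u)"
  proof (rule lborel_pair.Fubini_integrable[OF Gm])
    show "integrable lborel (\<lambda>p. LINT u|lborel. norm (case (p, u) of (p, u) \<Rightarrow> G p u))"
      unfolding split inner(2) by (intro integrable_mult_left integrable_norm gb)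
    show "AE p in lborel. integrable lborel (\<lambda>u. case (p, u) of (p, u) \<Rightarrow> G p u)"
      using inner(1) by simp
  qed
  have other: "(LINT p|lborel. G p u) = exp (\<i> * of_real (k * u)) * of_real (2 * cosh u) powr (- \<alpha>) * Gamma \<alpha>" for u
  proof -
    have "(LINT p|lborel. G p u) = (LINT w|lborel. G (u + 1 * w) u)"
      using lborel_integral_real_affine[of 1 "\<lambda>p. G p u" u] by simp
    also have "\<dots> = (LINT w|lborel. (exp (\<i> * of_real (k * u)) * of_real (2 * cosh u) powr (- \<alpha>)) * gamma_kernel \<alpha> (ln (2 * cosh u) + 1 * w))"
      unfolding Feq sh by (simp add: mult_ac)
    also have "\<dots> = exp (\<i> * of_real (k * u)) * of_real (2 * cosh u) powr (- \<alpha>) * (LINT w|lborel. gamma_kernel \<alpha> (ln (2 * cosh u) + 1 * w))"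
      by (rule integral_mult_right_zero)
    also have "(LINT w|lborel. gamma_kernel \<alpha> (ln (2 * cosh u) + 1 * w)) = Gamma \<alpha>"
      using lborel_integral_real_affine[of 1 "gamma_kernel \<alpha>" "ln (2 * cosh u)"] gamma_kernel_integral(2)[OF a] by simp
    finally show ?thesis .
  qed
  have "\<alpha> \<notin> \<int>\<^sub>\<le>\<^sub>0" using a by (auto elim!: nonpos_Ints_cases)
  then have G0: "Gamma \<alpha> \<noteq> 0" by (simp add: Gamma_eq_zero_iff)
  have "integrable lborel (\<lambda>u. exp (\<i> * of_real (k * u)) * of_real (2 * cosh u) powr (- \<alpha>) * Gamma \<alpha>)"
    using lborel_pair.integrable_snd[OF Gi] unfolding other .
  then have "integrable lborel (\<lambda>u. exp (\<i> * of_real (k * u)) * of_real (2 * cosh u) powr (- \<alpha>) * Gamma \<alpha> * inverse (Gamma \<alpha>))"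
    by (rule integrable_mult_left)
  then show ?I using G0 by (simp add: mult.assoc)
  have "cosh_transform \<alpha> k * Gamma \<alpha> = (LINT u|lborel. LINT p|lborel. G p u)"
    unfolding other cosh_transform_def by (rule integral_mult_left_zero[symmetric])
  also have "\<dots> = (LINT p|lborel. LINT u|lborel. G p u)"
    by (rule lborel_pair.Fubini_integral[OF Gi])
  also have "\<dots> = Gamma b * ((1/2) * Gamma c)"
    unfolding inner(3) gb(2)[symmetric] by (rule integral_mult_left_zero)
  finally show ?E by (simp add: b_def c_def mult_ac)
qed

text \<open>The values at \<open>1/2 - ir\<close> (the model period), \<open>3/2 - ir\<close> (the Wronskian) and \<open>1 - 2ir\<close>
  (the amplitude at infinity) are linked by duplication, so only a quotient without \<open>k\<close> survives.\<close>

lemma cosh_transform_product: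
  fixes r k :: real
  shows "(cmod (cosh_transform (1/2 - \<i> * r) k) * cmod (cosh_transform (3/2 - \<i> * r) k) * cmod (1/2 - \<i> * r))\<^sup>2
     = pi * (cmod (Gamma (1 - \<i> * r) / Gamma (1/2 - \<i> * r)))\<^sup>2 * (cmod (cosh_transform (1 - 2 * \<i> * r) (2 * k)))\<^sup>2"
proof -
  \<comment> \<open>Adding 1/2 to \<open>z\<close> and \<open>w\<close> gives the Gamma arguments of
    the transform at 3/2, doubling them those of the transform at 1 with frequency
    \<open>2 * k\<close>.\<close>
  define z w where "z = (1/2 - \<i> * r + \<i> * k) / 2" and "w = (1/2 - \<i> * r - \<i> * k) / 2"
  have np: "x \<notin> \<int>\<^sub>\<le>\<^sub>0" if "Re x > 0" for x :: complex using that by (auto elim!: nonpos_Ints_cases)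
  have zw: "Re z > 0" "Re w > 0" "Re (z + 1/2) > 0" "Re (w + 1/2) > 0" by (simp_all add: z_def w_def)
  have G0: "Gamma x \<noteq> 0" if "Re x > 0" for x :: complex using np[OF that] by (simp add: Gamma_eq_zero_iff)
  have e1: "2 * Gamma (1/2 - \<i> * r) * cosh_transform (1/2 - \<i> * r) k = Gamma z * Gamma w"
    using cosh_transform_integral(2)[of "1/2 - \<i> * r" k] by (simp add: z_def w_def)
  have e2: "2 * Gamma (3/2 - \<i> * r) * cosh_transform (3/2 - \<i> * r) k = Gamma (z + 1/2) * Gamma (w + 1/2)"
  proof -
    have "(3/2 - \<i> * r + \<i> * k) / 2 = z + 1/2" "(3/2 - \<i> * r - \<i> * k) / 2 = w + 1/2"
      by (simp_all add: z_def w_def field_simps)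
    moreover have "Re (3/2 - \<i> * r) > 0" by simp
    ultimately show ?thesis using cosh_transform_integral(2)[of "3/2 - \<i> * r" k] by metis
  qed
  have e3: "2 * Gamma (1 - 2 * \<i> * r) * cosh_transform (1 - 2 * \<i> * r) (2 * k) = Gamma (2 * z) * Gamma (2 * w)"
  proof -
    have "(1 - 2 * \<i> * r + \<i> * of_real (2 * k)) / 2 = 2 * z" "(1 - 2 * \<i> * r - \<i> * of_real (2 * k)) / 2 = 2 * w"
      by (simp_all add: z_def w_def field_simps)
    moreover have "Re (1 - 2 * \<i> * r) > 0" by simp
    ultimately show ?thesis using cosh_transform_integral(2)[of "1 - 2 * \<i> * r" "2 * k"] by metis
  qed
  have e4: "Gamma (3/2 - \<i> * r) = (1/2 - \<i> * r) * Gamma (1/2 - \<i> * r)"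
  proof -
    have "1/2 - \<i> * r + 1 = 3/2 - \<i> * r" by simp
    moreover have "1/2 - \<i> * r \<notin> \<int>\<^sub>\<le>\<^sub>0" by (rule np) simp
    ultimately show ?thesis using Gamma_plus1[of "1/2 - \<i> * r"] by metis
  qed
  have dup: "cmod (Gamma x * Gamma (x + 1/2)) = sqrt pi * cmod (Gamma (2 * x)) * exp ((1 - 2 * Re x) * ln 2)" if "Re x > 0" for x :: complex
    using Gamma_legendre_duplication[OF np[OF that] np[of "x + 1/2"]] that by (simp add: norm_mult norm_exp_eq_Re mult_ac)
  have dup0: "cmod (Gamma (1/2 - \<i> * r) * Gamma (1 - \<i> * r)) = sqrt pi * cmod (Gamma (1 - 2 * \<i> * r))"
  proof -
    have "1/2 - \<i> * r + 1/2 = 1 - \<i> * r" "2 * (1/2 - \<i> * r) = 1 - 2 * \<i> * r" by simp_all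
    then show ?thesis using dup[of "1/2 - \<i> * r"] by (simp add: mult.assoc)
  qed
  let ?g = "cmod (Gamma (1/2 - \<i> * r))" and ?h = "cmod (Gamma (1 - \<i> * r))" and ?d = "cmod (Gamma (1 - 2 * \<i> * r))"
  let ?A = "cmod (cosh_transform (1/2 - \<i> * r) k)" and ?B = "cmod (cosh_transform (3/2 - \<i> * r) k)"
  let ?L = "cmod (cosh_transform (1 - 2 * \<i> * r) (2 * k))" and ?a = "cmod (1/2 - \<i> * r)"
  have gp: "?g > 0" "?h > 0" "?d > 0" using G0[of "1/2 - \<i> * r"] G0[of "1 - \<i> * r"] G0[of "1 - 2 * \<i> * r"] by simp_all
  have "4 * ?g * ?g * (?a * ?A * ?B) = cmod (2 * Gamma (1/2 - \<i> * r) * cosh_transform (1/2 - \<i> * r) k)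
      * cmod (2 * Gamma (3/2 - \<i> * r) * cosh_transform (3/2 - \<i> * r) k)"
    unfolding e4 by (simp add: norm_mult mult_ac)
  also have "\<dots> = cmod (Gamma z * Gamma (z + 1/2)) * cmod (Gamma w * Gamma (w + 1/2))"
    unfolding e1 e2 by (simp add: norm_mult mult_ac)
  \<comment> \<open>\<open>z\<close> and \<open>w\<close> have real part 1/4, so each duplication
    contributes \<open>exp (ln 2 / 2)\<close>.\<close>
  also have "\<dots> = (sqrt pi * sqrt pi) * (exp (ln 2 / 2) * exp (ln 2 / 2)) * cmod (Gamma (2 * z) * Gamma (2 * w))"
    unfolding dup[OF zw(1)] dup[OF zw(2)] by (simp add: z_def w_def norm_mult mult_ac)
  also have "exp (ln 2 / 2) * exp (ln 2 / 2) = (2::real)" by (simp add: exp_add[symmetric])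
  also have "cmod (Gamma (2 * z) * Gamma (2 * w)) = 2 * ?d * ?L"
    unfolding e3[symmetric] by (simp add: norm_mult)
  finally have m: "?g * ?g * (?a * ?A * ?B) = pi * ?d * ?L" by (simp add: mult_ac)
  \<comment> \<open>A third duplication, at \<open>1/2 - \<i> * r\<close>, eliminates the Gamma
    value at \<open>1 - 2 * \<i> * r\<close>.\<close>
  have "sqrt pi * ?d = ?g * ?h" using dup0 by (simp add: norm_mult)
  then have "?g * ?g * (?a * ?A * ?B) = sqrt pi * (?g * ?h) * ?L"
    using m by (metis (no_types, lifting) mult.assoc pi_ge_zero real_sqrt_mult_self abs_of_nonneg)
  then have "?a * ?A * ?B = sqrt pi * (?h / ?g) * ?L"
    using gp by (simp add: field_simps)
  then have "(?a * ?A * ?B)\<^sup>2 = (sqrt pi * (?h / ?g) * ?L)\<^sup>2" by simp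
  then show ?thesis by (simp add: power_mult_distrib norm_divide power_divide mult_ac)
qed

text \<open>By reflection the squared quotient is \<open>r * cosh (pi * r) / sinh (pi * r)\<close>,
  which is at least \<open>r\<close> and at least \<open>1 / pi\<close>. With the constant 1/5 the
  claim follows from the first bound for \<open>r \<ge> 1/4\<close> and from the second below; at
  \<open>r = 0\<close> the value is \<open>1 / pi\<close>.\<close>

lemma cmod_Gamma_ratio_ge:
  fixes r :: real
  assumes r: "r \<ge> 0"
  shows "(cmod (Gamma (1 - \<i> * r) / Gamma (1/2 - \<i> * r)))\<^sup>2 \<ge> (1 + r) / 5"
proof -
  have sq: "(cmod (Gamma z))\<^sup>2 = cmod (Gamma z * Gamma (cnj z))" for z :: complex
    by (simp add: norm_mult power2_eq_square flip: cnj_Gamma)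
  have half: "(cmod (Gamma (1/2 - \<i> * r)))\<^sup>2 = pi / cosh (pi * r)"
  proof -
    have "cnj (1/2 - \<i> * r) = 1 - (1/2 - \<i> * r)" by (simp add: complex_eq_iff)
    then have "(cmod (Gamma (1/2 - \<i> * r)))\<^sup>2 = cmod (of_real pi / sin (of_real pi * (1/2 - \<i> * r)))"
      unfolding sq by (simp only: Gamma_reflection_complex)
    also have "sin (of_real pi * (1/2 - \<i> * r)) = cos (\<i> * of_real (pi * r))"
    proof -
      have e: "complex_of_real pi * (1/2 - \<i> * r) = of_real pi / 2 - \<i> * of_real (pi * r)" by (simp add: algebra_simps)
      have s: "sin (complex_of_real pi / 2) = 1" "cos (complex_of_real pi / 2) = 0"
        using sin_of_real[of "pi/2", where 'a=complex] cos_of_real[of "pi/2", where 'a=complex] by simp_all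
      show ?thesis unfolding e sin_diff by (simp only: s) simp
    qed
    also have "cos (\<i> * of_real (pi * r)) = of_real (cosh (pi * r))"
      unfolding cosh_conv_cos[symmetric] by (simp add: cosh_def scaleR_conv_of_real exp_of_real[symmetric])
    finally show ?thesis by (simp add: norm_divide)
  qed
  show ?thesis
  proof (cases "r = 0")
    case True
    have "1 / pi \<ge> 1 / 5" using pi_less_4 by (intro divide_left_mono) auto
    then show ?thesis using half True by (simp add: norm_divide power_divide)
  next
    case False
    then have r: "r > 0" using r by simp
    have one: "(cmod (Gamma (1 - \<i> * r)))\<^sup>2 = pi * r / sinh (pi * r)"
    proof -
      have c: "cnj (1 - \<i> * r) = 1 + \<i> * r" by (simp add: complex_eq_iff)
      have np: "\<i> * r \<notin> \<int>\<^sub>\<le>\<^sub>0"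
        using r by (auto elim!: nonpos_Ints_cases simp: complex_eq_iff)
      have "Gamma (1 + \<i> * r) = \<i> * r * Gamma (\<i> * r)" using Gamma_plus1[OF np] by (simp add: add.commute)
      then have "(cmod (Gamma (1 - \<i> * r)))\<^sup>2 = cmod (\<i> * r * (Gamma (\<i> * r) * Gamma (1 - \<i> * r)))"
        unfolding sq c by (simp add: norm_mult mult_ac)
      also have "\<dots> = cmod (\<i> * r * (of_real pi / sin (of_real pi * (\<i> * r))))"
        by (simp only: Gamma_reflection_complex)
      also have "sin (of_real pi * (\<i> * r)) = \<i> * of_real (sinh (pi * r))"
      proof -
        have "complex_of_real pi * (\<i> * r) = \<i> * of_real (pi * r)" by simp
        moreover have "sinh (complex_of_real (pi * r)) = of_real (sinh (pi * r))"
          by (simp add: sinh_def scaleR_conv_of_real exp_of_real[symmetric])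
        ultimately show ?thesis by (simp add: sinh_conv_sin complex_eq_iff mult_ac)
      qed
      finally show ?thesis using r by (simp add: norm_mult norm_divide)
    qed
    have sp: "sinh (pi * r) > 0" using r by simp
    have q: "(cmod (Gamma (1 - \<i> * r) / Gamma (1/2 - \<i> * r)))\<^sup>2 = r * cosh (pi * r) / sinh (pi * r)"
      using r unfolding norm_divide power_divide one half by (simp add: field_simps)
    show ?thesis
    proof (cases "r \<ge> 1/4")
      case True
      have "sinh (pi * r) \<le> cosh (pi * r)" by (simp add: sinh_def cosh_def)
      then have "r \<le> r * cosh (pi * r) / sinh (pi * r)" using r sp by (simp add: pos_le_divide_eq)
      moreover have "(1 + r) / 5 \<le> r" using True by simp
      ultimately show ?thesis unfolding q by (rule order_trans[rotated])
    next
      case False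
      have "\<exists>\<xi>>0. \<xi> < pi * r \<and> sinh (pi * r) - sinh 0 = (pi * r - 0) * cosh \<xi>"
        by (rule MVT2) (use r in \<open>auto intro!: derivative_eq_intros\<close>)
      then obtain \<xi> where \<xi>: "\<xi> > 0" "\<xi> < pi * r" "sinh (pi * r) = pi * r * cosh \<xi>" by auto
      have "cosh \<xi> \<le> cosh (pi * r)" using \<xi> by (simp add: cosh_real_nonneg_le_iff)
      then have "sinh (pi * r) \<le> pi * r * cosh (pi * r)" using \<xi>(3) r by (simp add: mult_left_mono)
      also have "\<dots> \<le> 4 * (r * cosh (pi * r))" using pi_less_4 r by (simp add: mult_right_mono)
      finally have "1/4 \<le> r * cosh (pi * r) / sinh (pi * r)" using sp by (simp add: pos_le_divide_eq)
      moreover have "(1 + r) / 5 \<le> 1/4" using False by simp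
      ultimately show ?thesis unfolding q by (rule order_trans[rotated])
    qed
  qed
qed

lemma cosh_transform_nonzero:
  "cosh_transform (1 - 2 * \<i> * of_real r) k \<noteq> 0"
proof -
  have G0: "Gamma x \<noteq> 0" if "Re x > 0" for x :: complex
    using that by (auto simp: Gamma_eq_zero_iff elim!: nonpos_Ints_cases)
  have "Gamma ((1 - 2 * \<i> * of_real r + \<i> * of_real k) / 2) \<noteq> 0" "Gamma ((1 - 2 * \<i> * of_real r - \<i> * of_real k) / 2) \<noteq> 0"
    by (rule G0, simp)+
  then show ?thesis using cosh_transform_integral(2)[of "1 - 2 * \<i> * of_real r" k] by auto
qed

section \<open>The model period as a value of the transform\<close>

lemma absolutely_integrable_exp_substitution_converse:
  fixes f :: "real \<Rightarrow> complex"
  assumes f: "(\<lambda>p. of_real (exp p) * f (exp p)) absolutely_integrable_on UNIV"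
  shows "f absolutely_integrable_on {0<..}"
proof -
  have im: "range exp = {0::real<..}" by (auto simp: image_iff) (metis exp_ln)
  have cv: "g absolutely_integrable_on {0<..}" if "(\<lambda>x. exp x * g (exp x)) absolutely_integrable_on UNIV" for g :: "real \<Rightarrow> real"
    using has_absolute_integral_change_of_variables_1'[of UNIV exp exp g "integral UNIV (\<lambda>x. exp x * g (exp x))"] that im
    by (simp add: inj_on_def DERIV_exp)
  have a: "(\<lambda>x. Re (f x)) absolutely_integrable_on {0<..}"
    by (rule cv) (use absolutely_integrable_linear[OF f bounded_linear_Re] in \<open>simp add: o_def\<close>)
  have b: "(\<lambda>x. Im (f x)) absolutely_integrable_on {0<..}"
    by (rule cv) (use absolutely_integrable_linear[OF f bounded_linear_Im] in \<open>simp add: o_def\<close>)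
  have c1: "(\<lambda>x. complex_of_real (Re (f x))) absolutely_integrable_on {0<..}"
    using absolutely_integrable_linear[OF a bounded_linear_of_real[where 'a=complex]] by (simp add: o_def)
  have c2: "(\<lambda>x. \<i> * complex_of_real (Im (f x))) absolutely_integrable_on {0<..}"
    using absolutely_integrable_linear[OF b bounded_linear_compose[OF bounded_linear_mult_right[of \<i>] bounded_linear_of_real[where 'a=complex]]]
    by (simp add: o_def)
  show ?thesis
    using set_integral_add(1)[OF c1 c2] by (simp flip: complex_eq)
qed

lemma integral_abs_substitution:
  fixes f :: "real \<Rightarrow> complex"
  assumes ev: "\<And>x. f (- x) = f x" and fm [measurable]: "f \<in> borel_measurable borel"
    and i: "integrable lborel (\<lambda>p. of_real (exp p) * f (exp p))"
  shows "(LINT x|lborel. f x) = 2 * (LINT p|lborel. of_real (exp p) * f (exp p))"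
proof -
  have E: "(\<lambda>p. of_real (exp p) * f (exp p)) absolutely_integrable_on UNIV"
    using i by (simp add: set_integrable_def integrable_completion)
  note ai = absolutely_integrable_exp_substitution_converse[OF E]
  define g where "g = (\<lambda>x. indicator {0<..} x *\<^sub>R f x)"
  have gm [measurable]: "g \<in> borel_measurable borel" unfolding g_def by measurable
  have gi: "integrable lborel g"
    using ai integrable_completion[of g lborel] by (simp add: set_integrable_def g_def)
  have "integral\<^sup>L lborel g = integral\<^sup>L lebesgue g" using integral_completion[of g lborel] by simp
  also have "\<dots> = integral {0<..} f"
    using set_lebesgue_integral_eq_integral(2)[OF ai] by (simp add: set_lebesgue_integral_def g_def)
  also have "\<dots> = integral UNIV (\<lambda>p. of_real (exp p) * f (exp p))"
    by (rule absolutely_integrable_exp_substitution(2)[OF ai, symmetric])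
  also have "\<dots> = (LINT p|lborel. of_real (exp p) * f (exp p))"
    by (rule lborel_integral_of_absolutely_integrable(2)[OF E, symmetric]) measurable
  finally have g: "integral\<^sup>L lborel g = (LINT p|lborel. of_real (exp p) * f (exp p))" .
  have gi': "integrable lborel (\<lambda>x. g (0 + (- 1) * x))" by (rule lborel_integrable_real_affine[OF gi]) simp
  have "(LINT x|lborel. f x) = (LINT x|lborel. g x + g (0 + (- 1) * x))"
  proof (rule integral_cong_AE)
    \<comment> \<open>The even function is the sum of its two halves except at 0, a null
      set.\<close>
    show "AE x in lborel. f x = g x + g (0 + (- 1) * x)"
      using AE_lborel_singleton[of 0] by eventually_elim (auto simp: g_def ev indicator_def)
  qed measurable
  also have "\<dots> = integral\<^sup>L lborel g + (LINT x|lborel. g (0 + (- 1) * x))"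
    by (rule Bochner_Integration.integral_add[OF gi gi'])
  also have "(LINT x|lborel. g (0 + (- 1) * x)) = integral\<^sup>L lborel g"
    using lborel_integral_real_affine[of "-1" g 0] by simp
  finally show ?thesis by (simp add: g)
qed

text \<open>With \<open>x = exp p\<close> one has \<open>1 + x^2 = exp p * (2 * cosh p)\<close>. The
  Jacobian and all powers of \<open>exp p\<close> then combine to the pure oscillation of frequency
  \<open>k\<close>.\<close>

lemma model_period_eq:
  fixes r :: real
  assumes r: "r = sqrt (\<mu> - 1/4)" and mu: "\<mu> \<ge> 1/4" and l: "l > 0" and k: "k = 2 * pi * of_int n / l"
  shows "model_period \<mu> l n = 2 * of_real l * cosh_transform (1/2 - \<i> * r) k"
proof -
  have "sqrt (4 * \<mu> - 1) = sqrt (4 * (\<mu> - 1/4))" by simp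
  also have "\<dots> = 2 * r" unfolding r by (simp only: real_sqrt_mult real_sqrt_four)
  finally have s: "spectral_parameter \<mu> = 2 * \<i> * r" by (simp add: spectral_parameter_def)
  define f where "f = (\<lambda>x::real. complex_of_real \<bar>x\<bar> powr (- 1/2 - \<i> * r + \<i> * k) * complex_of_real (1 + x\<^sup>2) powr (- (1/2 - \<i> * r)))"
  have e: "of_real (exp p) * f (exp p) = exp (\<i> * of_real (k * p)) * of_real (2 * cosh p) powr (- (1/2 - \<i> * r))" for p :: real
  proof -
    have c: "ln (1 + (exp p)\<^sup>2) = p + ln (2 * cosh p)"
    proof -
      have "1 + (exp p)\<^sup>2 = exp p * (2 * cosh p)"
        by (simp add: cosh_field_def exp_minus field_simps power2_eq_square)
      then show ?thesis by (simp add: ln_mult cosh_real_pos)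
    qed
    have p1: "complex_of_real (1 + (exp p)\<^sup>2) powr z = exp (z * of_real (ln (1 + (exp p)\<^sup>2)))" for z
    proof -
      have "1 + (exp p)\<^sup>2 > 0" by (simp add: add_pos_nonneg)
      then show ?thesis by (simp add: powr_def Ln_of_real del: of_real_add of_real_power)
    qed
    have p2: "complex_of_real (2 * cosh p) powr z = exp (z * of_real (ln (2 * cosh p)))" for z
      using cosh_real_pos[of p] by (simp add: powr_def Ln_of_real del: of_real_mult)
    have p3: "complex_of_real \<bar>exp p\<bar> powr z = exp (z * of_real p)" for z
      by (simp add: powr_def Ln_of_real)
    have p0: "complex_of_real (exp p) = exp (of_real p)" by (simp add: exp_of_real)
    show ?thesis unfolding f_def p1 p2 p3 p0 c exp_add[symmetric] mult.assoc[symmetric]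
      by (intro arg_cong[where f=exp]) (simp add: algebra_simps)
  qed
  have fm: "f \<in> borel_measurable borel" unfolding f_def by measurable
  have "(2 * \<i> * r - 1) / 2 = - (1/2 - \<i> * r)" "- 1 / 2 - 2 * \<i> * r / 2 + 2 * complex_of_real pi * \<i> * of_int n / of_real l = - 1/2 - \<i> * r + \<i> * k"
    by (simp_all add: k field_simps)
  then have "model_period \<mu> l n = of_real l * (LINT x|lborel. f x)"
    unfolding model_period_def Let_def s f_def by (simp only:)
  also have "(LINT x|lborel. f x) = 2 * (LINT p|lborel. of_real (exp p) * f (exp p))"
  proof (rule integral_abs_substitution[OF _ fm])
    show "f (- x) = f x" for x by (simp add: f_def)
    show "integrable lborel (\<lambda>p. of_real (exp p) * f (exp p))"
      unfolding e by (rule cosh_transform_integral(1)) simp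
  qed
  finally show ?thesis unfolding e cosh_transform_def by simp
qed

section \<open>The Jost solution\<close>

text \<open>Dominated convergence for the remainder of the difference quotient; on the ball of
  radius 1 the mean value inequality bounds it by \<open>2 * D\<close>.\<close>

lemma has_vector_derivative_lebesgue_integral:
  fixes f f1 :: "real \<Rightarrow> real \<Rightarrow> complex"
  assumes fi: "\<And>s. s \<in> ball s0 1 \<Longrightarrow> integrable lborel (f s)"
    and fd: "\<And>s u. s \<in> ball s0 1 \<Longrightarrow> ((\<lambda>s. f s u) has_vector_derivative f1 s u) (at s)"
    and bd: "\<And>s u. s \<in> ball s0 1 \<Longrightarrow> cmod (f1 s u) \<le> D u"
    and Di: "integrable lborel D" and f1i: "integrable lborel (f1 s0)"
  shows "((\<lambda>s. LINT u|lborel. f s u) has_vector_derivative (LINT u|lborel. f1 s0 u)) (at s0)"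
proof -
  have D0: "D u \<ge> 0" for u using bd[of s0 u] norm_ge_zero[of "f1 s0 u"] by (meson centre_in_ball order_trans zero_less_one)
  define R where "R = (\<lambda>y u. (f y u - f s0 u - (y - s0) *\<^sub>R f1 s0 u) /\<^sub>R \<bar>y - s0\<bar>)"
  have Ri: "integrable lborel (R y)" if "y \<in> ball s0 1" for y
    unfolding R_def using fi[OF that] fi[of s0] f1i by (intro integrable_scaleR_right Bochner_Integration.integrable_diff) auto
  have RI: "(LINT u|lborel. R y u) = ((LINT u|lborel. f y u) - (LINT u|lborel. f s0 u) - (y - s0) *\<^sub>R (LINT u|lborel. f1 s0 u)) /\<^sub>R \<bar>y - s0\<bar>"
    if "y \<in> ball s0 1" for y
    unfolding R_def using fi[OF that] fi[of s0] f1i by simp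
  have Rb: "cmod (R y u) \<le> 2 * D u" if y: "y \<in> ball s0 1" "y \<noteq> s0" for y u
  proof -
    have "norm (f y u - f s0 u) \<le> D u * norm (y - s0)"
    proof (rule differentiable_bound[where S = "ball s0 1"])
      show "((\<lambda>s. f s u) has_derivative (\<lambda>h. h *\<^sub>R f1 s u)) (at s within ball s0 1)" if "s \<in> ball s0 1" for s
        using fd[OF that, of u] by (simp add: has_vector_derivative_def has_derivative_at_withinI)
      show "onorm (\<lambda>h. h *\<^sub>R f1 s u) \<le> D u" if "s \<in> ball s0 1" for s
        using mult_left_mono[OF bd[OF that, of u] abs_ge_zero] by (intro onorm_bound) (auto simp: D0 mult.commute)
    qed (use y in auto)
    moreover have "norm ((y - s0) *\<^sub>R f1 s0 u) \<le> D u * norm (y - s0)"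
      using mult_left_mono[OF bd[of s0 u] abs_ge_zero[of "y - s0"]] by (simp add: mult.commute)
    ultimately have "norm (f y u - f s0 u - (y - s0) *\<^sub>R f1 s0 u) \<le> 2 * D u * \<bar>y - s0\<bar>"
      using norm_triangle_ineq4[of "f y u - f s0 u" "(y - s0) *\<^sub>R f1 s0 u"] by simp
    then show ?thesis using y(2) by (simp add: R_def pos_divide_le_eq divide_inverse_commute[symmetric])
  qed
  have Rl: "((\<lambda>y. norm (R y u)) \<longlongrightarrow> 0) (at s0)" for u
    using fd[of s0 u] unfolding has_vector_derivative_def has_derivative_iff_norm R_def
    by (simp add: divide_inverse_commute)
  have "((\<lambda>y. norm (LINT u|lborel. R y u)) \<longlongrightarrow> 0) (at s0 within ball s0 1)"
    unfolding tendsto_at_iff_sequentially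
  proof (intro allI impI)
    fix X assume X: "\<forall>i. X i \<in> ball s0 1 - {s0}" "X \<longlonglongrightarrow> s0"
    have "(\<lambda>i. LINT u|lborel. R (X i) u) \<longlonglongrightarrow> (LINT u|(lborel::real measure). 0)"
    proof (rule integral_dominated_convergence[where w = "\<lambda>u. 2 * D u"])
      show "R (X i) \<in> borel_measurable lborel" for i using Ri[of "X i"] X(1) by auto
      show "integrable lborel (\<lambda>u. 2 * D u)" using Di by simp
      show "AE u in lborel. norm (R (X i) u) \<le> 2 * D u" for i using Rb X(1) by auto
      show "AE u in lborel. (\<lambda>i. R (X i) u) \<longlonglongrightarrow> 0"
      proof (rule AE_I2)
        fix u
        have "filterlim X (at s0) sequentially" using X by (auto simp: filterlim_at)
        from filterlim_compose[OF Rl this] show "(\<lambda>i. R (X i) u) \<longlonglongrightarrow> 0" by (simp add: tendsto_norm_zero_iff)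
      qed
    qed simp
    then show "((\<lambda>y. norm (LINT u|lborel. R y u)) \<circ> X) \<longlonglongrightarrow> 0" by (simp add: o_def tendsto_norm_zero)
  qed
  then have "((\<lambda>y. norm ((LINT u|lborel. f y u) - (LINT u|lborel. f s0 u) - (y - s0) *\<^sub>R (LINT u|lborel. f1 s0 u)) / norm (y - s0)) \<longlongrightarrow> 0) (at s0 within ball s0 1)"
  proof (rule Lim_transform_within[where d=1])
    fix y assume "y \<in> ball s0 1"
    then show "norm (LINT u|lborel. R y u) = norm ((LINT u|lborel. f y u) - (LINT u|lborel. f s0 u) - (y - s0) *\<^sub>R (LINT u|lborel. f1 s0 u)) / norm (y - s0)"
      by (simp only: RI norm_scaleR divide_inverse_commute real_norm_def abs_inverse abs_abs)
  qed simp
  moreover have "at s0 within ball s0 1 = at s0" by (rule at_within_open) auto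
  ultimately show ?thesis unfolding has_vector_derivative_def has_derivative_iff_norm
    by (simp add: bounded_linear_scaleR_left)
qed

text \<open>Equals \<open>exp (- s) * (cosh s * cosh u + sinh s)\<close>, and the bracket is an
  inverse Poisson kernel in distance coordinates. With the exponential split off, the base has a
  positive limit as \<open>s\<close> tends to infinity.\<close>

definition jost_base :: "real \<Rightarrow> real \<Rightarrow> real" where
  "jost_base s u = ((cosh u + 1) + exp (- 2 * s) * (cosh u - 1)) / 2"

definition jost_base_s :: "real \<Rightarrow> real \<Rightarrow> real" where
  "jost_base_s s u = - exp (- 2 * s) * (cosh u - 1)"

definition jost_base_u :: "real \<Rightarrow> real \<Rightarrow> real" where
  "jost_base_u s u = (1 + exp (- 2 * s)) / 2 * sinh u"

section \<open>Bounds and derivatives of the integrand\<close>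

lemma jost_base_bounds:
  shows "jost_base s u \<ge> cosh u / 2" "jost_base s u > 0"
    "\<bar>jost_base_s s u\<bar> \<le> 2 * exp (- 2 * s) * jost_base s u"
    "\<bar>jost_base_u s u\<bar> \<le> (1 + exp (- 2 * s)) * jost_base s u"
proof -
  have c: "cosh u \<ge> 1" by (rule cosh_real_ge_1)
  have p: "exp (- 2 * s) * (cosh u - 1) \<ge> 0" using c by simp
  then have q: "2 * jost_base s u \<ge> cosh u + 1" by (simp add: jost_base_def)
  then show "jost_base s u \<ge> cosh u / 2" and pos: "jost_base s u > 0" using c by auto
  have "\<bar>jost_base_s s u\<bar> = exp (- 2 * s) * (cosh u - 1)" using c by (simp add: jost_base_s_def abs_mult)
  also have "\<dots> \<le> exp (- 2 * s) * (2 * jost_base s u)" using q by (intro mult_left_mono) auto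
  finally show "\<bar>jost_base_s s u\<bar> \<le> 2 * exp (- 2 * s) * jost_base s u" by simp
  have "\<bar>sinh u\<bar> \<le> cosh u" using sinh_le_cosh_real[of u] sinh_le_cosh_real[of "- u"] by (simp add: abs_le_iff)
  then have "(1 + exp (- 2 * s)) / 2 * \<bar>sinh u\<bar> \<le> (1 + exp (- 2 * s)) / 2 * (2 * jost_base s u)"
    using q by (intro mult_left_mono) (auto intro: add_nonneg_nonneg)
  then show "\<bar>jost_base_u s u\<bar> \<le> (1 + exp (- 2 * s)) * jost_base s u"
    by (simp add: jost_base_u_def abs_mult)
qed

lemma jost_base_derivs:
  "((\<lambda>s. jost_base s u) has_real_derivative jost_base_s s u) (at s)"
  "((\<lambda>s. jost_base_s s u) has_real_derivative - 2 * jost_base_s s u) (at s)"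
  "((\<lambda>u. jost_base s u) has_real_derivative jost_base_u s u) (at u)"
  "((\<lambda>u. jost_base_u s u) has_real_derivative (1 + exp (- 2 * s)) / 2 * cosh u) (at u)"
  unfolding jost_base_def jost_base_s_def jost_base_u_def
  by (auto intro!: derivative_eq_intros simp: field_simps)

lemma has_vector_derivative_of_real_powr:
  fixes b :: "real \<Rightarrow> real"
  assumes "(b has_real_derivative b') (at x)" "b x > 0"
  shows "((\<lambda>x. complex_of_real (b x) powr z) has_vector_derivative z * of_real (b x) powr (z - 1) * of_real b') (at x)"
proof -
  have "((\<lambda>w::complex. w powr z) has_field_derivative z * of_real (b x) powr (z - 1)) (at (complex_of_real (b x)))"
    using assms(2) by (intro has_field_derivative_powr) (simp add: complex_nonpos_Reals_iff)
  moreover have "((\<lambda>x. complex_of_real (b x)) has_vector_derivative of_real b') (at x)"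
    using assms(1) by (simp add: has_real_derivative_iff_has_vector_derivative has_vector_derivative_of_real)
  ultimately show ?thesis using field_vector_diff_chain_at by (fastforce simp: o_def mult.commute)
qed

lemma cmod_of_real_powr: "x > 0 \<Longrightarrow> cmod (complex_of_real x powr z) = x powr Re z"
  by (simp add: norm_powr_real_powr)

lemma of_real_powr_pred:
  "b > 0 \<Longrightarrow> complex_of_real b powr (z - 1) * of_real b = complex_of_real b powr z"
  by (simp add: powr_diff)

definition jost_wave :: "complex \<Rightarrow> real \<Rightarrow> real \<Rightarrow> real \<Rightarrow> complex" where
  "jost_wave a k s u = exp (\<i> * of_real (k * u)) * of_real (jost_base s u) powr a"

definition jost_wave1 :: "complex \<Rightarrow> real \<Rightarrow> real \<Rightarrow> real \<Rightarrow> complex" where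
  "jost_wave1 a k s u = exp (\<i> * of_real (k * u)) * (a * of_real (jost_base s u) powr (a - 1) * of_real (jost_base_s s u))"

definition jost_wave2 :: "complex \<Rightarrow> real \<Rightarrow> real \<Rightarrow> real \<Rightarrow> complex" where
  "jost_wave2 a k s u = exp (\<i> * of_real (k * u)) *
     (a * ((a - 1) * of_real (jost_base s u) powr (a - 1 - 1) * of_real (jost_base_s s u) * of_real (jost_base_s s u)
       + of_real (jost_base s u) powr (a - 1) * of_real (- 2 * jost_base_s s u)))"

text \<open>Only the power of \<open>jost_base\<close> is differentiated twice in \<open>u\<close>.
  The oscillating factor is left alone, to receive the derivatives by parts.\<close>

definition jost_wave_uu :: "complex \<Rightarrow> real \<Rightarrow> real \<Rightarrow> real \<Rightarrow> complex" where
  "jost_wave_uu a k s u = exp (\<i> * of_real (k * u)) *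
     (a * ((a - 1) * of_real (jost_base s u) powr (a - 1 - 1) * of_real (jost_base_u s u) * of_real (jost_base_u s u)
       + of_real (jost_base s u) powr (a - 1) * of_real ((1 + exp (- 2 * s)) / 2 * cosh u)))"

lemma jost_measurable [measurable]:
  "jost_wave a k s \<in> borel_measurable borel" "jost_wave1 a k s \<in> borel_measurable borel"
  "jost_wave2 a k s \<in> borel_measurable borel" "jost_wave_uu a k s \<in> borel_measurable borel"
  unfolding jost_wave_def jost_wave1_def jost_wave2_def jost_wave_uu_def jost_base_def jost_base_s_def jost_base_u_def
    cosh_field_def sinh_field_def
  by measurable

lemma jost_wave_deriv:
  "((\<lambda>s. jost_wave a k s u) has_vector_derivative jost_wave1 a k s u) (at s)"
  "((\<lambda>s. jost_wave1 a k s u) has_vector_derivative jost_wave2 a k s u) (at s)"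
proof -
  note b = jost_base_bounds(2)[of s u]
  note d = has_vector_derivative_of_real_powr[OF jost_base_derivs(1) b]
  have d1: "((\<lambda>s. complex_of_real (jost_base_s s u)) has_vector_derivative of_real (- 2 * jost_base_s s u)) (at s)"
    by (rule has_vector_derivative_of_real[OF jost_base_derivs(2)])
  show "((\<lambda>s. jost_wave a k s u) has_vector_derivative jost_wave1 a k s u) (at s)"
    unfolding jost_wave_def jost_wave1_def by (rule has_vector_derivative_mult_right[OF d])
  have "((\<lambda>s. a * (complex_of_real (jost_base s u) powr (a - 1) * of_real (jost_base_s s u))) has_vector_derivative
     a * (complex_of_real (jost_base s u) powr (a - 1) * of_real (- 2 * jost_base_s s u)
      + (a - 1) * of_real (jost_base s u) powr (a - 1 - 1) * of_real (jost_base_s s u) * of_real (jost_base_s s u))) (at s)"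
    by (intro has_vector_derivative_mult_right has_vector_derivative_mult d d1)
  from has_vector_derivative_mult_right[OF this, of "exp (\<i> * of_real (k * u))"]
  show "((\<lambda>s. jost_wave1 a k s u) has_vector_derivative jost_wave2 a k s u) (at s)"
    unfolding jost_wave1_def jost_wave2_def by (simp only: mult.assoc add.commute)
qed

text \<open>The bound \<open>(cosh u / 2) powr (- 1/2)\<close> for the power of
  \<open>jost_base\<close>, written with base \<open>2 * cosh u\<close> so that
  \<open>cosh_transform_integral\<close> gives its integrability.\<close>

definition jost_dom :: "real \<Rightarrow> real" where
  "jost_dom u = 2 * (2 * cosh u) powr (- 1/2)"

lemma integrable_jost_dom: "integrable lborel jost_dom"
proof -
  have "integrable lborel (\<lambda>u. norm (exp (\<i> * of_real (0 * u)) * complex_of_real (2 * cosh u) powr (- (1/2))))"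
    by (intro integrable_norm cosh_transform_integral(1)) simp
  also have "(\<lambda>u. norm (exp (\<i> * of_real (0 * u)) * complex_of_real (2 * cosh u) powr (- (1/2)))) = (\<lambda>u. (2 * cosh u) powr (- 1/2))"
    by (simp add: norm_mult cmod_of_real_powr fun_eq_iff del: of_real_mult)
  finally show ?thesis unfolding jost_dom_def by simp
qed

text \<open>A derivative of \<open>jost_base\<close> in \<open>s\<close> is at most a multiple of
  \<open>exp (- 2 * s)\<close> times the base itself. Differentiation therefore costs constants and
  such exponentials, but no growth in \<open>u\<close>.\<close>

lemma jost_wave_bounds:
  assumes a: "Re a = - 1/2"
  shows "cmod (jost_wave a k s u) \<le> jost_dom u"
    "cmod (jost_wave1 a k s u) \<le> 2 * cmod a * exp (- 2 * s) * jost_dom u"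
    "cmod (jost_wave2 a k s u) \<le> (4 * cmod a * cmod (a - 1) * (exp (- 2 * s))\<^sup>2 + 4 * cmod a * exp (- 2 * s)) * jost_dom u"
proof -
  note B = jost_base_bounds[where s = s and u = u]
  define \<beta> where "\<beta> = jost_base s u"
  define X where "X = exp (- 2 * s)"
  have X: "X > 0" by (simp add: X_def)
  have bp: "\<beta> > 0" and bc: "\<beta> \<ge> cosh u / 2" and bs: "\<bar>jost_base_s s u\<bar> \<le> 2 * X * \<beta>"
    using B by (simp_all add: \<beta>_def X_def)
  have e: "cmod (exp (\<i> * of_real (k * u))) = 1" by (simp add: norm_exp_eq_Re)
  have b0: "\<beta> powr (- 1/2) \<le> jost_dom u"
  proof -
    have "\<beta> powr (- 1/2) \<le> (cosh u / 2) powr (- 1/2)" using bc by (intro powr_mono2') auto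
    also have "cosh u / 2 = (2 * cosh u) * (1/4)" by simp
    also have "((2 * cosh u) * (1/4)) powr (- 1/2) = (2 * cosh u) powr (- 1/2) * (1/4) powr (- 1/2)"
      by (rule powr_mult)
    also have "(1/4) powr (- 1/2) = (2::real)"
    proof -
      have "(1/4::real) = 2 powr (- 2)" by (simp add: powr_minus_divide powr_numeral)
      then show ?thesis by (simp only: powr_powr) simp
    qed
    finally show ?thesis by (simp add: jost_dom_def)
  qed
  have n0: "cmod (of_real \<beta> powr a) = \<beta> powr (- 1/2)" using bp a by (simp add: cmod_of_real_powr)
  have n1: "cmod (of_real \<beta> powr (a - 1)) * \<beta> = \<beta> powr (- 1/2)"
    using of_real_powr_pred[OF bp, of a] n0 bp by (metis norm_mult norm_of_real abs_of_pos)
  have n2: "cmod (of_real \<beta> powr (a - 1 - 1)) * \<beta> * \<beta> = \<beta> powr (- 1/2)"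
    using of_real_powr_pred[OF bp, of "a - 1"] n1 bp by (metis norm_mult norm_of_real abs_of_pos)
  show "cmod (jost_wave a k s u) \<le> jost_dom u"
    using b0 n0 by (simp add: jost_wave_def norm_mult e \<beta>_def)
  have p1: "cmod (of_real \<beta> powr (a - 1)) * \<bar>jost_base_s s u\<bar> \<le> 2 * X * jost_dom u"
  proof -
    have "cmod (of_real \<beta> powr (a - 1)) * \<bar>jost_base_s s u\<bar> \<le> cmod (of_real \<beta> powr (a - 1)) * (2 * X * \<beta>)"
      using bs by (intro mult_left_mono) auto
    also have "\<dots> = 2 * X * \<beta> powr (- 1/2)" using n1 by (simp add: mult_ac)
    also have "\<dots> \<le> 2 * X * jost_dom u" using b0 X by (intro mult_left_mono) auto
    finally show ?thesis .
  qed
  have p2: "cmod (of_real \<beta> powr (a - 1 - 1)) * \<bar>jost_base_s s u\<bar> * \<bar>jost_base_s s u\<bar> \<le> 4 * X\<^sup>2 * jost_dom u"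
  proof -
    have "cmod (of_real \<beta> powr (a - 1 - 1)) * (\<bar>jost_base_s s u\<bar> * \<bar>jost_base_s s u\<bar>) \<le> cmod (of_real \<beta> powr (a - 1 - 1)) * ((2 * X * \<beta>) * (2 * X * \<beta>))"
      using bs X bp by (intro mult_left_mono mult_mono) auto
    also have "\<dots> = 4 * X\<^sup>2 * \<beta> powr (- 1/2)" unfolding n2[symmetric] by (simp add: power2_eq_square mult_ac)
    also have "\<dots> \<le> 4 * X\<^sup>2 * jost_dom u" using b0 X by (intro mult_left_mono) auto
    finally show ?thesis by (simp add: mult_ac)
  qed
  have "cmod (jost_wave1 a k s u) = cmod a * (cmod (of_real \<beta> powr (a - 1)) * \<bar>jost_base_s s u\<bar>)"
    by (simp add: jost_wave1_def norm_mult e \<beta>_def)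
  also have "\<dots> \<le> cmod a * (2 * X * jost_dom u)" using p1 by (intro mult_left_mono) auto
  finally show "cmod (jost_wave1 a k s u) \<le> 2 * cmod a * exp (- 2 * s) * jost_dom u" by (simp add: X_def mult_ac)
  have "cmod (jost_wave2 a k s u) \<le> cmod a * (cmod (a - 1) * (cmod (of_real \<beta> powr (a - 1 - 1)) * \<bar>jost_base_s s u\<bar> * \<bar>jost_base_s s u\<bar>)
       + 2 * (cmod (of_real \<beta> powr (a - 1)) * \<bar>jost_base_s s u\<bar>))"
    unfolding jost_wave2_def norm_mult e \<beta>_def[symmetric]
    using norm_triangle_ineq[of "(a - 1) * of_real \<beta> powr (a - 1 - 1) * of_real (jost_base_s s u) * of_real (jost_base_s s u)" "of_real \<beta> powr (a - 1) * of_real (- 2 * jost_base_s s u)"]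
    by (simp add: norm_mult mult_left_mono mult_ac)
  also have "\<dots> \<le> cmod a * (cmod (a - 1) * (4 * X\<^sup>2 * jost_dom u) + 2 * (2 * X * jost_dom u))"
    using p1 p2 by (intro mult_left_mono add_mono) auto
  finally show "cmod (jost_wave2 a k s u) \<le> (4 * cmod a * cmod (a - 1) * (exp (- 2 * s))\<^sup>2 + 4 * cmod a * exp (- 2 * s)) * jost_dom u"
    unfolding X_def[symmetric] by (simp add: algebra_simps)
qed

lemma jost_integrable:
  assumes a: "Re a = - 1/2"
  shows "integrable lborel (jost_wave a k s)" "integrable lborel (jost_wave1 a k s)" "integrable lborel (jost_wave2 a k s)"
proof -
  have d0: "jost_dom u \<ge> 0" for u by (simp add: jost_dom_def)
  show "integrable lborel (jost_wave a k s)"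
    by (rule Bochner_Integration.integrable_bound[OF integrable_jost_dom]) (use jost_wave_bounds(1)[OF a] d0 in auto)
  show "integrable lborel (jost_wave1 a k s)"
    by (rule Bochner_Integration.integrable_bound[OF integrable_mult_right[OF integrable_jost_dom, of "2 * cmod a * exp (- 2 * s)"]])
       (use jost_wave_bounds(2)[OF a] d0 in auto)
  show "integrable lborel (jost_wave2 a k s)"
    by (rule Bochner_Integration.integrable_bound[OF integrable_mult_right[OF integrable_jost_dom, of "4 * cmod a * cmod (a - 1) * (exp (- 2 * s))\<^sup>2 + 4 * cmod a * exp (- 2 * s)"]])
       (use jost_wave_bounds(3)[OF a] d0 in \<open>auto simp: abs_mult\<close>)
qed

text \<open>The eigenfunction equation for the power of the Poisson kernel, after splitting off
  \<open>exp (a * s)\<close>. With a common power of the base factored out it is an algebraic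
  identity in \<open>exp (- 2 * s)\<close> and \<open>cosh u\<close>.\<close>

lemma jost_wave_pde:
  "jost_wave2 a k s u + (2 * a + of_real (tanh s)) * jost_wave1 a k s u + a * (of_real (tanh s) - 1) * jost_wave a k s u
     = - jost_wave_uu a k s u / of_real ((cosh s)\<^sup>2)"
proof -
  define c X where "c = complex_of_real (cosh u)" and "X = complex_of_real (exp (- 2 * s))"
  define p where "p = complex_of_real (jost_base s u) powr (a - 1 - 1)"
  define e where "e = exp (\<i> * complex_of_real (k * u))"
  have Xp: "1 + X \<noteq> 0"
  proof -
    have "1 + exp (- 2 * s) > 0" by (simp add: add_pos_pos)
    then have "complex_of_real (1 + exp (- 2 * s)) \<noteq> 0" by (metis less_irrefl of_real_eq_0_iff)
    then show ?thesis by (simp add: X_def)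
  qed
  have ch: "1 / (cosh s)\<^sup>2 = 4 * exp (- 2 * s) / (1 + exp (- 2 * s))\<^sup>2" and th: "tanh s = (1 - exp (- 2 * s)) / (1 + exp (- 2 * s))"
  proof -
    have "cosh s = exp s * (1 + exp (- 2 * s)) / 2" by (simp add: cosh_field_def distrib_left exp_add[symmetric])
    then have "(cosh s)\<^sup>2 * (4 * exp (- 2 * s)) = ((exp s)\<^sup>2 * exp (- 2 * s)) * (1 + exp (- 2 * s))\<^sup>2"
      by (simp only: power_mult_distrib power_divide) (simp add: mult_ac)
    also have "(exp s)\<^sup>2 * exp (- 2 * s) = 1" by (simp add: power2_eq_square exp_add[symmetric])
    finally have "(cosh s)\<^sup>2 * (4 * exp (- 2 * s)) = (1 + exp (- 2 * s))\<^sup>2" by simp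
    moreover have "(1 + exp (- 2 * s))\<^sup>2 \<noteq> 0"
      using add_pos_pos[OF zero_less_one exp_gt_zero[of "- 2 * s"]] by (metis less_irrefl power_not_zero)
    ultimately show "1 / (cosh s)\<^sup>2 = 4 * exp (- 2 * s) / (1 + exp (- 2 * s))\<^sup>2"
      by (simp only: frac_eq_eq cosh_real_nonzero power_eq_0_iff simp_thms) (simp add: mult_ac)
    show "tanh s = (1 - exp (- 2 * s)) / (1 + exp (- 2 * s))" by (rule tanh_real_altdef)
  qed
  have t: "complex_of_real (tanh s) = (1 - X) / (1 + X)" by (simp add: th X_def)
  have sc: "1 / complex_of_real ((cosh s)\<^sup>2) = 4 * X / (1 + X)\<^sup>2"
    using arg_cong[OF ch, of complex_of_real] by (simp add: X_def)
  have b: "complex_of_real (jost_base s u) = ((c + 1) + X * (c - 1)) / 2"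
    by (simp add: jost_base_def c_def X_def)
  have bs: "complex_of_real (jost_base_s s u) = - X * (c - 1)" by (simp add: jost_base_s_def c_def X_def)
  have bu: "complex_of_real (jost_base_u s u) * of_real (jost_base_u s u) = ((1 + X) / 2)\<^sup>2 * (c\<^sup>2 - 1)"
  proof -
    have "jost_base_u s u * jost_base_u s u = ((1 + exp (- 2 * s)) / 2)\<^sup>2 * ((cosh u)\<^sup>2 - 1)"
      using cosh_square_eq[of u] by (simp add: jost_base_u_def power2_eq_square)
    then have "complex_of_real (jost_base_u s u * jost_base_u s u) = of_real (((1 + exp (- 2 * s)) / 2)\<^sup>2 * ((cosh u)\<^sup>2 - 1))" by simp
    then show ?thesis by (simp add: c_def X_def)
  qed
  have p1: "complex_of_real (jost_base s u) powr (a - 1) = p * of_real (jost_base s u)"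
    using of_real_powr_pred[OF jost_base_bounds(2), of s u "a - 1"] by (simp add: p_def)
  have p0: "complex_of_real (jost_base s u) powr a = p * of_real (jost_base s u) * of_real (jost_base s u)"
    using of_real_powr_pred[OF jost_base_bounds(2), of s u a] p1 by simp
  define b where "b = complex_of_real (jost_base s u)"
  have bb: "2 * b = (c + 1) + X * (c - 1)" unfolding b_def b by simp
  \<comment> \<open>The identity multiplied by \<open>(1 + X)^2\<close>, which clears the
    denominators of \<open>tanh s\<close> and \<open>1 / (cosh s)^2\<close>.\<close>
  have key: "(1 + X)\<^sup>2 * ((a - 1) * (X * (c - 1))\<^sup>2 + b * (2 * (X * (c - 1)))) - (2 * a * (1 + X) + (1 - X)) * (1 + X) * b * (X * (c - 1)) - 2 * X * (1 + X) * b\<^sup>2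
     = - 4 * X * ((a - 1) * (((1 + X) / 2)\<^sup>2 * (c\<^sup>2 - 1)) + b * ((1 + X) / 2 * c))"
  proof -
    have "b = ((c + 1) + X * (c - 1)) / 2" using bb by (simp add: mult.commute)
    then show ?thesis by (simp add: field_simps) algebra
  qed
  have L: "jost_wave2 a k s u + (2 * a + of_real (tanh s)) * jost_wave1 a k s u + a * (of_real (tanh s) - 1) * jost_wave a k s u
    = e * a * p * ((1 + X)\<^sup>2 * ((a - 1) * (X * (c - 1))\<^sup>2 + b * (2 * (X * (c - 1)))) - (2 * a * (1 + X) + (1 - X)) * (1 + X) * b * (X * (c - 1)) - 2 * X * (1 + X) * b\<^sup>2) / (1 + X)\<^sup>2"
  proof -
    have alg: "e * (a * ((a - 1) * p * y * y + p * b * (- 2 * y))) + (2 * a + t) * (e * (a * (p * b) * y)) + a * (t - 1) * (e * (p * b * b))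
      = e * a * p * ((a - 1) * y\<^sup>2 - 2 * b * y + (2 * a + t) * b * y + (t - 1) * b\<^sup>2)" for y t
      by (simp add: algebra_simps power2_eq_square)
    have "complex_of_real (- 2 * jost_base_s s u) = - 2 * (- X * (c - 1))" unfolding bs[symmetric] by simp
    then have "jost_wave2 a k s u + (2 * a + of_real (tanh s)) * jost_wave1 a k s u + a * (of_real (tanh s) - 1) * jost_wave a k s u
       = e * a * p * ((a - 1) * (- X * (c - 1))\<^sup>2 - 2 * b * (- X * (c - 1)) + (2 * a + (1 - X) / (1 + X)) * b * (- X * (c - 1)) + ((1 - X) / (1 + X) - 1) * b\<^sup>2)"
      unfolding alg[symmetric] jost_wave_def jost_wave1_def jost_wave2_def e_def[symmetric] p_def[symmetric] p1 p0 bs t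
      by (simp only: b_def)
    also have "(a - 1) * (- X * (c - 1))\<^sup>2 - 2 * b * (- X * (c - 1)) + (2 * a + (1 - X) / (1 + X)) * b * (- X * (c - 1)) + ((1 - X) / (1 + X) - 1) * b\<^sup>2
       = ((1 + X)\<^sup>2 * ((a - 1) * (X * (c - 1))\<^sup>2 + b * (2 * (X * (c - 1)))) - (2 * a * (1 + X) + (1 - X)) * (1 + X) * b * (X * (c - 1)) - 2 * X * (1 + X) * b\<^sup>2) / (1 + X)\<^sup>2"
    proof -
      define m where "m = 1 + X"
      have X: "X = m - 1" and m: "m \<noteq> 0" using Xp by (simp_all add: m_def)
      have "(1 - X) / (1 + X) = (2 - m) / m" by (simp add: X)
      then show ?thesis unfolding m_def[symmetric] using m by (simp add: X divide_simps) algebra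
    qed
    finally show ?thesis by simp
  qed
  have R: "- jost_wave_uu a k s u / of_real ((cosh s)\<^sup>2) = e * a * p * (- 4 * X * ((a - 1) * (((1 + X) / 2)\<^sup>2 * (c\<^sup>2 - 1)) + b * ((1 + X) / 2 * c))) / (1 + X)\<^sup>2"
  proof -
    have "jost_wave_uu a k s u = e * (a * p * ((a - 1) * (((1 + X) / 2)\<^sup>2 * (c\<^sup>2 - 1)) + b * ((1 + X) / 2 * c)))"
    proof -
      have "e * (a * ((a - 1) * p * y * y + p * b * z)) = e * (a * p * ((a - 1) * (y * y) + b * z))" for y z
        by (simp add: algebra_simps)
      moreover have "complex_of_real ((1 + exp (- 2 * s)) / 2 * cosh u) = (1 + X) / 2 * c" by (simp add: c_def X_def)
      ultimately show ?thesis unfolding jost_wave_uu_def e_def[symmetric] p_def[symmetric] p1 bu[symmetric]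
        by (simp only: b_def)
    qed
    then have "- jost_wave_uu a k s u / of_real ((cosh s)\<^sup>2) = - (e * (a * p * ((a - 1) * (((1 + X) / 2)\<^sup>2 * (c\<^sup>2 - 1)) + b * ((1 + X) / 2 * c)))) * (1 / of_real ((cosh s)\<^sup>2))"
      by simp
    then show ?thesis unfolding sc by simp
  qed
  show ?thesis unfolding L R key ..
qed

lemma jost_dom_tendsto: "(jost_dom \<longlongrightarrow> 0) at_top" "(jost_dom \<longlongrightarrow> 0) at_bot"
proof -
  have t: "filterlim (\<lambda>u::real. 2 * cosh u) at_top at_top" "filterlim (\<lambda>u::real. 2 * cosh u) at_top at_bot"
    by (rule filterlim_tendsto_pos_mult_at_top[OF tendsto_const _ cosh_real_at_top], simp)
       (rule filterlim_tendsto_pos_mult_at_top[OF tendsto_const _ cosh_real_at_bot], simp)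
  have "((\<lambda>u::real. 2 * (2 * cosh u) powr (- 1/2)) \<longlongrightarrow> 2 * 0) at_top" "((\<lambda>u::real. 2 * (2 * cosh u) powr (- 1/2)) \<longlongrightarrow> 2 * 0) at_bot"
    by (intro tendsto_mult tendsto_const tendsto_neg_powr t; simp)+
  then show "(jost_dom \<longlongrightarrow> 0) at_top" "(jost_dom \<longlongrightarrow> 0) at_bot" unfolding jost_dom_def[abs_def] by simp_all
qed

text \<open>Two integrations by parts in \<open>u\<close>. Integrability comes from
  \<open>jost_wave_pde\<close>, which expresses the integrand by functions already known to be
  integrable.\<close>

lemma jost_wave_uu_integral:
  assumes a: "Re a = - 1/2"
  shows "(LINT u|lborel. jost_wave_uu a k s u) = - of_real (k\<^sup>2) * (LINT u|lborel. jost_wave a k s u)"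
    and "integrable lborel (jost_wave_uu a k s)"
proof -
  have uu: "jost_wave_uu a k s u = - of_real ((cosh s)\<^sup>2) * (jost_wave2 a k s u + (2 * a + of_real (tanh s)) * jost_wave1 a k s u + a * (of_real (tanh s) - 1) * jost_wave a k s u)" for u
    unfolding jost_wave_pde by simp
  show uui: "integrable lborel (jost_wave_uu a k s)"
    unfolding uu by (intro integrable_mult_right Bochner_Integration.integrable_add jost_integrable[OF a])
  \<comment> \<open>An antiderivative of \<open>jost_wave_uu\<close> plus \<open>k^2\<close> times
    \<open>jost_wave\<close>; it is bounded by a multiple of \<open>jost_dom\<close> and so vanishes
    at both ends.\<close>
  define F where "F = (\<lambda>u. exp (\<i> * of_real (k * u)) * (a * of_real (jost_base s u) powr (a - 1) * of_real (jost_base_u s u) - \<i> * of_real k * of_real (jost_base s u) powr a))"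
  define f where "f = (\<lambda>u. jost_wave_uu a k s u + of_real (k\<^sup>2) * jost_wave a k s u)"
  have dp: "((\<lambda>u. complex_of_real (jost_base s u) powr z) has_vector_derivative z * of_real (jost_base s u) powr (z - 1) * of_real (jost_base_u s u)) (at u)" for z u
    by (rule has_vector_derivative_of_real_powr[OF jost_base_derivs(3) jost_base_bounds(2)])
  have du: "((\<lambda>u. complex_of_real (jost_base_u s u)) has_vector_derivative of_real ((1 + exp (- 2 * s)) / 2 * cosh u)) (at u)" for u
    by (rule has_vector_derivative_of_real[OF jost_base_derivs(4)])
  have de: "((\<lambda>u. exp (\<i> * of_real (k * u))) has_vector_derivative \<i> * of_real k * exp (\<i> * of_real (k * u))) (at u)" for u
  proof -
    have "((\<lambda>u. exp (u *\<^sub>R (\<i> * of_real k))) has_vector_derivative exp (u *\<^sub>R (\<i> * of_real k)) * (\<i> * of_real k)) (at u)"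
      by (rule exp_scaleR_has_vector_derivative_right)
    then show ?thesis by (simp add: scaleR_conv_of_real mult_ac)
  qed
  have alg: "e * (a * (P1 * U + (a - 1) * P2 * b * b) - \<i> * of_real k * (a * P1 * b)) + \<i> * of_real k * e * (a * (P1 * b) - \<i> * of_real k * P0)
      = e * (a * ((a - 1) * P2 * b * b + P1 * U)) + of_real (k\<^sup>2) * (e * P0)" for e P0 P1 P2 b U :: complex
    by (simp add: algebra_simps power2_eq_square)
  have Fd: "(F has_vector_derivative f u) (at u)" for u
  proof -
    have "((\<lambda>u. a * (complex_of_real (jost_base s u) powr (a - 1) * of_real (jost_base_u s u)) - \<i> * of_real k * of_real (jost_base s u) powr a)
      has_vector_derivative a * (of_real (jost_base s u) powr (a - 1) * of_real ((1 + exp (- 2 * s)) / 2 * cosh u)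
        + (a - 1) * of_real (jost_base s u) powr (a - 1 - 1) * of_real (jost_base_u s u) * of_real (jost_base_u s u))
        - \<i> * of_real k * (a * of_real (jost_base s u) powr (a - 1) * of_real (jost_base_u s u))) (at u)"
      by (intro has_vector_derivative_diff has_vector_derivative_mult_right has_vector_derivative_mult dp du)
    from has_vector_derivative_mult[OF de this]
    have "((\<lambda>u. exp (\<i> * of_real (k * u)) * (a * (complex_of_real (jost_base s u) powr (a - 1) * of_real (jost_base_u s u)) - \<i> * of_real k * of_real (jost_base s u) powr a))
      has_vector_derivative f u) (at u)"
      by (rule has_vector_derivative_eq_rhs) (simp only: f_def jost_wave_uu_def jost_wave_def alg)
    then show ?thesis by (simp add: F_def mult.assoc)
  qed
  have fc: "isCont f u" for u
  proof -
    have c: "isCont (\<lambda>u. complex_of_real (jost_base s u) powr z) u" "isCont (\<lambda>u. complex_of_real (jost_base_u s u)) u"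
      "isCont (\<lambda>u. exp (\<i> * complex_of_real (k * u))) u" for z u
      using has_vector_derivative_continuous[OF dp] has_vector_derivative_continuous[OF du] has_vector_derivative_continuous[OF de] by auto
    have "((\<lambda>u. (1 + exp (- 2 * s)) / 2 * cosh u) has_real_derivative (1 + exp (- 2 * s)) / 2 * sinh u) (at u)"
      by (auto intro!: derivative_eq_intros)
    then have c': "isCont (\<lambda>u. complex_of_real ((1 + exp (- 2 * s)) / 2 * cosh u)) u"
      by (rule continuous_of_real[OF DERIV_isCont])
    show ?thesis unfolding f_def jost_wave_uu_def jost_wave_def
      by (intro c c' continuous_add continuous_mult continuous_const)
  qed
  have Fb: "cmod (F u) \<le> (cmod a * (1 + exp (- 2 * s)) + \<bar>k\<bar>) * jost_dom u" for u
  proof -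
    have e: "cmod (exp (\<i> * of_real (k * u))) = 1" by (simp add: norm_exp_eq_Re)
    have j: "cmod (of_real (jost_base s u) powr a) \<le> jost_dom u"
      using jost_wave_bounds(1)[OF a, of k s u] by (simp add: jost_wave_def norm_mult e)
    have bp: "jost_base s u > 0" by (rule jost_base_bounds)
    have "cmod (of_real (jost_base s u) powr (a - 1)) * \<bar>jost_base_u s u\<bar> \<le> cmod (of_real (jost_base s u) powr (a - 1)) * ((1 + exp (- 2 * s)) * jost_base s u)"
      by (intro mult_left_mono jost_base_bounds) auto
    also have "\<dots> = (1 + exp (- 2 * s)) * cmod (of_real (jost_base s u) powr (a - 1) * of_real (jost_base s u))"
      using bp by (simp add: norm_mult)
    also have "\<dots> = (1 + exp (- 2 * s)) * cmod (of_real (jost_base s u) powr a)" using of_real_powr_pred[OF bp] by simp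
    also have "\<dots> \<le> (1 + exp (- 2 * s)) * jost_dom u" using j by (intro mult_left_mono) (auto intro: add_nonneg_nonneg)
    finally have 1: "cmod (of_real (jost_base s u) powr (a - 1)) * \<bar>jost_base_u s u\<bar> \<le> (1 + exp (- 2 * s)) * jost_dom u" .
    have "cmod (F u) \<le> cmod a * (cmod (of_real (jost_base s u) powr (a - 1)) * \<bar>jost_base_u s u\<bar>) + \<bar>k\<bar> * cmod (of_real (jost_base s u) powr a)"
      unfolding F_def norm_mult e
      using norm_triangle_ineq4[of "a * of_real (jost_base s u) powr (a - 1) * of_real (jost_base_u s u)" "\<i> * of_real k * of_real (jost_base s u) powr a"]
      by (simp add: norm_mult mult.assoc)
    also have "\<dots> \<le> cmod a * ((1 + exp (- 2 * s)) * jost_dom u) + \<bar>k\<bar> * jost_dom u"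
      using 1 j by (intro add_mono mult_left_mono) auto
    finally show ?thesis by (simp add: algebra_simps)
  qed
  have Ft: "(F \<longlongrightarrow> 0) G" if "(jost_dom \<longlongrightarrow> 0) G" for G
    by (rule Lim_null_comparison[OF _ tendsto_mult_right_zero[OF that, of "cmod a * (1 + exp (- 2 * s)) + \<bar>k\<bar>"]])
       (use Fb in auto)
  have fi: "integrable lborel f" unfolding f_def using uui jost_integrable(1)[OF a] by simp
  have "(LBINT u=-\<infinity>..\<infinity>. f u) = 0 - 0"
    by (rule interval_integral_FTC_integrable[where F = F])
       (use Fd fc fi Ft jost_dom_tendsto in \<open>auto simp: set_integrable_def ereal_tendsto_simps\<close>)
  then have "integral\<^sup>L lborel f = 0" by (simp add: interval_lebesgue_integral_def set_lebesgue_integral_def)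
  then show "(LINT u|lborel. jost_wave_uu a k s u) = - of_real (k\<^sup>2) * (LINT u|lborel. jost_wave a k s u)"
  proof -
    have "integral\<^sup>L lborel f = (LINT u|lborel. jost_wave_uu a k s u) + of_real (k\<^sup>2) * (LINT u|lborel. jost_wave a k s u)"
      unfolding f_def using uui jost_integrable(1)[OF a] by simp
    then show ?thesis using \<open>integral\<^sup>L lborel f = 0\<close> by (simp add: eq_neg_iff_add_eq_0)
  qed
qed

lemma jost_integral_derivs:
  assumes a: "Re a = - 1/2"
  shows "((\<lambda>s. LINT u|lborel. jost_wave a k s u) has_vector_derivative (LINT u|lborel. jost_wave1 a k s u)) (at s)"
    "((\<lambda>s. LINT u|lborel. jost_wave1 a k s u) has_vector_derivative (LINT u|lborel. jost_wave2 a k s u)) (at s)"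
proof -
  \<comment> \<open>The maximal size of \<open>exp (- 2 * s')\<close> for \<open>s'\<close> within
    distance 1 of \<open>s\<close>; it makes the bounds uniform for differentiation under the
    integral.\<close>
  define E where "E = exp (- 2 * s + 2)"
  have E: "exp (- 2 * s') \<le> E" if "s' \<in> ball s 1" for s' using that by (auto simp: E_def dist_real_def)
  have d0: "jost_dom u \<ge> 0" for u by (simp add: jost_dom_def)
  show "((\<lambda>s. LINT u|lborel. jost_wave a k s u) has_vector_derivative (LINT u|lborel. jost_wave1 a k s u)) (at s)"
  proof (rule has_vector_derivative_lebesgue_integral)
    fix s' u assume "s' \<in> ball s 1"
    then show "cmod (jost_wave1 a k s' u) \<le> 2 * cmod a * E * jost_dom u"
      by (intro order_trans[OF jost_wave_bounds(2)[OF a]] mult_right_mono mult_left_mono E d0) auto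
  qed (auto intro!: jost_integrable jost_wave_deriv a integrable_jost_dom)
  show "((\<lambda>s. LINT u|lborel. jost_wave1 a k s u) has_vector_derivative (LINT u|lborel. jost_wave2 a k s u)) (at s)"
  proof (rule has_vector_derivative_lebesgue_integral)
    fix s' u assume "s' \<in> ball s 1"
    then show "cmod (jost_wave2 a k s' u) \<le> (4 * cmod a * cmod (a - 1) * E\<^sup>2 + 4 * cmod a * E) * jost_dom u"
      by (intro order_trans[OF jost_wave_bounds(3)[OF a]] mult_right_mono mult_left_mono add_mono power_mono E d0) auto
  qed (auto intro!: jost_integrable jost_wave_deriv a integrable_jost_dom)
qed

text \<open>The base tends to \<open>(cosh u + 1) / 2\<close>, the square of
  \<open>cosh (u / 2)\<close>; with \<open>u = 2 * v\<close> both the exponent and the frequency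
  double. Of the factor 4, one 2 comes from the substitution and one from
  \<open>exp (- 2 * a * of_real (ln 2))\<close>.\<close>

lemma jost_integral_limit:
  assumes a: "Re a = - 1/2"
  obtains L where "((\<lambda>s. LINT u|lborel. jost_wave a k s u) \<longlongrightarrow> L) at_top" "cmod L = 4 * cmod (cosh_transform (- 2 * a) (2 * k))"
proof -
  define W where "W = (\<lambda>u. exp (\<i> * of_real (k * u)) * complex_of_real ((cosh u + 1) / 2) powr a)"
  have Wm [measurable]: "W \<in> borel_measurable borel" unfolding W_def cosh_field_def by measurable
  have lim: "((\<lambda>s. LINT u|lborel. jost_wave a k s u) \<longlongrightarrow> (LINT u|lborel. W u)) at_top"
  proof (rule integral_dominated_convergence_at_top[OF _ _ integrable_jost_dom])
    show "\<forall>\<^sub>F s in at_top. AE u in lborel. norm (jost_wave a k s u) \<le> jost_dom u"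
      using jost_wave_bounds(1)[OF a] by simp
    show "AE u in lborel. ((\<lambda>s. jost_wave a k s u) \<longlongrightarrow> W u) at_top"
    proof (rule AE_I2)
      fix u
      have "((\<lambda>s. exp (- 2 * s)) \<longlongrightarrow> (0::real)) at_top" by real_asymp
      then have "((\<lambda>s. jost_base s u) \<longlongrightarrow> ((cosh u + 1) + 0 * (cosh u - 1)) / 2) at_top"
        unfolding jost_base_def by (intro tendsto_intros) auto
      then have b: "((\<lambda>s. complex_of_real (jost_base s u)) \<longlongrightarrow> of_real ((cosh u + 1) / 2)) at_top"
        by (intro tendsto_of_real) simp
      have "(cosh u + 1) / 2 > 0" using cosh_real_pos[of u] by (simp add: add_pos_pos)
      then have "complex_of_real ((cosh u + 1) / 2) \<notin> \<real>\<^sub>\<le>\<^sub>0" by (simp only: complex_nonpos_Reals_iff) simp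
      then show "((\<lambda>s. jost_wave a k s u) \<longlongrightarrow> W u) at_top"
        unfolding jost_wave_def W_def by (intro tendsto_mult tendsto_const tendsto_powr_complex b)
    qed
  qed measurable
  have "(LINT u|lborel. W u) = 2 * (LINT v|lborel. W (0 + 2 * v))"
    using lborel_integral_real_affine[of 2 W 0] by (simp add: scaleR_conv_of_real)
  also have "(\<lambda>v. W (0 + 2 * v)) = (\<lambda>v. exp (- 2 * a * of_real (ln 2)) * (exp (\<i> * of_real (2 * k * v)) * of_real (2 * cosh v) powr (- (- 2 * a))))"
  proof
    fix v :: real
    have cp: "cosh v > 0" by simp
    have "(cosh (2 * v) + 1) / 2 = (cosh v)\<^sup>2" by (simp add: cosh_double_cosh)
    then have "complex_of_real ((cosh (2 * v) + 1) / 2) powr a = exp (a * of_real (ln ((cosh v)\<^sup>2)))"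
      by (simp only:) (simp add: powr_def Ln_of_real del: of_real_power)
    also have "a * of_real (ln ((cosh v)\<^sup>2)) = - 2 * a * of_real (ln 2) + (- (- 2 * a)) * of_real (ln (2 * cosh v))"
      by (simp add: ln_mult ln_realpow algebra_simps)
    also have "exp \<dots> = exp (- 2 * a * of_real (ln 2)) * of_real (2 * cosh v) powr (- (- 2 * a))"
      unfolding exp_add by (simp add: powr_def Ln_of_real del: of_real_mult)
    finally show "W (0 + 2 * v) = exp (- 2 * a * of_real (ln 2)) * (exp (\<i> * of_real (2 * k * v)) * of_real (2 * cosh v) powr (- (- 2 * a)))"
      by (simp only: W_def add_0) (simp add: mult_ac)
  qed
  also have "(LINT v|lborel. exp (- 2 * a * of_real (ln 2)) * (exp (\<i> * of_real (2 * k * v)) * of_real (2 * cosh v) powr (- (- 2 * a))))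
      = exp (- 2 * a * of_real (ln 2)) * cosh_transform (- 2 * a) (2 * k)"
    unfolding cosh_transform_def by (rule integral_mult_right_zero)
  finally have "cmod (LINT u|lborel. W u) = 4 * cmod (cosh_transform (- 2 * a) (2 * k))"
    using a by (simp add: norm_mult norm_exp_eq_Re)
  with lim show ?thesis by (rule that)
qed

text \<open>Up to the normalization in \<open>w\<close>, \<psi> is the Fourier transform in
  \<open>u\<close> of a power of the Poisson kernel. At \<open>s = 0\<close> the kernel is
  \<open>cosh u\<close> and its derivative 1, so \<open>\<psi>'\<close> there is the transform with
  exponent raised to 3/2; the limit at infinity is that of
  \<open>jost_integral_limit\<close>.\<close>

lemma jost_solution:
  fixes r k :: real
  obtains \<psi> \<psi>' :: "real \<Rightarrow> complex" and K where
    "\<And>s. (\<psi> has_vector_derivative \<psi>' s) (at s)"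
    "\<And>s. (\<psi>' has_vector_derivative of_real ((k\<^sup>2 + 1/4) / (cosh s)\<^sup>2 - r\<^sup>2) * \<psi> s) (at s)"
    "cmod (\<psi>' 0) = 2 * sqrt 2 * cmod (1/2 - \<i> * r) * cmod (cosh_transform (3/2 - \<i> * r) k)"
    "((\<lambda>s. cmod (\<psi> s)) \<longlongrightarrow> 2 * sqrt 2 * cmod (cosh_transform (1 - 2 * \<i> * r) (2 * k))) at_top"
    "\<And>s. s \<ge> 0 \<Longrightarrow> cmod (\<psi>' s - \<i> * r * \<psi> s) \<le> K * exp (- 2 * s)"
proof -
  define a :: complex where "a = - 1/2 + \<i> * r"
  have a: "Re a = - 1/2" by (simp add: a_def)
  have a2: "a * (a + 1) = - of_real (r\<^sup>2 + 1/4)" by (simp add: a_def algebra_simps power2_eq_square)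
  define N0 where "N0 = (\<lambda>s. LINT u|lborel. jost_wave a k s u)"
  define N1 where "N1 = (\<lambda>s. LINT u|lborel. jost_wave1 a k s u)"
  define N2 where "N2 = (\<lambda>s. LINT u|lborel. jost_wave2 a k s u)"
  have dN0: "(N0 has_vector_derivative N1 s) (at s)" and dN1: "(N1 has_vector_derivative N2 s) (at s)" for s
    unfolding N0_def N1_def N2_def by (rule jost_integral_derivs[OF a])+
  have ode: "N2 s + (2 * a + of_real (tanh s)) * N1 s + a * (of_real (tanh s) - 1) * N0 s = of_real (k\<^sup>2) * N0 s / of_real ((cosh s)\<^sup>2)" for s
  proof -
    have "N2 s + (2 * a + of_real (tanh s)) * N1 s + a * (of_real (tanh s) - 1) * N0 s
       = (LINT u|lborel. jost_wave2 a k s u + (2 * a + of_real (tanh s)) * jost_wave1 a k s u + a * (of_real (tanh s) - 1) * jost_wave a k s u)"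
      unfolding N0_def N1_def N2_def using jost_integrable[OF a] by simp
    also have "\<dots> = - (LINT u|lborel. jost_wave_uu a k s u) / of_real ((cosh s)\<^sup>2)"
      unfolding jost_wave_pde by simp
    finally show ?thesis unfolding jost_wave_uu_integral(1)[OF a] by (simp add: N0_def)
  qed
  \<comment> \<open>Restores the factor \<open>exp (a * s)\<close> missing in
    \<open>jost_base\<close> and adds the \<open>sqrt (cosh s)\<close> of the Liouville normal
    form.\<close>
  define w where "w = (\<lambda>s. of_real (sqrt (cosh s)) * exp (s *\<^sub>R a))"
  define T where "T = (\<lambda>s. complex_of_real (tanh s / 2))"
  have dw: "(w has_vector_derivative w s * (a + T s)) (at s)" for s
  proof -
    have "((\<lambda>s. sqrt (cosh s)) has_real_derivative sqrt (cosh s) * (tanh s / 2)) (at s)"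
    proof -
      have "((\<lambda>s. sqrt (cosh s)) has_real_derivative inverse (sqrt (cosh s)) / 2 * (sinh s * 1)) (at s)"
        by (rule DERIV_chain2[OF DERIV_real_sqrt[OF cosh_real_pos] has_field_derivative_cosh[OF DERIV_ident]])
      then show ?thesis
      proof (rule DERIV_cong)
        have "sqrt (cosh s) * sqrt (cosh s) = cosh s" by simp
        then have "inverse (sqrt (cosh s)) = sqrt (cosh s) / cosh s" by (simp add: field_simps)
        then show "inverse (sqrt (cosh s)) / 2 * (sinh s * 1) = sqrt (cosh s) * (tanh s / 2)" by (simp add: tanh_def)
      qed
    qed
    then have d: "((\<lambda>s. complex_of_real (sqrt (cosh s))) has_vector_derivative of_real (sqrt (cosh s) * (tanh s / 2))) (at s)"
      by (rule has_vector_derivative_of_real)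
    show ?thesis unfolding w_def
      by (rule has_vector_derivative_eq_rhs[OF has_vector_derivative_mult[OF d exp_scaleR_has_vector_derivative_right]])
         (simp add: T_def algebra_simps)
  qed
  have dT: "(T has_vector_derivative of_real ((1 - (tanh s)\<^sup>2) / 2)) (at s)" for s
    unfolding T_def by (rule has_vector_derivative_of_real) (auto intro!: derivative_eq_intros)
  define \<psi> where "\<psi> = (\<lambda>s. w s * N0 s)"
  define \<psi>' where "\<psi>' = (\<lambda>s. w s * (N1 s + (a + T s) * N0 s))"
  have 1: "(\<psi> has_vector_derivative \<psi>' s) (at s)" for s
    unfolding \<psi>_def by (rule has_vector_derivative_eq_rhs[OF has_vector_derivative_mult[OF dw dN0]]) (simp add: \<psi>'_def algebra_simps)
  have 2: "(\<psi>' has_vector_derivative of_real ((k\<^sup>2 + 1/4) / (cosh s)\<^sup>2 - r\<^sup>2) * \<psi> s) (at s)" for s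
  proof -
    have dS: "((\<lambda>s. a + T s) has_vector_derivative of_real ((1 - (tanh s)\<^sup>2) / 2)) (at s)"
      by (rule has_vector_derivative_eq_rhs[OF has_vector_derivative_add[OF has_vector_derivative_const dT]]) simp
    have d: "(\<psi>' has_vector_derivative w s * (N2 s + ((a + T s) * N1 s + of_real ((1 - (tanh s)\<^sup>2) / 2) * N0 s)) + w s * (a + T s) * (N1 s + (a + T s) * N0 s)) (at s)"
      unfolding \<psi>'_def by (intro has_vector_derivative_mult has_vector_derivative_add dS dw dN0 dN1)
    have sech: "1 / (cosh s)\<^sup>2 = 1 - (tanh s)\<^sup>2"
    proof -
      have "1 - (tanh s)\<^sup>2 = ((cosh s)\<^sup>2 - (sinh s)\<^sup>2) / (cosh s)\<^sup>2" by (simp add: tanh_def power_divide diff_divide_distrib)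
      also have "(cosh s)\<^sup>2 - (sinh s)\<^sup>2 = 1" by (simp add: cosh_square_eq)
      finally show ?thesis ..
    qed
    define t where "t = complex_of_real (tanh s)"
    have S: "1 / complex_of_real ((cosh s)\<^sup>2) = 1 - t\<^sup>2"
      using arg_cong[OF sech, of complex_of_real] by (simp add: t_def)
    have n2: "N2 s = of_real (k\<^sup>2) * N0 s * (1 - t\<^sup>2) - (2 * a + t) * N1 s - a * (t - 1) * N0 s"
    proof -
      have "N2 s + (2 * a + t) * N1 s + a * (t - 1) * N0 s = of_real (k\<^sup>2) * N0 s * (1 / complex_of_real ((cosh s)\<^sup>2))"
        using ode[of s] by (simp add: t_def)
      then show ?thesis unfolding S by (simp add: algebra_simps)
    qed
    have Tt: "T s = t / 2" by (simp add: T_def t_def)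
    have pot: "complex_of_real ((k\<^sup>2 + 1/4) / (cosh s)\<^sup>2 - r\<^sup>2) = (of_real (k\<^sup>2) + 1/4) * (1 - t\<^sup>2) + a * (a + 1) + 1/4"
    proof -
      have "complex_of_real ((k\<^sup>2 + 1/4) / (cosh s)\<^sup>2) = (of_real (k\<^sup>2) + 1/4) * (1 / complex_of_real ((cosh s)\<^sup>2))" by simp
      then show ?thesis unfolding S a2 by simp
    qed
    have h: "complex_of_real ((1 - (tanh s)\<^sup>2) / 2) = (1 - t\<^sup>2) / 2" by (simp add: t_def)
    show ?thesis
      by (rule has_vector_derivative_eq_rhs[OF d], unfold pot h n2 Tt \<psi>_def) (simp add: field_simps power2_eq_square)
  qed
  have 3: "cmod (\<psi>' 0) = 2 * sqrt 2 * cmod (1/2 - \<i> * r) * cmod (cosh_transform (3/2 - \<i> * r) k)"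
  proof -
    have "\<psi>' 0 = N1 0 + a * N0 0" by (simp add: \<psi>'_def w_def T_def)
    also have "\<dots> = (LINT u|lborel. jost_wave1 a k 0 u + a * jost_wave a k 0 u)"
      unfolding N0_def N1_def using jost_integrable[OF a] by simp
    also have "(\<lambda>u. jost_wave1 a k 0 u + a * jost_wave a k 0 u)
        = (\<lambda>u. a * exp ((1 - a) * of_real (ln 2)) * (exp (\<i> * of_real (k * u)) * of_real (2 * cosh u) powr (- (3/2 - \<i> * r))))"
    proof
      fix u :: real
      have b: "jost_base 0 u = cosh u" "jost_base_s 0 u = 1 - cosh u" by (simp_all add: jost_base_def jost_base_s_def)
      have e: "- (3/2 - \<i> * r) = a - 1" by (simp add: a_def)
      have p: "complex_of_real (cosh u) powr a = of_real (cosh u) powr (a - 1) * of_real (cosh u)"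
        by (simp add: of_real_powr_pred)
      have q: "complex_of_real (cosh u) powr (a - 1) = exp ((1 - a) * of_real (ln 2)) * of_real (2 * cosh u) powr (a - 1)"
      proof -
        have "(a - 1) * of_real (ln (cosh u)) = (1 - a) * of_real (ln 2) + (a - 1) * of_real (ln (2 * cosh u))"
          by (simp add: ln_mult algebra_simps)
        moreover have "complex_of_real (cosh u) powr (a - 1) = exp ((a - 1) * of_real (ln (cosh u)))"
          "complex_of_real (2 * cosh u) powr (a - 1) = exp ((a - 1) * of_real (ln (2 * cosh u)))"
          using cosh_real_pos[of u] by (simp_all add: powr_def Ln_of_real del: of_real_mult)
        ultimately show ?thesis by (simp only: exp_add)
      qed
      have "jost_wave1 a k 0 u + a * jost_wave a k 0 u = a * (exp (\<i> * of_real (k * u)) * of_real (cosh u) powr (a - 1))"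
        unfolding jost_wave1_def jost_wave_def b p by (simp add: algebra_simps)
      then show "jost_wave1 a k 0 u + a * jost_wave a k 0 u = a * exp ((1 - a) * of_real (ln 2)) * (exp (\<i> * of_real (k * u)) * of_real (2 * cosh u) powr (- (3/2 - \<i> * r)))"
        unfolding e q by (simp only: mult_ac)
    qed
    also have "(LINT u|lborel. a * exp ((1 - a) * of_real (ln 2)) * (exp (\<i> * of_real (k * u)) * of_real (2 * cosh u) powr (- (3/2 - \<i> * r))))
        = a * exp ((1 - a) * of_real (ln 2)) * cosh_transform (3/2 - \<i> * r) k"
      unfolding cosh_transform_def by (rule integral_mult_right_zero)
    finally have "cmod (\<psi>' 0) = cmod a * exp (3/2 * ln 2) * cmod (cosh_transform (3/2 - \<i> * r) k)"
      using a by (simp add: norm_mult norm_exp_eq_Re)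
    moreover have "cmod a = cmod (1/2 - \<i> * r)"
    proof -
      have "a = - (1/2 - \<i> * r)" by (simp add: a_def)
      then show ?thesis by (simp only: norm_minus_cancel)
    qed
    moreover have "exp (3/2 * ln 2) = 2 * sqrt 2"
    proof -
      have "(3/2 * ln 2 :: real) = ln 2 + ln (sqrt 2)" by (simp add: ln_sqrt)
      then have "exp (3/2 * ln 2) = exp (ln 2 :: real) * exp (ln (sqrt 2))" by (simp only: exp_add)
      then show ?thesis by simp
    qed
    ultimately show ?thesis by simp
  qed
  have cw: "cmod (w s) = sqrt ((1 + exp (- 2 * s)) / 2)" for s
  proof -
    have "cmod (w s) = sqrt (cosh s) * exp (- s / 2)" using a by (simp add: w_def norm_mult norm_exp_eq_Re)
    also have "exp (- s / 2) = sqrt (exp (- s))"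
      by (rule real_sqrt_unique[symmetric]) (simp_all add: power2_eq_square exp_add[symmetric])
    also have "sqrt (cosh s) * sqrt (exp (- s)) = sqrt (cosh s * exp (- s))" by (simp add: real_sqrt_mult)
    also have "cosh s * exp (- s) = (1 + exp (- 2 * s)) / 2"
      by (simp add: cosh_field_def distrib_right exp_add[symmetric])
    finally show ?thesis .
  qed
  have 4: "((\<lambda>s. cmod (\<psi> s)) \<longlongrightarrow> 2 * sqrt 2 * cmod (cosh_transform (1 - 2 * \<i> * r) (2 * k))) at_top"
  proof -
    obtain L where L: "(N0 \<longlongrightarrow> L) at_top" "cmod L = 4 * cmod (cosh_transform (- 2 * a) (2 * k))"
      using jost_integral_limit[OF a, of k] unfolding N0_def by blast
    have "((\<lambda>s. exp (- 2 * s)) \<longlongrightarrow> (0::real)) at_top" by real_asymp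
    then have "((\<lambda>s. sqrt ((1 + exp (- 2 * s)) / 2)) \<longlongrightarrow> sqrt ((1 + 0) / 2)) at_top" by (intro tendsto_intros) auto
    then have "((\<lambda>s. cmod (\<psi> s)) \<longlongrightarrow> sqrt ((1 + 0) / 2) * cmod L) at_top"
      unfolding \<psi>_def norm_mult cw by (intro tendsto_mult tendsto_norm L)
    also have "sqrt ((1 + 0) / 2) * cmod L = 2 * sqrt 2 * cmod (cosh_transform (- 2 * a) (2 * k))"
      unfolding L(2) by (simp add: real_sqrt_divide field_simps)
    also have "- 2 * a = 1 - 2 * \<i> * r" by (simp add: a_def)
    finally show ?thesis .
  qed
  define D where "D = integral\<^sup>L lborel jost_dom"
  have d0: "jost_dom u \<ge> 0" for u by (simp add: jost_dom_def)
  have D0: "D \<ge> 0" unfolding D_def by (intro Bochner_Integration.integral_nonneg d0)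
  have 5: "cmod (\<psi>' s - \<i> * r * \<psi> s) \<le> ((2 * cmod a + 1) * D) * exp (- 2 * s)" if s: "s \<ge> 0" for s
  proof -
    have X: "exp (- 2 * s) \<le> 1" using s by simp
    have w1: "cmod (w s) \<le> 1" unfolding cw using X by simp
    have n0: "cmod (N0 s) \<le> D" unfolding N0_def D_def
      by (rule order_trans[OF integral_norm_bound]) (intro integral_mono integrable_norm jost_integrable a integrable_jost_dom jost_wave_bounds)
    have n1: "cmod (N1 s) \<le> 2 * cmod a * exp (- 2 * s) * D"
    proof -
      have "cmod (N1 s) \<le> (LINT u|lborel. 2 * cmod a * exp (- 2 * s) * jost_dom u)" unfolding N1_def
        by (rule order_trans[OF integral_norm_bound]) (intro integral_mono integrable_norm integrable_mult_right jost_integrable a integrable_jost_dom jost_wave_bounds)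
      then show ?thesis by (simp add: D_def)
    qed
    have t: "\<bar>tanh s / 2 - 1/2\<bar> \<le> exp (- 2 * s)"
    proof -
      have "1 + exp (- 2 * s) > 0" by (simp add: add_pos_pos)
      then have "tanh s / 2 - 1/2 = - exp (- 2 * s) / (1 + exp (- 2 * s))"
        unfolding tanh_real_altdef by (simp add: field_simps)
      also have "\<bar>\<dots>\<bar> \<le> exp (- 2 * s)" by (simp add: abs_mult add_pos_pos pos_divide_le_eq)
      finally show ?thesis .
    qed
    \<comment> \<open>Since \<open>a - \<i> * r = - 1/2\<close>, the logarithmic derivative of
      \<open>w\<close> leaves \<open>tanh s / 2 - 1/2\<close>, which decays as fast as
      \<open>N1\<close>.\<close>
    have "\<psi>' s - \<i> * r * \<psi> s = w s * (N1 s + of_real (tanh s / 2 - 1/2) * N0 s)"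
      by (simp add: \<psi>'_def \<psi>_def a_def T_def algebra_simps)
    then have "cmod (\<psi>' s - \<i> * r * \<psi> s) = cmod (w s) * cmod (N1 s + of_real (tanh s / 2 - 1/2) * N0 s)" by (simp only: norm_mult)
    also have "\<dots> \<le> 1 * (cmod (N1 s) + \<bar>tanh s / 2 - 1/2\<bar> * cmod (N0 s))"
      by (intro mult_mono w1 order_trans[OF norm_triangle_ineq]) (auto simp: norm_mult simp del: of_real_diff of_real_divide)
    also have "\<dots> \<le> 1 * (2 * cmod a * exp (- 2 * s) * D + exp (- 2 * s) * D)"
      by (intro mult_left_mono add_mono mult_mono n0 n1 t) auto
    finally show ?thesis by (simp add: algebra_simps)
  qed
  show ?thesis by (rule that[OF 1 2 3 4 5])
qed

section \<open>Bounds for the coefficients\<close>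

lemma has_real_derivative_cmod_squared:
  assumes "(f has_vector_derivative f') (at s)"
  shows "((\<lambda>s. (cmod (f s))\<^sup>2) has_real_derivative 2 * (f s \<bullet> f')) (at s)"
  unfolding power2_norm_eq_inner has_real_derivative_iff_has_vector_derivative
  by (rule has_vector_derivative_eq_rhs[OF bounded_bilinear.has_vector_derivative[OF bounded_bilinear_inner assms assms]])
     (simp add: inner_commute)

text \<open>The condition on \<open>S\<close> places the window beyond the turning point: from there
  on the potential is at most \<open>(1 + r)^2 / 16\<close> and decays exponentially.\<close>

lemma potential_le:
  fixes r \<kappa> S s :: real
  assumes r: "r \<ge> 0" and k: "\<kappa> \<ge> 0" and S: "8 * \<kappa> \<le> exp S * (1 + r)"
  shows "\<kappa>\<^sup>2 / (cosh s)\<^sup>2 \<le> (1 + r)\<^sup>2 / 16 * (exp (- (s - S)))\<^sup>2"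
proof -
  have "exp s / 2 \<le> cosh s" by (simp add: cosh_field_def)
  then have "\<kappa> / cosh s \<le> \<kappa> / (exp s / 2)" using k by (intro divide_left_mono) auto
  also have "\<dots> = 2 * \<kappa> * exp (- s)" by (simp add: exp_minus field_simps)
  also have "\<dots> \<le> (exp S * (1 + r) / 4) * exp (- s)" using S by (intro mult_right_mono) auto
  also have "\<dots> = (1 + r) / 4 * exp (- (s - S))" by (simp add: exp_diff exp_minus field_simps)
  finally have "(\<kappa> / cosh s)\<^sup>2 \<le> ((1 + r) / 4 * exp (- (s - S)))\<^sup>2" using k by (intro power_mono) auto
  then show ?thesis by (simp add: power_mult_distrib power_divide)
qed

text \<open>For \<open>r \<ge> 1\<close> the energy increases to its value at infinity; for \<open>r < 1\<close> it degenerates, and the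
  weight \<open>exp (s - S)\<close> on the part \<open>\<psi>' - ir\<psi>\<close>, which decays like \<open>exp (- 2 s)\<close>, takes its place.\<close>

lemma jost_bounds:
  fixes r \<kappa> S L K :: real
  assumes d1: "\<And>s. (\<psi> has_vector_derivative \<psi>' s) (at s)"
    and d2: "\<And>s. (\<psi>' has_vector_derivative of_real (\<kappa>\<^sup>2 / (cosh s)\<^sup>2 - r\<^sup>2) * \<psi> s) (at s)"
    and lim: "((\<lambda>s. cmod (\<psi> s)) \<longlongrightarrow> L) at_top"
    and dec: "\<And>s. s \<ge> 0 \<Longrightarrow> cmod (\<psi>' s - \<i> * r * \<psi> s) \<le> K * exp (- 2 * s)"
    and r: "r \<ge> 0" and k: "\<kappa> \<ge> 0" and S: "8 * \<kappa> \<le> exp S * (1 + r)" "S \<ge> 0" and s: "s \<ge> S"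
  shows "cmod (\<psi> s) \<le> 3 * L" "cmod (\<psi>' s) \<le> 6 * (1 + r) * L"
proof -
  define V where "V = (\<lambda>s. \<kappa>\<^sup>2 / (cosh s)\<^sup>2)"
  define D where "D = (\<lambda>s. \<psi>' s - \<i> * r * \<psi> s)"
  have Vb: "V s \<le> (1 + r)\<^sup>2 / 16 * (exp (- (s - S)))\<^sup>2" for s
    unfolding V_def by (rule potential_le[OF r k S(1)])
  have V0: "V s \<ge> 0" for s by (simp add: V_def)
  have L0: "L \<ge> 0" by (rule tendsto_lowerbound[OF lim]) auto
  have K0: "K \<ge> 0"
    using dec[of 0] norm_ge_zero[of "\<psi>' 0 - \<i> * r * \<psi> 0"] by (simp del: norm_ge_zero)
  have Db: "cmod (D s) \<le> K * exp (- 2 * s)" if "s \<ge> 0" for s using dec[OF that] by (simp add: D_def)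
  have Dlim: "((\<lambda>s. cmod (D s)) \<longlongrightarrow> 0) at_top"
  proof (rule Lim_null_comparison)
    show "\<forall>\<^sub>F s in at_top. norm (cmod (D s)) \<le> K * exp (- 2 * s)"
      using eventually_ge_at_top[of 0] by eventually_elim (use Db in auto)
    show "((\<lambda>s. K * exp (- 2 * s)) \<longlongrightarrow> 0) at_top" by real_asymp
  qed
  have "cmod (\<psi> s) \<le> 3 * L \<and> cmod (\<psi>' s) \<le> 6 * (1 + r) * L"
  proof (cases "r \<ge> 1")
    case True
    \<comment> \<open>Its derivative is minus that of \<open>V\<close> times
      \<open>|\<psi>|^2\<close>, nonnegative for \<open>s \<ge> 0\<close>, and its limit is
      \<open>2 * r^2 * L^2\<close>. Beyond \<open>S\<close> the coefficient of
      \<open>|\<psi>|^2\<close> is at least \<open>r^2 / 2\<close>.\<close>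
    define E where "E = (\<lambda>s. (cmod (\<psi>' s))\<^sup>2 + (r\<^sup>2 - V s) * (cmod (\<psi> s))\<^sup>2)"
    have dV: "(V has_real_derivative - 2 * \<kappa>\<^sup>2 * sinh s / (cosh s) ^ 3) (at s)" for s
      unfolding V_def by (auto intro!: derivative_eq_intros simp: power2_eq_square power3_eq_cube field_simps)
    have dE: "(E has_real_derivative 2 * \<kappa>\<^sup>2 * sinh s / (cosh s) ^ 3 * (cmod (\<psi> s))\<^sup>2) (at s)" for s
    proof -
      have "((\<lambda>s. r\<^sup>2 - V s) has_real_derivative 0 - (- 2 * \<kappa>\<^sup>2 * sinh s / (cosh s) ^ 3)) (at s)"
        by (intro DERIV_diff DERIV_const dV)
      from DERIV_add[OF has_real_derivative_cmod_squared[OF d2[of s]] DERIV_mult[OF this has_real_derivative_cmod_squared[OF d1[of s]]]]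
      have A: "(E has_real_derivative 2 * (\<psi>' s \<bullet> (of_real (\<kappa>\<^sup>2 / (cosh s)\<^sup>2 - r\<^sup>2) * \<psi> s))
         + ((0 - (- 2 * \<kappa>\<^sup>2 * sinh s / (cosh s) ^ 3)) * (cmod (\<psi> s))\<^sup>2 + 2 * (\<psi> s \<bullet> \<psi>' s) * (r\<^sup>2 - V s))) (at s)"
        unfolding E_def .
      have B: "\<psi>' s \<bullet> (of_real (\<kappa>\<^sup>2 / (cosh s)\<^sup>2 - r\<^sup>2) * \<psi> s) = (V s - r\<^sup>2) * (\<psi> s \<bullet> \<psi>' s)"
        unfolding V_def scaleR_conv_of_real[symmetric] by (simp add: inner_commute)
      show ?thesis by (rule DERIV_cong[OF A], unfold B) (simp add: algebra_simps)
    qed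
    have mono: "E s \<le> E s'" if "s \<le> s'" for s'
    proof (rule DERIV_nonneg_imp_nondecreasing[OF that])
      fix x assume "s \<le> x" "x \<le> s'"
      then have "sinh x \<ge> 0" using s S(2) by simp
      then show "\<exists>d. (E has_real_derivative d) (at x) \<and> 0 \<le> d" by - (rule exI, rule conjI[OF dE], simp)
    qed
    have Vl: "(V \<longlongrightarrow> 0) at_top" unfolding V_def
      by (intro tendsto_divide_0[OF tendsto_const] filterlim_at_top_imp_at_infinity filterlim_pow_at_top cosh_real_at_top) simp
    have dl: "((\<lambda>s. cmod (\<psi>' s)) \<longlongrightarrow> r * L) at_top"
    proof (rule Lim_transform)
      show "((\<lambda>s. r * cmod (\<psi> s)) \<longlongrightarrow> r * L) at_top" by (intro tendsto_intros lim)
      show "((\<lambda>s. cmod (\<psi>' s) - r * cmod (\<psi> s)) \<longlongrightarrow> 0) at_top"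
      proof (rule Lim_null_comparison[OF always_eventually Dlim], intro allI)
        fix s
        have "r * cmod (\<psi> s) = cmod (\<i> * r * \<psi> s)" using r by (simp add: norm_mult)
        then show "norm (cmod (\<psi>' s) - r * cmod (\<psi> s)) \<le> cmod (D s)"
          using norm_triangle_ineq3[of "\<psi>' s" "\<i> * r * \<psi> s"] by (simp add: D_def)
      qed
    qed
    have El: "(E \<longlongrightarrow> (r * L)\<^sup>2 + (r\<^sup>2 - 0) * L\<^sup>2) at_top"
      unfolding E_def by (intro tendsto_intros dl lim Vl)
    have "E s \<le> (r * L)\<^sup>2 + (r\<^sup>2 - 0) * L\<^sup>2"
      by (rule tendsto_lowerbound[OF El]) (use eventually_mono[OF eventually_ge_at_top[of s] mono] in auto)
    then have E: "E s \<le> 2 * r\<^sup>2 * L\<^sup>2" by (simp add: power_mult_distrib mult_ac)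
    have "V s \<le> (1 + r)\<^sup>2 / 16 * 1" using s by (intro order_trans[OF Vb] mult_left_mono) (auto simp: power_le_one)
    also have "(1 + r)\<^sup>2 \<le> (2 * r)\<^sup>2" using True by (intro power_mono) auto
    finally have "V s * 4 \<le> r\<^sup>2" by (simp add: power_mult_distrib)
    then have V: "V s \<le> r\<^sup>2 / 2" using zero_le_power2[of r] by linarith
    have q: "r\<^sup>2 / 2 * (cmod (\<psi> s))\<^sup>2 \<le> (r\<^sup>2 - V s) * (cmod (\<psi> s))\<^sup>2" using V by (intro mult_right_mono) auto
    have "r\<^sup>2 / 2 * (cmod (\<psi> s))\<^sup>2 \<le> 2 * r\<^sup>2 * L\<^sup>2" proof -
      have "(r\<^sup>2 - V s) * (cmod (\<psi> s))\<^sup>2 \<le> E s" by (simp add: E_def)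
      then show ?thesis using E q by linarith
    qed
    then have "r\<^sup>2 * (cmod (\<psi> s))\<^sup>2 \<le> r\<^sup>2 * (2 * L)\<^sup>2" by (simp add: power_mult_distrib)
    then have "(cmod (\<psi> s))\<^sup>2 \<le> (2 * L)\<^sup>2" using True by simp
    then have p: "cmod (\<psi> s) \<le> 2 * L" by (rule power2_le_imp_le) (use L0 in auto)
    have "0 \<le> r\<^sup>2 / 2 * (cmod (\<psi> s))\<^sup>2" by simp
    then have "0 \<le> (r\<^sup>2 - V s) * (cmod (\<psi> s))\<^sup>2" using q by linarith
    then have "(cmod (\<psi>' s))\<^sup>2 \<le> 2 * r\<^sup>2 * L\<^sup>2" using E unfolding E_def by linarith
    also have "\<dots> = 2 * (r * L)\<^sup>2" by (simp add: power_mult_distrib)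
    also have "\<dots> \<le> (2 * (r * L))\<^sup>2" by (simp add: power_mult_distrib)
    finally have "cmod (\<psi>' s) \<le> 2 * (r * L)" by (rule power2_le_imp_le) (use L0 r in auto)
    also have "\<dots> \<le> 6 * (1 + r) * L"
    proof -
      have "2 * r * L \<le> 6 * (1 + r) * L" using r L0 by (intro mult_right_mono) auto
      then show ?thesis by simp
    qed
    finally show ?thesis using p L0 by simp
  next
    case False
    define y where "y = (\<lambda>s. exp (s - S))"
    define z where "z = (\<lambda>s. exp (- (s - S)))"
    define P where "P = (\<lambda>s. (cmod (\<psi> s))\<^sup>2 + y s * (cmod (D s))\<^sup>2)"
    \<comment> \<open>The last factor is an integrating factor for
      \<open>P' \<ge> - 2 * z * P\<close>. For \<open>s \<ge> S\<close> it lies between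
      \<open>exp (- 2)\<close> and 1, so the comparison with the limit costs a constant
      only.\<close>
    define R where "R = (\<lambda>s. P s * exp (- 2 * z s))"
    have yz: "y s * z s = 1" for s by (simp add: y_def z_def exp_add[symmetric])
    have dD: "(D has_vector_derivative of_real (V s) * \<psi> s - \<i> * r * D s) (at s)" for s
    proof -
      have "(D has_vector_derivative of_real (\<kappa>\<^sup>2 / (cosh s)\<^sup>2 - r\<^sup>2) * \<psi> s - \<i> * r * \<psi>' s) (at s)"
        unfolding D_def by (intro has_vector_derivative_diff has_vector_derivative_mult_right d1 d2)
      moreover have "of_real (\<kappa>\<^sup>2 / (cosh s)\<^sup>2 - r\<^sup>2) * \<psi> s - \<i> * r * \<psi>' s = of_real (V s) * \<psi> s - \<i> * r * D s"
        unfolding D_def V_def of_real_diff by (simp add: algebra_simps power2_eq_square)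
      ultimately show ?thesis by simp
    qed
    have i0: "x \<bullet> (\<i> * r * x) = 0" for x :: complex by (simp add: inner_complex_def algebra_simps)
    have dP: "(P has_real_derivative y s * (cmod (D s))\<^sup>2 + 2 * (1 + y s * V s) * (\<psi> s \<bullet> D s)) (at s)" for s
    proof -
      have dy: "(y has_real_derivative y s) (at s)" unfolding y_def by (auto intro!: derivative_eq_intros)
      have A: "(P has_real_derivative 2 * (\<psi> s \<bullet> \<psi>' s) + (y s * (cmod (D s))\<^sup>2 + 2 * (D s \<bullet> (of_real (V s) * \<psi> s - \<i> * r * D s)) * y s)) (at s)"
        unfolding P_def by (intro DERIV_add DERIV_mult dy has_real_derivative_cmod_squared d1 dD)
      have B: "\<psi> s \<bullet> \<psi>' s = \<psi> s \<bullet> D s"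
      proof -
        have "\<psi>' s = D s + \<i> * r * \<psi> s" by (simp add: D_def)
        then show ?thesis using i0[of "\<psi> s"] by (simp only: inner_add_right)
      qed
      have C: "D s \<bullet> (of_real (V s) * \<psi> s - \<i> * r * D s) = V s * (\<psi> s \<bullet> D s)"
        unfolding inner_diff_right i0 scaleR_conv_of_real[symmetric] by (simp add: inner_commute)
      show ?thesis by (rule DERIV_cong[OF A], unfold B C) (simp add: algebra_simps)
    qed
    have dR: "(R has_real_derivative exp (- 2 * z s) * (y s * (cmod (D s))\<^sup>2 + 2 * (1 + y s * V s) * (\<psi> s \<bullet> D s) + 2 * z s * P s)) (at s)" for s
    proof -
      have "((\<lambda>s. exp (- 2 * z s)) has_real_derivative 2 * z s * exp (- 2 * z s)) (at s)"
        unfolding z_def by (auto intro!: derivative_eq_intros)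
      from DERIV_mult[OF dP this] show ?thesis unfolding R_def by (rule DERIV_cong) (simp add: algebra_simps)
    qed
    \<comment> \<open>In terms of \<open>A\<close> and \<open>B = y * |D|\<close> the expression is
      at least \<open>z\<close> times \<open>B^2 - 2 * m * A * B + 2 * A^2\<close>, a nonnegative
      form because \<open>m^2 \<le> 2\<close>.\<close>
    have pos: "y s * (cmod (D s))\<^sup>2 + 2 * (1 + y s * V s) * (\<psi> s \<bullet> D s) + 2 * z s * P s \<ge> 0" if s: "s \<ge> S" for s
    proof -
      define A B m where "A = cmod (\<psi> s)" and "B = y s * cmod (D s)" and "m = 1 + y s * V s"
      have y0: "y s > 0" and z0: "z s > 0" and z1: "z s \<le> 1" using s by (auto simp: y_def z_def)
      have "V s \<le> (1 + r)\<^sup>2 / 16 * (z s)\<^sup>2" using Vb by (simp add: z_def)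
      also have "\<dots> \<le> 2\<^sup>2 / 16 * (z s)\<^sup>2" using False r by (intro mult_right_mono divide_right_mono power_mono) auto
      finally have "y s * V s \<le> y s * (1/4 * (z s)\<^sup>2)" using y0 by (intro mult_left_mono) auto
      also have "\<dots> = 1/4 * z s" using yz[of s] by (simp add: power2_eq_square)
      finally have m: "m \<ge> 1" "m \<le> 5/4" using z1 y0 V0[of s] by (auto simp: m_def)
      have "m\<^sup>2 \<le> (5/4)\<^sup>2" using m by (intro power_mono) auto
      then have m2: "m\<^sup>2 \<le> 2" by (simp add: power2_eq_square)
      have "\<bar>\<psi> s \<bullet> D s\<bar> \<le> A * cmod (D s)" unfolding A_def by (rule Cauchy_Schwarz_ineq2)
      then have e1: "2 * m * (- (A * cmod (D s))) \<le> 2 * m * (\<psi> s \<bullet> D s)" using m by (intro mult_left_mono) auto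
      have e2: "y s * (cmod (D s))\<^sup>2 = z s * B\<^sup>2" and e3: "A * cmod (D s) = z s * (A * B)"
        using yz[of s] by (simp_all add: B_def power2_eq_square mult_ac)
      have e4: "2 * z s * A\<^sup>2 \<le> 2 * z s * P s"
        using z0 y0 by (intro mult_left_mono) (auto simp: P_def A_def)
      have "0 \<le> z s * ((B - m * A)\<^sup>2 + (2 - m\<^sup>2) * A\<^sup>2)" using z0 m2 by (intro mult_nonneg_nonneg add_nonneg_nonneg) auto
      then have e5: "0 \<le> z s * B\<^sup>2 + 2 * m * (- (z s * (A * B))) + 2 * z s * A\<^sup>2" by (simp add: power2_eq_square algebra_simps)
      show ?thesis unfolding m_def[symmetric] using e1[unfolded e3] e2 e4 e5 by linarith
    qed
    have mono: "R s \<le> R s'" if "s \<le> s'" for s'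
    proof (rule DERIV_nonneg_imp_nondecreasing[OF that])
      fix x assume "s \<le> x" "x \<le> s'"
      then show "\<exists>d. (R has_real_derivative d) (at x) \<and> 0 \<le> d" using pos[of x] s by - (rule exI, rule conjI[OF dR], simp)
    qed
    have zl: "(z \<longlongrightarrow> 0) at_top" unfolding z_def by real_asymp
    have yl: "((\<lambda>s. y s * (cmod (D s))\<^sup>2) \<longlongrightarrow> 0) at_top"
    proof (rule Lim_null_comparison)
      show "\<forall>\<^sub>F s in at_top. norm (y s * (cmod (D s))\<^sup>2) \<le> exp (s - S) * (K * exp (- 2 * s))\<^sup>2"
        using eventually_ge_at_top[of 0]
        by eventually_elim (use Db in \<open>auto simp: y_def abs_mult intro!: mult_left_mono power_mono\<close>)
      have "exp (s - S) * (K * exp (- 2 * s))\<^sup>2 = K\<^sup>2 * exp (- S) * exp (- 3 * s)" for s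
      proof -
        have "exp (s - S) * (exp (- 2 * s))\<^sup>2 = exp (- S) * exp (- 3 * s)"
          by (simp add: power2_eq_square exp_add[symmetric])
        then show ?thesis by (simp add: power_mult_distrib)
      qed
      moreover have "((\<lambda>s. exp (- 3 * s)) \<longlongrightarrow> (0::real)) at_top" by real_asymp
      ultimately show "((\<lambda>s. exp (s - S) * (K * exp (- 2 * s))\<^sup>2) \<longlongrightarrow> 0) at_top"
        by (simp only: tendsto_mult_right_zero)
    qed
    have Rl: "(R \<longlongrightarrow> (L\<^sup>2 + 0) * exp (- 2 * 0)) at_top"
      unfolding R_def P_def by (intro tendsto_intros lim yl zl)
    have "R s \<le> (L\<^sup>2 + 0) * exp (- 2 * 0)"
      by (rule tendsto_lowerbound[OF Rl]) (use eventually_mono[OF eventually_ge_at_top[of s] mono] in auto)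
    then have Rs: "R s \<le> L\<^sup>2" by simp
    have P0: "P s \<ge> 0" by (simp add: P_def y_def)
    have "exp (- 2 * 1) \<le> exp (- 2 * z s)" using s by (simp add: z_def)
    then have "P s * exp (- 2) \<le> L\<^sup>2" using Rs P0 mult_left_mono[of "exp (- 2)" "exp (- 2 * z s)" "P s"] by (simp add: R_def)
    then have "P s \<le> exp 2 * L\<^sup>2" by (simp add: exp_minus field_simps)
    \<comment> \<open>\<open>exp 1 \<le> 3\<close> bounds the loss by 9, the square of the constant
      3 claimed for \<psi>.\<close>
    also have "exp 2 = exp 1 * exp (1::real)" by (simp add: exp_add[symmetric])
    also have "exp 1 * exp 1 * L\<^sup>2 \<le> 3 * 3 * L\<^sup>2" using exp_le by (intro mult_right_mono mult_mono) auto
    finally have P9: "P s \<le> (3 * L)\<^sup>2" by (simp add: power_mult_distrib)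
    have y1: "y s \<ge> 1" using s by (simp add: y_def)
    have yD: "(cmod (D s))\<^sup>2 \<le> y s * (cmod (D s))\<^sup>2" using y1 by (simp add: mult_le_cancel_right1)
    have "(cmod (\<psi> s))\<^sup>2 \<le> P s" using y1 by (simp add: P_def)
    then have "(cmod (\<psi> s))\<^sup>2 \<le> (3 * L)\<^sup>2" using P9 by (rule order_trans)
    then have p: "cmod (\<psi> s) \<le> 3 * L" by (rule power2_le_imp_le) (use L0 in auto)
    have "(cmod (D s))\<^sup>2 \<le> (3 * L)\<^sup>2" using P9 yD zero_le_power2[of "cmod (\<psi> s)"] unfolding P_def by linarith
    then have d: "cmod (D s) \<le> 3 * L" by (rule power2_le_imp_le) (use L0 in auto)
    have "\<psi>' s = D s + \<i> * r * \<psi> s" by (simp add: D_def)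
    then have "cmod (\<psi>' s) \<le> cmod (D s) + r * cmod (\<psi> s)"
      using norm_triangle_ineq[of "D s" "\<i> * r * \<psi> s"] r by (simp add: norm_mult)
    also have "\<dots> \<le> 3 * L + 1 * (3 * L)" using d p False r L0 by (intro add_mono mult_mono) auto
    also have "\<dots> \<le> 6 * (1 + r) * L" using r L0 by (simp add: algebra_simps)
    finally show ?thesis using p by simp
  qed
  then show "cmod (\<psi> s) \<le> 3 * L" "cmod (\<psi>' s) \<le> 6 * (1 + r) * L" by auto
qed

text \<open>The Wronskian is \<open>f 0 * \<psi>' 0\<close> at every \<open>s\<close>, so its square
  is bounded by \<open>|f|^2\<close> and \<open>|f'|^2\<close> at each point of the window.
  Averaging against a cutoff exchanges \<open>|f'|^2\<close> for \<open>|f|^2\<close>, as in a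
  Caccioppoli inequality.\<close>

lemma window_estimate:
  fixes r \<kappa> S L :: real
  assumes d1: "\<And>s. (f has_vector_derivative f' s) (at s)"
    and d2: "\<And>s. (f' has_vector_derivative of_real (\<kappa>\<^sup>2 / (cosh s)\<^sup>2 - r\<^sup>2) * f s) (at s)"
    and f0: "f' 0 = 0"
    and e1: "\<And>s. (\<psi> has_vector_derivative \<psi>' s) (at s)"
    and e2: "\<And>s. (\<psi>' has_vector_derivative of_real (\<kappa>\<^sup>2 / (cosh s)\<^sup>2 - r\<^sup>2) * \<psi> s) (at s)"
    and b1: "\<And>s. s \<ge> S \<Longrightarrow> cmod (\<psi> s) \<le> 3 * L" and b2: "\<And>s. s \<ge> S \<Longrightarrow> cmod (\<psi>' s) \<le> 6 * (1 + r) * L"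
    and r: "r \<ge> 0" and L: "L \<ge> 0"
  shows "(cmod (f 0) * cmod (\<psi>' 0))\<^sup>2 \<le> 3240 * L\<^sup>2 * (1 + r)\<^sup>2 * integral {S..S+1} (\<lambda>s. (cmod (f s))\<^sup>2)"
proof -
  define q where "q = (\<lambda>s. r\<^sup>2 - \<kappa>\<^sup>2 / (cosh s)\<^sup>2)"
  define c where "c = (cmod (f 0) * cmod (\<psi>' 0))\<^sup>2"
  \<comment> \<open>Double zeros at both ends make \<open>\<eta>1\<close>, and hence
    \<open>H\<close>, vanish there. \<open>X\<close> is an antiderivative of \<open>\<eta>\<close>,
    which gives the total weight 1/3 - 1/2 + 1/5 = 1/30.\<close>
  define \<eta> where "\<eta> = (\<lambda>s. (s - S)\<^sup>2 * (S + 1 - s)\<^sup>2)"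
  define \<eta>1 where "\<eta>1 = (\<lambda>s. 2 * (s - S) * (S + 1 - s)\<^sup>2 - 2 * (s - S)\<^sup>2 * (S + 1 - s))"
  define \<eta>2 where "\<eta>2 = (\<lambda>s. 2 - 12 * (s - S) * (S + 1 - s))"
  define X where "X = (\<lambda>s. (s - S) ^ 3 / 3 - (s - S) ^ 4 / 2 + (s - S) ^ 5 / 5)"
  define H where "H = (\<lambda>s. \<eta> s * (f s \<bullet> f' s) - \<eta>1 s / 2 * (cmod (f s))\<^sup>2)"
  have W: "f 0 * \<psi>' 0 = f s * \<psi>' s - f' s * \<psi> s" for s
  proof -
    have "((\<lambda>s. f s * \<psi>' s - f' s * \<psi> s) has_vector_derivative 0) (at s)" for s
    proof -
      have "((\<lambda>s. f s * \<psi>' s - f' s * \<psi> s) has_vector_derivative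
         (f s * (of_real (\<kappa>\<^sup>2 / (cosh s)\<^sup>2 - r\<^sup>2) * \<psi> s) + f' s * \<psi>' s) - (f' s * \<psi>' s + of_real (\<kappa>\<^sup>2 / (cosh s)\<^sup>2 - r\<^sup>2) * f s * \<psi> s)) (at s)"
        by (intro has_vector_derivative_diff has_vector_derivative_mult d1 d2 e1 e2)
      then show ?thesis by (rule has_vector_derivative_eq_rhs) simp
    qed
    then have "((\<lambda>s. f s * \<psi>' s - f' s * \<psi> s) has_derivative (\<lambda>h. 0)) (at s within UNIV)" for s
      by (simp add: has_vector_derivative_def)
    from has_derivative_zero_unique[OF convex_UNIV this, of 0 s] show ?thesis by (simp add: f0)
  qed
  have dX: "(X has_real_derivative \<eta> s) (at s)" and dchi: "(\<eta> has_real_derivative \<eta>1 s) (at s)" and dchi1: "(\<eta>1 has_real_derivative \<eta>2 s) (at s)" for s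
    unfolding X_def \<eta>_def \<eta>1_def \<eta>2_def
    by (auto intro!: derivative_eq_intros) (simp_all add: algebra_simps power2_eq_square power3_eq_cube power4_eq_xxxx)
  have dH: "(H has_real_derivative \<eta> s * (cmod (f' s))\<^sup>2 - (\<eta> s * q s + \<eta>2 s / 2) * (cmod (f s))\<^sup>2) (at s)" for s
  proof -
    have di: "((\<lambda>s. f s \<bullet> f' s) has_real_derivative (f s \<bullet> (of_real (\<kappa>\<^sup>2 / (cosh s)\<^sup>2 - r\<^sup>2) * f s) + f' s \<bullet> f' s)) (at s)"
      unfolding has_real_derivative_iff_has_vector_derivative
      by (rule bounded_bilinear.has_vector_derivative[OF bounded_bilinear_inner d1 d2])
    have B: "f s \<bullet> (of_real (\<kappa>\<^sup>2 / (cosh s)\<^sup>2 - r\<^sup>2) * f s) = - q s * (cmod (f s))\<^sup>2" "f' s \<bullet> f' s = (cmod (f' s))\<^sup>2"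
      unfolding q_def scaleR_conv_of_real[symmetric] by (simp_all add: power2_norm_eq_inner)
    have "(H has_real_derivative (\<eta>1 s * (f s \<bullet> f' s) + (f s \<bullet> (of_real (\<kappa>\<^sup>2 / (cosh s)\<^sup>2 - r\<^sup>2) * f s) + f' s \<bullet> f' s) * \<eta> s)
        - (\<eta>2 s / 2 * (cmod (f s))\<^sup>2 + 2 * (f s \<bullet> f' s) * (\<eta>1 s / 2))) (at s)"
      unfolding H_def by (intro DERIV_diff DERIV_mult DERIV_cdivide dchi dchi1 di has_real_derivative_cmod_squared d1)
    then show ?thesis by (rule DERIV_cong) (unfold B, simp add: algebra_simps)
  qed
  have bnd: "X (S + 1) = 1/30" "X S = 0" "H (S + 1) = 0" "H S = 0"
    by (simp_all add: X_def H_def \<eta>_def \<eta>1_def)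
  \<comment> \<open>The multiple \<open>18 * L^2\<close> of the derivative of \<open>H\<close>
    cancels the \<open>|f'|^2\<close> part of the pointwise bound. What remains is 72 + 36 = 108,
    and 30 * 108 = 3240.\<close>
  let ?g = "\<lambda>s. c * \<eta> s - 18 * L\<^sup>2 * (\<eta> s * (cmod (f' s))\<^sup>2 - (\<eta> s * q s + \<eta>2 s / 2) * (cmod (f s))\<^sup>2)"
  have gi: "(?g has_integral c / 30) {S..S+1}"
  proof -
    have "(?g has_integral (c * X (S + 1) - 18 * L\<^sup>2 * H (S + 1)) - (c * X S - 18 * L\<^sup>2 * H S)) {S..S+1}"
      by (rule fundamental_theorem_of_calculus)
         (auto simp: has_real_derivative_iff_has_vector_derivative[symmetric] intro!: DERIV_diff DERIV_cmult DERIV_subset[OF dX] DERIV_subset[OF dH])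
    then show ?thesis by (simp add: bnd)
  qed
  have fc: "continuous_on {S..S+1} f"
    by (intro continuous_at_imp_continuous_on ballI has_vector_derivative_continuous[OF d1])
  have fi: "(\<lambda>s. (cmod (f s))\<^sup>2) integrable_on {S..S+1}"
    by (intro integrable_continuous_interval continuous_intros fc)
  have hi: "((\<lambda>s. 108 * L\<^sup>2 * (1 + r)\<^sup>2 * (cmod (f s))\<^sup>2) has_integral 108 * L\<^sup>2 * (1 + r)\<^sup>2 * integral {S..S+1} (\<lambda>s. (cmod (f s))\<^sup>2)) {S..S+1}"
    by (intro has_integral_mult_right integrable_integral fi)
  have pt: "?g s \<le> 108 * L\<^sup>2 * (1 + r)\<^sup>2 * (cmod (f s))\<^sup>2" if s: "s \<in> {S..S+1}" for s
  proof -
    define A B where "A = cmod (f s)" and "B = cmod (f' s)"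
    define T where "T = s - S"
    have T: "0 \<le> T" "T \<le> 1" using s by (auto simp: T_def)
    have T1: "S + 1 - s = 1 - T" by (simp add: T_def)
    have c01: "0 \<le> \<eta> s" "\<eta> s \<le> 1"
      unfolding \<eta>_def T_def[symmetric] T1 using T by (auto intro!: mult_le_one power_le_one)
    have c2: "\<eta>2 s / 2 \<le> 1" unfolding \<eta>2_def T_def[symmetric] T1 using T by simp
    have "cmod (f 0 * \<psi>' 0) \<le> cmod (f s) * cmod (\<psi>' s) + cmod (f' s) * cmod (\<psi> s)"
      unfolding W[of s] using norm_triangle_ineq4[of "f s * \<psi>' s" "f' s * \<psi> s"] by (simp add: norm_mult)
    also have "\<dots> \<le> A * (6 * (1 + r) * L) + B * (3 * L)"
      unfolding A_def B_def using b1[of s] b2[of s] s by (intro add_mono mult_left_mono) auto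
    finally have "c \<le> (A * (6 * (1 + r) * L) + B * (3 * L))\<^sup>2"
      unfolding c_def norm_mult[symmetric] by (intro power_mono) auto
    also have "\<dots> \<le> 2 * (A * (6 * (1 + r) * L))\<^sup>2 + 2 * (B * (3 * L))\<^sup>2"
      using sum_squares_bound[of "A * (6 * (1 + r) * L)" "B * (3 * L)"] by (simp add: power2_sum)
    also have "\<dots> = L\<^sup>2 * (72 * (1 + r)\<^sup>2 * A\<^sup>2 + 18 * B\<^sup>2)"
      by (simp only: power_mult_distrib) (simp add: algebra_simps)
    finally have "c * \<eta> s \<le> L\<^sup>2 * (72 * (1 + r)\<^sup>2 * A\<^sup>2 + 18 * B\<^sup>2) * \<eta> s" using c01 by (intro mult_right_mono) auto
    moreover have "18 * L\<^sup>2 * ((\<eta> s * q s + \<eta>2 s / 2) * A\<^sup>2) \<le> 18 * L\<^sup>2 * ((2 * (1 + r)\<^sup>2) * A\<^sup>2)"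
    proof (intro mult_left_mono mult_right_mono)
      have "q s \<le> r\<^sup>2" by (simp add: q_def)
      also have "\<dots> \<le> (1 + r)\<^sup>2" using r by (intro power_mono) auto
      finally have "\<eta> s * q s \<le> \<eta> s * (1 + r)\<^sup>2" using c01 by (intro mult_left_mono) auto
      also have "\<dots> \<le> 1 * (1 + r)\<^sup>2" using c01 by (intro mult_right_mono) auto
      finally have "\<eta> s * q s \<le> (1 + r)\<^sup>2" by simp
      moreover have "1 \<le> (1 + r)\<^sup>2" using r by (intro one_le_power) auto
      ultimately show "\<eta> s * q s + \<eta>2 s / 2 \<le> 2 * (1 + r)\<^sup>2" using c2 by linarith
    qed auto
    moreover have "\<eta> s * (72 * L\<^sup>2 * (1 + r)\<^sup>2 * A\<^sup>2) \<le> 1 * (72 * L\<^sup>2 * (1 + r)\<^sup>2 * A\<^sup>2)"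
      using c01 by (intro mult_right_mono) auto
    ultimately show ?thesis unfolding A_def[symmetric] B_def[symmetric] by (simp add: algebra_simps)
  qed
  have "c / 30 \<le> 108 * L\<^sup>2 * (1 + r)\<^sup>2 * integral {S..S+1} (\<lambda>s. (cmod (f s))\<^sup>2)"
    by (rule has_integral_le[OF gi hi pt])
  then show ?thesis unfolding c_def by simp
qed

text \<open>The amplitude \<open>L\<close> occurs squared on both sides: in the bound of
  \<open>window_estimate\<close> and, through \<open>cosh_transform_product\<close>, in the product
  of the model period with \<open>\<psi>' 0\<close>. The Gamma quotient supplies one factor
  \<open>1 + r\<close>, leaving one of the two in the estimate.\<close>

lemma fourier_coeff_window_bound:
  fixes \<mu> l S :: real and n :: int
  defines "r \<equiv> sqrt (\<mu> - 1/4)" and "k \<equiv> 2 * pi * of_int n / l"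
  assumes mu: "\<mu> \<ge> 1/4" and l: "l > 0"
    and d1: "\<And>s. (f has_vector_derivative f' s) (at s)"
    and d2: "\<And>s. (f' has_vector_derivative of_real ((k\<^sup>2 + 1/4) / (cosh s)\<^sup>2 - (\<mu> - 1/4)) * f s) (at s)"
    and f0: "f 0 = period l t \<phi> n" "f' 0 = 0"
    and S: "S \<ge> 0" "8 * sqrt (k\<^sup>2 + 1/4) \<le> exp S * (1 + r)"
  shows "(cmod (fourier_coeff \<mu> l t \<phi> n))\<^sup>2 \<le> 1620 / l\<^sup>2 * (1 + r) * integral {S..S+1} (\<lambda>s. (cmod (f s))\<^sup>2)"
proof -
  have r: "r \<ge> 0" "r\<^sup>2 = \<mu> - 1/4" using mu by (simp_all add: r_def)
  define \<kappa> where "\<kappa> = sqrt (k\<^sup>2 + 1/4)"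
  have \<kappa>: "\<kappa> \<ge> 0" "\<kappa>\<^sup>2 = k\<^sup>2 + 1/4" by (simp_all add: \<kappa>_def add_nonneg_nonneg)
  define J where "J = cmod (cosh_transform (1 - 2 * \<i> * r) (2 * k))"
  define L where "L = 2 * sqrt 2 * J"
  have J: "J > 0" using cosh_transform_nonzero[of r "2 * k"] by (simp add: J_def)
  then have L: "L > 0" by (simp add: L_def)
  obtain \<psi> \<psi>' :: "real \<Rightarrow> complex" and K where
    e1: "\<And>s. (\<psi> has_vector_derivative \<psi>' s) (at s)" and
    e2: "\<And>s. (\<psi>' has_vector_derivative of_real ((k\<^sup>2 + 1/4) / (cosh s)\<^sup>2 - r\<^sup>2) * \<psi> s) (at s)" and
    p0: "cmod (\<psi>' 0) = 2 * sqrt 2 * cmod (1/2 - \<i> * r) * cmod (cosh_transform (3/2 - \<i> * r) k)" and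
    lim: "((\<lambda>s. cmod (\<psi> s)) \<longlongrightarrow> L) at_top" and
    dec: "\<And>s. s \<ge> 0 \<Longrightarrow> cmod (\<psi>' s - \<i> * r * \<psi> s) \<le> K * exp (- 2 * s)"
    unfolding L_def J_def by (rule jost_solution[of k r]) blast
  note e2 = e2[folded \<kappa>(2)]
  have S': "8 * \<kappa> \<le> exp S * (1 + r)" using S by (simp add: \<kappa>_def)
  note b = jost_bounds[OF e1 e2 lim dec r(1) \<kappa>(1) S' S(1)]
  let ?I = "integral {S..S+1} (\<lambda>s. (cmod (f s))\<^sup>2)"
  have I0: "?I \<ge> 0"
    by (rule Henstock_Kurzweil_Integration.integral_nonneg)
       (auto intro!: integrable_continuous_interval continuous_intros continuous_at_imp_continuous_on has_vector_derivative_continuous[OF d1])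
  have W: "(cmod (f 0) * cmod (\<psi>' 0))\<^sup>2 \<le> 3240 * L\<^sup>2 * (1 + r)\<^sup>2 * ?I"
    by (rule window_estimate[OF d1 d2[folded r(2) \<kappa>(2)] f0(2) e1 e2 b r(1)]) (use L in auto)
  define G where "G = model_period \<mu> l n"
  have "model_period \<mu> l n = 2 * of_real l * cosh_transform (1/2 - \<i> * r) k"
    by (rule model_period_eq[OF _ mu l]) (simp_all add: r_def k_def)
  then have G: "cmod G = 2 * l * cmod (cosh_transform (1/2 - \<i> * r) k)" using l by (simp add: G_def norm_mult)
  \<comment> \<open>The factor 32 is the square of \<open>2 * (2 * sqrt 2)\<close>; then
    \<open>32 * J^2 = 4 * L^2\<close>.\<close>
  have "(cmod G * cmod (\<psi>' 0))\<^sup>2 = 32 * l\<^sup>2 * (cmod (cosh_transform (1/2 - \<i> * r) k) * cmod (cosh_transform (3/2 - \<i> * r) k) * cmod (1/2 - \<i> * r))\<^sup>2"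
    unfolding G p0 by (simp add: power_mult_distrib)
  also have "\<dots> = 4 * l\<^sup>2 * L\<^sup>2 * (pi * (cmod (Gamma (1 - \<i> * r) / Gamma (1/2 - \<i> * r)))\<^sup>2)"
    unfolding cosh_transform_product by (simp add: L_def J_def power_mult_distrib)
  finally have GP: "(cmod G * cmod (\<psi>' 0))\<^sup>2 = 4 * l\<^sup>2 * L\<^sup>2 * (pi * (cmod (Gamma (1 - \<i> * r) / Gamma (1/2 - \<i> * r)))\<^sup>2)" .
  have "1/2 * (1 + r) \<le> 3 * ((1 + r) / 5)" using r by simp
  also have "\<dots> \<le> pi * (cmod (Gamma (1 - \<i> * r) / Gamma (1/2 - \<i> * r)))\<^sup>2"
    using pi_gt3 cmod_Gamma_ratio_ge[OF r(1)] r(1) by (intro mult_mono) auto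
  finally have "4 * l\<^sup>2 * L\<^sup>2 * (1/2 * (1 + r)) \<le> (cmod G * cmod (\<psi>' 0))\<^sup>2"
    unfolding GP by (intro mult_left_mono) auto
  then have lower: "2 * l\<^sup>2 * L\<^sup>2 * (1 + r) \<le> (cmod G * cmod (\<psi>' 0))\<^sup>2" by (simp add: mult_ac)
  have pos: "0 < 2 * l\<^sup>2 * L\<^sup>2 * (1 + r)" using l L r by simp
  \<comment> \<open>So the quotient defining \<open>fourier_coeff\<close> is a genuine one and not
    the value 0 of a division by zero.\<close>
  then have "G \<noteq> 0" using lower by auto
  then have f: "cmod (f 0) = cmod (fourier_coeff \<mu> l t \<phi> n) * cmod G"
    by (simp add: fourier_coeff_def G_def[symmetric] f0(1) norm_divide)
  let ?a = "(cmod (fourier_coeff \<mu> l t \<phi> n))\<^sup>2"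
  have "?a * (2 * l\<^sup>2 * L\<^sup>2 * (1 + r)) \<le> ?a * (cmod G * cmod (\<psi>' 0))\<^sup>2"
    by (intro mult_left_mono lower) auto
  also have "\<dots> = (cmod (f 0) * cmod (\<psi>' 0))\<^sup>2" unfolding f by (simp add: power_mult_distrib)
  also have "\<dots> \<le> (1620 / l\<^sup>2 * (1 + r) * ?I) * (2 * l\<^sup>2 * L\<^sup>2 * (1 + r))"
  proof -
    have "(1620 / l\<^sup>2 * (1 + r) * ?I) * (2 * l\<^sup>2 * L\<^sup>2 * (1 + r)) = 3240 * L\<^sup>2 * (1 + r)\<^sup>2 * ?I"
      using l by (simp add: field_simps power2_eq_square)
    then show ?thesis using W by simp
  qed
  finally show ?thesis using pos by (rule mult_right_le_imp_le)
qed

section \<open>Summation over the modes in a common window\<close>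

theorem theoremB:
  fixes A :: "'a::t2_space chart set"
    and \<rho> :: "'a chart \<Rightarrow> complex \<Rightarrow> real"
    and v :: "'a measure"
    and l :: real
    and t :: "real \<Rightarrow> 'a"
  assumes "compact_hyperbolic_surface A \<rho>"
    and "volume_measure A \<rho> v"
    and "closed_geodesic A \<rho> l t"
  shows "\<exists>C>0. \<forall>(\<mu>::real) (\<phi> :: 'a \<Rightarrow> complex).
           laplace_eigenfunction A \<rho> \<mu> \<phi> \<longrightarrow> norm_L2 v \<phi> = 1 \<longrightarrow> \<mu> \<ge> 1 / 4 \<longrightarrow>
           (\<forall>T::real. T \<ge> 1 \<longrightarrow>
              (\<Sum>n | \<bar>real_of_int n\<bar> \<le> T. (cmod (fourier_coeff \<mu> l t \<phi> n))\<^sup>2) \<le> C * max T (sqrt \<mu>))"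
proof -
  interpret hyperbolic_surface A \<rho> by unfold_locales (rule assms(1))
  have l: "l > 0" using assms(3) by (simp add: closed_geodesic_def)
  obtain C where C: "C > 0" and modes: "\<And>\<mu> \<phi>. laplace_eigenfunction A \<rho> \<mu> \<phi> \<Longrightarrow> norm_L2 v \<phi> = 1 \<Longrightarrow>
      \<exists>f f'. \<forall>n::int. f n 0 = period l t \<phi> n \<and> f' n 0 = 0 \<and>
        (\<forall>s. (f n has_vector_derivative f' n s) (at s) \<and>
             (f' n has_vector_derivative
                of_real (((2 * pi * of_int n / l)\<^sup>2 + 1/4) / (cosh s)\<^sup>2 - (\<mu> - 1/4)) * f n s) (at s)) \<and>
        (\<forall>S\<ge>0. \<forall>N. finite N \<longrightarrow>
            integral {S..S+1} (\<lambda>s. \<Sum>n\<in>N. (cmod (f n s))\<^sup>2) \<le> C * exp S)"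
    by (rule geometric_bound[OF assms(3,2)]) blast
  \<comment> \<open>The 6 is 2 + 4: \<open>1 + r\<close> is at most twice the maximum, and the
    summand 1/2 in \<open>\<kappa>\<close> contributes 4 to \<open>8 * \<kappa>\<close>, absorbed by
    \<open>T \<ge> 1\<close>.\<close>
  define C' where "C' = 1620 / l\<^sup>2 * C * (6 + 16 * pi / l)"
  have C': "C' > 0" using C l pi_gt_zero by (simp add: C'_def add_pos_pos)
  have "(\<Sum>n | \<bar>real_of_int n\<bar> \<le> T. (cmod (fourier_coeff \<mu> l t \<phi> n))\<^sup>2) \<le> C' * max T (sqrt \<mu>)"
    if ef: "laplace_eigenfunction A \<rho> \<mu> \<phi>" and nm: "norm_L2 v \<phi> = 1" and mu: "\<mu> \<ge> 1/4" and T: "T \<ge> 1"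
    for \<mu> T :: real and \<phi> :: "'a \<Rightarrow> complex"
  proof -
    obtain f f' :: "int \<Rightarrow> real \<Rightarrow> complex" where
      f0: "\<And>n. f n 0 = period l t \<phi> n" "\<And>n. f' n 0 = 0" and
      d1: "\<And>n s. (f n has_vector_derivative f' n s) (at s)" and
      d2: "\<And>n s. (f' n has_vector_derivative of_real (((2 * pi * of_int n / l)\<^sup>2 + 1/4) / (cosh s)\<^sup>2 - (\<mu> - 1/4)) * f n s) (at s)" and
      win: "\<And>n S N. S \<ge> 0 \<Longrightarrow> finite N \<Longrightarrow> integral {S..S+1} (\<lambda>s. \<Sum>n\<in>N. (cmod (f n s))\<^sup>2) \<le> C * exp S"
      using modes[OF ef nm] by blast
    define N where "N = {n. \<bar>real_of_int n\<bar> \<le> T}"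
    have "N \<subseteq> {\<lfloor>- T\<rfloor>..\<lceil>T\<rceil>}" by (auto simp: N_def abs_le_iff floor_le_iff le_ceiling_iff)
    then have fin: "finite N" by (rule finite_subset) simp
    define r where "r = sqrt (\<mu> - 1/4)"
    have r: "r \<ge> 0" "r \<le> sqrt \<mu>" using mu by (simp_all add: r_def)
    \<comment> \<open>Dominates \<open>sqrt (k^2 + 1/4)\<close> for all frequencies with
      \<open>|n| \<le> T\<close>, so that one window serves every mode and the modes can be summed
      inside the integral.\<close>
    define \<kappa> where "\<kappa> = 2 * pi * T / l + 1/2"
    have \<kappa>: "\<kappa> > 0" using l T by (simp add: \<kappa>_def add_pos_pos)
    \<comment> \<open>The least nonnegative \<open>S\<close> beyond the turning point of all these
      modes. The factor \<open>1 + r\<close> of the coefficient bound then meets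
      \<open>exp S \<le> 1 + 8 * \<kappa> / (1 + r)\<close>, and the product is linear in
      \<open>r\<close> and \<open>\<kappa>\<close>.\<close>
    define S where "S = max 0 (ln (8 * \<kappa> / (1 + r)))"
    have S0: "S \<ge> 0" by (simp add: S_def)
    have q: "8 * \<kappa> / (1 + r) > 0" using \<kappa> r by simp
    have S1: "8 * \<kappa> / (1 + r) \<le> exp S" "exp S \<le> 1 + 8 * \<kappa> / (1 + r)"
      using q by (auto simp: S_def max_def ln_ge_iff)
    have coeff: "(cmod (fourier_coeff \<mu> l t \<phi> n))\<^sup>2 \<le> 1620 / l\<^sup>2 * (1 + r) * integral {S..S+1} (\<lambda>s. (cmod (f n s))\<^sup>2)" if n: "n \<in> N" for n
    proof -
      have "sqrt ((2 * pi * of_int n / l)\<^sup>2 + 1/4) \<le> \<bar>2 * pi * of_int n / l\<bar> + 1/2"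
        using sqrt_sum_squares_le_sum_abs[of "2 * pi * of_int n / l" "1/2"] by (simp add: power_divide)
      also have "\<dots> \<le> \<kappa>" using n l by (simp add: \<kappa>_def N_def abs_mult divide_right_mono)
      finally have "8 * sqrt ((2 * pi * of_int n / l)\<^sup>2 + 1/4) \<le> 8 * \<kappa>" by simp
      also have "\<dots> \<le> exp S * (1 + r)" using S1(1) r by (simp add: pos_divide_le_eq)
      finally have "8 * sqrt ((2 * pi * of_int n / l)\<^sup>2 + 1/4) \<le> exp S * (1 + sqrt (\<mu> - 1/4))" by (simp add: r_def)
      from fourier_coeff_window_bound[OF mu l d1 d2 f0 S0 this] show ?thesis by (simp add: r_def)
    qed
    have ic: "(\<lambda>s. (cmod (f n s))\<^sup>2) integrable_on {S..S+1}" for n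
      by (intro integrable_continuous_interval continuous_intros continuous_at_imp_continuous_on ballI has_vector_derivative_continuous[OF d1])
    have "(\<Sum>n\<in>N. (cmod (fourier_coeff \<mu> l t \<phi> n))\<^sup>2) \<le> (\<Sum>n\<in>N. 1620 / l\<^sup>2 * (1 + r) * integral {S..S+1} (\<lambda>s. (cmod (f n s))\<^sup>2))"
      by (rule sum_mono) (rule coeff)
    also have "\<dots> = 1620 / l\<^sup>2 * (1 + r) * integral {S..S+1} (\<lambda>s. \<Sum>n\<in>N. (cmod (f n s))\<^sup>2)"
      unfolding Henstock_Kurzweil_Integration.integral_sum[OF fin ic] sum_distrib_left ..
    also have "\<dots> \<le> 1620 / l\<^sup>2 * (1 + r) * (C * exp S)"
      using r by (intro mult_left_mono win S0 fin) auto
    also have "\<dots> \<le> 1620 / l\<^sup>2 * (1 + r) * (C * (1 + 8 * \<kappa> / (1 + r)))"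
      using r C S1(2) by (intro mult_left_mono) auto
    also have "\<dots> = 1620 / l\<^sup>2 * C * ((1 + r) * (1 + 8 * \<kappa> / (1 + r)))" by (simp only: mult_ac)
    also have "(1 + r) * (1 + 8 * \<kappa> / (1 + r)) = 1 + r + 8 * \<kappa>"
      using r by (simp add: distrib_left)
    also have "1620 / l\<^sup>2 * C * (1 + r + 8 * \<kappa>) \<le> 1620 / l\<^sup>2 * C * ((6 + 16 * pi / l) * max T (sqrt \<mu>))"
    proof (rule mult_left_mono)
      have "1 + r \<le> 2 * max T (sqrt \<mu>)" using r T by auto
      moreover have "8 * \<kappa> \<le> (4 + 16 * pi / l) * T" using T by (simp add: \<kappa>_def algebra_simps)
      moreover have "(4 + 16 * pi / l) * T \<le> (4 + 16 * pi / l) * max T (sqrt \<mu>)"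
        using l by (intro mult_left_mono) (auto intro!: add_nonneg_nonneg)
      ultimately show "1 + r + 8 * \<kappa> \<le> (6 + 16 * pi / l) * max T (sqrt \<mu>)" by (simp add: algebra_simps)
    qed (use C in auto)
    finally show ?thesis by (simp add: N_def C'_def mult_ac)
  qed
  then show ?thesis using C' by blast
qed

end
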